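(* Let $\alpha\ge-\frac12$ and let $\rho:\mathbb{R}^+\to\mathbb{R}^+$ satisfy, for some constants $C_1,C_1',C_1''>0$: (a) $\frac12\le\frac rs\le2\implies\frac1{C_1}\le\frac{\rho(r)}{\rho(s)}\le C_1$; (b) $\int_0^1\frac{\rho(t)}t\,dt<\infty$; (c) $\int_r^\infty\frac{\rho(t)}{t^2}\,dt\le C_1'\frac{\rho(r)}r$ for all $r>0$; (d) $\frac12\le\frac rs\le2\implies\Big|\frac{\rho(r)}{r^{d_\alpha}}-\frac{\rho(s)}{s^{d_\alpha}}\Big|\le C_1''|r-s|\frac{\rho(s)}{s^{d_\alpha+1}}$. Let $\phi,\psi:\mathbb{R}^+\to\mathbb{R}^+$ be almost increasing with $\phi(r)\sim\phi(2r)$ and $\psi(r)\sim\psi(2r)$. If there are constants $A,A'>0$ such that for all $r>0$ $$\int_r^\infty\frac{\rho(t)\phi(t)}{t^2}\,dt\le A\,\frac{\rho(r)\phi(r)}r,\qquad \phi(r)\int_0^r\frac{\rho(t)}t\,dt\le A'\psi(r),$$ then $\tilde T_\rho^\alpha$ is bounded from $BMO_\phi(\mathbb{R},d\mu_\alpha)$ to $BMO_\psi(\mathbb{R},d\mu_\alpha)$, i.e. there is a constant $C>0$ such that $\|\tilde T_\rho^\alpha f\|_{BMO_\psi(\mathbb{R},d\mu_\alpha)}\le C\|f\|_{BMO_\phi(\mathbb{R},d\mu_\alpha)}$ for all $f\in BMO_\phi(\mathbb{R},d\mu_\alpha)$.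
   Context: Notation: $\mathbb{R}^+=(0,\infty)$; $\alpha\ge-\frac12$ is a fixed real number; $d_\alpha=2\alpha+2$; $d\mu_\alpha(x)=A_\alpha|x|^{2\alpha+1}dx$ on $\mathbb{R}$ with $A_\alpha=(2^{\alpha+1}\Gamma(\alpha+1))^{-1}$; $B(0,r)=(-r,r)$; $B_0=B(0,1)$ and $\chi_{B_0}$ is its characteristic function. Dunkl translation: for $x,y\in\mathbb{R}$ and $\theta\in[0,\pi]$ put $(x,y)_\theta=\sqrt{x^2+y^2-2xy\cos\theta}$. For a function $g$ on $\mathbb{R}$ (continuous, or locally integrable with respect to $\mu_\alpha$, in which case the formula is understood for almost every $y$), $$\tau_x^\alpha g(y)=\frac{c_\alpha}{2}\int_0^\pi\Big\{g((x,y)_\theta)+g(-(x,y)_\theta)+\frac{x+y}{(x,y)_\theta}\big[g((x,y)_\theta)-g(-(x,y)_\theta)\big]\Big\}(1-\cos\theta)\sin^{2\alpha}\theta\,d\theta,$$ with $c_\alpha=\big(\int_0^\pi\sin^{2\alpha}\theta\,d\theta\big)^{-1}$; for $\alpha=-\frac12$ it is the ordinary translation $\tau_x^\alpha g(y)=g(x+y)$. Dunkl-type $BMO_\phi$ space: for $\phi:\mathbb{R}^+\to\mathbb{R}^+$, $BMO_\phi(\mathbb{R},d\mu_\alpha)$ is the space of locally integrable $f$ on $\mathbb{R}$ with $$\|f\|_{BMO_\phi(\mathbb{R},d\mu_\alpha)}=\sup_{r>0,\,x\in\mathbb{R}}\frac1{\phi(r)}\frac1{\mu_\alpha(B(0,r))}\int_{B(0,r)}|\tau_x^\alpha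 f(y)-f_{B(0,r)}(x)|\,d\mu_\alpha(y)<\infty,$$ where $f_{B(0,r)}(x)=\frac1{\mu_\alpha(B(0,r))}\int_{B(0,r)}\tau_x^\alpha f(y)\,d\mu_\alpha(y)$. Modified generalized Dunkl-type fractional integral operator: with $K_\rho^\alpha(y)=\frac{\rho(|y|)}{|y|^{d_\alpha}}$, $$\tilde T_\rho^\alpha f(x)=\int_{\mathbb{R}}f(y)\Big(\tau_x^\alpha K_\rho^\alpha(y)-K_\rho^\alpha(y)(1-\chi_{B_0}(y))\Big)d\mu_\alpha(y).$$ For $\theta_1,\theta_2:(0,\infty)\to(0,\infty)$, $\theta_1(r)\sim\theta_2(r)$ means there is $C>0$ with $\frac1C\theta_1(r)\le\theta_2(r)\le C\theta_1(r)$ for all $r>0$. A function $\theta:(0,\infty)\to(0,\infty)$ is almost increasing if there is $C>0$ with $\theta(r)\le C\theta(s)$ for all $r\le s$. *)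

theory Defs
  imports "HOL-Analysis.Analysis"
begin

text \<open>
  Functions of class \<^class>\<open>real_normed_field\<close> and \<^class>\<open>banach\<close> are the real- and the
  complex-valued ones.  Functions on \<open>(0,\<infinity>)\<close> are rendered as \<open>real \<Rightarrow> real\<close>; only their values
  at positive arguments matter.
\<close>

definition dunkl_dim :: "real \<Rightarrow> real" where
  "dunkl_dim \<alpha> = 2 * \<alpha> + 2"

text \<open>\<^const>\<open>lebesgue\<close> rather than \<^const>\<open>lborel\<close>, so that locally integrable functions are
  Lebesgue measurable and not necessarily Borel.\<close>

definition dunkl_measure :: "real \<Rightarrow> real measure" where
  "dunkl_measure \<alpha> = density lebesgue
     (\<lambda>x. ennreal (inverse (2 powr (\<alpha> + 1) * Gamma (\<alpha> + 1)) * \<bar>x\<bar> powr (2 * \<alpha> + 1)))"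

definition dunkl_dist :: "real \<Rightarrow> real \<Rightarrow> real \<Rightarrow> real" where
  "dunkl_dist x y \<theta> = sqrt (x\<^sup>2 + y\<^sup>2 - 2 * x * y * cos \<theta>)"

definition dunkl_const :: "real \<Rightarrow> real" where
  "dunkl_const \<alpha> = inverse (LINT \<theta>:{0..pi}|lebesgue. sin \<theta> powr (2 * \<alpha>))"

text \<open>The integral over \<open>\<theta>\<close> is \<open>0\<close> by convention where it diverges; for locally integrable \<open>g\<close> this
  concerns only a null set of \<open>y\<close>, for each \<open>x\<close>.  The quotient by \<^const>\<open>dunkl_dist\<close> vanishes by
  convention when \<open>x = y = 0\<close>, where the formula then gives \<open>g 0\<close>.\<close>

definition dunkl_translation ::
    "real \<Rightarrow> real \<Rightarrow> (real \<Rightarrow> 'a) \<Rightarrow> real \<Rightarrow> 'a::{real_normed_field,banach,second_countable_topology}" where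
  "dunkl_translation \<alpha> x g y =
     (if \<alpha> = - 1 / 2 then g (x + y)
      else (dunkl_const \<alpha> / 2) *\<^sub>R
        (LINT \<theta>:{0..pi}|lebesgue. ((1 - cos \<theta>) * sin \<theta> powr (2 * \<alpha>)) *\<^sub>R
          (g (dunkl_dist x y \<theta>) + g (- dunkl_dist x y \<theta>)
           + ((x + y) / dunkl_dist x y \<theta>) *\<^sub>R
               (g (dunkl_dist x y \<theta>) - g (- dunkl_dist x y \<theta>)))))"

definition locally_integrable ::
    "real measure \<Rightarrow> (real \<Rightarrow> 'a::{banach,second_countable_topology}) \<Rightarrow> bool" where
  "locally_integrable M f \<longleftrightarrow> (\<forall>K. compact K \<longrightarrow> set_integrable M K f)"

definition dunkl_average ::
    "real \<Rightarrow> (real \<Rightarrow> 'a) \<Rightarrow> real \<Rightarrow> real \<Rightarrow> 'a::{real_normed_field,banach,second_countable_topology}" where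
  "dunkl_average \<alpha> f r x =
     inverse (measure (dunkl_measure \<alpha>) (ball 0 r)) *\<^sub>R
       (LINT y:ball 0 r|dunkl_measure \<alpha>. dunkl_translation \<alpha> x f y)"

definition dunkl_BMO_norm ::
    "real \<Rightarrow> (real \<Rightarrow> real) \<Rightarrow> (real \<Rightarrow> 'a::{real_normed_field,banach,second_countable_topology}) \<Rightarrow> ennreal" where
  "dunkl_BMO_norm \<alpha> \<phi> f =
     (SUP r\<in>{0<..}. SUP x.
        ennreal (1 / \<phi> r) * (1 / emeasure (dunkl_measure \<alpha>) (ball 0 r)) *
          (\<integral>\<^sup>+y\<in>ball 0 r. ennreal (norm (dunkl_translation \<alpha> x f y - dunkl_average \<alpha> f r x))
             \<partial>dunkl_measure \<alpha>))"

definition dunkl_BMO ::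
    "real \<Rightarrow> (real \<Rightarrow> real) \<Rightarrow> (real \<Rightarrow> 'a::{real_normed_field,banach,second_countable_topology}) set" where
  "dunkl_BMO \<alpha> \<phi> = {f. locally_integrable (dunkl_measure \<alpha>) f \<and> dunkl_BMO_norm \<alpha> \<phi> f < \<infinity>}"

definition dunkl_kernel :: "real \<Rightarrow> (real \<Rightarrow> real) \<Rightarrow> real \<Rightarrow> real" where
  "dunkl_kernel \<alpha> \<rho> y = \<rho> \<bar>y\<bar> / \<bar>y\<bar> powr dunkl_dim \<alpha>"

definition dunkl_frac_integrand ::
    "real \<Rightarrow> (real \<Rightarrow> real) \<Rightarrow> (real \<Rightarrow> 'a) \<Rightarrow> real \<Rightarrow> real \<Rightarrow> 'a::{real_normed_field,banach,second_countable_topology}" where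
  "dunkl_frac_integrand \<alpha> \<rho> f x y =
     f y * of_real (dunkl_translation \<alpha> x (dunkl_kernel \<alpha> \<rho>) y
                    - dunkl_kernel \<alpha> \<rho> y * (1 - indicator (ball 0 1) y))"

definition dunkl_frac_integral ::
    "real \<Rightarrow> (real \<Rightarrow> real) \<Rightarrow> (real \<Rightarrow> 'a) \<Rightarrow> real \<Rightarrow> 'a::{real_normed_field,banach,second_countable_topology}" where
  "dunkl_frac_integral \<alpha> \<rho> f x = (LINT y|dunkl_measure \<alpha>. dunkl_frac_integrand \<alpha> \<rho> f x y)"

definition comparable :: "(real \<Rightarrow> real) \<Rightarrow> (real \<Rightarrow> real) \<Rightarrow> bool" where
  "comparable \<theta>\<^sub>1 \<theta>\<^sub>2 \<longleftrightarrow> (\<exists>C>0. \<forall>r>0. 1 / C * \<theta>\<^sub>1 r \<le> \<theta>\<^sub>2 r \<and> \<theta>\<^sub>2 r \<le> C * \<theta>\<^sub>1 r)"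

definition almost_increasing :: "(real \<Rightarrow> real) \<Rightarrow> bool" where
  "almost_increasing \<theta> \<longleftrightarrow> (\<exists>C>0. \<forall>r s. 0 < r \<and> r \<le> s \<longrightarrow> \<theta> r \<le> C * \<theta> s)"

end

theory Submission
  imports Defs "HOL-Computational_Algebra.Formal_Power_Series"
begin

text \<open>
  The oscillation of \<open>f\<close> is measured through the functions \<open>\<tau>\<^sub>x f\<close> on balls centred at the origin, so
  the operator has to be compared with translations. The proof rests on the identity
  \<open>\<tau>\<^sub>x (T f) = T (\<tau>\<^bsub>-x\<^esub> f) + const\<close> almost everywhere (\<open>frac_op_commute\<close>). It reduces the claim to an
  estimate, on one ball \<open>B\<^sub>r\<close> around the origin, of \<open>T F\<close> for a single function \<open>F = \<tau>\<^bsub>-x\<^esub> f\<close> whose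
  mean oscillation on every centred ball \<open>B\<^sub>R\<close> is at most \<open>N \<phi> R\<close> (\<open>frac_op_osc\<close>).

  That estimate is classical. Write \<open>L a z w\<close> for \<open>\<tau>\<^sub>z K w\<close> minus the part of \<open>K\<close> outside the ball of
  radius \<open>a\<close>. Changing \<open>a\<close> changes \<open>T F\<close> by a constant, so \<open>a = 2 r\<close> may be used on \<open>B\<^sub>r\<close>. The
  integral of \<open>L a z\<close> does not depend on \<open>z\<close> (\<open>L_integral\<close>), so, up to a further constant, \<open>F\<close> may
  be replaced by its difference from the average over \<open>B\<^sub>2\<^sub>r\<close>. Near the origin the estimate is then
  Fubini and \<open>\<phi> r \<integral>\<^sub>0\<^sup>r \<rho> t / t dt \<le> A' \<psi> r\<close>. Far away the smoothness of \<open>K\<close> gives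
  \<open>\<bar>L a z w\<bar> \<le> C \<bar>z\<bar> \<rho> \<bar>w\<bar> / \<bar>w\<bar>\<^sup>D\<^sup>+\<^sup>1\<close> (\<open>kernel_smooth\<close>), and the oscillation of \<open>F\<close> is summed over
  dyadic annuli (\<open>osc_tail\<close>) with the two integral conditions at infinity.

  Only a few properties of the translation enter. It averages a function over positions \<open>p x y \<omega>\<close>
  with \<open>\<bar>\<bar>x\<bar> - \<bar>y\<bar>\<bar> \<le> \<bar>p x y \<omega>\<bar> \<le> \<bar>x\<bar> + \<bar>y\<bar>\<close> and bounded weights of total mass one; it satisfies the
  duality \<open>\<integral> \<tau>\<^sub>x g \<cdot> f = \<integral> g \<cdot> \<tau>\<^bsub>-x\<^esub> f\<close>; and for even \<open>g\<close> the expression \<open>\<tau>\<^sub>x (\<lambda>z. \<tau>\<^sub>z g w) y\<close> is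
  symmetric in \<open>y\<close> and \<open>w\<close>. These are collected in the locale \<open>symmetric_translation\<close>, in which the
  analysis is carried out; the theorem there is \<open>frac_op_bounded\<close>.

  For the Dunkl translation the duality comes from substituting \<open>z = (x, y)\<^sub>\<theta>\<close>: the measure becomes a
  density in \<open>(y, z)\<close> that for fixed \<open>x\<close> depends only on the area of the triangle with sides
  \<open>\<bar>x\<bar>, \<bar>y\<bar>, \<bar>z\<bar>\<close> and on \<open>\<bar>y z\<bar>\<close>, hence is symmetric. The triple symmetry is verified on even
  monomials and extended by the Weierstrass theorem. Both sides for \<open>t\<^sup>2\<^sup>m\<close> are the coefficient of
  \<open>t\<^sup>2\<^sup>m\<close> in \<open>E (x t) E (y t) E (w t)\<close>, where \<open>E\<close> is the Dunkl exponential (\<open>tau_tau_even_power\<close>);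
  this follows from the product formula for \<open>E (x t) E (y t)\<close>, which is proved by matching
  recurrences for the coefficients with recurrences for integrals over the angle (\<open>angint_qdist\<close>).
  For \<open>\<alpha> = -1/2\<close> the ordinary translation satisfies the same axioms with a one-point space of
  positions.
\<close>

section \<open>Products of Dunkl exponentials\<close>

text \<open>
  The Dunkl operator of parameter \<open>\<alpha>\<close> maps \<open>t\<^sup>n\<^sup>+\<^sup>1 / dunkl_fact d (n + 1)\<close> to \<open>t\<^sup>n / dunkl_fact d n\<close>
  when \<open>d = 2 \<alpha> + 2\<close>, so \<open>\<Sum> (x t)\<^sup>n / dunkl_fact d n\<close> is its eigenfunction, the Dunkl exponential
  \<open>E (x t)\<close>.
\<close>
fun dunkl_fact :: "real \<Rightarrow> nat \<Rightarrow> real" where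
  "dunkl_fact d 0 = 1"
| "dunkl_fact d (Suc n) = (if even n then real n + d else real n + 1) * dunkl_fact d n"

lemma dunkl_fact_pos: "d > 0 \<Longrightarrow> dunkl_fact d n > 0"
  by (induction n) (auto intro!: mult_pos_pos)

text \<open>
  With \<open>T = t\<^sup>2\<close> the exponential splits as \<open>E (x t) = dunkl_exp_even d x + t dunkl_exp_odd d x\<close>.
\<close>
definition dunkl_exp_even :: "real \<Rightarrow> real \<Rightarrow> real fps" where
  "dunkl_exp_even d x = Abs_fps (\<lambda>i. x ^ (2 * i) / dunkl_fact d (2 * i))"
definition dunkl_exp_odd :: "real \<Rightarrow> real \<Rightarrow> real fps" where
  "dunkl_exp_odd d x = Abs_fps (\<lambda>i. x ^ (2 * i + 1) / dunkl_fact d (2 * i + 1))"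

text \<open>
  The operator \<open>T d/dT\<close>, that is, half of \<open>t d/dt\<close>. In terms of it the eigenvalue equation of the
  Dunkl exponential becomes the pair of first order equations \<open>euler_exp_even\<close> and \<open>euler_exp_odd\<close>.
\<close>
definition euler :: "real fps \<Rightarrow> real fps" where "euler F = fps_X * fps_deriv F"

lemma euler_nth [simp]: "fps_nth (euler F) n = real n * fps_nth F n"
  by (cases n) (auto simp: euler_def)

lemma euler_mult: "euler (F * G) = euler F * G + F * euler G"
  by (simp add: euler_def algebra_simps)

lemma euler_exp_even:
  assumes "d > 0"
  shows "2 * euler (dunkl_exp_even d x) = fps_const x * (fps_X * dunkl_exp_odd d x)"
proof (rule fps_ext)
  fix n
  show "fps_nth (2 * euler (dunkl_exp_even d x)) n = fps_nth (fps_const x * (fps_X * dunkl_exp_odd d x)) n"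
  proof (cases n)
    case 0 then show ?thesis by (simp add: numeral_fps_const)
  next
    case (Suc m)
    have g: "dunkl_fact d (2 * Suc m) = (2 * real m + 2) * dunkl_fact d (2 * m + 1)" by (simp add: algebra_simps)
    have "fps_nth (2 * euler (dunkl_exp_even d x)) n = 2 * (real (Suc m) * (x ^ (2 * Suc m) / dunkl_fact d (2 * Suc m)))"
      using Suc by (simp add: dunkl_exp_even_def numeral_fps_const del: dunkl_fact.simps mult_Suc_right)
    also have "\<dots> = (2 * real m + 2) * (x * x ^ (2 * m + 1)) / ((2 * real m + 2) * dunkl_fact d (2 * m + 1))"
    proof -
      have "2 * (r * (z / G)) = 2 * r * z / G" for r z G :: real by simp
      then show ?thesis unfolding g by (simp only: of_nat_Suc) (simp add: algebra_simps del: dunkl_fact.simps)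
    qed
    also have "\<dots> = x * x ^ (2 * m + 1) / dunkl_fact d (2 * m + 1)"
      by (rule mult_divide_mult_cancel_left) auto
    also have "\<dots> = fps_nth (fps_const x * (fps_X * dunkl_exp_odd d x)) n"
      using Suc by (simp add: dunkl_exp_odd_def del: dunkl_fact.simps)
    finally show ?thesis .
  qed
qed

lemma euler_exp_odd:
  assumes "d > 0"
  shows "2 * euler (dunkl_exp_odd d x) + fps_const d * dunkl_exp_odd d x = fps_const x * dunkl_exp_even d x"
proof (rule fps_ext)
  fix n
  have "dunkl_fact d (2 * n + 1) = (2 * real n + d) * dunkl_fact d (2 * n)" by simp
  moreover have "2 * (real n * (z / ((2 * real n + d) * g))) + d * (z / ((2 * real n + d) * g)) = z / g" for z g :: real
  proof -
    have "2 * real n + d \<noteq> 0" using assms by auto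
    have "2 * (real n * (z / ((2 * real n + d) * g))) + d * (z / ((2 * real n + d) * g))
      = (2 * real n + d) * (z / ((2 * real n + d) * g))" by (simp only: distrib_right mult.assoc)
    then show ?thesis using \<open>2 * real n + d \<noteq> 0\<close> by simp
  qed
  ultimately show "fps_nth (2 * euler (dunkl_exp_odd d x) + fps_const d * dunkl_exp_odd d x) n
     = fps_nth (fps_const x * dunkl_exp_even d x) n"
    by (simp add: dunkl_exp_even_def dunkl_exp_odd_def numeral_fps_const del: dunkl_fact.simps)
qed

text \<open>
  The even part of \<open>E (x t) E (y t)\<close> is \<open>prod_even + prod_odd\<close> and the odd part is \<open>t prod_mixed\<close>.
  The two summands of the even part are kept apart because the mean of a power of \<open>qdist\<close> over the
  angle produces the first one, and the mean with a factor \<open>cos \<theta>\<close> the second.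
\<close>
definition prod_even :: "real \<Rightarrow> real \<Rightarrow> real \<Rightarrow> real fps" where
  "prod_even d x y = dunkl_exp_even d x * dunkl_exp_even d y"
definition prod_odd :: "real \<Rightarrow> real \<Rightarrow> real \<Rightarrow> real fps" where
  "prod_odd d x y = fps_X * (dunkl_exp_odd d x * dunkl_exp_odd d y)"
definition prod_mixed :: "real \<Rightarrow> real \<Rightarrow> real \<Rightarrow> real fps" where
  "prod_mixed d x y = dunkl_exp_odd d x * dunkl_exp_even d y + dunkl_exp_even d x * dunkl_exp_odd d y"

lemma euler_prod_mixed:
  assumes "d > 0"
  shows "2 * euler (prod_mixed d x y) + fps_const d * prod_mixed d x y
     = (fps_const x + fps_const y) * (prod_even d x y + prod_odd d x y)"
proof -
  note e = euler_exp_even[OF assms] and o = euler_exp_odd[OF assms]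
  have "2 * euler (prod_mixed d x y) + fps_const d * prod_mixed d x y
    = (2 * euler (dunkl_exp_odd d x) + fps_const d * dunkl_exp_odd d x) * dunkl_exp_even d y
    + dunkl_exp_odd d x * (2 * euler (dunkl_exp_even d y)) + (2 * euler (dunkl_exp_even d x)) * dunkl_exp_odd d y
    + dunkl_exp_even d x * (2 * euler (dunkl_exp_odd d y) + fps_const d * dunkl_exp_odd d y)"
    unfolding prod_mixed_def by (simp add: euler_mult euler_def algebra_simps)
  also have "\<dots> = (fps_const x + fps_const y) * (prod_even d x y + prod_odd d x y)"
    unfolding e o prod_even_def prod_odd_def by (simp only: algebra_simps)
  finally show ?thesis .
qed

lemma euler_prod_even:
  assumes "d > 0"
  shows "2 * euler (prod_even d x y)
     = fps_X * (fps_const x * (dunkl_exp_odd d x * dunkl_exp_even d y) + fps_const y * (dunkl_exp_even d x * dunkl_exp_odd d y))"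
proof -
  note e = euler_exp_even[OF assms]
  have "2 * euler (prod_even d x y) =
     (2 * euler (dunkl_exp_even d x)) * dunkl_exp_even d y + dunkl_exp_even d x * (2 * euler (dunkl_exp_even d y))"
    unfolding prod_even_def by (simp add: euler_mult algebra_simps)
  then show ?thesis unfolding e by (simp only: algebra_simps)
qed

lemma euler_mixed_single:
  assumes "d > 0"
  shows "2 * euler (dunkl_exp_odd d x * dunkl_exp_even d y) + fps_const d * (dunkl_exp_odd d x * dunkl_exp_even d y)
     = fps_const x * prod_even d x y + fps_const y * prod_odd d x y"
proof -
  note e = euler_exp_even[OF assms] and o = euler_exp_odd[OF assms]
  have "2 * euler (dunkl_exp_odd d x * dunkl_exp_even d y) + fps_const d * (dunkl_exp_odd d x * dunkl_exp_even d y)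
    = (2 * euler (dunkl_exp_odd d x) + fps_const d * dunkl_exp_odd d x) * dunkl_exp_even d y
     + dunkl_exp_odd d x * (2 * euler (dunkl_exp_even d y))"
    by (simp add: euler_mult algebra_simps)
  then show ?thesis unfolding e o prod_even_def prod_odd_def by (simp only: algebra_simps)
qed

text \<open>
  Eliminating the two mixed products between the equations for \<open>euler\<close> leaves a recurrence that
  couples only \<open>prod_even\<close> and \<open>prod_odd\<close>.
\<close>
lemma prod_even_Suc:
  assumes "d > 0"
  shows "(2 * real m + 2) * (2 * real m + d) * fps_nth (prod_even d x y) (Suc m)
     = (x\<^sup>2 + y\<^sup>2) * fps_nth (prod_even d x y) m + 2 * x * y * fps_nth (prod_odd d x y) m"
proof -
  let ?F = "dunkl_exp_odd d x * dunkl_exp_even d y" and ?G = "dunkl_exp_even d x * dunkl_exp_odd d y"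
  have 1: "(2 * real m + 2) * fps_nth (prod_even d x y) (Suc m) = x * fps_nth ?F m + y * fps_nth ?G m"
    using arg_cong[OF euler_prod_even[OF assms, of x y], of "\<lambda>F. fps_nth F (Suc m)"]
    by (simp add: numeral_fps_const algebra_simps)
  have 2: "(2 * real m + d) * fps_nth ?F m = x * fps_nth (prod_even d x y) m + y * fps_nth (prod_odd d x y) m"
    using arg_cong[OF euler_mixed_single[OF assms, of x y], of "\<lambda>F. fps_nth F m"]
    by (simp add: numeral_fps_const algebra_simps)
  have 3: "(2 * real m + d) * fps_nth ?G m = y * fps_nth (prod_even d x y) m + x * fps_nth (prod_odd d x y) m"
    using arg_cong[OF euler_mixed_single[OF assms, of y x], of "\<lambda>F. fps_nth F m"]
    by (simp add: numeral_fps_const algebra_simps prod_even_def prod_odd_def)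
  have "(2 * real m + 2) * (2 * real m + d) * fps_nth (prod_even d x y) (Suc m)
     = (2 * real m + d) * (x * fps_nth ?F m + y * fps_nth ?G m)" unfolding 1[symmetric] by (simp add: algebra_simps)
  also have "\<dots> = x * ((2 * real m + d) * fps_nth ?F m) + y * ((2 * real m + d) * fps_nth ?G m)"
    by (simp add: algebra_simps)
  finally show ?thesis unfolding 2 3 by (simp add: algebra_simps power2_eq_square)
qed

lemma prod_odd_Suc:
  assumes "d > 0"
  shows "(2 * real m + 2 * d) * (2 * real m + d) * fps_nth (prod_odd d x y) (Suc m)
     = (x\<^sup>2 + y\<^sup>2) * fps_nth (prod_odd d x y) m + 2 * x * y * fps_nth (prod_even d x y) m"
proof -
  let ?F = "dunkl_exp_odd d x * dunkl_exp_even d y" and ?G = "dunkl_exp_even d x * dunkl_exp_odd d y"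
  let ?H = "dunkl_exp_odd d x * dunkl_exp_odd d y"
  note o = euler_exp_odd[OF assms]
  have "2 * euler ?H + 2 * fps_const d * ?H
    = (2 * euler (dunkl_exp_odd d x) + fps_const d * dunkl_exp_odd d x) * dunkl_exp_odd d y
     + dunkl_exp_odd d x * (2 * euler (dunkl_exp_odd d y) + fps_const d * dunkl_exp_odd d y)"
    by (simp add: euler_mult algebra_simps)
  also have "\<dots> = fps_const x * ?G + fps_const y * ?F" unfolding o by (simp only: algebra_simps)
  finally have E: "2 * euler ?H + 2 * fps_const d * ?H = fps_const x * ?G + fps_const y * ?F" .
  have "2 * fps_const d * ?H = fps_const (2 * d) * ?H"
    by (simp add: numeral_fps_const flip: fps_const_mult)
  then have 1: "(2 * real m + 2 * d) * fps_nth ?H m = x * fps_nth ?G m + y * fps_nth ?F m"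
    using arg_cong[OF E, of "\<lambda>F. fps_nth F m"] by (simp add: numeral_fps_const distrib_right mult.assoc)
  have 2: "(2 * real m + d) * fps_nth ?F m = x * fps_nth (prod_even d x y) m + y * fps_nth (prod_odd d x y) m"
    using arg_cong[OF euler_mixed_single[OF assms, of x y], of "\<lambda>F. fps_nth F m"]
    by (simp add: numeral_fps_const algebra_simps)
  have 3: "(2 * real m + d) * fps_nth ?G m = y * fps_nth (prod_even d x y) m + x * fps_nth (prod_odd d x y) m"
    using arg_cong[OF euler_mixed_single[OF assms, of y x], of "\<lambda>F. fps_nth F m"]
    by (simp add: numeral_fps_const algebra_simps prod_even_def prod_odd_def)
  have H: "fps_nth (prod_odd d x y) (Suc m) = fps_nth ?H m" by (simp add: prod_odd_def)
  have "(2 * real m + 2 * d) * (2 * real m + d) * fps_nth (prod_odd d x y) (Suc m)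
     = (2 * real m + d) * (x * fps_nth ?G m + y * fps_nth ?F m)" unfolding 1[symmetric] H by (simp add: algebra_simps)
  also have "\<dots> = x * ((2 * real m + d) * fps_nth ?G m) + y * ((2 * real m + d) * fps_nth ?F m)"
    by (simp add: algebra_simps)
  finally show ?thesis unfolding 2 3 by (simp add: algebra_simps power2_eq_square)
qed

section \<open>Integrals over the angle\<close>

definition angw :: "real \<Rightarrow> real \<Rightarrow> real" where "angw \<alpha> \<theta> = sin \<theta> powr (2 * \<alpha>)"

lemma angw_nonneg [simp]: "angw \<alpha> \<theta> \<ge> 0" by (simp add: angw_def)

lemma angw_borel [measurable]: "angw \<alpha> \<in> borel_measurable borel"
  unfolding angw_def by measurable

lemma sin_powr_has_derivative:
  assumes "\<theta> \<in> {0<..<pi}"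
  shows "((\<lambda>\<theta>. sin \<theta> powr (2 * \<alpha> + 1)) has_real_derivative (2 * \<alpha> + 1) * cos \<theta> * angw \<alpha> \<theta>) (at \<theta>)"
proof -
  have "sin \<theta> > 0" using assms by (simp add: sin_gt_zero)
  moreover have "((\<lambda>\<theta>. sin \<theta> powr (2 * \<alpha> + 1)) has_real_derivative
      (2 * \<alpha> + 1) * sin \<theta> powr (2 * \<alpha> + 1 - 1) * cos \<theta>) (at \<theta>)"
    using calculation DERIV_fun_powr[OF DERIV_sin, of \<theta> "2*\<alpha>+1"] by simp
  ultimately show ?thesis by (simp add: angw_def algebra_simps)
qed

lemma sin_powr_continuous:
  assumes "\<alpha> > -1/2"
  shows "continuous_on {0..pi} (\<lambda>\<theta>. sin \<theta> powr (2 * \<alpha> + 1))"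
  using assms by (intro continuous_on_powr' continuous_intros) (auto simp: sin_ge_zero)

text \<open>
  For \<open>\<alpha> < 0\<close> the weight blows up at both ends of the interval. Since \<open>1 = sin\<^sup>2 \<theta> + cos\<^sup>2 \<theta>\<close> it is
  bounded by \<open>1 + \<bar>cos \<theta>\<bar> sin\<^sup>2\<^sup>\<alpha> \<theta>\<close>, and the second term is, up to a constant and the sign, the
  derivative of \<open>sin\<^bsup>2\<alpha>+1\<^esup> \<theta>\<close> on either half of the interval.
\<close>
lemma angw_integrable:
  assumes \<alpha>: "\<alpha> > -1/2"
  shows "set_integrable lborel {0..pi} (angw \<alpha>)"
proof -
  let ?g = "\<lambda>\<theta>. \<bar>cos \<theta>\<bar> * angw \<alpha> \<theta>"
  have 1: "?g integrable_on {0..pi/2}"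
  proof -
    have "((\<lambda>\<theta>. (2 * \<alpha> + 1) * cos \<theta> * angw \<alpha> \<theta>) has_integral sin (pi/2) powr (2*\<alpha>+1) - sin 0 powr (2*\<alpha>+1)) {0..pi/2}"
      by (rule fundamental_theorem_of_calculus_interior)
         (use sin_powr_continuous[OF \<alpha>] in \<open>auto intro: continuous_on_subset sin_powr_has_derivative
             simp flip: has_real_derivative_iff_has_vector_derivative\<close>)
    then have "((\<lambda>\<theta>. (1/(2*\<alpha>+1)) * ((2 * \<alpha> + 1) * cos \<theta> * angw \<alpha> \<theta>))) integrable_on {0..pi/2}"
      using integrable_on_mult_right by blast
    then show ?thesis
      by (rule integrable_eq) (use \<alpha> in \<open>auto simp: field_simps abs_of_nonneg cos_ge_zero\<close>)
  qed
  have 2: "?g integrable_on {pi/2..pi}"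
  proof -
    have "((\<lambda>\<theta>. (2 * \<alpha> + 1) * cos \<theta> * angw \<alpha> \<theta>) has_integral sin pi powr (2*\<alpha>+1) - sin (pi/2) powr (2*\<alpha>+1)) {pi/2..pi}"
      by (rule fundamental_theorem_of_calculus_interior)
         (use sin_powr_continuous[OF \<alpha>] pi_gt_zero in \<open>auto intro: continuous_on_subset sin_powr_has_derivative
             simp flip: has_real_derivative_iff_has_vector_derivative\<close>)
    then have "((\<lambda>\<theta>. (-1/(2*\<alpha>+1)) * ((2 * \<alpha> + 1) * cos \<theta> * angw \<alpha> \<theta>))) integrable_on {pi/2..pi}"
      using integrable_on_mult_right by blast
    moreover have "cos \<theta> \<le> 0" if "\<theta> \<in> {pi/2..pi}" for \<theta>
      using cos_monotone_0_pi_le[of "pi/2" \<theta>] that pi_gt_zero by auto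
    ultimately show ?thesis
      by (elim integrable_eq) (use \<alpha> in \<open>auto simp: field_simps abs_of_nonpos\<close>)
  qed
  have "?g integrable_on {0..pi}" using Henstock_Kurzweil_Integration.integrable_combine[OF _ _ 1 2] by auto
  then have "?g absolutely_integrable_on {0..pi}"
    by (rule nonnegative_absolutely_integrable_1) auto
  then have g: "set_integrable lborel {0..pi} ?g"
    unfolding set_integrable_def by (subst (asm) integrable_completion) auto
  have "set_integrable lborel {0..pi} (\<lambda>\<theta>. 1 + ?g \<theta>)"
    by (rule set_integral_add(1)[OF _ g])
       (simp add: set_integrable_def integrable_indicator_iff)
  then show ?thesis
  proof (rule set_integrable_bound)
    show "set_borel_measurable lborel {0..pi} (angw \<alpha>)"
      unfolding set_borel_measurable_def by measurable
    show "AE \<theta> in lborel. \<theta> \<in> {0..pi} \<longrightarrow> norm (angw \<alpha> \<theta>) \<le> norm (1 + \<bar>cos \<theta>\<bar> * angw \<alpha> \<theta>)"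
    proof (intro always_eventually allI impI)
      fix \<theta>::real assume t: "\<theta> \<in> {0..pi}"
      have "angw \<alpha> \<theta> \<le> 1 + \<bar>cos \<theta>\<bar> * angw \<alpha> \<theta>"
      proof (cases "sin \<theta> = 0")
        case True then show ?thesis by (simp add: angw_def)
      next
        case False
        then have s: "sin \<theta> > 0" using sin_ge_zero[of \<theta>] t by auto
        have "(sin \<theta>)\<^sup>2 * angw \<alpha> \<theta> = sin \<theta> powr (2*\<alpha>+2)"
          using s by (simp add: angw_def powr_add powr_numeral mult.commute)
        also have "\<dots> \<le> 1" using s \<alpha> by (intro powr_le1) auto
        finally have a: "(sin \<theta>)\<^sup>2 * angw \<alpha> \<theta> \<le> 1" .
        have "(cos \<theta>)\<^sup>2 \<le> \<bar>cos \<theta>\<bar>"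
          using abs_cos_le_one[of \<theta>] by (metis abs_ge_zero mult_left_le power2_abs power2_eq_square)
        then have "(cos \<theta>)\<^sup>2 * angw \<alpha> \<theta> \<le> \<bar>cos \<theta>\<bar> * angw \<alpha> \<theta>" by (intro mult_right_mono) auto
        moreover have "angw \<alpha> \<theta> = (sin \<theta>)\<^sup>2 * angw \<alpha> \<theta> + (cos \<theta>)\<^sup>2 * angw \<alpha> \<theta>"
          by (simp only: distrib_right[symmetric] sin_cos_squared_add mult_1)
        ultimately show ?thesis using a by linarith
      qed
      then show "norm (angw \<alpha> \<theta>) \<le> norm (1 + \<bar>cos \<theta>\<bar> * angw \<alpha> \<theta>)" by simp
    qed
  qed
qed

lemma angw_integrable_mult:
  assumes \<alpha>: "\<alpha> > -1/2" and h: "continuous_on UNIV h"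
  shows "set_integrable lborel {0..pi} (\<lambda>\<theta>. h \<theta> * angw \<alpha> \<theta> :: real)"
proof -
  have hm [measurable]: "h \<in> borel_measurable borel" by (rule borel_measurable_continuous_onI[OF h])
  have "compact (h ` {0..pi})" by (intro compact_continuous_image continuous_on_subset[OF h]) auto
  then obtain B where B: "\<And>\<theta>. \<theta> \<in> {0..pi} \<Longrightarrow> \<bar>h \<theta>\<bar> \<le> B"
    by (meson bounded_real compact_imp_bounded imageI)
  have "set_integrable lborel {0..pi} (\<lambda>\<theta>. B * angw \<alpha> \<theta>)"
    using angw_integrable[OF \<alpha>] by simp
  then show ?thesis
  proof (rule set_integrable_bound)
    show "set_borel_measurable lborel {0..pi} (\<lambda>\<theta>. h \<theta> * angw \<alpha> \<theta>)"
      unfolding set_borel_measurable_def by measurable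
    show "AE \<theta> in lborel. \<theta> \<in> {0..pi} \<longrightarrow> norm (h \<theta> * angw \<alpha> \<theta>) \<le> norm (B * angw \<alpha> \<theta>)"
      using B by (intro always_eventually) (force simp: abs_mult intro!: mult_right_mono)
  qed
qed

definition angint :: "real \<Rightarrow> (real \<Rightarrow> real) \<Rightarrow> real" where
  "angint \<alpha> h = (LINT \<theta>:{0..pi}|lborel. h \<theta> * angw \<alpha> \<theta>)"

lemma angint_add:
  assumes "\<alpha> > -1/2" "continuous_on UNIV g" "continuous_on UNIV h"
  shows "angint \<alpha> (\<lambda>\<theta>. g \<theta> + h \<theta>) = angint \<alpha> g + angint \<alpha> h"
  unfolding angint_def distrib_right
  by (rule set_integral_add(2)[OF angw_integrable_mult[OF assms(1,2)] angw_integrable_mult[OF assms(1,3)]])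

lemma angint_cmult: "angint \<alpha> (\<lambda>\<theta>. c * h \<theta>) = c * angint \<alpha> h"
  unfolding angint_def by (simp add: mult.assoc)

text \<open>
  The function \<open>g sin\<^bsup>2\<alpha>+1\<^esup>\<close> vanishes at both ends of the interval and has the derivative
  \<open>(g' sin + (2 \<alpha> + 1) g cos) sin\<^sup>2\<^sup>\<alpha>\<close>.
\<close>
lemma angint_by_parts:
  assumes \<alpha>: "\<alpha> > -1/2"
    and g: "\<And>\<theta>. (g has_real_derivative g' \<theta>) (at \<theta>)" and g': "continuous_on UNIV g'"
  shows "(2 * \<alpha> + 1) * angint \<alpha> (\<lambda>\<theta>. g \<theta> * cos \<theta>) = - angint \<alpha> (\<lambda>\<theta>. g' \<theta> * sin \<theta>)"
proof -
  have gc: "continuous_on UNIV g" by (rule DERIV_continuous_on[OF has_field_derivative_at_within[OF g]])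
  let ?h = "\<lambda>\<theta>. g' \<theta> * sin \<theta> + (2*\<alpha>+1) * (g \<theta> * cos \<theta>)"
  have hc: "continuous_on UNIV ?h" by (intro continuous_intros gc g')
  have "((\<lambda>\<theta>. ?h \<theta> * angw \<alpha> \<theta>) has_integral
      g pi * sin pi powr (2*\<alpha>+1) - g 0 * sin 0 powr (2*\<alpha>+1)) {0..pi}"
  proof (rule fundamental_theorem_of_calculus_interior)
    show "continuous_on {0..pi} (\<lambda>\<theta>. g \<theta> * sin \<theta> powr (2*\<alpha>+1))"
      by (intro continuous_intros sin_powr_continuous[OF \<alpha>] continuous_on_subset[OF gc]) auto
    fix \<theta> assume t: "\<theta> \<in> {0<..<pi}"
    then have "sin \<theta> > 0" by (simp add: sin_gt_zero)
    then have e: "sin \<theta> powr (2*\<alpha>+1) = sin \<theta> * angw \<alpha> \<theta>" by (simp add: angw_def powr_add)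
    show "((\<lambda>\<theta>. g \<theta> * sin \<theta> powr (2*\<alpha>+1)) has_vector_derivative ?h \<theta> * angw \<alpha> \<theta>) (at \<theta>)"
      unfolding has_real_derivative_iff_has_vector_derivative[symmetric]
      by (rule DERIV_cong[OF DERIV_mult[OF g sin_powr_has_derivative[OF t]]])
         (unfold e, simp only: algebra_simps)
  qed auto
  then have "integral {0..pi} (\<lambda>\<theta>. ?h \<theta> * angw \<alpha> \<theta>) = 0" using \<alpha> by (simp add: integral_unique)
  then have "angint \<alpha> ?h = 0"
    unfolding angint_def using set_borel_integral_eq_integral(2)[OF angw_integrable_mult[OF \<alpha> hc]] by simp
  moreover have "angint \<alpha> ?h = angint \<alpha> (\<lambda>\<theta>. g' \<theta> * sin \<theta>) + angint \<alpha> (\<lambda>\<theta>. (2*\<alpha>+1) * (g \<theta> * cos \<theta>))"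
    by (rule angint_add[OF \<alpha>]) (intro continuous_intros g' gc)+
  ultimately show ?thesis by (simp only: angint_cmult)
qed

text \<open>
  The square of \<open>dunkl_dist\<close>; it is a polynomial in \<open>cos \<theta>\<close>.
\<close>
definition qdist :: "real \<Rightarrow> real \<Rightarrow> real \<Rightarrow> real" where
  "qdist x y \<theta> = x\<^sup>2 + y\<^sup>2 - 2 * x * y * cos \<theta>"

lemma continuous_on_qdist [continuous_intros]: "continuous_on S (qdist x y)"
  unfolding qdist_def by (intro continuous_intros)

lemma angint_qdist_Suc_even:
  assumes \<alpha>: "\<alpha> > -1/2"
  shows "angint \<alpha> (\<lambda>\<theta>. qdist x y \<theta> ^ Suc m)
    = (x\<^sup>2 + y\<^sup>2) * angint \<alpha> (\<lambda>\<theta>. qdist x y \<theta> ^ m)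
      - 2 * x * y * angint \<alpha> (\<lambda>\<theta>. qdist x y \<theta> ^ m * cos \<theta>)"
proof -
  have "angint \<alpha> (\<lambda>\<theta>. qdist x y \<theta> ^ Suc m)
     = angint \<alpha> (\<lambda>\<theta>. (x\<^sup>2 + y\<^sup>2) * qdist x y \<theta> ^ m + (- 2 * x * y) * (qdist x y \<theta> ^ m * cos \<theta>))"
    by (rule arg_cong[of _ _ "angint \<alpha>"], rule ext) (simp add: qdist_def algebra_simps)
  also have "\<dots> = (x\<^sup>2 + y\<^sup>2) * angint \<alpha> (\<lambda>\<theta>. qdist x y \<theta> ^ m)
      + (- 2 * x * y) * angint \<alpha> (\<lambda>\<theta>. qdist x y \<theta> ^ m * cos \<theta>)"
    unfolding angint_cmult[symmetric] by (rule angint_add[OF \<alpha>]; intro continuous_intros)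
  finally show ?thesis by simp
qed

text \<open>
  One factor \<open>qdist\<close> is expanded, which produces \<open>cos\<^sup>2 \<theta> = 1 - sin\<^sup>2 \<theta>\<close>; the term with \<open>sin\<^sup>2 \<theta>\<close> is
  then eliminated with an integration by parts.
\<close>
lemma angint_qdist_Suc_odd:
  assumes \<alpha>: "\<alpha> > -1/2"
  shows "(real m + 2 * \<alpha> + 2) * angint \<alpha> (\<lambda>\<theta>. qdist x y \<theta> ^ Suc m * cos \<theta>)
    = (real m + 1) * ((x\<^sup>2 + y\<^sup>2) * angint \<alpha> (\<lambda>\<theta>. qdist x y \<theta> ^ m * cos \<theta>)
      - 2 * x * y * angint \<alpha> (\<lambda>\<theta>. qdist x y \<theta> ^ m))"
proof -
  let ?q = "qdist x y"
  let ?J = "\<lambda>h. angint \<alpha> (\<lambda>\<theta>. ?q \<theta> ^ m * h \<theta>)"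
  have der: "((\<lambda>\<theta>. ?q \<theta> ^ Suc m) has_real_derivative real (Suc m) * ?q \<theta> ^ m * (2 * x * y * sin \<theta>)) (at \<theta>)" for \<theta>
  proof -
    have "(?q has_real_derivative 2 * x * y * sin \<theta>) (at \<theta>)"
      unfolding qdist_def by (auto intro!: derivative_eq_intros)
    from DERIV_power[OF this, of "Suc m"] show ?thesis by (simp add: mult_ac)
  qed
  have "(2 * \<alpha> + 1) * angint \<alpha> (\<lambda>\<theta>. ?q \<theta> ^ Suc m * cos \<theta>)
     = - angint \<alpha> (\<lambda>\<theta>. real (Suc m) * ?q \<theta> ^ m * (2 * x * y * sin \<theta>) * sin \<theta>)"
    by (rule angint_by_parts[OF \<alpha> der]) (intro continuous_intros)
  also have "(\<lambda>\<theta>. real (Suc m) * ?q \<theta> ^ m * (2 * x * y * sin \<theta>) * sin \<theta>)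
      = (\<lambda>\<theta>. (real (Suc m) * 2 * x * y) * (?q \<theta> ^ m * (sin \<theta>)\<^sup>2))"
    by (rule ext) (simp add: power2_eq_square)
  finally have 1: "(2 * \<alpha> + 1) * angint \<alpha> (\<lambda>\<theta>. ?q \<theta> ^ Suc m * cos \<theta>)
      = - (real (Suc m) * 2 * x * y) * ?J (\<lambda>\<theta>. (sin \<theta>)\<^sup>2)" by (simp only: angint_cmult mult_minus_left)
  have "angint \<alpha> (\<lambda>\<theta>. ?q \<theta> ^ Suc m * cos \<theta>)
    = angint \<alpha> (\<lambda>\<theta>. ((x\<^sup>2 + y\<^sup>2) * (?q \<theta> ^ m * cos \<theta>) + (- 2 * x * y) * ?q \<theta> ^ m)
       + (2 * x * y) * (?q \<theta> ^ m * (sin \<theta>)\<^sup>2))"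
  proof (rule arg_cong[of _ _ "angint \<alpha>"], rule ext)
    fix \<theta>
    define Q where "Q = ?q \<theta> ^ m"
    show "?q \<theta> ^ Suc m * cos \<theta> = ((x\<^sup>2 + y\<^sup>2) * (?q \<theta> ^ m * cos \<theta>) + (- 2 * x * y) * ?q \<theta> ^ m)
       + (2 * x * y) * (?q \<theta> ^ m * (sin \<theta>)\<^sup>2)"
      unfolding power_Suc Q_def[symmetric] sin_squared_eq qdist_def
      by (simp add: algebra_simps power2_eq_square)
  qed
  also have "\<dots> = ((x\<^sup>2 + y\<^sup>2) * ?J cos + (- 2 * x * y) * angint \<alpha> (\<lambda>\<theta>. ?q \<theta> ^ m))
       + (2 * x * y) * ?J (\<lambda>\<theta>. (sin \<theta>)\<^sup>2)"
  proof -
    have "angint \<alpha> (\<lambda>\<theta>. (x\<^sup>2 + y\<^sup>2) * (?q \<theta> ^ m * cos \<theta>) + (- 2 * x * y) * ?q \<theta> ^ m)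
        = angint \<alpha> (\<lambda>\<theta>. (x\<^sup>2 + y\<^sup>2) * (?q \<theta> ^ m * cos \<theta>)) + angint \<alpha> (\<lambda>\<theta>. (- 2 * x * y) * ?q \<theta> ^ m)"
      by (rule angint_add[OF \<alpha>]; intro continuous_intros)
    moreover have "angint \<alpha> (\<lambda>\<theta>. ((x\<^sup>2 + y\<^sup>2) * (?q \<theta> ^ m * cos \<theta>) + (- 2 * x * y) * ?q \<theta> ^ m)
       + (2 * x * y) * (?q \<theta> ^ m * (sin \<theta>)\<^sup>2))
        = angint \<alpha> (\<lambda>\<theta>. (x\<^sup>2 + y\<^sup>2) * (?q \<theta> ^ m * cos \<theta>) + (- 2 * x * y) * ?q \<theta> ^ m)
         + angint \<alpha> (\<lambda>\<theta>. (2 * x * y) * (?q \<theta> ^ m * (sin \<theta>)\<^sup>2))"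
      by (rule angint_add[OF \<alpha>]; intro continuous_intros)
    ultimately show ?thesis by (simp only: angint_cmult)
  qed
  finally have 2: "angint \<alpha> (\<lambda>\<theta>. ?q \<theta> ^ Suc m * cos \<theta>)
     = ((x\<^sup>2 + y\<^sup>2) * ?J cos + (- 2 * x * y) * angint \<alpha> (\<lambda>\<theta>. ?q \<theta> ^ m))
       + (2 * x * y) * ?J (\<lambda>\<theta>. (sin \<theta>)\<^sup>2)" .
  have "(real m + 2 * \<alpha> + 2) * angint \<alpha> (\<lambda>\<theta>. ?q \<theta> ^ Suc m * cos \<theta>)
    = (real m + 1) * angint \<alpha> (\<lambda>\<theta>. ?q \<theta> ^ Suc m * cos \<theta>)
    + (2 * \<alpha> + 1) * angint \<alpha> (\<lambda>\<theta>. ?q \<theta> ^ Suc m * cos \<theta>)" by (simp add: algebra_simps)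
  also have "\<dots> = (real m + 1) * (((x\<^sup>2 + y\<^sup>2) * ?J cos + (- 2 * x * y) * angint \<alpha> (\<lambda>\<theta>. ?q \<theta> ^ m))
       + (2 * x * y) * ?J (\<lambda>\<theta>. (sin \<theta>)\<^sup>2)) - (real (Suc m) * 2 * x * y) * ?J (\<lambda>\<theta>. (sin \<theta>)\<^sup>2)"
    unfolding 1 unfolding 2 by (simp only: mult_minus_left diff_conv_add_uminus)
  also have "(real m + 1) * ((X * J + (- 2 * x * y) * K) + (2 * x * y) * S) - (real (Suc m) * 2 * x * y) * S
      = (real m + 1) * (X * J - 2 * x * y * K)" for J K S X :: real
    by (simp add: algebra_simps)
  finally show ?thesis .
qed

lemma angint_1_pos: assumes "\<alpha> > -1/2" shows "angint \<alpha> (\<lambda>_. 1) > 0"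
proof -
  have i: "set_integrable lborel {0..pi} (\<lambda>\<theta>. 1 * angw \<alpha> \<theta>)"
    using angw_integrable_mult[OF assms, of "\<lambda>_. 1"] by simp
  have "angint \<alpha> (\<lambda>_. 1) \<noteq> 0"
  proof
    assume "angint \<alpha> (\<lambda>_. 1) = 0"
    then have "AE \<theta> in lborel. indicator {0..pi} \<theta> * angw \<alpha> \<theta> = 0"
      using integral_nonneg_eq_0_iff_AE[of lborel "\<lambda>\<theta>. indicator {0..pi} \<theta> * angw \<alpha> \<theta>"] i
      by (auto simp: angint_def set_lebesgue_integral_def set_integrable_def)
    then have "AE \<theta> in lborel. \<theta> \<notin> {0<..<pi}"
      by (rule AE_mp) (rule AE_I2, auto simp: angw_def indicator_def dest: sin_gt_zero)
    then have "{0<..<pi} \<in> null_sets lborel" using AE_iff_null_sets[of "{0<..<pi}" lborel] by simp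
    then have "emeasure lborel {0<..<pi} = 0" by blast
    then show False using pi_gt_zero by simp
  qed
  moreover have "angint \<alpha> (\<lambda>_. 1) \<ge> 0"
    unfolding angint_def set_lebesgue_integral_def by (intro integral_nonneg_AE AE_I2) auto
  ultimately show ?thesis by linarith
qed

lemma angint_cos: assumes "\<alpha> > -1/2" shows "angint \<alpha> cos = 0"
proof -
  have "(2 * \<alpha> + 1) * angint \<alpha> (\<lambda>\<theta>. 1 * cos \<theta>) = - angint \<alpha> (\<lambda>\<theta>. 0 * sin \<theta>)"
    by (rule angint_by_parts[OF assms]) auto
  then show ?thesis using assms angint_cmult[of \<alpha> 0 sin] by simp
qed

text \<open>
  The product formula for the Dunkl exponential, coefficient by coefficient: both sides satisfy the
  same recurrence, because \<open>prod_even_Suc\<close> and \<open>prod_odd_Suc\<close> are \<open>angint_qdist_Suc_even\<close> and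
  \<open>angint_qdist_Suc_odd\<close> up to normalisation.
\<close>
lemma angint_qdist:
  assumes \<alpha>: "\<alpha> > -1/2" and d: "d = 2 * \<alpha> + 2"
  shows "angint \<alpha> (\<lambda>\<theta>. qdist x y \<theta> ^ m) = angint \<alpha> (\<lambda>_. 1) * dunkl_fact d (2 * m) * fps_nth (prod_even d x y) m"
    and "angint \<alpha> (\<lambda>\<theta>. qdist x y \<theta> ^ m * cos \<theta>) = - angint \<alpha> (\<lambda>_. 1) * dunkl_fact d (2 * m) * fps_nth (prod_odd d x y) m"
proof (induction m)
  case 0
  { case 1 show ?case by (simp add: prod_even_def dunkl_exp_even_def) }
  { case 2 show ?case using angint_cos[OF \<alpha>] by (simp add: prod_odd_def) }
next
  case (Suc m)
  have dp: "d > 0" using \<alpha> d by simp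
  let ?c = "angint \<alpha> (\<lambda>_. 1)" and ?e = "fps_nth (prod_even d x y)" and ?o = "fps_nth (prod_odd d x y)"
  have g: "dunkl_fact d (2 * Suc m) = (2 * real m + 2) * (2 * real m + d) * dunkl_fact d (2 * m)"
    by (simp add: algebra_simps)
  { case 1
    have "angint \<alpha> (\<lambda>\<theta>. qdist x y \<theta> ^ Suc m)
       = ?c * dunkl_fact d (2*m) * ((x\<^sup>2 + y\<^sup>2) * ?e m + 2 * x * y * ?o m)"
      unfolding angint_qdist_Suc_even[OF \<alpha>] Suc.IH by (simp add: algebra_simps)
    then show ?case unfolding g prod_even_Suc[OF dp, symmetric] by (simp add: algebra_simps) }
  { case 2
    have "(real m + d) * angint \<alpha> (\<lambda>\<theta>. qdist x y \<theta> ^ Suc m * cos \<theta>)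
       = - (real m + 1) * ?c * dunkl_fact d (2*m) * ((x\<^sup>2 + y\<^sup>2) * ?o m + 2 * x * y * ?e m)"
      using angint_qdist_Suc_odd[OF \<alpha>, of m x y] unfolding Suc.IH d by (simp add: algebra_simps)
    also have "\<dots> = (real m + d) * (- ?c * dunkl_fact d (2 * Suc m) * ?o (Suc m))"
      unfolding g prod_odd_Suc[OF dp, symmetric] by (simp add: algebra_simps)
    finally show ?case using dp by (simp only: mult_cancel_left) auto }
qed

section \<open>Translations by weighted averages\<close>

lemma ball_0_measurable [measurable]: "ball (0::real) r \<in> sets borel" by simp

text \<open>
  A translate of \<open>g\<close> at \<open>y\<close> is the average of \<open>g (p x y \<omega>)\<close> over \<open>\<omega>\<close> with weight \<open>k x y \<omega>\<close>, which
  may be negative.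

  Duality is split in two parts. The hypothesis \<open>dual_distr\<close> says that the unweighted averaging has
  the averaging for \<open>- x\<close> as adjoint, in a form that applies to arbitrary functions of
  \<open>(y, p x y \<omega>)\<close>. The hypothesis \<open>\<kappa>_eq\<close> says that the weight is such a function, and is unchanged
  when the roles of \<open>y\<close> and of the position are exchanged and \<open>x\<close> changes its sign. For \<open>x = 0\<close> no
  such function \<open>\<kappa>\<close> need exist, and \<open>at_zero\<close> makes \<open>\<tau>\<^sub>0\<close> the identity instead.
\<close>
locale averaged_translation = sigma_finite_measure M + P: finite_measure P
  for M :: "real measure" and P :: "'w measure" +
  fixes p k :: "real \<Rightarrow> real \<Rightarrow> 'w \<Rightarrow> real" and \<kappa> :: "real \<Rightarrow> real \<Rightarrow> real \<Rightarrow> real"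
    and B D cM :: real
  assumes sets_M [measurable_cong]: "sets M = sets borel"
    and M_ball: "\<And>R. R > 0 \<Longrightarrow> emeasure M (ball 0 R) = ennreal (cM * R powr D)"
    and cM_pos: "cM > 0" and D_ge_1: "D \<ge> 1"
    and M_zero: "emeasure M {0} = 0"
    and p_meas: "(\<lambda>(x, y, \<omega>). p x y \<omega>) \<in> borel_measurable (borel \<Otimes>\<^sub>M borel \<Otimes>\<^sub>M P)"
    and k_meas: "(\<lambda>(x, y, \<omega>). k x y \<omega>) \<in> borel_measurable (borel \<Otimes>\<^sub>M borel \<Otimes>\<^sub>M P)"
    and B_ge_1: "B \<ge> 1"
    and k_bound: "\<And>x y \<omega>. \<bar>k x y \<omega>\<bar> \<le> B"
    and k_int: "\<And>x y. (\<integral>\<omega>. k x y \<omega> \<partial>P) = 1"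
    and p_lower: "\<And>x y \<omega>. \<bar>\<bar>x\<bar> - \<bar>y\<bar>\<bar> \<le> \<bar>p x y \<omega>\<bar>"
    and p_upper: "\<And>x y \<omega>. \<bar>p x y \<omega>\<bar> \<le> \<bar>x\<bar> + \<bar>y\<bar>"
    and p_sym: "\<And>x y \<omega>. p x y \<omega> = p y x \<omega>"
    and k_sym: "\<And>x y \<omega>. k x y \<omega> = k y x \<omega>"
    and dual_distr: "\<And>x. distr (M \<Otimes>\<^sub>M P) (borel \<Otimes>\<^sub>M borel) (\<lambda>(y, \<omega>). (y, p x y \<omega>))
         = distr (M \<Otimes>\<^sub>M P) (borel \<Otimes>\<^sub>M borel) (\<lambda>(z, \<omega>). (p (- x) z \<omega>, z))"
    and \<kappa>_meas: "\<And>x. (\<lambda>(y, z). \<kappa> x y z) \<in> borel_measurable (borel \<Otimes>\<^sub>M borel)"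
    and \<kappa>_eq: "\<And>x. x \<noteq> 0 \<Longrightarrow> AE (y, \<omega>) in M \<Otimes>\<^sub>M P. k x y \<omega> = \<kappa> x y (p x y \<omega>) \<and> \<kappa> x y (p x y \<omega>) = \<kappa> (- x) (p x y \<omega>) y"
    and at_zero: "\<And>y \<omega>. y \<noteq> 0 \<Longrightarrow> k 0 y \<omega> = 0 \<or> p 0 y \<omega> = y"
begin

sublocale MP: pair_sigma_finite M P
  by (simp add: pair_sigma_finite_def sigma_finite_measure_axioms P.sigma_finite_measure_axioms)

definition tau :: "real \<Rightarrow> (real \<Rightarrow> 'b::{banach,second_countable_topology}) \<Rightarrow> real \<Rightarrow> 'b" where
  "tau x g y = (\<integral>\<omega>. k x y \<omega> *\<^sub>R g (p x y \<omega>) \<partial>P)"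

text \<open>
  The unweighted average of a function with values in \<open>[0, \<infinity>]\<close>. Up to the factor \<open>B\<close> it dominates
  the norm of a translate (\<open>norm_tau_le\<close>) and, being monotone and always defined, serves for all
  questions of integrability.
\<close>
definition maj :: "real \<Rightarrow> (real \<Rightarrow> ennreal) \<Rightarrow> real \<Rightarrow> ennreal" where
  "maj x g y = (\<integral>\<^sup>+\<omega>. g (p x y \<omega>) \<partial>P)"

definition mP :: real where "mP = measure P (space P)"

lemma emeasure_P: "emeasure P (space P) = ennreal mP"
  unfolding mP_def by (rule P.emeasure_eq_measure)

lemma mP_nonneg: "mP \<ge> 0" by (simp add: mP_def)

lemma space_M [simp]: "space M = UNIV"
  using sets_eq_imp_space_eq[OF sets_M] by simp

lemma p_measurable [measurable (raw)]:
  assumes "a \<in> borel_measurable N" "b \<in> borel_measurable N" "c \<in> measurable N P"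
  shows "(\<lambda>n. p (a n) (b n) (c n)) \<in> borel_measurable N"
  using measurable_compose[OF measurable_Pair[OF assms(1) measurable_Pair[OF assms(2,3)]] p_meas] by simp

lemma k_measurable [measurable (raw)]:
  assumes "a \<in> borel_measurable N" "b \<in> borel_measurable N" "c \<in> measurable N P"
  shows "(\<lambda>n. k (a n) (b n) (c n)) \<in> borel_measurable N"
  using measurable_compose[OF measurable_Pair[OF assms(1) measurable_Pair[OF assms(2,3)]] k_meas] by simp

lemma \<kappa>_measurable [measurable (raw)]:
  assumes "a \<in> borel_measurable N" "b \<in> borel_measurable N"
  shows "(\<lambda>n. \<kappa> x (a n) (b n)) \<in> borel_measurable N"
  using measurable_compose[OF measurable_Pair[OF assms(1,2)] \<kappa>_meas[of x]] by simp

lemma maj_measurable [measurable (raw)]: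
  assumes [measurable]: "a \<in> borel_measurable N" "b \<in> borel_measurable N"
    and g: "(\<lambda>(n, z). g n z) \<in> borel_measurable (N \<Otimes>\<^sub>M borel)"
  shows "(\<lambda>n. maj (a n) (g n) (b n)) \<in> borel_measurable N"
proof -
  have [measurable]: "(\<lambda>(n, \<omega>). g n (p (a n) (b n) \<omega>)) \<in> borel_measurable (N \<Otimes>\<^sub>M P)"
    using measurable_compose[OF _ g, of "\<lambda>(n, \<omega>). (n, p (a n) (b n) \<omega>)" "N \<Otimes>\<^sub>M P"]
    by (simp add: case_prod_beta')
  show ?thesis unfolding maj_def by measurable
qed

lemma tau_measurable [measurable (raw)]:
  fixes g :: "'n \<Rightarrow> real \<Rightarrow> 'b::{banach,second_countable_topology}"
  assumes [measurable]: "a \<in> borel_measurable N" "b \<in> borel_measurable N"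
    and g: "(\<lambda>(n, z). g n z) \<in> borel_measurable (N \<Otimes>\<^sub>M borel)"
  shows "(\<lambda>n. tau (a n) (g n) (b n)) \<in> borel_measurable N"
proof -
  have [measurable]: "(\<lambda>(n, \<omega>). g n (p (a n) (b n) \<omega>)) \<in> borel_measurable (N \<Otimes>\<^sub>M P)"
    using measurable_compose[OF _ g, of "\<lambda>(n, \<omega>). (n, p (a n) (b n) \<omega>)" "N \<Otimes>\<^sub>M P"]
    by (simp add: case_prod_beta')
  show ?thesis unfolding tau_def by measurable
qed

lemma dual_nn:
  assumes F: "(\<lambda>(y, z). F y z) \<in> borel_measurable (borel \<Otimes>\<^sub>M borel)"
  shows "(\<integral>\<^sup>+y. (\<integral>\<^sup>+\<omega>. F y (p x y \<omega>) \<partial>P) \<partial>M) = (\<integral>\<^sup>+z. (\<integral>\<^sup>+\<omega>. F (p (- x) z \<omega>) z \<partial>P) \<partial>M)"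
proof -
  have F': "(\<lambda>q. F (a q) (b q)) \<in> borel_measurable N"
    if "a \<in> borel_measurable N" "b \<in> borel_measurable N" for a b and N :: "'z measure"
    using measurable_compose[OF measurable_Pair[OF that] F] by simp
  have "(\<integral>\<^sup>+y. (\<integral>\<^sup>+\<omega>. F y (p x y \<omega>) \<partial>P) \<partial>M) = (\<integral>\<^sup>+q. F (fst q) (p x (fst q) (snd q)) \<partial>(M \<Otimes>\<^sub>M P))"
    by (subst P.nn_integral_fst[symmetric]) (auto intro!: F')
  also have "\<dots> = (\<integral>\<^sup>+q. F (fst q) (snd q) \<partial>distr (M \<Otimes>\<^sub>M P) (borel \<Otimes>\<^sub>M borel) (\<lambda>(y, \<omega>). (y, p x y \<omega>)))"
    by (subst nn_integral_distr) (auto intro!: F' simp: case_prod_beta')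
  also have "\<dots> = (\<integral>\<^sup>+q. F (p (- x) (fst q) (snd q)) (fst q) \<partial>(M \<Otimes>\<^sub>M P))"
    unfolding dual_distr by (subst nn_integral_distr) (auto intro!: F' simp: case_prod_beta')
  also have "\<dots> = (\<integral>\<^sup>+z. (\<integral>\<^sup>+\<omega>. F (p (- x) z \<omega>) z \<partial>P) \<partial>M)"
    by (subst P.nn_integral_fst[symmetric]) (auto intro!: F')
  finally show ?thesis .
qed

lemma maj_dual:
  assumes [measurable]: "g \<in> borel_measurable borel" "h \<in> borel_measurable borel"
  shows "(\<integral>\<^sup>+y. h y * maj x g y \<partial>M) = (\<integral>\<^sup>+z. g z * maj (- x) h z \<partial>M)"
proof -
  have "(\<integral>\<^sup>+y. h y * maj x g y \<partial>M) = (\<integral>\<^sup>+y. (\<integral>\<^sup>+\<omega>. h y * g (p x y \<omega>) \<partial>P) \<partial>M)"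
    unfolding maj_def by (subst nn_integral_cmult) auto
  also have "\<dots> = (\<integral>\<^sup>+z. (\<integral>\<^sup>+\<omega>. h (p (- x) z \<omega>) * g z \<partial>P) \<partial>M)"
    by (rule dual_nn) measurable
  also have "\<dots> = (\<integral>\<^sup>+z. g z * maj (- x) h z \<partial>M)"
    unfolding maj_def by (subst nn_integral_cmult[symmetric]) (auto simp: mult.commute)
  finally show ?thesis .
qed

lemma maj_sym: "maj x g y = maj y g x"
  unfolding maj_def by (subst p_sym) simp

lemma tau_sym: "tau x g y = tau y g x"
  unfolding tau_def by (subst p_sym, subst k_sym) simp

lemma maj_mono:
  assumes "\<And>z. \<bar>\<bar>x\<bar> - \<bar>y\<bar>\<bar> \<le> \<bar>z\<bar> \<Longrightarrow> \<bar>z\<bar> \<le> \<bar>x\<bar> + \<bar>y\<bar> \<Longrightarrow> g z \<le> h z"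
  shows "maj x g y \<le> maj x h y"
  unfolding maj_def by (intro nn_integral_mono assms p_lower p_upper)

lemma maj_const: "maj x (\<lambda>_. c) y = c * ennreal mP"
  by (simp add: maj_def emeasure_P)

lemma maj_le:
  assumes "\<And>z. \<bar>\<bar>x\<bar> - \<bar>y\<bar>\<bar> \<le> \<bar>z\<bar> \<Longrightarrow> \<bar>z\<bar> \<le> \<bar>x\<bar> + \<bar>y\<bar> \<Longrightarrow> g z \<le> c"
  shows "maj x g y \<le> c * ennreal mP"
  using maj_mono[of x y g "\<lambda>_. c"] assms by (simp add: maj_const)

lemma maj_cmult:
  assumes [measurable]: "g \<in> borel_measurable borel"
  shows "maj x (\<lambda>z. c * g z) y = c * maj x g y"
  unfolding maj_def by (rule nn_integral_cmult) measurable

lemma norm_tau_le: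
  fixes g :: "real \<Rightarrow> 'b::{banach,second_countable_topology}"
  assumes [measurable]: "g \<in> borel_measurable borel"
  shows "ennreal (norm (tau x g y)) \<le> ennreal B * maj x (\<lambda>z. ennreal (norm (g z))) y"
proof (cases "integrable P (\<lambda>\<omega>. k x y \<omega> *\<^sub>R g (p x y \<omega>))")
  case True
  have "ennreal (norm (tau x g y)) \<le> (\<integral>\<^sup>+\<omega>. ennreal (norm (k x y \<omega> *\<^sub>R g (p x y \<omega>))) \<partial>P)"
    unfolding tau_def by (rule integral_norm_bound_ennreal[OF True])
  also have "\<dots> \<le> (\<integral>\<^sup>+\<omega>. ennreal B * ennreal (norm (g (p x y \<omega>))) \<partial>P)"
    using B_ge_1 by (intro nn_integral_mono) (auto simp: ennreal_mult[symmetric] intro!: ennreal_leI mult_right_mono k_bound)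
  also have "\<dots> = ennreal B * maj x (\<lambda>z. ennreal (norm (g z))) y"
    unfolding maj_def by (rule nn_integral_cmult) measurable
  finally show ?thesis .
qed (simp add: tau_def not_integrable_integral_eq)

lemma tau_integrand_integrable:
  fixes g :: "real \<Rightarrow> 'b::{banach,second_countable_topology}"
  assumes [measurable]: "g \<in> borel_measurable borel"
    and fin: "maj x (\<lambda>z. ennreal (norm (g z))) y < \<infinity>"
  shows "integrable P (\<lambda>\<omega>. g (p x y \<omega>))" "integrable P (\<lambda>\<omega>. k x y \<omega> *\<^sub>R g (p x y \<omega>))"
proof -
  show 1: "integrable P (\<lambda>\<omega>. g (p x y \<omega>))"
    using fin unfolding maj_def by (intro integrableI_bounded) auto
  have "integrable P (\<lambda>\<omega>. B *\<^sub>R g (p x y \<omega>))" using 1 by simp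
  then show "integrable P (\<lambda>\<omega>. k x y \<omega> *\<^sub>R g (p x y \<omega>))"
  proof (rule Bochner_Integration.integrable_bound)
    show "(\<lambda>\<omega>. k x y \<omega> *\<^sub>R g (p x y \<omega>)) \<in> borel_measurable P" by measurable
    show "AE \<omega> in P. norm (k x y \<omega> *\<^sub>R g (p x y \<omega>)) \<le> norm (B *\<^sub>R g (p x y \<omega>))"
      using B_ge_1 by (intro AE_I2) (auto intro!: mult_right_mono k_bound)
  qed
qed

lemma k_integrable: "integrable P (k x y)"
  by (rule P.integrable_const_bound[of _ B]) (auto intro: k_bound)

lemma tau_const: "tau x (\<lambda>_. c) y = c"
  unfolding tau_def by (simp add: k_integrable k_int)

lemma tau_cong:
  assumes "\<And>z. \<bar>\<bar>x\<bar> - \<bar>y\<bar>\<bar> \<le> \<bar>z\<bar> \<Longrightarrow> \<bar>z\<bar> \<le> \<bar>x\<bar> + \<bar>y\<bar> \<Longrightarrow> g z = h z"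
  shows "tau x g y = tau x h y"
  unfolding tau_def using assms p_lower p_upper by simp

lemma tau_diff:
  fixes g h :: "real \<Rightarrow> 'b::{banach,second_countable_topology}"
  assumes [measurable]: "g \<in> borel_measurable borel" "h \<in> borel_measurable borel"
    and "maj x (\<lambda>z. ennreal (norm (g z))) y < \<infinity>" "maj x (\<lambda>z. ennreal (norm (h z))) y < \<infinity>"
  shows "tau x (\<lambda>z. g z - h z) y = tau x g y - tau x h y"
  unfolding tau_def scaleR_diff_right
  by (intro Bochner_Integration.integral_diff tau_integrand_integrable assms)

text \<open>
  As the weights have total mass one, the constant can be subtracted under the integral.
\<close>
lemma tau_near_const:
  fixes g :: "real \<Rightarrow> 'b::{banach,second_countable_topology}"
  assumes [measurable]: "g \<in> borel_measurable borel"
    and near: "\<And>z. \<bar>\<bar>x\<bar> - \<bar>y\<bar>\<bar> \<le> \<bar>z\<bar> \<Longrightarrow> \<bar>z\<bar> \<le> \<bar>x\<bar> + \<bar>y\<bar> \<Longrightarrow> norm (g z - c) \<le> e"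
    and e: "e \<ge> 0"
  shows "norm (tau x g y - c) \<le> B * mP * e"
proof -
  have fin: "maj x (\<lambda>z. ennreal (norm (g z))) y < \<infinity>"
  proof -
    have "maj x (\<lambda>z. ennreal (norm (g z))) y \<le> ennreal (norm c + e) * ennreal mP"
    proof (rule maj_le)
      fix z assume "\<bar>\<bar>x\<bar> - \<bar>y\<bar>\<bar> \<le> \<bar>z\<bar>" "\<bar>z\<bar> \<le> \<bar>x\<bar> + \<bar>y\<bar>"
      from near[OF this] show "ennreal (norm (g z)) \<le> ennreal (norm c + e)"
        using norm_triangle_ineq2[of "g z" c] by (intro ennreal_leI) linarith
    qed
    then show ?thesis by (rule le_less_trans) (simp add: ennreal_mult_less_top)
  qed
  have "tau x (\<lambda>z. g z - c) y = tau x g y - tau x (\<lambda>_. c) y"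
    by (rule tau_diff[OF _ _ fin]) (simp_all add: maj_const ennreal_mult_less_top)
  then have "ennreal (norm (tau x g y - c)) = ennreal (norm (tau x (\<lambda>z. g z - c) y))"
    by (simp add: tau_const)
  also have "\<dots> \<le> ennreal B * maj x (\<lambda>z. ennreal (norm (g z - c))) y" by (rule norm_tau_le) measurable
  also have "\<dots> \<le> ennreal B * (ennreal e * ennreal mP)"
    by (intro mult_left_mono maj_le ennreal_leI near) auto
  also have "\<dots> = ennreal (B * mP * e)"
    using B_ge_1 mP_nonneg e by (simp add: ennreal_mult[symmetric] mult_ac)
  finally show ?thesis using B_ge_1 mP_nonneg e by (subst (asm) ennreal_le_iff) auto
qed

text \<open>
  By duality the left side integrates \<open>g\<close> against the average of an indicator function, which
  vanishes unless some position lies in the ball.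
\<close>
lemma maj_ball_le:
  assumes [measurable]: "g \<in> borel_measurable borel"
  shows "(\<integral>\<^sup>+y\<in>ball 0 r. maj x g y \<partial>M) \<le> ennreal mP * (\<integral>\<^sup>+z\<in>ball 0 (r + \<bar>x\<bar>). g z \<partial>M)"
proof -
  have "(\<integral>\<^sup>+y\<in>ball 0 r. maj x g y \<partial>M) = (\<integral>\<^sup>+z. g z * maj (- x) (indicator (ball 0 r)) z \<partial>M)"
    by (subst maj_dual[symmetric]) (auto simp: mult.commute intro!: borel_measurable_indicator)
  also have "\<dots> \<le> (\<integral>\<^sup>+z. ennreal mP * (g z * indicator (ball 0 (r + \<bar>x\<bar>)) z) \<partial>M)"
  proof (rule nn_integral_mono)
    fix z
    have "maj (- x) (indicator (ball 0 r)) z \<le> indicator (ball 0 (r + \<bar>x\<bar>)) z * ennreal mP"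
      by (rule maj_le) (auto simp: indicator_def abs_le_iff)
    then have "g z * maj (- x) (indicator (ball 0 r)) z \<le> g z * (indicator (ball 0 (r + \<bar>x\<bar>)) z * ennreal mP)"
      by (rule mult_left_mono) simp
    then show "g z * maj (- x) (indicator (ball 0 r)) z \<le> ennreal mP * (g z * indicator (ball 0 (r + \<bar>x\<bar>)) z)"
      by (simp add: mult_ac)
  qed
  also have "\<dots> = ennreal mP * (\<integral>\<^sup>+z\<in>ball 0 (r + \<bar>x\<bar>). g z \<partial>M)" by (rule nn_integral_cmult) measurable
  finally show ?thesis .
qed

lemma AE_nonzero: "AE y in M. y \<noteq> 0"
  using M_zero by (intro AE_I[of _ _ "{0}"]) (auto simp: sets_M)

lemma AE_of_balls:
  assumes [measurable]: "h \<in> borel_measurable borel"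
    and fin: "\<And>t. t > 0 \<Longrightarrow> (\<integral>\<^sup>+z\<in>ball 0 t. h z \<partial>M) < \<infinity>"
  shows "AE z in M. h z < \<infinity>"
proof -
  have "AE z in M. \<bar>z\<bar> < real (Suc n) \<longrightarrow> h z < \<infinity>" for n
  proof -
    have "AE z in M. h z * indicator (ball 0 (real (Suc n))) z \<noteq> \<infinity>"
      using fin[of "real (Suc n)"] by (intro nn_integral_PInf_AE) auto
    then show ?thesis by eventually_elim (auto simp: less_top)
  qed
  then have "AE z in M. \<forall>n. \<bar>z\<bar> < real (Suc n) \<longrightarrow> h z < \<infinity>" unfolding AE_all_countable by blast
  then show ?thesis
  proof eventually_elim
    case (elim z)
    obtain n where "\<bar>z\<bar> < real n" using reals_Archimedean2 by blast
    then show ?case using elim[rule_format, of n] by simp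
  qed
qed

lemma tau_zero:
  fixes g :: "real \<Rightarrow> 'b::{banach,second_countable_topology}"
  assumes "y \<noteq> 0" shows "tau 0 g y = g y"
proof -
  have "(\<lambda>\<omega>. k 0 y \<omega> *\<^sub>R g (p 0 y \<omega>)) = (\<lambda>\<omega>. k 0 y \<omega> *\<^sub>R g y)"
    using at_zero[OF assms] by fastforce
  then show ?thesis unfolding tau_def by (simp add: k_integrable k_int)
qed

text \<open>
  If \<open>c = 0\<close> both sides vanish, even when \<open>f\<close> is not integrable.
\<close>
lemma integral_scaleR_left_AE:
  fixes f :: "'w \<Rightarrow> real" and c :: "'b::{banach,second_countable_topology}"
  assumes [measurable]: "f \<in> borel_measurable P" and int: "integrable P (\<lambda>\<omega>. f \<omega> *\<^sub>R c)"
  shows "(\<integral>\<omega>. f \<omega> *\<^sub>R c \<partial>P) = (\<integral>\<omega>. f \<omega> \<partial>P) *\<^sub>R c"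
proof (rule integral_scaleR_left)
  assume c: "c \<noteq> 0"
  have "integrable P (\<lambda>\<omega>. norm (f \<omega>) * norm c)" using integrable_norm[OF int] by simp
  then have "integrable P (\<lambda>\<omega>. norm (f \<omega>))" using c by simp
  then show "integrable P f" by (subst (asm) integrable_norm_iff) auto
qed

text \<open>
  On the set where \<open>k\<close> is given by \<open>\<kappa>\<close>, both sides are integrals of one function of two variables
  against the measure in \<open>dual_distr\<close>.
\<close>
lemma tau_dual:
  fixes f :: "real \<Rightarrow> 'b::{banach,second_countable_topology}" and g :: "real \<Rightarrow> real"
  assumes [measurable]: "f \<in> borel_measurable borel" "g \<in> borel_measurable borel"
    and fin: "(\<integral>\<^sup>+w. ennreal (norm (f w)) * maj x (\<lambda>z. ennreal \<bar>g z\<bar>) w \<partial>M) < \<infinity>"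
  shows "(\<integral>w. tau x g w *\<^sub>R f w \<partial>M) = (\<integral>w. g w *\<^sub>R tau (- x) f w \<partial>M)"
proof (cases "x = 0")
  case True
  have "(\<integral>w. tau x g w *\<^sub>R f w \<partial>M) = (\<integral>w. g w *\<^sub>R f w \<partial>M)"
    by (rule integral_cong_AE, measurable) (use AE_nonzero in \<open>auto simp: True tau_zero elim: AE_mp\<close>)
  also have "\<dots> = (\<integral>w. g w *\<^sub>R tau (- x) f w \<partial>M)"
    by (rule integral_cong_AE, measurable) (use AE_nonzero in \<open>auto simp: True tau_zero elim: AE_mp\<close>)
  finally show ?thesis .
next
  case False
  let ?Q = "M \<Otimes>\<^sub>M P"
  let ?G = "\<lambda>(y, z). (\<kappa> x y z * g z) *\<^sub>R f y"
  let ?H = "\<lambda>(y, \<omega>). (k x y \<omega> * g (p x y \<omega>)) *\<^sub>R f y"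
  let ?H' = "\<lambda>(z, \<omega>). (g z * k (- x) z \<omega>) *\<^sub>R f (p (- x) z \<omega>)"
  have iH: "integrable ?Q ?H"
  proof (rule integrableI_bounded)
    have "(\<integral>\<^sup>+q. ennreal (norm (?H q)) \<partial>?Q) = (\<integral>\<^sup>+y. \<integral>\<^sup>+\<omega>. ennreal (norm (?H (y, \<omega>))) \<partial>P \<partial>M)"
      by (rule P.nn_integral_fst[symmetric]) measurable
    also have "\<dots> \<le> (\<integral>\<^sup>+y. \<integral>\<^sup>+\<omega>. ennreal B * (ennreal (norm (f y)) * ennreal \<bar>g (p x y \<omega>)\<bar>) \<partial>P \<partial>M)"
    proof (intro nn_integral_mono)
      fix y \<omega>
      have "\<bar>k x y \<omega>\<bar> * (norm (f y) * \<bar>g (p x y \<omega>)\<bar>) \<le> B * (norm (f y) * \<bar>g (p x y \<omega>)\<bar>)"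
        by (intro mult_right_mono k_bound) auto
      then show "ennreal (norm (?H (y, \<omega>))) \<le> ennreal B * (ennreal (norm (f y)) * ennreal \<bar>g (p x y \<omega>)\<bar>)"
        using B_ge_1 by (auto simp: abs_mult ennreal_mult[symmetric] mult_ac intro!: ennreal_leI)
    qed
    also have "\<dots> = ennreal B * (\<integral>\<^sup>+w. ennreal (norm (f w)) * maj x (\<lambda>z. ennreal \<bar>g z\<bar>) w \<partial>M)"
      unfolding maj_def by (simp add: nn_integral_cmult)
    also have "\<dots> < \<infinity>" using fin by (simp add: ennreal_mult_less_top)
    finally show "(\<integral>\<^sup>+q. ennreal (norm (?H q)) \<partial>?Q) < \<infinity>" .
  qed measurable
  have HG: "AE q in ?Q. ?H q = ?G (fst q, p x (fst q) (snd q))"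
    using \<kappa>_eq[OF False] by (auto elim: AE_mp)
  have HG': "AE q in ?Q. ?H' q = ?G (p (- x) (fst q) (snd q), fst q)"
    using \<kappa>_eq[of "-x"] False by (auto elim: AE_mp simp: mult.commute)
  have Gm [measurable]: "?G \<in> borel_measurable (borel \<Otimes>\<^sub>M borel)" by measurable
  have *: "integrable (distr ?Q (borel \<Otimes>\<^sub>M borel) (\<lambda>(y, \<omega>). (y, p x y \<omega>))) ?G"
  proof (subst integrable_distr_eq)
    have "AE q in ?Q. ?G (fst q, p x (fst q) (snd q)) = ?H q" using HG by (auto elim: AE_mp)
    then show "integrable ?Q (\<lambda>q. ?G (case q of (y, \<omega>) \<Rightarrow> (y, p x y \<omega>)))"
      by (intro integrable_cong_AE_imp[OF iH]) (auto simp: case_prod_beta')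
  qed measurable
  have iH': "integrable ?Q ?H'"
  proof -
    have "integrable ?Q (\<lambda>q. ?G (case q of (z, \<omega>) \<Rightarrow> (p (- x) z \<omega>, z)))"
      using * unfolding dual_distr by (subst (asm) integrable_distr_eq) measurable
    then show ?thesis
      by (rule integrable_cong_AE_imp) (use HG' in \<open>auto simp: case_prod_beta'\<close>)
  qed
  have "(\<integral>w. tau x g w *\<^sub>R f w \<partial>M) = (\<integral>y. (\<integral>\<omega>. ?H (y, \<omega>) \<partial>P) \<partial>M)"
    using MP.AE_integrable_fst'[OF iH]
    by (intro integral_cong_AE) (auto simp: tau_def integral_scaleR_left_AE elim!: AE_mp)
  also have "\<dots> = (\<integral>q. ?H q \<partial>?Q)" by (rule MP.integral_fst'[OF iH])
  also have "\<dots> = (\<integral>q. ?G (fst q, p x (fst q) (snd q)) \<partial>?Q)" using HG by (intro integral_cong_AE) auto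
  also have "\<dots> = (\<integral>q. ?G q \<partial>distr ?Q (borel \<Otimes>\<^sub>M borel) (\<lambda>(y, \<omega>). (y, p x y \<omega>)))"
    by (subst integral_distr) (auto simp: case_prod_beta')
  also have "\<dots> = (\<integral>q. ?G (p (- x) (fst q) (snd q), fst q) \<partial>?Q)"
    unfolding dual_distr by (subst integral_distr) (auto simp: case_prod_beta')
  also have "\<dots> = (\<integral>q. ?H' q \<partial>?Q)" using HG' by (intro integral_cong_AE) auto
  also have "\<dots> = (\<integral>y. (\<integral>\<omega>. ?H' (y, \<omega>) \<partial>P) \<partial>M)" by (rule MP.integral_fst'[OF iH', symmetric])
  also have "\<dots> = (\<integral>w. g w *\<^sub>R tau (- x) f w \<partial>M)"
    using MP.AE_integrable_fst'[OF iH']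
    by (intro integral_cong_AE)
       (auto simp: tau_def scaleR_scaleR[symmetric] simp del: scaleR_scaleR elim!: AE_mp)
  finally show ?thesis .
qed

end

text \<open>
  Continuity makes all averages finite, so that the symmetry holds everywhere; for kernels with a
  singularity it is recovered almost everywhere by truncation (\<open>K_triple\<close>).
\<close>
locale symmetric_translation = averaged_translation +
  assumes triple: "\<And>g :: real \<Rightarrow> real. continuous_on UNIV g \<Longrightarrow> (\<And>t. g (- t) = g t) \<Longrightarrow>
    tau x (\<lambda>z. tau z g w) y = tau x (\<lambda>z. tau z g y) w"

section \<open>The kernel of the fractional integral and its translates\<close>

text \<open>
  The smoothness condition on the kernel entails that \<open>\<rho>\<close> is continuous, hence Borel measurable on
  \<open>(0, \<infinity>)\<close>.
\<close>
lemma quotient_isCont: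
  fixes \<rho> :: "real \<Rightarrow> real"
  assumes "s > 0" and rho_d: "\<And>r. r > 0 \<Longrightarrow> r \<le> 2 * s \<Longrightarrow> s \<le> 2 * r \<Longrightarrow>
        \<bar>\<rho> r / r powr D - \<rho> s / s powr D\<bar> \<le> Cd * \<bar>r - s\<bar> * (\<rho> s / s powr (D + 1))"
  shows "isCont (\<lambda>t. \<rho> t / t powr D) s"
proof -
  let ?q = "\<lambda>t. \<rho> t / t powr D"
  let ?c = "Cd * (\<rho> s / s powr (D + 1))"
  have "((\<lambda>t. ?q t - ?q s) \<longlongrightarrow> 0) (at s)"
  proof (rule Lim_null_comparison)
    have "\<forall>\<^sub>F t in at s. t \<in> {s / 2 <..< 2 * s}"
      using assms(1) by (intro eventually_at_in_open') auto
    then show "\<forall>\<^sub>F t in at s. norm (?q t - ?q s) \<le> ?c * \<bar>t - s\<bar>"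
    proof eventually_elim
      case (elim t)
      then show ?case using rho_d[of t] assms by (simp add: mult_ac)
    qed
    have "((\<lambda>t. ?c * \<bar>t - s\<bar>) \<longlongrightarrow> ?c * \<bar>s - s\<bar>) (at s)" by (intro tendsto_intros)
    then show "((\<lambda>t. ?c * \<bar>t - s\<bar>) \<longlongrightarrow> 0) (at s)" by simp
  qed
  then show ?thesis unfolding isCont_def by (simp add: LIM_zero_iff)
qed

lemma continuous_of_quotient_isCont:
  fixes \<rho> :: "real \<Rightarrow> real"
  assumes "\<And>s. s > 0 \<Longrightarrow> isCont (\<lambda>t. \<rho> t / t powr D) s"
  shows "continuous_on {0<..} \<rho>"
proof -
  have "continuous_on {0<..} (\<lambda>t. (\<rho> t / t powr D) * t powr D)"
    by (intro continuous_intros continuous_at_imp_continuous_on ballI assms) auto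
  then show ?thesis by (rule continuous_on_eq) auto
qed

text \<open>
  The hypothesis \<open>K_int\<close> is integration in polar coordinates, with the kernel \<open>K\<close> of \<open>K_def\<close> written
  out.
\<close>
locale kernel_translation = symmetric_translation M P p k \<kappa> B D cM
  for M :: "real measure" and P :: "'w measure" and p k :: "real \<Rightarrow> real \<Rightarrow> 'w \<Rightarrow> real"
    and \<kappa> :: "real \<Rightarrow> real \<Rightarrow> real \<Rightarrow> real" and B D cM :: real +
  fixes \<rho> :: "real \<Rightarrow> real" and C1 Cc Cd cK :: real
  assumes rho_pos: "\<And>r. r > 0 \<Longrightarrow> \<rho> r > 0"
    and rho_a: "\<And>r s. r > 0 \<Longrightarrow> s > 0 \<Longrightarrow> r \<le> 2 * s \<Longrightarrow> s \<le> 2 * r \<Longrightarrow> \<rho> r \<le> C1 * \<rho> s"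
    and rho_b: "\<And>R. R > 0 \<Longrightarrow> (\<integral>\<^sup>+t\<in>{0<..<R}. ennreal (\<rho> t / t) \<partial>lborel) < \<infinity>"
    and rho_c: "\<And>r. r > 0 \<Longrightarrow> (\<integral>\<^sup>+t\<in>{r<..}. ennreal (\<rho> t / t\<^sup>2) \<partial>lborel) \<le> ennreal (Cc * (\<rho> r / r))"
    and rho_d: "\<And>r s. r > 0 \<Longrightarrow> s > 0 \<Longrightarrow> r \<le> 2 * s \<Longrightarrow> s \<le> 2 * r \<Longrightarrow>
        \<bar>\<rho> r / r powr D - \<rho> s / s powr D\<bar> \<le> Cd * \<bar>r - s\<bar> * (\<rho> s / s powr (D + 1))"
    and Cc_pos: "Cc > 0" and Cd_pos: "Cd > 0" and cK_pos: "cK > 0"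
    and K_int: "\<And>R. R > 0 \<Longrightarrow> (\<integral>\<^sup>+y\<in>ball 0 R. ennreal (\<rho> \<bar>y\<bar> / \<bar>y\<bar> powr D) \<partial>M)
         = ennreal cK * (\<integral>\<^sup>+t\<in>{0<..<R}. ennreal (\<rho> t / t) \<partial>lborel)"
begin

sublocale MM: pair_sigma_finite M M
  by (simp add: pair_sigma_finite_def sigma_finite_measure_axioms)

definition K :: "real \<Rightarrow> real" where "K y = \<rho> \<bar>y\<bar> / \<bar>y\<bar> powr D"

abbreviation KE :: "real \<Rightarrow> ennreal" where "KE y \<equiv> ennreal (K y)"

text \<open>
  The kernel outside the ball of radius \<open>a\<close>; subtracting it from \<open>\<tau>\<^sub>z K\<close> makes the difference \<open>L a z\<close>
  integrable at infinity.
\<close>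
definition cut :: "real \<Rightarrow> real \<Rightarrow> real" where "cut a w = (if \<bar>w\<bar> < a then 0 else K w)"

definition L :: "real \<Rightarrow> real \<Rightarrow> real \<Rightarrow> real" where "L a z w = tau z K w - cut a w"

text \<open>
  The decay of \<open>L a z w\<close> for large \<open>w\<close>, frozen for \<open>\<bar>w\<bar> \<le> 1\<close> so that it is bounded below on balls.
  The functions integrable against \<open>V\<close> form the class \<open>weighted\<close> to which the operator is applied;
  it is stable under translation.
\<close>
definition V :: "real \<Rightarrow> real" where "V w = \<rho> (max \<bar>w\<bar> 1) / max \<bar>w\<bar> 1 powr (D + 1)"

lemma K_zero [simp]: "K 0 = 0" by (simp add: K_def)

lemma K_nonneg: "K y \<ge> 0"
  using rho_pos[of "\<bar>y\<bar>"] by (cases "y = 0") (auto simp: K_def)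

lemma K_abs: "K \<bar>y\<bar> = K y" by (simp add: K_def)

lemma C1_ge_1: "C1 \<ge> 1"
  using rho_a[of 1 1] rho_pos[of 1] by simp

lemma K_ball_finite: "(\<integral>\<^sup>+y\<in>ball 0 R. KE y \<partial>M) < \<infinity>"
proof (cases "R > 0")
  case True
  then show ?thesis
    using K_int[OF True] rho_b[OF True] by (simp add: K_def ennreal_mult_less_top)
next
  case False
  then have "ball (0::real) R = {}" by simp
  then show ?thesis by simp
qed

lemma K_isCont: assumes s: "s > 0" shows "isCont (\<lambda>t. \<rho> t / t powr D) s"
  by (rule quotient_isCont[OF s rho_d[OF _ s]])

lemma rho_continuous: "continuous_on {0<..} \<rho>"
  by (rule continuous_of_quotient_isCont[OF K_isCont])

lemma K_continuous: "continuous_on {0<..} K"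
  by (rule continuous_on_eq[of _ "\<lambda>t. \<rho> t / t powr D"])
     (auto simp: K_def intro!: continuous_at_imp_continuous_on K_isCont)

lemma K_measurable [measurable]: "K \<in> borel_measurable borel"
proof -
  have "(\<lambda>t. indicator {0<..} t *\<^sub>R K t) \<in> borel_measurable borel"
    by (intro borel_measurable_continuous_on_indicator K_continuous) auto
  then have "(\<lambda>y. indicator {0<..} \<bar>y\<bar> *\<^sub>R K \<bar>y\<bar>) \<in> borel_measurable borel"
    by (rule measurable_compose[rotated]) measurable
  moreover have "(\<lambda>y. indicator {0<..} \<bar>y\<bar> *\<^sub>R K \<bar>y\<bar>) = K"
    by (rule ext) (auto simp: indicator_def K_abs)
  ultimately show ?thesis by simp
qed

lemma cut_measurable [measurable]: "cut a \<in> borel_measurable borel"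
  unfolding cut_def by measurable

lemma cut_nonneg: "cut a w \<ge> 0" by (simp add: cut_def K_nonneg)

lemma L_measurable [measurable (raw)]:
  assumes [measurable]: "b \<in> borel_measurable N" "c \<in> borel_measurable N"
  shows "(\<lambda>n. L a (b n) (c n)) \<in> borel_measurable N"
  unfolding L_def by measurable

text \<open>
  The doubling condition is iterated along a chain from \<open>r\<close> to \<open>s\<close>.
\<close>
lemma rho_ratio:
  "0 < r \<Longrightarrow> 0 < s \<Longrightarrow> r \<le> 2 ^ n * s \<Longrightarrow> s \<le> 2 ^ n * r \<Longrightarrow> \<rho> r \<le> C1 ^ n * \<rho> s"
proof (induction n arbitrary: r)
  case (Suc n)
  consider "r \<le> 2 * s" "s \<le> 2 * r" | "r > 2 * s" | "s > 2 * r" by linarith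
  then show ?case
  proof cases
    case 1
    have "\<rho> r \<le> C1 * \<rho> s" using 1 Suc.prems rho_a by simp
    also have "\<dots> \<le> C1 ^ Suc n * \<rho> s"
      using rho_pos[of s] Suc.prems self_le_power[of C1 "Suc n"] C1_ge_1
      by (intro mult_right_mono) auto
    finally show ?thesis .
  next
    case 2
    have "s \<le> 2 ^ n * (r / 2)" 
    proof -
      have "s \<le> 1 * (r / 2)" using 2 by simp
      also have "\<dots> \<le> 2 ^ n * (r / 2)" using Suc.prems by (intro mult_right_mono) auto
      finally show ?thesis .
    qed
    then have "\<rho> (r / 2) \<le> C1 ^ n * \<rho> s" using Suc.prems by (intro Suc.IH) auto
    moreover have "\<rho> r \<le> C1 * \<rho> (r / 2)" using Suc.prems by (intro rho_a) auto
    ultimately show ?thesis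
      using order_trans[OF _ mult_left_mono[of "\<rho> (r / 2)" "C1 ^ n * \<rho> s" C1]] C1_ge_1 by (simp add: mult.assoc)
  next
    case 3
    have "2 * r \<le> 2 ^ n * s" 
    proof -
      have "2 * r \<le> 1 * s" using 3 by simp
      also have "\<dots> \<le> 2 ^ n * s" using Suc.prems by (intro mult_right_mono) auto
      finally show ?thesis .
    qed
    then have "\<rho> (2 * r) \<le> C1 ^ n * \<rho> s" using Suc.prems by (intro Suc.IH) auto
    moreover have "\<rho> r \<le> C1 * \<rho> (2 * r)" using Suc.prems by (intro rho_a) auto
    ultimately show ?thesis
      using order_trans[OF _ mult_left_mono[of "\<rho> (2 * r)" "C1 ^ n * \<rho> s" C1]] C1_ge_1 by (simp add: mult.assoc)
  qed
qed simp

lemma exists_pow2: "\<exists>n. (q::real) \<le> 2 ^ n"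
  using real_arch_pow[of 2 q] by (auto intro: less_imp_le)

lemma V_pos: "V w > 0"
  unfolding V_def by (intro divide_pos_pos rho_pos) auto

lemma V_measurable [measurable]: "V \<in> borel_measurable borel"
proof -
  have "continuous_on UNIV (\<lambda>w. \<rho> (max \<bar>w\<bar> 1) / max \<bar>w\<bar> 1 powr (D + 1))"
    by (intro continuous_intros continuous_on_compose2[OF rho_continuous]) auto
  then show ?thesis unfolding V_def[abs_def] by (rule borel_measurable_continuous_onI)
qed

text \<open>
  Points at bounded distance have comparable values of \<open>max \<bar>w\<bar> 1\<close>, so the ratio of the weights is
  bounded through a fixed number of doublings.
\<close>
lemma V_shift: "\<exists>C>0. \<forall>u w. \<bar>\<bar>u\<bar> - \<bar>w\<bar>\<bar> \<le> X \<longrightarrow> V u \<le> C * V w"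
proof -
  define q where "q = 1 + \<bar>X\<bar>"
  obtain n where n: "q \<le> 2 ^ n" using exists_pow2 by blast
  let ?C = "C1 ^ n * q powr (D + 1)"
  have q: "q \<ge> 1" by (simp add: q_def)
  have "?C > 0" using C1_ge_1 q by auto
  moreover have "V u \<le> ?C * V w" if uw: "\<bar>\<bar>u\<bar> - \<bar>w\<bar>\<bar> \<le> X" for u w
  proof -
    define a b where "a = max \<bar>u\<bar> 1" and "b = max \<bar>w\<bar> 1"
    have step: "max \<bar>b\<bar> 1 \<le> q * max \<bar>c\<bar> 1" if "\<bar>\<bar>b\<bar> - \<bar>c\<bar>\<bar> \<le> X" for b c
    proof -
      have "\<bar>X\<bar> \<le> \<bar>X\<bar> * max \<bar>c\<bar> 1" using mult_left_mono[of 1 "max \<bar>c\<bar> 1" "\<bar>X\<bar>"] by simp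
      moreover have "max \<bar>b\<bar> 1 \<le> max \<bar>c\<bar> 1 + \<bar>X\<bar>" using that by linarith
      ultimately show ?thesis by (simp add: q_def distrib_right)
    qed
    have 1: "a \<le> q * b" "b \<le> q * a"
      unfolding a_def b_def using step[of u w] step[of w u] uw by (auto simp: abs_minus_commute)
    have ab: "a > 0" "b > 0" by (simp_all add: a_def b_def)
    have "q * b \<le> 2 ^ n * b" "q * a \<le> 2 ^ n * a" using n ab by (auto intro!: mult_right_mono)
    then have "a \<le> 2 ^ n * b" "b \<le> 2 ^ n * a" using 1 by linarith+
    then have r: "\<rho> a \<le> C1 ^ n * \<rho> b" using ab by (intro rho_ratio)
    have "b powr (D + 1) \<le> (q * a) powr (D + 1)" using 1(2) ab D_ge_1 by (intro powr_mono2) auto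
    also have "\<dots> = q powr (D + 1) * a powr (D + 1)" using q ab by (simp add: powr_mult)
    finally have w: "b powr (D + 1) \<le> q powr (D + 1) * a powr (D + 1)" .
    have p: "a powr (D + 1) > 0" "b powr (D + 1) > 0" using ab by auto
    have "V u = \<rho> a * (1 / a powr (D + 1))" by (simp add: V_def a_def)
    also have "\<dots> \<le> (C1 ^ n * \<rho> b) * (q powr (D + 1) / b powr (D + 1))"
    proof (rule mult_mono[OF r])
      show "1 / a powr (D + 1) \<le> q powr (D + 1) / b powr (D + 1)" using w p by (simp add: field_simps)
    qed (use C1_ge_1 rho_pos[OF ab(2)] p in auto)
    also have "\<dots> = ?C * V w" by (simp add: V_def b_def)
    finally show ?thesis .
  qed
  ultimately show ?thesis by blast
qed

lemma V_lower: "\<exists>c>0. \<forall>w. \<bar>w\<bar> < T \<longrightarrow> c \<le> V w"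
proof -
  obtain C where C: "C > 0" "\<And>u w. \<bar>\<bar>u\<bar> - \<bar>w\<bar>\<bar> \<le> T \<Longrightarrow> V u \<le> C * V w"
    using V_shift[of T] by blast
  have "V 0 / C \<le> V w" if "\<bar>w\<bar> < T" for w
    using C(2)[of 0 w] C(1) that by (simp add: field_simps)
  then show ?thesis using C(1) V_pos[of 0] by (intro exI[of _ "V 0 / C"]) auto
qed

lemma cut_bound:
  assumes "a > 0" shows "\<exists>C>0. \<forall>w. \<bar>w\<bar> < T \<longrightarrow> cut a w \<le> C"
proof -
  obtain n where n: "max T (1/a) \<le> 2 ^ n" using exists_pow2 by blast
  let ?C = "C1 ^ n * \<rho> 1 / a powr D"
  have Cp: "?C > 0" using C1_ge_1 rho_pos[of 1] assms by auto
  moreover have "cut a w \<le> ?C" if "\<bar>w\<bar> < T" for w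
  proof (cases "\<bar>w\<bar> < a")
    case False
    then have w: "\<bar>w\<bar> > 0" "a \<le> \<bar>w\<bar>" using assms by auto
    have "1 \<le> 2 ^ n * a" using n assms by (simp add: field_simps)
    also have "\<dots> \<le> 2 ^ n * \<bar>w\<bar>" using w by (intro mult_left_mono) auto
    finally have "\<rho> \<bar>w\<bar> \<le> C1 ^ n * \<rho> 1" using that w n by (intro rho_ratio) auto
    moreover have "a powr D \<le> \<bar>w\<bar> powr D" using w assms D_ge_1 by (intro powr_mono2) auto
    ultimately have "K w \<le> ?C"
      unfolding K_def using rho_pos[of "\<bar>w\<bar>"] w assms by (intro frac_le) auto
    then show ?thesis using False by (simp add: cut_def)
  qed (use Cp in \<open>simp add: cut_def\<close>)
  ultimately show ?thesis by blast
qed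

lemma cut_le_V:
  assumes "a > 0" shows "\<exists>C>0. \<forall>w. \<bar>w\<bar> < T \<longrightarrow> cut a w \<le> C * V w"
proof -
  obtain C where C: "C > 0" "\<And>w. \<bar>w\<bar> < T \<Longrightarrow> cut a w \<le> C" using cut_bound[OF assms] by blast
  obtain c where c: "c > 0" "\<And>w. \<bar>w\<bar> < T \<Longrightarrow> c \<le> V w" using V_lower by blast
  have "cut a w \<le> (C / c) * V w" if "\<bar>w\<bar> < T" for w
  proof -
    have "cut a w \<le> C / c * c" using C(2)[OF that] c by simp
    also have "\<dots> \<le> C / c * V w" using C(1) c that by (intro mult_left_mono) auto
    finally show ?thesis .
  qed
  then show ?thesis using C c by (intro exI[of _ "C / c"]) auto
qed

text \<open>
  All positions \<open>u\<close> reached from \<open>w\<close> by the shift \<open>z\<close> satisfy \<open>\<bar>w\<bar> / 2 \<le> \<bar>u\<bar> \<le> 2 \<bar>w\<bar>\<close> and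
  \<open>\<bar>\<bar>u\<bar> - \<bar>w\<bar>\<bar> \<le> \<bar>z\<bar>\<close>, which is the range of the smoothness condition.
\<close>
lemma kernel_smooth:
  assumes w: "w \<noteq> 0" "2 * \<bar>z\<bar> \<le> \<bar>w\<bar>"
  shows "\<bar>tau z K w - K w\<bar> \<le> B * mP * Cd * \<bar>z\<bar> * (\<rho> \<bar>w\<bar> / \<bar>w\<bar> powr (D + 1))"
proof -
  have "norm (tau z K w - K w) \<le> B * mP * (Cd * \<bar>z\<bar> * (\<rho> \<bar>w\<bar> / \<bar>w\<bar> powr (D + 1)))"
  proof (rule tau_near_const)
    have rp: "\<rho> \<bar>w\<bar> > 0" using w by (intro rho_pos) auto
    fix u assume u: "\<bar>\<bar>z\<bar> - \<bar>w\<bar>\<bar> \<le> \<bar>u\<bar>" "\<bar>u\<bar> \<le> \<bar>z\<bar> + \<bar>w\<bar>"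
    have *: "0 < a \<and> a \<le> 2 * b \<and> b \<le> 2 * a \<and> \<bar>a - b\<bar> \<le> c"
      if "c - b \<le> a" "b - c \<le> a" "a \<le> c + b" "b > 0" "2 * c \<le> b" "c \<ge> 0" for a b c :: real
      using that unfolding abs_le_iff by linarith
    have "0 < \<bar>u\<bar> \<and> \<bar>u\<bar> \<le> 2 * \<bar>w\<bar> \<and> \<bar>w\<bar> \<le> 2 * \<bar>u\<bar> \<and> \<bar>\<bar>u\<bar> - \<bar>w\<bar>\<bar> \<le> \<bar>z\<bar>"
      by (rule *) (use u w in \<open>auto simp: abs_le_iff[of "\<bar>z\<bar> - \<bar>w\<bar>"]\<close>)
    then have "\<bar>u\<bar> > 0" "\<bar>u\<bar> \<le> 2 * \<bar>w\<bar>" "\<bar>w\<bar> \<le> 2 * \<bar>u\<bar>" "\<bar>\<bar>u\<bar> - \<bar>w\<bar>\<bar> \<le> \<bar>z\<bar>" by blast+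
    then have "\<bar>K u - K w\<bar> \<le> Cd * \<bar>\<bar>u\<bar> - \<bar>w\<bar>\<bar> * (\<rho> \<bar>w\<bar> / \<bar>w\<bar> powr (D + 1))"
      unfolding K_def using w by (intro rho_d) auto
    also have "\<dots> \<le> Cd * \<bar>z\<bar> * (\<rho> \<bar>w\<bar> / \<bar>w\<bar> powr (D + 1))"
      by (rule mult_right_mono[OF mult_left_mono[OF \<open>\<bar>\<bar>u\<bar> - \<bar>w\<bar>\<bar> \<le> \<bar>z\<bar>\<close>]])
         (simp_all add: Cd_pos rp less_imp_le)
    finally show "norm (K u - K w) \<le> Cd * \<bar>z\<bar> * (\<rho> \<bar>w\<bar> / \<bar>w\<bar> powr (D + 1))" by simp
  qed (use Cd_pos rho_pos[of "\<bar>w\<bar>"] w in auto)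
  then show ?thesis by (simp add: mult.assoc)
qed

lemma norm_tau_K_le: "ennreal \<bar>tau z K w\<bar> \<le> ennreal B * maj z KE w"
  using norm_tau_le[of K z w] by (simp add: K_nonneg)

text \<open>
  Beyond the radius \<open>T\<close> the shift is at most half of \<open>\<bar>w\<bar>\<close> and the truncation has no effect, so \<open>L\<close>
  is the difference in \<open>kernel_smooth\<close>. Inside, the two terms of \<open>L\<close> are estimated separately.
\<close>
lemma L_bound:
  assumes a: "a > 0" and t: "t > 0"
  shows "\<exists>C>0. \<exists>T>0. \<forall>z w. \<bar>z\<bar> < t \<longrightarrow>
    ennreal \<bar>L a z w\<bar> \<le> ennreal (C * V w) + ennreal B * (maj z KE w * indicator (ball 0 T) w)"
proof -
  define T where "T = max (max (2 * t) a) 1"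
  have T: "T \<ge> 2 * t" "T \<ge> a" "T \<ge> 1" by (auto simp: T_def)
  obtain Cv where Cv: "Cv > 0" "\<And>w. \<bar>w\<bar> < T \<Longrightarrow> cut a w \<le> Cv * V w" using cut_le_V[OF a] by blast
  define C where "C = Cv + B * mP * Cd * t"
  have tail_const: "B * mP * Cd * t \<ge> 0" using B_ge_1 mP_nonneg Cd_pos t by auto
  then have Cpos: "C > 0" "C \<ge> Cv" "C \<ge> B * mP * Cd * t" using Cv by (auto simp: C_def)
  have "ennreal \<bar>L a z w\<bar> \<le> ennreal (C * V w) + ennreal B * (maj z KE w * indicator (ball 0 T) w)"
    if z: "\<bar>z\<bar> < t" for z w
  proof (cases "\<bar>w\<bar> < T")
    case True
    have "ennreal \<bar>L a z w\<bar> \<le> ennreal \<bar>tau z K w\<bar> + ennreal (cut a w)"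
    proof -
      have "\<bar>L a z w\<bar> \<le> \<bar>tau z K w\<bar> + cut a w" using cut_nonneg[of a w] unfolding L_def by linarith
      then show ?thesis using cut_nonneg[of a w] by (simp add: ennreal_plus[symmetric] ennreal_leI del: ennreal_plus)
    qed
    also have "\<dots> \<le> ennreal B * maj z KE w + ennreal (C * V w)"
    proof (intro add_mono norm_tau_K_le ennreal_leI)
      have "cut a w \<le> Cv * V w" using Cv True by blast
      also have "\<dots> \<le> C * V w" using Cpos V_pos[of w] by (intro mult_right_mono) auto
      finally show "cut a w \<le> C * V w" .
    qed
    finally show ?thesis using True by (simp add: add.commute)
  next
    case False
    then have w: "w \<noteq> 0" "2 * \<bar>z\<bar> \<le> \<bar>w\<bar>" "max \<bar>w\<bar> 1 = \<bar>w\<bar>" "cut a w = K w"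
      using T z t by (auto simp: cut_def)
    have "\<bar>L a z w\<bar> \<le> B * mP * Cd * \<bar>z\<bar> * V w"
      using kernel_smooth[OF w(1,2)] w(3,4) by (simp add: L_def V_def)
    also have "\<dots> \<le> B * mP * Cd * t * V w"
      using z B_ge_1 mP_nonneg Cd_pos V_pos[of w] by (intro mult_right_mono mult_left_mono) auto
    also have "\<dots> \<le> C * V w" using Cpos V_pos[of w] by (intro mult_right_mono) auto
    finally have "ennreal \<bar>L a z w\<bar> \<le> ennreal (C * V w)" by (rule ennreal_leI)
    then show ?thesis by (rule order_trans) simp
  qed
  then show ?thesis using Cpos T(3) by (intro exI[of _ C] conjI exI[of _ T]) auto
qed

lemma maj_K_local: "\<exists>C\<ge>0. \<forall>w. \<bar>w\<bar> < T \<longrightarrow> (\<integral>\<^sup>+z\<in>ball 0 t. maj z KE w \<partial>M) \<le> ennreal C"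
proof -
  let ?I = "ennreal mP * (\<integral>\<^sup>+y\<in>ball 0 (t + T). KE y \<partial>M)"
  have "(\<integral>\<^sup>+z\<in>ball 0 t. maj z KE w \<partial>M) \<le> ?I" if "\<bar>w\<bar> < T" for w
  proof -
    have "(\<integral>\<^sup>+z\<in>ball 0 t. maj z KE w \<partial>M) = (\<integral>\<^sup>+z\<in>ball 0 t. maj w KE z \<partial>M)" by (subst maj_sym) simp
    also have "\<dots> \<le> ennreal mP * (\<integral>\<^sup>+y\<in>ball 0 (t + \<bar>w\<bar>). KE y \<partial>M)" by (rule maj_ball_le) measurable
    also have "\<dots> \<le> ?I"
      using that by (intro mult_left_mono nn_integral_mono) (auto simp: indicator_def)
    finally show ?thesis .
  qed
  moreover have "?I < \<infinity>" using K_ball_finite by (simp add: ennreal_mult_less_top)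
  ultimately show ?thesis
    by (intro exI[of _ "enn2real ?I"]) (auto simp: ennreal_enn2real_if)
qed

lemma ball_weight_finite:
  assumes [measurable]: "g \<in> borel_measurable borel" and fin: "(\<integral>\<^sup>+w. g w * ennreal (V w) \<partial>M) < \<infinity>"
  shows "(\<integral>\<^sup>+w\<in>ball 0 T. g w \<partial>M) < \<infinity>"
proof -
  obtain c where c: "c > 0" "\<And>w. \<bar>w\<bar> < T \<Longrightarrow> c \<le> V w" using V_lower by blast
  have "(\<integral>\<^sup>+w\<in>ball 0 T. g w \<partial>M) \<le> (\<integral>\<^sup>+w. ennreal (1 / c) * (g w * ennreal (V w)) \<partial>M)"
  proof (rule nn_integral_mono)
    fix w
    show "g w * indicator (ball 0 T) w \<le> ennreal (1 / c) * (g w * ennreal (V w))"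
    proof (cases "\<bar>w\<bar> < T")
      case True
      then have "1 \<le> ennreal (1 / c) * ennreal (V w)"
        using c V_pos[of w] by (simp add: ennreal_mult[symmetric] field_simps)
      then have "g w * 1 \<le> g w * (ennreal (1 / c) * ennreal (V w))" by (rule mult_left_mono) simp
      then show ?thesis using True by (simp add: mult_ac)
    qed simp
  qed
  also have "\<dots> = ennreal (1 / c) * (\<integral>\<^sup>+w. g w * ennreal (V w) \<partial>M)" by (rule nn_integral_cmult) measurable
  also have "\<dots> < \<infinity>" using fin by (simp add: ennreal_mult_less_top)
  finally show ?thesis .
qed

lemma M_ball_finite: "emeasure M (ball 0 t) < \<infinity>"
proof (cases "t > 0")
  case False
  then have "ball (0::real) t = {}" by simp
  then show ?thesis by (simp only: emeasure_empty) simp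
qed (simp add: M_ball)

text \<open>
  The local singularity of \<open>L\<close> is integrated first in \<open>z\<close>, where \<open>maj_K_local\<close> bounds it uniformly
  in \<open>w\<close>.
\<close>
lemma L_weight_finite:
  assumes [measurable]: "g \<in> borel_measurable borel" and fin: "(\<integral>\<^sup>+w. g w * ennreal (V w) \<partial>M) < \<infinity>"
    and a: "a > 0"
  shows "(\<integral>\<^sup>+z\<in>ball 0 t. (\<integral>\<^sup>+w. g w * ennreal \<bar>L a z w\<bar> \<partial>M) \<partial>M) < \<infinity>"
proof (cases "t > 0")
  case True
  obtain C T where CT: "C > 0" "T > 0" "\<And>z w. \<bar>z\<bar> < t \<Longrightarrow>
    ennreal \<bar>L a z w\<bar> \<le> ennreal (C * V w) + ennreal B * (maj z KE w * indicator (ball 0 T) w)"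
    using L_bound[OF a True] by blast
  obtain C' where C': "C' \<ge> 0" "\<And>w. \<bar>w\<bar> < T \<Longrightarrow> (\<integral>\<^sup>+z\<in>ball 0 t. maj z KE w \<partial>M) \<le> ennreal C'"
    using maj_K_local by blast
  let ?J = "\<integral>\<^sup>+w. g w * ennreal (V w) \<partial>M"
  have "(\<integral>\<^sup>+z\<in>ball 0 t. (\<integral>\<^sup>+w. g w * ennreal \<bar>L a z w\<bar> \<partial>M) \<partial>M)
     \<le> (\<integral>\<^sup>+z. (ennreal C * ?J) * indicator (ball 0 t) z
          + ennreal B * (\<integral>\<^sup>+w. g w * indicator (ball 0 T) w * maj z KE w * indicator (ball 0 t) z \<partial>M) \<partial>M)"
  proof (rule nn_integral_mono)
    fix z
    show "(\<integral>\<^sup>+w. g w * ennreal \<bar>L a z w\<bar> \<partial>M) * indicator (ball 0 t) z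
      \<le> (ennreal C * ?J) * indicator (ball 0 t) z
          + ennreal B * (\<integral>\<^sup>+w. g w * indicator (ball 0 T) w * maj z KE w * indicator (ball 0 t) z \<partial>M)"
    proof (cases "\<bar>z\<bar> < t")
      case True
      have "(\<integral>\<^sup>+w. g w * ennreal \<bar>L a z w\<bar> \<partial>M)
        \<le> (\<integral>\<^sup>+w. ennreal C * (g w * ennreal (V w)) + ennreal B * (g w * indicator (ball 0 T) w * maj z KE w) \<partial>M)"
      proof (rule nn_integral_mono)
        fix w
        have "g w * ennreal \<bar>L a z w\<bar> \<le> g w * (ennreal (C * V w) + ennreal B * (maj z KE w * indicator (ball 0 T) w))"
          by (intro mult_left_mono CT True) simp
        then show "g w * ennreal \<bar>L a z w\<bar> \<le> ennreal C * (g w * ennreal (V w)) + ennreal B * (g w * indicator (ball 0 T) w * maj z KE w)"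
          using CT(1) V_pos[of w] by (simp add: ennreal_mult distrib_left mult_ac)
      qed
      also have "\<dots> = ennreal C * ?J + ennreal B * (\<integral>\<^sup>+w. g w * indicator (ball 0 T) w * maj z KE w \<partial>M)"
        by (subst nn_integral_add) (auto simp: nn_integral_cmult)
      finally show ?thesis using True by simp
    qed simp
  qed
  also have "\<dots> = ennreal C * ?J * emeasure M (ball 0 t)
     + ennreal B * (\<integral>\<^sup>+z. \<integral>\<^sup>+w. g w * indicator (ball 0 T) w * maj z KE w * indicator (ball 0 t) z \<partial>M \<partial>M)"
    by (subst nn_integral_add) (auto simp: nn_integral_cmult nn_integral_cmult_indicator)
  also have "(\<integral>\<^sup>+z. \<integral>\<^sup>+w. g w * indicator (ball 0 T) w * maj z KE w * indicator (ball 0 t) z \<partial>M \<partial>M)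
     = (\<integral>\<^sup>+w. \<integral>\<^sup>+z. g w * indicator (ball 0 T) w * maj z KE w * indicator (ball 0 t) z \<partial>M \<partial>M)"
    by (rule MM.Fubini') measurable
  also have "\<dots> = (\<integral>\<^sup>+w. g w * indicator (ball 0 T) w * (\<integral>\<^sup>+z\<in>ball 0 t. maj z KE w \<partial>M) \<partial>M)"
    by (subst nn_integral_cmult[symmetric]) (auto simp: mult.assoc)
  also have "\<dots> \<le> (\<integral>\<^sup>+w. (g w * indicator (ball 0 T) w) * ennreal C' \<partial>M)"
  proof (rule nn_integral_mono)
    fix w
    show "g w * indicator (ball 0 T) w * (\<integral>\<^sup>+z\<in>ball 0 t. maj z KE w \<partial>M) \<le> g w * indicator (ball 0 T) w * ennreal C'"
      by (cases "\<bar>w\<bar> < T") (auto intro!: mult_left_mono C'(2))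
  qed
  also have "\<dots> = (\<integral>\<^sup>+w\<in>ball 0 T. g w \<partial>M) * ennreal C'"
    by (rule nn_integral_multc) measurable
  finally have "(\<integral>\<^sup>+z\<in>ball 0 t. (\<integral>\<^sup>+w. g w * ennreal \<bar>L a z w\<bar> \<partial>M) \<partial>M)
    \<le> ennreal C * ?J * emeasure M (ball 0 t) + ennreal B * ((\<integral>\<^sup>+w\<in>ball 0 T. g w \<partial>M) * ennreal C')"
    by (simp add: add_left_mono mult_left_mono)
  also have "\<dots> < \<infinity>"
    using fin ball_weight_finite[OF assms(1) fin, of T] M_ball_finite[of t] by (simp add: ennreal_mult_less_top)
  finally show ?thesis .
next
  case False
  then have "ball (0::real) t = {}" by simp
  then show ?thesis by simp
qed

lemma maj_V: "\<exists>C>0. \<forall>w. maj x (\<lambda>z. ennreal (V z)) w \<le> ennreal (C * V w)"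
proof -
  obtain C where C: "C > 0" "\<And>u w. \<bar>\<bar>u\<bar> - \<bar>w\<bar>\<bar> \<le> \<bar>x\<bar> \<Longrightarrow> V u \<le> C * V w"
    using V_shift[of "\<bar>x\<bar>"] by blast
  have "maj x (\<lambda>z. ennreal (V z)) w \<le> ennreal ((C * (mP + 1)) * V w)" for w
  proof -
    have "maj x (\<lambda>z. ennreal (V z)) w \<le> ennreal (C * V w) * ennreal mP"
    proof (rule maj_le)
      fix z assume "\<bar>\<bar>x\<bar> - \<bar>w\<bar>\<bar> \<le> \<bar>z\<bar>" "\<bar>z\<bar> \<le> \<bar>x\<bar> + \<bar>w\<bar>"
      then have "\<bar>\<bar>z\<bar> - \<bar>w\<bar>\<bar> \<le> \<bar>x\<bar>" unfolding abs_le_iff[of "\<bar>_\<bar> - \<bar>_\<bar>"] by simp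
      then show "ennreal (V z) \<le> ennreal (C * V w)" by (intro ennreal_leI C)
    qed
    also have "\<dots> = ennreal (C * V w * mP)"
      using C(1) V_pos[of w] mP_nonneg by (simp add: ennreal_mult)
    also have "\<dots> \<le> ennreal ((C * (mP + 1)) * V w)"
      using C(1) V_pos[of w] by (intro ennreal_leI) (simp add: algebra_simps)
    finally show ?thesis .
  qed
  then show ?thesis using C(1) mP_nonneg by (intro exI[of _ "C * (mP + 1)"]) auto
qed

lemma maj_weight_finite:
  assumes [measurable]: "g \<in> borel_measurable borel" and fin: "(\<integral>\<^sup>+w. g w * ennreal (V w) \<partial>M) < \<infinity>"
  shows "(\<integral>\<^sup>+w. maj x g w * ennreal (V w) \<partial>M) < \<infinity>"
proof -
  obtain C where C: "C > 0" "\<And>w. maj (- x) (\<lambda>z. ennreal (V z)) w \<le> ennreal (C * V w)"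
    using maj_V by blast
  have "(\<integral>\<^sup>+w. maj x g w * ennreal (V w) \<partial>M) = (\<integral>\<^sup>+w. g w * maj (- x) (\<lambda>z. ennreal (V z)) w \<partial>M)"
    by (subst maj_dual[symmetric]) (auto simp: mult.commute)
  also have "\<dots> \<le> (\<integral>\<^sup>+w. ennreal C * (g w * ennreal (V w)) \<partial>M)"
  proof (rule nn_integral_mono)
    fix w
    have "g w * maj (- x) (\<lambda>z. ennreal (V z)) w \<le> g w * ennreal (C * V w)"
      by (intro mult_left_mono C) simp
    then show "g w * maj (- x) (\<lambda>z. ennreal (V z)) w \<le> ennreal C * (g w * ennreal (V w))"
      using C(1) V_pos[of w] by (simp add: ennreal_mult mult_ac)
  qed
  also have "\<dots> = ennreal C * (\<integral>\<^sup>+w. g w * ennreal (V w) \<partial>M)" by (rule nn_integral_cmult) measurable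
  also have "\<dots> < \<infinity>" using fin by (simp add: ennreal_mult_less_top)
  finally show ?thesis .
qed

section \<open>Triple symmetry of the kernel\<close>

text \<open>
  The integral of \<open>\<rho> u / u\<^sup>2\<close> over \<open>(t, 2 t)\<close> is comparable to \<open>\<rho> t / t\<close> and is part of the integral
  from \<open>s\<close>.
\<close>
lemma rho_over_decreasing:
  assumes "0 < s" "s \<le> t" shows "\<rho> t / t \<le> 4 * C1 * Cc * (\<rho> s / s)"
proof -
  have t: "t > 0" using assms by simp
  have "ennreal (\<rho> t / (4 * C1 * t)) = (\<integral>\<^sup>+u. ennreal (\<rho> t / (4 * C1 * t\<^sup>2)) * indicator {t<..<2*t} u \<partial>lborel)"
    using t rho_pos[OF t] C1_ge_1
    by (subst nn_integral_cmult_indicator) (auto simp: ennreal_mult[symmetric] power2_eq_square field_simps)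
  also have "\<dots> \<le> (\<integral>\<^sup>+u\<in>{s<..}. ennreal (\<rho> u / u\<^sup>2) \<partial>lborel)"
  proof (rule nn_integral_mono)
    fix u :: real
    show "ennreal (\<rho> t / (4 * C1 * t\<^sup>2)) * indicator {t<..<2*t} u \<le> ennreal (\<rho> u / u\<^sup>2) * indicator {s<..} u"
    proof (cases "u \<in> {t<..<2*t}")
      case True
      then have u: "u > 0" "u > s" "u\<^sup>2 \<le> (2 * t)\<^sup>2"
        using assms t power_mono[of u "2 * t" 2] by auto
      have "\<rho> t \<le> C1 * \<rho> u" using True t by (intro rho_a) auto
      then have "\<rho> t / C1 \<le> \<rho> u" using C1_ge_1 by (simp add: field_simps)
      then have "(\<rho> t / C1) / (2 * t)\<^sup>2 \<le> \<rho> u / u\<^sup>2"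
        using u C1_ge_1 rho_pos[OF t] rho_pos[OF u(1)] by (intro frac_le) auto
      then show ?thesis using True u by (auto intro!: ennreal_leI simp: power2_eq_square mult_ac)
    qed simp
  qed
  also have "\<dots> \<le> ennreal (Cc * (\<rho> s / s))" by (rule rho_c) fact
  finally have "\<rho> t / (4 * C1 * t) \<le> Cc * (\<rho> s / s)"
    using Cc_pos rho_pos[OF assms(1)] assms by (subst (asm) ennreal_le_iff) auto
  then show ?thesis using t C1_ge_1 by (simp add: field_simps)
qed

definition K_const :: real where "K_const = max 1 (4 * C1 * Cc)"

text \<open>Dominates the truncations \<open>K_trunc\<close> by the kernel itself.\<close>
lemma K_decreasing:
  assumes "0 < s" "s \<le> t" shows "K t \<le> K_const * K s"
proof -
  have *: "K u = (\<rho> u / u) * u powr (1 - D)" if "u > 0" for u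
    using that by (simp add: K_def powr_diff)
  have "\<rho> t / t \<le> K_const * (\<rho> s / s)"
  proof -
    have "4 * C1 * Cc * (\<rho> s / s) \<le> K_const * (\<rho> s / s)"
      using assms rho_pos[OF assms(1)] by (intro mult_right_mono) (auto simp: K_const_def)
    then show ?thesis using rho_over_decreasing[OF assms] by linarith
  qed
  moreover have "t powr (1 - D) \<le> s powr (1 - D)" using assms D_ge_1 by (intro powr_mono2') auto
  ultimately have "(\<rho> t / t) * t powr (1 - D) \<le> (K_const * (\<rho> s / s)) * s powr (1 - D)"
    using rho_pos[of t] rho_pos[of s] assms by (intro mult_mono) (auto simp: K_const_def)
  then show ?thesis using assms by (simp add: *)
qed

text \<open>
  The kernel frozen inside the ball of radius \<open>1 / (n + 1)\<close>: a continuous even function.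
\<close>
definition K_trunc :: "nat \<Rightarrow> real \<Rightarrow> real" where "K_trunc n u = K (max \<bar>u\<bar> (1 / real (Suc n)))"

lemma K_trunc_continuous: "continuous_on UNIV (K_trunc n)"
  unfolding K_trunc_def
  by (rule continuous_on_compose2[OF K_continuous]) (auto intro!: continuous_intros simp: less_max_iff_disj)

lemma K_trunc_measurable [measurable]: "K_trunc n \<in> borel_measurable borel"
  by (rule borel_measurable_continuous_onI[OF K_trunc_continuous])

lemma K_trunc_even: "K_trunc n (- u) = K_trunc n u" by (simp add: K_trunc_def)

lemma K_trunc_nonneg: "K_trunc n u \<ge> 0" by (simp add: K_trunc_def K_nonneg)

lemma K_trunc_le: assumes "u \<noteq> 0" shows "K_trunc n u \<le> K_const * K u"
  using K_decreasing[of "\<bar>u\<bar>" "max \<bar>u\<bar> (1 / real (Suc n))"] assms by (simp add: K_trunc_def K_abs)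

lemma K_trunc_tendsto: assumes "u \<noteq> 0" shows "(\<lambda>n. K_trunc n u) \<longlonglongrightarrow> K u"
proof -
  have "\<forall>\<^sub>F n in sequentially. 1 / real (Suc n) < \<bar>u\<bar>"
    using order_tendstoD(2)[OF LIMSEQ_inverse_real_of_nat, of "\<bar>u\<bar>"] assms by (simp add: inverse_eq_divide)
  then have "\<forall>\<^sub>F n in sequentially. K_trunc n u = K u"
    by eventually_elim (simp add: K_trunc_def max_def K_abs)
  then show ?thesis by (rule tendsto_eventually)
qed

text \<open>
  The value \<open>\<infinity>\<close> at the origin, in place of \<open>K 0 = 0\<close>, makes the finiteness of \<open>maj z K_inf w\<close> imply
  that almost no position is the origin, the only point where the truncations may fail to converge
  to \<open>K\<close>.
\<close>
definition K_inf :: "real \<Rightarrow> ennreal" where "K_inf u = (if u = 0 then \<infinity> else KE u)"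

lemma K_inf_measurable [measurable]: "K_inf \<in> borel_measurable borel"
  unfolding K_inf_def by measurable

lemma K_inf_ball: "(\<integral>\<^sup>+y\<in>ball 0 R. K_inf y \<partial>M) = (\<integral>\<^sup>+y\<in>ball 0 R. KE y \<partial>M)"
proof (rule nn_integral_cong_AE)
  show "AE y in M. K_inf y * indicator (ball 0 R) y = KE y * indicator (ball 0 R) y"
    using AE_nonzero by eventually_elim (simp add: K_inf_def)
qed

lemma K_inf_finite_AE:
  assumes fin: "maj z K_inf w < \<infinity>"
  shows "AE \<omega> in P. p z w \<omega> \<noteq> 0"
proof -
  have "AE \<omega> in P. K_inf (p z w \<omega>) \<noteq> \<infinity>"
    using fin unfolding maj_def by (intro nn_integral_PInf_AE) auto
  then show ?thesis by eventually_elim (auto simp: K_inf_def)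
qed

lemma tau_K_trunc_bound:
  assumes fin: "maj z K_inf w < \<infinity>"
  shows "\<bar>tau z (K_trunc n) w\<bar> \<le> B * K_const * enn2real (maj z K_inf w)"
proof -
  have K_const: "K_const \<ge> 0" by (simp add: K_const_def)
  have "ennreal \<bar>tau z (K_trunc n) w\<bar> \<le> ennreal B * maj z (\<lambda>u. ennreal (norm (K_trunc n u))) w"
    using norm_tau_le[of "K_trunc n" z w] by simp
  also have "maj z (\<lambda>u. ennreal (norm (K_trunc n u))) w \<le> maj z (\<lambda>u. ennreal K_const * K_inf u) w"
    using K_trunc_le K_trunc_nonneg K_const
    by (intro maj_mono) (auto simp: K_inf_def ennreal_mult[symmetric] K_nonneg ennreal_mult_top K_const_def intro!: ennreal_leI)
  also have "\<dots> = ennreal K_const * maj z K_inf w" by (rule maj_cmult) measurable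
  also have "\<dots> = ennreal (K_const * enn2real (maj z K_inf w))"
    using fin K_const by (simp add: ennreal_mult ennreal_enn2real_if)
  finally have "ennreal \<bar>tau z (K_trunc n) w\<bar> \<le> ennreal (B * K_const * enn2real (maj z K_inf w))"
    using B_ge_1 K_const by (simp add: ennreal_mult mult.assoc mult_left_mono)
  then show ?thesis using B_ge_1 K_const by (subst (asm) ennreal_le_iff) auto
qed

lemma tau_K_trunc_tendsto:
  assumes fin: "maj z K_inf w < \<infinity>"
  shows "(\<lambda>n. tau z (K_trunc n) w) \<longlonglongrightarrow> tau z K w"
  unfolding tau_def
proof (rule integral_dominated_convergence)
  have K_const: "K_const \<ge> 0" by (simp add: K_const_def)
  have "maj z KE w \<le> maj z K_inf w" by (rule maj_mono) (simp add: K_inf_def)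
  then have "maj z KE w < \<infinity>" using fin by (rule le_less_trans)
  then have "integrable P (\<lambda>\<omega>. K (p z w \<omega>))"
    by (intro tau_integrand_integrable) (auto simp: K_nonneg)
  then show "integrable P (\<lambda>\<omega>. (B * K_const) * K (p z w \<omega>))" by simp
  show "AE \<omega> in P. (\<lambda>n. k z w \<omega> *\<^sub>R K_trunc n (p z w \<omega>)) \<longlonglongrightarrow> k z w \<omega> *\<^sub>R K (p z w \<omega>)"
    using K_inf_finite_AE[OF fin] by eventually_elim (intro tendsto_intros K_trunc_tendsto)
  show "AE \<omega> in P. norm (k z w \<omega> *\<^sub>R K_trunc n (p z w \<omega>)) \<le> (B * K_const) * K (p z w \<omega>)" for n
    using K_inf_finite_AE[OF fin]
  proof eventually_elim
    case (elim \<omega>)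
    have "\<bar>k z w \<omega>\<bar> * K_trunc n (p z w \<omega>) \<le> B * (K_const * K (p z w \<omega>))"
      using K_trunc_le[OF elim] B_ge_1 by (intro mult_mono k_bound K_trunc_nonneg) auto
    then show ?case by (simp add: abs_mult K_trunc_nonneg mult.assoc)
  qed
qed measurable

lemma tau_tau_K_trunc_tendsto:
  assumes fin: "maj x (\<lambda>z. maj z K_inf w) y < \<infinity>"
  shows "(\<lambda>n. tau x (\<lambda>z. tau z (K_trunc n) w) y) \<longlonglongrightarrow> tau x (\<lambda>z. tau z K w) y"
proof -
  let ?s = "\<lambda>z. maj z K_inf w"
  have AE: "AE \<omega> in P. ?s (p x y \<omega>) < \<infinity>"
  proof -
    have "AE \<omega> in P. ?s (p x y \<omega>) \<noteq> \<infinity>"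
      using fin unfolding maj_def[of x] by (intro nn_integral_PInf_AE) auto
    then show ?thesis by eventually_elim (simp add: less_top)
  qed
  have int: "integrable P (\<lambda>\<omega>. enn2real (?s (p x y \<omega>)))"
  proof (rule integrableI_bounded)
    have "(\<integral>\<^sup>+\<omega>. ennreal (norm (enn2real (?s (p x y \<omega>)))) \<partial>P) = (\<integral>\<^sup>+\<omega>. ?s (p x y \<omega>) \<partial>P)"
      using AE by (intro nn_integral_cong_AE) (auto simp: ennreal_enn2real_if elim!: AE_mp)
    then show "(\<integral>\<^sup>+\<omega>. ennreal (norm (enn2real (?s (p x y \<omega>)))) \<partial>P) < \<infinity>"
      using fin by (simp add: maj_def[of x])
  qed measurable
  show ?thesis
    unfolding tau_def[of x]
  proof (rule integral_dominated_convergence)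
    show "integrable P (\<lambda>\<omega>. (B * (B * K_const)) * enn2real (?s (p x y \<omega>)))" using int by simp
    show "AE \<omega> in P. (\<lambda>n. k x y \<omega> *\<^sub>R tau (p x y \<omega>) (K_trunc n) w) \<longlonglongrightarrow> k x y \<omega> *\<^sub>R tau (p x y \<omega>) K w"
      using AE by eventually_elim (intro tendsto_intros tau_K_trunc_tendsto)
    show "AE \<omega> in P. norm (k x y \<omega> *\<^sub>R tau (p x y \<omega>) (K_trunc n) w) \<le> (B * (B * K_const)) * enn2real (?s (p x y \<omega>))" for n
      using AE
    proof eventually_elim
      case (elim \<omega>)
      have "\<bar>k x y \<omega>\<bar> * \<bar>tau (p x y \<omega>) (K_trunc n) w\<bar> \<le> B * (B * K_const * enn2real (?s (p x y \<omega>)))"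
        using tau_K_trunc_bound[OF elim] B_ge_1 by (intro mult_mono k_bound) auto
      then show ?case by (simp add: abs_mult mult.assoc)
    qed
  qed measurable
qed

lemma maj_KI_local:
  "(\<integral>\<^sup>+w\<in>ball 0 t. maj z K_inf w \<partial>M) \<le> ennreal mP * (\<integral>\<^sup>+y\<in>ball 0 (t + \<bar>z\<bar>). KE y \<partial>M)"
  unfolding K_inf_ball[symmetric] by (rule maj_ball_le) measurable

text \<open>
  This lemma and the next one concern the two iterated averages in \<open>K_triple\<close>. By \<open>maj_ball_le\<close>
  their integrals over balls are bounded by the integral of the kernel over a larger ball.
\<close>
lemma AE_maj_maj_1: "AE w in M. maj x (\<lambda>z. maj z K_inf w) y < \<infinity>"
proof (rule AE_of_balls)
  fix t :: real assume t: "t > 0"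
  have "(\<integral>\<^sup>+w\<in>ball 0 t. maj x (\<lambda>z. maj z K_inf w) y \<partial>M)
     = (\<integral>\<^sup>+w. \<integral>\<^sup>+\<omega>. maj (p x y \<omega>) K_inf w * indicator (ball 0 t) w \<partial>P \<partial>M)"
    unfolding maj_def[of x] by (subst nn_integral_multc) auto
  also have "\<dots> = (\<integral>\<^sup>+\<omega>. \<integral>\<^sup>+w. maj (p x y \<omega>) K_inf w * indicator (ball 0 t) w \<partial>M \<partial>P)"
    by (rule MP.Fubini'[symmetric]) measurable
  also have "\<dots> = maj x (\<lambda>z. \<integral>\<^sup>+w\<in>ball 0 t. maj z K_inf w \<partial>M) y"
    unfolding maj_def[of x] ..
  also have "\<dots> \<le> (ennreal mP * (\<integral>\<^sup>+y\<in>ball 0 (t + (\<bar>x\<bar> + \<bar>y\<bar>)). KE y \<partial>M)) * ennreal mP"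
  proof (rule maj_le)
    fix z assume z: "\<bar>z\<bar> \<le> \<bar>x\<bar> + \<bar>y\<bar>"
    have "(\<integral>\<^sup>+w\<in>ball 0 t. maj z K_inf w \<partial>M) \<le> ennreal mP * (\<integral>\<^sup>+y\<in>ball 0 (t + \<bar>z\<bar>). KE y \<partial>M)"
      by (rule maj_KI_local)
    also have "\<dots> \<le> ennreal mP * (\<integral>\<^sup>+y\<in>ball 0 (t + (\<bar>x\<bar> + \<bar>y\<bar>)). KE y \<partial>M)"
      using z by (intro mult_left_mono nn_integral_mono) (auto simp: indicator_def)
    finally show "(\<integral>\<^sup>+w\<in>ball 0 t. maj z K_inf w \<partial>M) \<le> \<dots>" .
  qed
  also have "\<dots> < \<infinity>" using K_ball_finite by (simp add: ennreal_mult_less_top)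
  finally show "(\<integral>\<^sup>+w\<in>ball 0 t. maj x (\<lambda>z. maj z K_inf w) y \<partial>M) < \<infinity>" .
qed measurable

lemma AE_maj_maj_2: "AE w in M. maj x (\<lambda>z. maj z K_inf y) w < \<infinity>"
proof (rule AE_of_balls)
  fix t :: real assume t: "t > 0"
  have "(\<integral>\<^sup>+w\<in>ball 0 t. maj x (\<lambda>z. maj z K_inf y) w \<partial>M)
     \<le> ennreal mP * (\<integral>\<^sup>+z\<in>ball 0 (t + \<bar>x\<bar>). maj z K_inf y \<partial>M)"
    by (rule maj_ball_le) measurable
  also have "(\<integral>\<^sup>+z\<in>ball 0 (t + \<bar>x\<bar>). maj z K_inf y \<partial>M) = (\<integral>\<^sup>+z\<in>ball 0 (t + \<bar>x\<bar>). maj y K_inf z \<partial>M)"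
    by (subst maj_sym) simp
  also have "\<dots> \<le> ennreal mP * (\<integral>\<^sup>+u\<in>ball 0 (t + \<bar>x\<bar> + \<bar>y\<bar>). KE u \<partial>M)" by (rule maj_KI_local)
  finally have "(\<integral>\<^sup>+w\<in>ball 0 t. maj x (\<lambda>z. maj z K_inf y) w \<partial>M)
     \<le> ennreal mP * (ennreal mP * (\<integral>\<^sup>+u\<in>ball 0 (t + \<bar>x\<bar> + \<bar>y\<bar>). KE u \<partial>M))"
    by (simp add: mult_left_mono)
  also have "\<dots> < \<infinity>" using K_ball_finite by (simp add: ennreal_mult_less_top)
  finally show "(\<integral>\<^sup>+w\<in>ball 0 t. maj x (\<lambda>z. maj z K_inf y) w \<partial>M) < \<infinity>" .
qed measurable

text \<open>
  The symmetry holds for the continuous truncations and passes to the limit by dominated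
  convergence, once in each of the two averages.
\<close>
lemma K_triple: "AE w in M. tau x (\<lambda>z. tau z K w) y = tau x (\<lambda>z. tau z K y) w"
  using AE_maj_maj_1[of x y] AE_maj_maj_2[of x y]
proof eventually_elim
  case (elim w)
  have "tau x (\<lambda>z. tau z (K_trunc n) w) y = tau x (\<lambda>z. tau z (K_trunc n) y) w" for n
    using triple[OF K_trunc_continuous K_trunc_even] .
  then show ?case
    using tau_tau_K_trunc_tendsto[OF elim(1)] tau_tau_K_trunc_tendsto[OF elim(2)] LIMSEQ_unique by auto
qed

end

section \<open>The mean of the regularised kernel\<close>

lemma abs_shift_le:
  fixes x y z :: real
  assumes "\<bar>\<bar>x\<bar> - \<bar>y\<bar>\<bar> \<le> \<bar>z\<bar>" "\<bar>z\<bar> \<le> \<bar>x\<bar> + \<bar>y\<bar>"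
  shows "\<bar>\<bar>z\<bar> - \<bar>y\<bar>\<bar> \<le> \<bar>x\<bar>"
proof -
  have "\<bar>c - b\<bar> \<le> a" if "\<bar>a - b\<bar> \<le> c" "c \<le> a + b" for a b c :: real using that by linarith
  then show ?thesis using assms by blast
qed

lemma suminf_annuli:
  fixes g h :: "real \<Rightarrow> ennreal" and c :: "nat \<Rightarrow> ennreal"
  assumes [measurable]: "g \<in> borel_measurable M" and sets: "sets M = sets borel"
    and r: "r > 0"
    and le: "\<And>j w. 2 ^ j * r \<le> \<bar>w\<bar> \<Longrightarrow> \<bar>w\<bar> < 2 ^ Suc j * r \<Longrightarrow> h w \<le> c j * g w"
  shows "(\<integral>\<^sup>+w\<in>- ball 0 r. h w \<partial>M) \<le> (\<Sum>j. c j * (\<integral>\<^sup>+w\<in>ball 0 (2 ^ Suc j * r). g w \<partial>M))"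
proof -
  note [measurable_cong] = sets
  have "(\<integral>\<^sup>+w\<in>- ball 0 r. h w \<partial>M) \<le> (\<integral>\<^sup>+w. (\<Sum>j. c j * (g w * indicator (ball 0 (2 ^ Suc j * r)) w)) \<partial>M)"
  proof (rule nn_integral_mono)
    fix w
    show "h w * indicator (- ball 0 r) w \<le> (\<Sum>j. c j * (g w * indicator (ball 0 (2 ^ Suc j * r)) w))"
    proof (cases "\<bar>w\<bar> < r")
      case False
      define N where "N = (LEAST n. \<bar>w\<bar> < 2 ^ n * r)"
      obtain n where "\<bar>w\<bar> / r < 2 ^ n" using real_arch_pow[of 2 "\<bar>w\<bar> / r"] by auto
      then have "\<bar>w\<bar> < 2 ^ n * r" using r by (simp add: field_simps)
      then have N: "\<bar>w\<bar> < 2 ^ N * r" unfolding N_def by (rule LeastI)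
      have "N \<noteq> 0" using N False by (intro notI) simp
      then obtain j where j: "N = Suc j" by (cases N) auto
      have "\<not> \<bar>w\<bar> < 2 ^ j * r" using not_less_Least[of j "\<lambda>n. \<bar>w\<bar> < 2 ^ n * r"] j by (simp add: N_def)
      then have "h w \<le> c j * (g w * indicator (ball 0 (2 ^ Suc j * r)) w)" using le[of j w] N j by simp
      also have "\<dots> = (\<Sum>i\<in>{j}. c i * (g w * indicator (ball 0 (2 ^ Suc i * r)) w))" by simp
      also have "\<dots> \<le> (\<Sum>j. c j * (g w * indicator (ball 0 (2 ^ Suc j * r)) w))"
        by (rule sum_le_suminf) auto
      finally show ?thesis using False by simp
    qed simp
  qed
  also have "\<dots> = (\<Sum>j. c j * (\<integral>\<^sup>+w\<in>ball 0 (2 ^ Suc j * r). g w \<partial>M))"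
    by (subst nn_integral_suminf) (auto simp: nn_integral_cmult)
  finally show ?thesis .
qed

text \<open>
  The function \<open>G\<close> may fail to be measurable, so the argument uses the step function with the value
  \<open>c j\<close> on the open interval \<open>A j\<close>, which lies below it and is integrated term by term.
\<close>
lemma dyadic_sum_le_integral:
  fixes G :: "real \<Rightarrow> ennreal" and c :: "nat \<Rightarrow> ennreal"
  assumes r: "r > 0"
    and le: "\<And>j t. 2 ^ j * r < t \<Longrightarrow> t < 2 ^ Suc j * r \<Longrightarrow> c j \<le> G t"
  shows "(\<Sum>j. c j * ennreal (2 ^ j * r)) \<le> (\<integral>\<^sup>+t\<in>{r<..}. G t \<partial>lborel)"
proof -
  define A where "A j = {2 ^ j * r <..< 2 ^ Suc j * r}" for j :: nat
  have disj: "i = j" if "t \<in> A i" "t \<in> A j" for i j t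
  proof (rule ccontr)
    assume "i \<noteq> j"
    then consider "Suc i \<le> j" | "Suc j \<le> i" by linarith
    then show False
    proof cases
      case 1
      have "(2::real) ^ Suc i * r \<le> 2 ^ j * r" using 1 r by (intro mult_right_mono power_increasing) auto
      then show ?thesis using that by (auto simp: A_def)
    next
      case 2
      have "(2::real) ^ Suc j * r \<le> 2 ^ i * r" using 2 r by (intro mult_right_mono power_increasing) auto
      then show ?thesis using that by (auto simp: A_def)
    qed
  qed
  have "(\<Sum>j. c j * ennreal (2 ^ j * r)) = (\<Sum>j. \<integral>\<^sup>+t. c j * indicator (A j) t \<partial>lborel)"
    using r by (intro suminf_cong, subst nn_integral_cmult_indicator) (auto simp: A_def mult.commute)
  also have "\<dots> = (\<integral>\<^sup>+t. (\<Sum>j. c j * indicator (A j) t) \<partial>lborel)"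
    by (rule nn_integral_suminf[symmetric]) (auto simp: A_def)
  also have "\<dots> \<le> (\<integral>\<^sup>+t\<in>{r<..}. G t \<partial>lborel)"
  proof (rule nn_integral_mono)
    fix t
    show "(\<Sum>j. c j * indicator (A j) t) \<le> G t * indicator {r<..} t"
    proof (cases "\<exists>j. t \<in> A j")
      case True
      then obtain j where j: "t \<in> A j" by blast
      have "(\<Sum>i. c i * indicator (A i) t) = (\<Sum>i\<in>{j}. c i * indicator (A i) t)"
        using disj j by (intro suminf_finite) (auto simp: indicator_def)
      moreover have "r < t"
      proof -
        have "1 * r \<le> 2 ^ j * r" using r by (intro mult_right_mono) auto
        then show ?thesis using j by (simp add: A_def)
      qed
      moreover have "c j \<le> G t" using le j by (auto simp: A_def)
      ultimately show ?thesis using j by simp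
    next
      case False
      then have "(\<Sum>j. c j * indicator (A j) t) = (\<Sum>i\<in>{}. c i * indicator (A i) t)"
        by (intro suminf_finite) auto
      then show ?thesis by simp
    qed
  qed
  finally show ?thesis .
qed

text \<open>
  A Lipschitz function of \<open>\<bar>w\<bar>\<close> that is \<open>1\<close> on the ball of radius \<open>R\<close> and vanishes outside the ball
  of radius \<open>2 R\<close>.
\<close>
definition plateau :: "real \<Rightarrow> real \<Rightarrow> real" where "plateau R w = max 0 (min 1 (2 - \<bar>w\<bar> / R))"

lemma plateau_measurable [measurable]: "plateau R \<in> borel_measurable borel"
  unfolding plateau_def[abs_def] by measurable

lemma plateau_le_1: "plateau R w \<le> 1" "plateau R w \<ge> 0" by (auto simp: plateau_def)

lemma plateau_1: assumes "R > 0" "\<bar>w\<bar> \<le> R" shows "plateau R w = 1"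
proof -
  have "max 0 (min 1 (2 - a)) = 1" if "a \<le> 1" for a :: real using that by linarith
  moreover have "\<bar>w\<bar> / R \<le> 1" using assms by simp
  ultimately show ?thesis unfolding plateau_def by blast
qed

lemma plateau_0: assumes "R > 0" "2 * R \<le> \<bar>w\<bar>" shows "plateau R w = 0"
proof -
  have "max 0 (min 1 (2 - a)) = 0" if "2 \<le> a" for a :: real using that by linarith
  moreover have "2 \<le> \<bar>w\<bar> / R" using assms by (simp add: pos_le_divide_eq)
  ultimately show ?thesis unfolding plateau_def by blast
qed

lemma plateau_lipschitz: assumes "R > 0" shows "\<bar>plateau R u - plateau R w\<bar> \<le> \<bar>\<bar>u\<bar> - \<bar>w\<bar>\<bar> / R"
proof -
  have "\<bar>max 0 (min 1 (2 - a)) - max 0 (min 1 (2 - b))\<bar> \<le> \<bar>a - b\<bar>" for a b :: real by linarith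
  from this[of "\<bar>u\<bar> / R" "\<bar>w\<bar> / R"] show ?thesis
    using assms by (simp add: plateau_def diff_divide_distrib[symmetric] abs_divide)
qed

context kernel_translation begin

text \<open>
  The factor \<open>4 C1\<close> comes from comparing \<open>\<rho> t / t\<^sup>2\<close> with its value at the left end of a dyadic
  interval.
\<close>
lemma rho_dyadic_sum:
  assumes r: "r > 0"
  shows "(\<Sum>j. ennreal (\<rho> (2 ^ j * r) / (2 ^ j * r))) \<le> ennreal (4 * C1 * Cc * (\<rho> r / r))"
proof -
  let ?c = "\<lambda>j. ennreal (\<rho> (2 ^ j * r) / (4 * C1 * (2 ^ j * r)\<^sup>2))"
  have "(\<Sum>j. ?c j * ennreal (2 ^ j * r)) \<le> (\<integral>\<^sup>+t\<in>{r<..}. ennreal (\<rho> t / t\<^sup>2) \<partial>lborel)"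
  proof (rule dyadic_sum_le_integral[OF r])
    fix j t assume t: "2 ^ j * r < t" "t < 2 ^ Suc j * r"
    let ?s = "2 ^ j * r"
    have s: "?s > 0" using r by simp
    have tp: "t > 0" using t s by linarith
    have "\<rho> ?s \<le> C1 * \<rho> t" using t s by (intro rho_a) auto
    then have "\<rho> ?s / C1 \<le> \<rho> t" using C1_ge_1 by (simp add: field_simps)
    moreover have "t\<^sup>2 \<le> (2 * ?s)\<^sup>2" using t tp by (intro power_mono) auto
    ultimately have "(\<rho> ?s / C1) / (2 * ?s)\<^sup>2 \<le> \<rho> t / t\<^sup>2"
      using tp C1_ge_1 rho_pos[OF s] rho_pos[OF tp] by (intro frac_le) auto
    moreover have "(\<rho> ?s / C1) / (2 * ?s)\<^sup>2 = \<rho> ?s / (4 * C1 * ?s\<^sup>2)" by (simp add: power_mult_distrib)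
    ultimately show "?c j \<le> ennreal (\<rho> t / t\<^sup>2)" by (intro ennreal_leI) simp
  qed
  also have "\<dots> \<le> ennreal (Cc * (\<rho> r / r))" by (rule rho_c[OF r])
  finally have le: "(\<Sum>j. ?c j * ennreal (2 ^ j * r)) \<le> ennreal (Cc * (\<rho> r / r))" .
  have "(\<Sum>j. ennreal (\<rho> (2 ^ j * r) / (2 ^ j * r))) = (\<Sum>j. ennreal (4 * C1) * (?c j * ennreal (2 ^ j * r)))"
  proof (rule suminf_cong)
    fix j
    have s: "2 ^ j * r > 0" using r by simp
    have "4 * C1 * (\<rho> s / (4 * C1 * s\<^sup>2) * s) = \<rho> s / s" if "s > 0" for s
      using that C1_ge_1 by (simp add: power2_eq_square)
    from this[OF s] show "ennreal (\<rho> (2 ^ j * r) / (2 ^ j * r)) = ennreal (4 * C1) * (?c j * ennreal (2 ^ j * r))"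
      using s C1_ge_1 rho_pos[OF s] by (simp add: ennreal_mult[symmetric] less_imp_le del: times_divide_eq_left times_divide_eq_right)
  qed
  also have "\<dots> = ennreal (4 * C1) * (\<Sum>j. ?c j * ennreal (2 ^ j * r))" by simp
  also have "\<dots> \<le> ennreal (4 * C1) * ennreal (Cc * (\<rho> r / r))" by (intro mult_left_mono le) simp
  also have "\<dots> = ennreal (4 * C1 * Cc * (\<rho> r / r))"
    using C1_ge_1 Cc_pos rho_pos[OF r] r by (simp add: ennreal_mult[symmetric] mult.assoc)
  finally show ?thesis .
qed

lemma weight_annulus:
  assumes r: "r > 0" and w: "r \<le> \<bar>w\<bar>" "\<bar>w\<bar> \<le> 2 * r"
  shows "\<rho> \<bar>w\<bar> / \<bar>w\<bar> powr (D + 1) \<le> C1 * \<rho> r / r powr (D + 1)"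
proof (rule frac_le)
  show "\<rho> \<bar>w\<bar> \<le> C1 * \<rho> r" using r w by (intro rho_a) auto
  show "r powr (D + 1) \<le> \<bar>w\<bar> powr (D + 1)" using r w D_ge_1 by (intro powr_mono2) auto
qed (use r C1_ge_1 rho_pos[OF r] in auto)

lemma V_integral_finite: "(\<integral>\<^sup>+w. ennreal (V w) \<partial>M) < \<infinity>"
proof -
  obtain C where C: "C > 0" "\<And>u w. \<bar>\<bar>u\<bar> - \<bar>w\<bar>\<bar> \<le> 1 \<Longrightarrow> V u \<le> C * V w"
    using V_shift[of 1] by blast
  have 1: "(\<integral>\<^sup>+w\<in>ball 0 1. ennreal (V w) \<partial>M) < \<infinity>"
  proof -
    have "(\<integral>\<^sup>+w\<in>ball 0 1. ennreal (V w) \<partial>M) \<le> (\<integral>\<^sup>+w. ennreal (C * V 0) * indicator (ball 0 1) w \<partial>M)"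
      using C(2)[of _ 0] by (intro nn_integral_mono) (auto simp: indicator_def intro!: ennreal_leI)
    also have "\<dots> = ennreal (C * V 0) * emeasure M (ball 0 1)" by (rule nn_integral_cmult_indicator) measurable
    also have "\<dots> < \<infinity>" using M_ball_finite by (simp add: ennreal_mult_less_top)
    finally show ?thesis .
  qed
  have 2: "(\<integral>\<^sup>+w\<in>-ball 0 1. ennreal (V w) \<partial>M) < \<infinity>"
  proof -
    let ?R = "\<lambda>j. 2 ^ j * (1::real)"
    have "(\<integral>\<^sup>+w\<in>-ball 0 1. ennreal (V w) \<partial>M)
      \<le> (\<Sum>j. ennreal (C1 * \<rho> (?R j) / ?R j powr (D + 1)) * (\<integral>\<^sup>+w\<in>ball 0 (2 ^ Suc j * 1). 1 \<partial>M))"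
    proof (rule suminf_annuli)
      fix j w assume w: "2 ^ j * 1 \<le> \<bar>w\<bar>" "\<bar>w\<bar> < 2 ^ Suc j * (1::real)"
      have R: "?R j \<ge> 1" by simp
      have "1 \<le> \<bar>w\<bar>" using w R by linarith
      then have "max \<bar>w\<bar> 1 = \<bar>w\<bar>" by (rule max_absorb1)
      then have "V w = \<rho> \<bar>w\<bar> / \<bar>w\<bar> powr (D + 1)" by (simp add: V_def)
      also have "\<dots> \<le> C1 * \<rho> (?R j) / ?R j powr (D + 1)" using w R by (intro weight_annulus) auto
      finally show "ennreal (V w) \<le> ennreal (C1 * \<rho> (?R j) / ?R j powr (D + 1)) * 1" by (simp add: ennreal_leI)
    qed (auto simp: sets_M)
    also have "\<dots> = (\<Sum>j. ennreal (C1 * cM * 2 powr D) * ennreal (\<rho> (?R j) / ?R j))"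
    proof (rule suminf_cong)
      fix j
      let ?r = "?R j"
      have r: "?r > 0" by simp
      have "(\<integral>\<^sup>+w\<in>ball 0 (2 ^ Suc j * 1). 1 \<partial>M) = emeasure M (ball 0 (2 * ?r))" by simp
      also have "\<dots> = ennreal (cM * (2 * ?r) powr D)" using r by (subst M_ball) auto
      finally have *: "(\<integral>\<^sup>+w\<in>ball 0 (2 ^ Suc j * 1). 1 \<partial>M) = ennreal (cM * (2 * ?r) powr D)" .
      have "C1 * \<rho> s / s powr (D + 1) * (cM * (2 * s) powr D) = C1 * cM * 2 powr D * (\<rho> s / s)" if "s > 0" for s
        using that by (simp add: powr_mult powr_add)
      from this[OF r] show "ennreal (C1 * \<rho> ?r / ?r powr (D + 1)) * (\<integral>\<^sup>+w\<in>ball 0 (2 ^ Suc j * 1). 1 \<partial>M)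
         = ennreal (C1 * cM * 2 powr D) * ennreal (\<rho> ?r / ?r)"
        unfolding * using C1_ge_1 cM_pos rho_pos[OF r]
        by (subst (1 2) ennreal_mult[symmetric]) (auto simp: less_imp_le)
    qed
    also have "\<dots> = ennreal (C1 * cM * 2 powr D) * (\<Sum>j. ennreal (\<rho> (?R j) / ?R j))" by simp
    also have "\<dots> < \<infinity>"
      using rho_dyadic_sum[of 1] by (auto simp: ennreal_mult_less_top intro: le_less_trans)
    finally show ?thesis .
  qed
  have "(\<integral>\<^sup>+w. ennreal (V w) \<partial>M) = (\<integral>\<^sup>+w. ennreal (V w) * indicator (ball 0 1) w + ennreal (V w) * indicator (-ball 0 1) w \<partial>M)"
    by (intro nn_integral_cong) (auto simp: indicator_def)
  also have "\<dots> = (\<integral>\<^sup>+w\<in>ball 0 1. ennreal (V w) \<partial>M) + (\<integral>\<^sup>+w\<in>-ball 0 1. ennreal (V w) \<partial>M)"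
    by (rule nn_integral_add) (auto intro!: borel_measurable_times borel_measurable_indicator simp: sets_M)
  finally show ?thesis using 1 2 by simp
qed

lemma L_integrable:
  assumes a: "a > 0" shows "integrable M (L a y)"
proof (rule integrableI_bounded)
  have "\<bar>y\<bar> + 1 > 0" by simp
  from L_bound[OF a this] obtain C T where CT: "C > 0" "T > 0" "\<And>z w. \<bar>z\<bar> < \<bar>y\<bar> + 1 \<Longrightarrow>
    ennreal \<bar>L a z w\<bar> \<le> ennreal (C * V w) + ennreal B * (maj z KE w * indicator (ball 0 T) w)"
    by blast
  have "(\<integral>\<^sup>+w. ennreal (norm (L a y w)) \<partial>M)
     \<le> (\<integral>\<^sup>+w. ennreal C * ennreal (V w) + ennreal B * (maj y KE w * indicator (ball 0 T) w) \<partial>M)"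
    using CT(3)[of y] CT(1) V_pos by (intro nn_integral_mono) (auto simp: ennreal_mult less_imp_le)
  also have "\<dots> = ennreal C * (\<integral>\<^sup>+w. ennreal (V w) \<partial>M) + ennreal B * (\<integral>\<^sup>+w\<in>ball 0 T. maj y KE w \<partial>M)"
    by (subst nn_integral_add) (auto simp: nn_integral_cmult)
  also have "\<dots> < \<infinity>"
  proof -
    have "(\<integral>\<^sup>+w\<in>ball 0 T. maj y KE w \<partial>M) \<le> ennreal mP * (\<integral>\<^sup>+z\<in>ball 0 (T + \<bar>y\<bar>). KE z \<partial>M)"
      by (rule maj_ball_le) measurable
    also have "\<dots> < \<infinity>" using K_ball_finite by (simp add: ennreal_mult_less_top)
    finally show ?thesis using V_integral_finite by (simp add: ennreal_mult_less_top)
  qed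
  finally show "(\<integral>\<^sup>+w. ennreal (norm (L a y w)) \<partial>M) < \<infinity>" .
qed measurable

definition K_mass :: "real \<Rightarrow> real" where "K_mass a = (\<integral>w. indicator (ball 0 a) w * K w \<partial>M)"

lemma K_ball_integrable: "integrable M (\<lambda>w. indicator (ball 0 R) w * K w)"
proof (rule integrableI_bounded)
  show "(\<integral>\<^sup>+w. ennreal (norm (indicator (ball 0 R) w * K w)) \<partial>M) < \<infinity>"
    using K_ball_finite[of R] K_nonneg
    by (intro le_less_trans[OF eq_refl K_ball_finite[of R]] nn_integral_cong) (auto simp: indicator_def)
qed measurable

text \<open>
  By duality the shift is moved from \<open>K\<close> to the plateau function. There it causes an error \<open>e\<close> that
  is at most a multiple of \<open>\<bar>y\<bar> / R\<close> and is supported where \<open>R / 2 \<le> \<bar>w\<bar> \<le> 4 R\<close>; the kernel is at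
  most a multiple of \<open>\<rho> R / R\<^sup>D\<close> there, and the measure of that set is at most a multiple of \<open>R\<^sup>D\<close>.
\<close>
lemma L_plateau:
  assumes a: "a > 0"
  shows "\<exists>C\<ge>0. \<forall>R. R \<ge> a \<and> R \<ge> 2 * \<bar>y\<bar> \<longrightarrow>
     \<bar>(\<integral>w. L a y w * plateau R w \<partial>M) - K_mass a\<bar> \<le> C * (\<rho> R / R)"
proof -
  define C where "C = K_const * C1 * cM * 8 powr D * (B * mP * \<bar>y\<bar>)"
  have CK0: "K_const \<ge> 0" by (simp add: K_const_def)
  have C: "C \<ge> 0" using C1_ge_1 cM_pos B_ge_1 mP_nonneg CK0 by (simp add: C_def)
  have "\<bar>(\<integral>w. L a y w * plateau R w \<partial>M) - K_mass a\<bar> \<le> C * (\<rho> R / R)" if R: "R \<ge> a" "R \<ge> 2 * \<bar>y\<bar>" for R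
  proof -
    have R0: "R > 0" using a R by simp
    define e where "e w = tau (- y) (plateau R) w - plateau R w" for w
    have e_meas [measurable]: "e \<in> borel_measurable borel" unfolding e_def by measurable
    have e1: "\<bar>e w\<bar> \<le> B * mP * (\<bar>y\<bar> / R)" for w
    proof -
      have "norm (tau (- y) (plateau R) w - plateau R w) \<le> B * mP * (\<bar>y\<bar> / R)"
      proof (rule tau_near_const)
      fix u assume u: "\<bar>\<bar>- y\<bar> - \<bar>w\<bar>\<bar> \<le> \<bar>u\<bar>" "\<bar>u\<bar> \<le> \<bar>- y\<bar> + \<bar>w\<bar>"
      then have "\<bar>\<bar>u\<bar> - \<bar>w\<bar>\<bar> \<le> \<bar>y\<bar>" using abs_shift_le[of "- y" w u] by simp
      then have "\<bar>\<bar>u\<bar> - \<bar>w\<bar>\<bar> / R \<le> \<bar>y\<bar> / R" using R0 by (intro divide_right_mono) auto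
      then show "norm (plateau R u - plateau R w) \<le> \<bar>y\<bar> / R"
        using plateau_lipschitz[OF R0, of u w] by simp
      qed (use R0 in auto)
      then show ?thesis by (simp add: e_def)
    qed
    have e2: "e w = 0" if "\<bar>w\<bar> \<le> R / 2 \<or> \<bar>w\<bar> \<ge> 4 * R" for w
    proof -
      from that consider "\<bar>w\<bar> \<le> R / 2" | "\<bar>w\<bar> \<ge> 4 * R" by blast
      then show ?thesis
      proof cases
        case 1
        have "tau (- y) (plateau R) w = tau (- y) (\<lambda>_. 1) w"
        proof (rule tau_cong)
          fix z assume "\<bar>z\<bar> \<le> \<bar>- y\<bar> + \<bar>w\<bar>"
          then have "\<bar>z\<bar> \<le> R" using 1 R(2) unfolding abs_minus_cancel by linarith
          then show "plateau R z = 1" by (rule plateau_1[OF R0])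
        qed
        then show ?thesis using 1 R0 by (simp add: e_def tau_const plateau_1)
      next
        case 2
        have "tau (- y) (plateau R) w = tau (- y) (\<lambda>_. 0) w"
        proof (rule tau_cong)
          fix z assume "\<bar>\<bar>- y\<bar> - \<bar>w\<bar>\<bar> \<le> \<bar>z\<bar>"
          then have "\<bar>w\<bar> - \<bar>y\<bar> \<le> \<bar>z\<bar>" unfolding abs_minus_cancel abs_le_iff by simp
          then have "2 * R \<le> \<bar>z\<bar>" using 2 R(2) R0 by linarith
          then show "plateau R z = 0" by (rule plateau_0[OF R0])
        qed
        then show ?thesis using 2 R0 by (simp add: e_def tau_const plateau_0)
      qed
    qed
    have Ke: "ennreal \<bar>K w * e w\<bar> \<le> ennreal (K_const * C1 * \<rho> R / (R / 2) powr D * (B * mP * (\<bar>y\<bar> / R))) * indicator (ball 0 (4 * R)) w" for w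
    proof (cases "R / 2 < \<bar>w\<bar> \<and> \<bar>w\<bar> < 4 * R")
      case True
      have "K \<bar>w\<bar> \<le> K_const * K (R / 2)" using True R0 by (intro K_decreasing) auto
      moreover have "K (R / 2) \<le> C1 * \<rho> R / (R / 2) powr D"
        unfolding K_def using R0 by (auto intro!: divide_right_mono rho_a)
      ultimately have "K w \<le> K_const * (C1 * \<rho> R / (R / 2) powr D)"
        unfolding K_abs using CK0 by (rule order_trans[OF _ mult_left_mono])
      then have "K w * \<bar>e w\<bar> \<le> K_const * (C1 * \<rho> R / (R / 2) powr D) * (B * mP * (\<bar>y\<bar> / R))"
        using C1_ge_1 rho_pos[OF R0] CK0 by (intro mult_mono e1) auto
      then show ?thesis using True by (simp add: abs_mult K_nonneg ennreal_leI mult.assoc)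
    qed (use e2 in auto)
    have intKe: "integrable M (\<lambda>w. K w * e w)"
    proof (rule integrableI_bounded)
      have "(\<integral>\<^sup>+w. ennreal (norm (K w * e w)) \<partial>M)
        \<le> (\<integral>\<^sup>+w. ennreal (K_const * C1 * \<rho> R / (R / 2) powr D * (B * mP * (\<bar>y\<bar> / R))) * indicator (ball 0 (4 * R)) w \<partial>M)"
        using Ke by (intro nn_integral_mono) simp
      also have "\<dots> < \<infinity>"
        using M_ball_finite by (subst nn_integral_cmult_indicator) (auto simp: ennreal_mult_less_top sets_M)
      finally show "(\<integral>\<^sup>+w. ennreal (norm (K w * e w)) \<partial>M) < \<infinity>" .
    qed measurable
    have intKp: "integrable M (\<lambda>w. K w * plateau R w)"
    proof (rule Bochner_Integration.integrable_bound[OF K_ball_integrable[of "3 * R"]])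
      have "\<bar>plateau R w\<bar> \<le> indicator (ball 0 (3 * R)) w" for w
        using plateau_le_1[of R w] plateau_0[OF R0, of w] R0 by (auto simp: indicator_def not_less)
      then show "AE w in M. norm (K w * plateau R w) \<le> norm (indicator (ball 0 (3 * R)) w * K w)"
        by (intro AE_I2) (simp add: abs_mult K_nonneg mult.commute[of _ "K _"] mult_left_mono)
    qed measurable
    have intcut: "integrable M (\<lambda>w. cut a w * plateau R w)"
      by (rule Bochner_Integration.integrable_bound[OF intKp])
         (auto simp: cut_def K_nonneg)
    have fin: "(\<integral>\<^sup>+w. ennreal (norm (plateau R w)) * maj y (\<lambda>z. ennreal \<bar>K z\<bar>) w \<partial>M) < \<infinity>"
    proof -
      have "(\<integral>\<^sup>+w. ennreal (norm (plateau R w)) * maj y (\<lambda>z. ennreal \<bar>K z\<bar>) w \<partial>M)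
        \<le> (\<integral>\<^sup>+w\<in>ball 0 (3 * R). maj y KE w \<partial>M)"
      proof (rule nn_integral_mono)
        fix w
        have "ennreal (norm (plateau R w)) \<le> indicator (ball 0 (3 * R)) w"
          using plateau_le_1[of R w] plateau_0[OF R0, of w] R0 by (auto simp: indicator_def not_less ennreal_le_1)
        then have "ennreal (norm (plateau R w)) * maj y KE w \<le> indicator (ball 0 (3 * R)) w * maj y KE w"
          by (rule mult_right_mono) simp
        then show "ennreal (norm (plateau R w)) * maj y (\<lambda>z. ennreal \<bar>K z\<bar>) w \<le> maj y KE w * indicator (ball 0 (3 * R)) w"
          by (simp add: K_nonneg mult.commute)
      qed
      also have "\<dots> \<le> ennreal mP * (\<integral>\<^sup>+z\<in>ball 0 (3 * R + \<bar>y\<bar>). KE z \<partial>M)" by (rule maj_ball_le) measurable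
      also have "\<dots> < \<infinity>" using K_ball_finite by (simp add: ennreal_mult_less_top)
      finally show ?thesis .
    qed
    have "(\<integral>w. tau y K w *\<^sub>R plateau R w \<partial>M) = (\<integral>w. K w *\<^sub>R tau (- y) (plateau R) w \<partial>M)"
      by (rule tau_dual[OF _ _ fin]) measurable
    then have dual: "(\<integral>w. tau y K w * plateau R w \<partial>M) = (\<integral>w. K w * tau (- y) (plateau R) w \<partial>M)" by simp
    have inttau: "integrable M (\<lambda>w. tau y K w * plateau R w)"
    proof (rule integrableI_bounded)
      have "(\<integral>\<^sup>+w. ennreal (norm (tau y K w * plateau R w)) \<partial>M)
        \<le> (\<integral>\<^sup>+w. ennreal B * (ennreal (norm (plateau R w)) * maj y (\<lambda>z. ennreal \<bar>K z\<bar>) w) \<partial>M)"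
      proof (rule nn_integral_mono)
        fix w
        have "ennreal \<bar>tau y K w\<bar> * ennreal \<bar>plateau R w\<bar> \<le> (ennreal B * maj y KE w) * ennreal \<bar>plateau R w\<bar>"
          by (intro mult_right_mono norm_tau_K_le) simp
        then show "ennreal (norm (tau y K w * plateau R w)) \<le> ennreal B * (ennreal (norm (plateau R w)) * maj y (\<lambda>z. ennreal \<bar>K z\<bar>) w)"
          by (simp add: abs_mult ennreal_mult K_nonneg mult_ac)
      qed
      also have "\<dots> = ennreal B * (\<integral>\<^sup>+w. ennreal (norm (plateau R w)) * maj y (\<lambda>z. ennreal \<bar>K z\<bar>) w \<partial>M)"
        by (rule nn_integral_cmult) measurable
      also have "\<dots> < \<infinity>" using fin by (simp add: ennreal_mult_less_top)
      finally show "(\<integral>\<^sup>+w. ennreal (norm (tau y K w * plateau R w)) \<partial>M) < \<infinity>" .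
    qed measurable
    have "(\<integral>w. L a y w * plateau R w \<partial>M) = (\<integral>w. tau y K w * plateau R w - cut a w * plateau R w \<partial>M)"
      by (simp add: L_def left_diff_distrib)
    also have "\<dots> = (\<integral>w. tau y K w * plateau R w \<partial>M) - (\<integral>w. cut a w * plateau R w \<partial>M)"
      by (rule Bochner_Integration.integral_diff[OF inttau intcut])
    also have "(\<integral>w. tau y K w * plateau R w \<partial>M) = (\<integral>w. K w * e w + K w * plateau R w \<partial>M)"
      unfolding dual by (simp add: e_def algebra_simps)
    also have "\<dots> = (\<integral>w. K w * e w \<partial>M) + (\<integral>w. K w * plateau R w \<partial>M)"
      by (rule Bochner_Integration.integral_add[OF intKe intKp])
    also have "(\<integral>w. K w * plateau R w \<partial>M) = (\<integral>w. cut a w * plateau R w + indicator (ball 0 a) w * K w \<partial>M)"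
    proof (rule Bochner_Integration.integral_cong[OF refl])
      fix w show "K w * plateau R w = cut a w * plateau R w + indicator (ball 0 a) w * K w"
        using plateau_1[OF R0, of w] R by (cases "\<bar>w\<bar> < a") (auto simp: cut_def)
    qed
    also have "\<dots> = (\<integral>w. cut a w * plateau R w \<partial>M) + K_mass a"
      unfolding K_mass_def by (rule Bochner_Integration.integral_add[OF intcut K_ball_integrable])
    finally have "(\<integral>w. L a y w * plateau R w \<partial>M) - K_mass a = (\<integral>w. K w * e w \<partial>M)" by simp
    moreover have "\<bar>\<integral>w. K w * e w \<partial>M\<bar> \<le> C * (\<rho> R / R)"
    proof -
      have "ennreal \<bar>\<integral>w. K w * e w \<partial>M\<bar> \<le> (\<integral>\<^sup>+w. ennreal \<bar>K w * e w\<bar> \<partial>M)"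
        using integral_norm_bound_ennreal[OF intKe] by simp
      also have "\<dots> \<le> (\<integral>\<^sup>+w. ennreal (K_const * C1 * \<rho> R / (R / 2) powr D * (B * mP * (\<bar>y\<bar> / R))) * indicator (ball 0 (4 * R)) w \<partial>M)"
        by (intro nn_integral_mono Ke)
      also have "\<dots> = ennreal (K_const * C1 * \<rho> R / (R / 2) powr D * (B * mP * (\<bar>y\<bar> / R))) * ennreal (cM * (4 * R) powr D)"
        using R0 by (subst nn_integral_cmult_indicator) (auto simp: M_ball sets_M)
      also have "\<dots> = ennreal (K_const * C1 * \<rho> R / (R / 2) powr D * (B * mP * (\<bar>y\<bar> / R)) * (cM * (4 * R) powr D))"
        using C1_ge_1 cM_pos B_ge_1 mP_nonneg R0 rho_pos[OF R0] CK0 by (simp add: ennreal_mult[symmetric])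
      also have "K_const * C1 * \<rho> R / (R / 2) powr D * (B * mP * (\<bar>y\<bar> / R)) * (cM * (4 * R) powr D) = C * (\<rho> R / R)"
      proof -
        have "(4 * R) powr D = (8 * (R / 2)) powr D" by simp
        also have "\<dots> = 8 powr D * (R / 2) powr D" by (rule powr_mult)
        finally have *: "(4 * R) powr D = 8 powr D * (R / 2) powr D" .
        have "(R / 2) powr D \<noteq> 0" using R0 by simp
        then show ?thesis unfolding * C_def by (simp add: field_simps)
      qed
      finally show ?thesis using C rho_pos[OF R0] R0 by (subst (asm) ennreal_le_iff) auto
    qed
    ultimately show ?thesis by simp
  qed
  then show ?thesis using C by blast
qed

text \<open>
  The integral is the limit of \<open>L_plateau\<close> along \<open>R = 2\<^sup>n\<close>, where the errors tend to \<open>0\<close> because they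
  are summable.
\<close>
lemma L_integral: assumes a: "a > 0" shows "(\<integral>w. L a y w \<partial>M) = K_mass a"
proof -
  obtain C where C: "C \<ge> 0" "\<And>R. R \<ge> a \<Longrightarrow> R \<ge> 2 * \<bar>y\<bar> \<Longrightarrow>
     \<bar>(\<integral>w. L a y w * plateau R w \<partial>M) - K_mass a\<bar> \<le> C * (\<rho> R / R)"
    using L_plateau[OF a, of y] by auto
  let ?R = "\<lambda>n::nat. (2::real) ^ n"
  have ev: "\<forall>\<^sub>F n in sequentially. X \<le> ?R n" for X :: real
  proof -
    obtain N where "X < 2 ^ N" using real_arch_pow[of 2 X] by auto
    then have "X \<le> 2 ^ n" if "n \<ge> N" for n using power_increasing[OF that, of "2::real"] by linarith
    then show ?thesis unfolding eventually_sequentially by blast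
  qed
  have "summable (\<lambda>n. \<rho> (?R n) / ?R n)"
  proof (rule summable_suminf_not_top)
    show "(\<Sum>n. ennreal (\<rho> (?R n) / ?R n)) \<noteq> top"
    proof -
      have "(\<Sum>n. ennreal (\<rho> (?R n) / ?R n)) \<le> ennreal (4 * C1 * Cc * (\<rho> 1 / 1))"
        using rho_dyadic_sum[of 1] by simp
      then show ?thesis by (metis ennreal_neq_top neq_top_trans)
    qed
  qed (use rho_pos in \<open>auto simp: less_imp_le\<close>)
  then have "(\<lambda>n. \<rho> (?R n) / ?R n) \<longlonglongrightarrow> 0" by (rule summable_LIMSEQ_zero)
  then have lim0: "(\<lambda>n. C * (\<rho> (?R n) / ?R n)) \<longlonglongrightarrow> 0" by (rule tendsto_mult_right_zero)
  have "(\<lambda>n. (\<integral>w. L a y w * plateau (?R n) w \<partial>M) - K_mass a) \<longlonglongrightarrow> 0"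
  proof (rule Lim_null_comparison[OF _ lim0])
    show "\<forall>\<^sub>F n in sequentially. norm ((\<integral>w. L a y w * plateau (?R n) w \<partial>M) - K_mass a) \<le> C * (\<rho> (?R n) / ?R n)"
      using ev[of a] ev[of "2 * \<bar>y\<bar>"] by eventually_elim (use C in auto)
  qed
  then have 1: "(\<lambda>n. \<integral>w. L a y w * plateau (?R n) w \<partial>M) \<longlonglongrightarrow> K_mass a" by (simp add: LIM_zero_iff)
  have 2: "(\<lambda>n. \<integral>w. L a y w * plateau (?R n) w \<partial>M) \<longlonglongrightarrow> (\<integral>w. L a y w \<partial>M)"
  proof (rule integral_dominated_convergence)
    show "integrable M (\<lambda>w. \<bar>L a y w\<bar>)" using L_integrable[OF a] by simp
    show "AE w in M. (\<lambda>n. L a y w * plateau (?R n) w) \<longlonglongrightarrow> L a y w"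
    proof (rule AE_I2)
      fix w
      have "\<forall>\<^sub>F n in sequentially. L a y w * plateau (?R n) w = L a y w"
        using ev[of "\<bar>w\<bar>"] by eventually_elim (simp add: plateau_1)
      then show "(\<lambda>n. L a y w * plateau (?R n) w) \<longlonglongrightarrow> L a y w" by (rule tendsto_eventually)
    qed
    show "AE w in M. norm (L a y w * plateau (?R n) w) \<le> \<bar>L a y w\<bar>" for n
      using plateau_le_1 by (intro AE_I2) (auto simp: abs_mult intro!: mult_left_le)
  qed measurable
  show ?thesis by (rule LIMSEQ_unique[OF 2 1])
qed

section \<open>The regularised operator commutes with translations\<close>

text \<open>
  The modified fractional integral, with the kernel regularised at radius \<open>a\<close> instead of \<open>1\<close>.
\<close>
definition frac_op :: "real \<Rightarrow> (real \<Rightarrow> 'b::{banach,second_countable_topology}) \<Rightarrow> real \<Rightarrow> 'b" where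
  "frac_op a f z = (\<integral>w. L a z w *\<^sub>R f w \<partial>M)"

lemma frac_op_measurable [measurable]:
  fixes f :: "real \<Rightarrow> 'b::{banach,second_countable_topology}"
  assumes [measurable]: "f \<in> borel_measurable borel"
  shows "frac_op a f \<in> borel_measurable borel"
  unfolding frac_op_def by measurable

definition weighted :: "(real \<Rightarrow> 'b::{banach,second_countable_topology}) \<Rightarrow> bool" where
  "weighted f \<longleftrightarrow> f \<in> borel_measurable borel \<and> (\<integral>\<^sup>+w. ennreal (norm (f w)) * ennreal (V w) \<partial>M) < \<infinity>"

lemma weighted_AE_finite:
  assumes [measurable]: "g \<in> borel_measurable borel" and fin: "(\<integral>\<^sup>+w. g w * ennreal (V w) \<partial>M) < \<infinity>" and a: "a > 0"
  shows "AE z in M. (\<integral>\<^sup>+w. g w * ennreal \<bar>L a z w\<bar> \<partial>M) < \<infinity>"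
  by (rule AE_of_balls[OF _ L_weight_finite[OF assms]]) measurable

text \<open>
  For large \<open>w\<close> the truncation is invisible to the shift, which leaves \<open>kernel_smooth\<close>; for small
  \<open>w\<close> both terms are bounded.
\<close>
lemma cut_error:
  assumes a: "a > 0"
  shows "\<exists>C>0. \<forall>w. \<bar>tau x (cut a) w - cut a w\<bar> \<le> C * V w"
proof -
  define T where "T = 2 * \<bar>x\<bar> + a + 1"
  have T: "T > 0" using a by (simp add: T_def)
  obtain C' where C': "C' > 0" "\<And>w. \<bar>w\<bar> < T + \<bar>x\<bar> \<Longrightarrow> cut a w \<le> C'"
    using cut_bound[OF a, of "T + \<bar>x\<bar>"] by blast
  obtain c where c: "c > 0" "\<And>w. \<bar>w\<bar> < T \<Longrightarrow> c \<le> V w" using V_lower by blast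
  define E1 E2 where "E1 = (B * mP * C' + C') / c" and "E2 = B * mP * Cd * \<bar>x\<bar>"
  have E: "E1 > 0" "E2 \<ge> 0"
    using B_ge_1 mP_nonneg C' c Cd_pos by (auto simp: E1_def E2_def intro!: divide_pos_pos add_nonneg_pos)
  have "\<bar>tau x (cut a) w - cut a w\<bar> \<le> (E1 + E2) * V w" for w
  proof (cases "\<bar>w\<bar> < T")
    case True
    have "norm (tau x (cut a) w - 0) \<le> B * mP * C'"
    proof (rule tau_near_const)
      fix u assume "\<bar>u\<bar> \<le> \<bar>x\<bar> + \<bar>w\<bar>"
      then have "\<bar>u\<bar> < T + \<bar>x\<bar>" using True by linarith
      then show "norm (cut a u - 0) \<le> C'" using C'(2) cut_nonneg[of a u] by simp
    qed (use C' in auto)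
    moreover have "cut a w \<le> C'" using C'(2)[of w] True by simp
    ultimately have "\<bar>tau x (cut a) w - cut a w\<bar> \<le> B * mP * C' + C'"
      using cut_nonneg[of a w] unfolding real_norm_def by linarith
    also have "\<dots> = E1 * c" using c by (simp add: E1_def)
    also have "\<dots> \<le> E1 * V w" using c(2)[OF True] E by (intro mult_left_mono) auto
    also have "\<dots> \<le> (E1 + E2) * V w" using E V_pos[of w] by (intro mult_right_mono) auto
    finally show ?thesis .
  next
    case False
    then have w: "T \<le> \<bar>w\<bar>" by simp
    then have w': "w \<noteq> 0" "2 * \<bar>x\<bar> \<le> \<bar>w\<bar>" "1 \<le> \<bar>w\<bar>" "a \<le> \<bar>w\<bar> - \<bar>x\<bar>" "a \<le> \<bar>w\<bar>" using T a by (auto simp: T_def)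
    have "tau x (cut a) w = tau x K w"
    proof (rule tau_cong)
      fix z assume "\<bar>\<bar>x\<bar> - \<bar>w\<bar>\<bar> \<le> \<bar>z\<bar>"
      then have "\<bar>w\<bar> - \<bar>x\<bar> \<le> \<bar>z\<bar>" unfolding abs_le_iff by simp
      then show "cut a z = K z" using w'(4) by (simp add: cut_def)
    qed
    moreover have "cut a w = K w" using w' by (simp add: cut_def)
    moreover have "max \<bar>w\<bar> 1 = \<bar>w\<bar>" using w' by simp
    ultimately have "\<bar>tau x (cut a) w - cut a w\<bar> \<le> E2 * V w"
      using kernel_smooth[OF w'(1,2)] by (simp add: E2_def V_def)
    also have "\<dots> \<le> (E1 + E2) * V w" using E V_pos[of w] by (intro mult_right_mono) auto
    finally show ?thesis .
  qed
  then show ?thesis using E by (intro exI[of _ "E1 + E2"]) auto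
qed

lemma cut_finite: "a > 0 \<Longrightarrow> maj x (\<lambda>z. ennreal (norm (cut a z))) w < \<infinity>"
proof -
  assume a: "a > 0"
  obtain C' where C': "C' > 0" "\<And>u. \<bar>u\<bar> < \<bar>x\<bar> + \<bar>w\<bar> + 1 \<Longrightarrow> cut a u \<le> C'"
    using cut_bound[OF a, of "\<bar>x\<bar> + \<bar>w\<bar> + 1"] by blast
  have "maj x (\<lambda>z. ennreal (norm (cut a z))) w \<le> ennreal C' * ennreal mP"
    using C'(2) by (intro maj_le) (auto simp: cut_nonneg intro!: ennreal_leI)
  also have "\<dots> < \<infinity>" by (simp add: ennreal_mult_less_top)
  finally show ?thesis .
qed

lemma tau_tau_K_finite:
  assumes "maj x (\<lambda>z. maj z K_inf w) y < \<infinity>"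
  shows "maj x (\<lambda>z. ennreal (norm (tau z K w))) y < \<infinity>"
proof -
  have "maj x (\<lambda>z. ennreal (norm (tau z K w))) y \<le> maj x (\<lambda>z. ennreal B * maj z K_inf w) y"
  proof (rule maj_mono)
    fix z
    have "maj z KE w \<le> maj z K_inf w" by (rule maj_mono) (simp add: K_inf_def)
    then show "ennreal (norm (tau z K w)) \<le> ennreal B * maj z K_inf w"
      using order_trans[OF norm_tau_K_le[of z w] mult_left_mono[of _ _ "ennreal B"]] by simp
  qed
  also have "\<dots> = ennreal B * maj x (\<lambda>z. maj z K_inf w) y" by (rule maj_cmult) measurable
  also have "\<dots> < \<infinity>" using assms by (simp add: ennreal_mult_less_top)
  finally show ?thesis .
qed

text \<open>
  The triple symmetry exchanges \<open>y\<close> and \<open>w\<close> in the first term of \<open>L\<close>. The second term is a constant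
  for the shift on the left but not for the shift on the right.
\<close>
lemma L_swap:
  assumes a: "a > 0"
  shows "AE w in M. tau x (\<lambda>z. L a z w) y = tau x (L a y) w + (tau x (cut a) w - cut a w)"
  using AE_maj_maj_1[of x y] AE_maj_maj_2[of x y] K_triple[of x y]
proof eventually_elim
  case (elim w)
  have "tau x (\<lambda>z. L a z w) y = tau x (\<lambda>z. tau z K w) y - tau x (\<lambda>_. cut a w) y"
    unfolding L_def using tau_tau_K_finite[OF elim(1)]
    by (intro tau_diff) (auto simp: maj_const ennreal_mult_less_top)
  moreover have "tau x (L a y) w = tau x (\<lambda>z. tau z K y) w - tau x (cut a) w"
  proof -
    have "L a y = (\<lambda>z. tau z K y - cut a z)" unfolding L_def by (subst tau_sym) simp
    then show ?thesis
      using tau_tau_K_finite[OF elim(2)] cut_finite[OF a] by (simp only:) (intro tau_diff, auto)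
  qed
  ultimately show ?case using elim(3) by (simp add: tau_const)
qed

text \<open>
  Fubini moves the shift inside the integral, \<open>L_swap\<close> lets it act on the variable \<open>w\<close>, and the
  duality then passes it on to \<open>f\<close>. The constant is the integral of \<open>f\<close> against the error in
  \<open>L_swap\<close>, which does not depend on \<open>y\<close>.
\<close>
lemma frac_op_commute:
  fixes f :: "real \<Rightarrow> 'b::{banach,second_countable_topology}"
  assumes f: "weighted f" and a: "a > 0"
  shows "\<exists>c. AE y in M. tau x (frac_op a f) y = frac_op a (tau (- x) f) y + c"
proof -
  have fm [measurable]: "f \<in> borel_measurable borel" using f by (simp add: weighted_def)
  define nf where "nf w = ennreal (norm (f w))" for w
  have [measurable]: "nf \<in> borel_measurable borel" unfolding nf_def by measurable
  have nfV: "(\<integral>\<^sup>+w. nf w * ennreal (V w) \<partial>M) < \<infinity>" using f by (simp add: weighted_def nf_def)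
  define G1 where "G1 z = (\<integral>\<^sup>+w. nf w * ennreal \<bar>L a z w\<bar> \<partial>M)" for z
  have [measurable]: "G1 \<in> borel_measurable borel" unfolding G1_def by measurable
  have A1: "AE y in M. maj x G1 y < \<infinity>"
  proof (rule AE_of_balls)
    fix t :: real assume "t > 0"
    have "(\<integral>\<^sup>+z\<in>ball 0 t. maj x G1 z \<partial>M) \<le> ennreal mP * (\<integral>\<^sup>+z\<in>ball 0 (t + \<bar>x\<bar>). G1 z \<partial>M)"
      by (rule maj_ball_le) measurable
    also have "\<dots> < \<infinity>" using L_weight_finite[OF _ nfV a, of "t + \<bar>x\<bar>"] by (simp add: ennreal_mult_less_top G1_def)
    finally show "(\<integral>\<^sup>+z\<in>ball 0 t. maj x G1 z \<partial>M) < \<infinity>" .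
  qed measurable
  have A2: "AE y in M. (\<integral>\<^sup>+w. maj (- x) nf w * ennreal \<bar>L a y w\<bar> \<partial>M) < \<infinity>"
    by (rule weighted_AE_finite[OF _ maj_weight_finite[OF _ nfV] a]) measurable
  obtain CE where CE: "CE > 0" "\<And>w. \<bar>tau x (cut a) w - cut a w\<bar> \<le> CE * V w" using cut_error[OF a] by blast
  define E where "E w = tau x (cut a) w - cut a w" for w
  have Em [measurable]: "E \<in> borel_measurable borel" unfolding E_def by measurable
  have intE: "integrable M (\<lambda>w. E w *\<^sub>R f w)"
  proof (rule integrableI_bounded)
    have "(\<integral>\<^sup>+w. ennreal (norm (E w *\<^sub>R f w)) \<partial>M) \<le> (\<integral>\<^sup>+w. ennreal CE * (nf w * ennreal (V w)) \<partial>M)"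
    proof (rule nn_integral_mono)
      fix w
      have "\<bar>E w\<bar> * norm (f w) \<le> (CE * V w) * norm (f w)"
        unfolding E_def by (intro mult_right_mono CE) auto
      then show "ennreal (norm (E w *\<^sub>R f w)) \<le> ennreal CE * (nf w * ennreal (V w))"
        using CE(1) V_pos[of w] by (simp add: nf_def ennreal_mult[symmetric] ennreal_leI mult_ac)
    qed
    also have "\<dots> = ennreal CE * (\<integral>\<^sup>+w. nf w * ennreal (V w) \<partial>M)" by (rule nn_integral_cmult) measurable
    also have "\<dots> < \<infinity>" using nfV by (simp add: ennreal_mult_less_top)
    finally show "(\<integral>\<^sup>+w. ennreal (norm (E w *\<^sub>R f w)) \<partial>M) < \<infinity>" .
  qed measurable
  have "AE y in M. tau x (frac_op a f) y = frac_op a (tau (- x) f) y + (\<integral>w. E w *\<^sub>R f w \<partial>M)"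
    using A1 A2
  proof eventually_elim
    case (elim y)
    let ?F = "\<lambda>\<omega> w. (k x y \<omega> * L a (p x y \<omega>) w) *\<^sub>R f w"
    have int: "integrable (M \<Otimes>\<^sub>M P) (\<lambda>(w, \<omega>). ?F \<omega> w)"
    proof (rule integrableI_bounded)
      have "(\<integral>\<^sup>+q. ennreal (norm (case q of (w, \<omega>) \<Rightarrow> ?F \<omega> w)) \<partial>(M \<Otimes>\<^sub>M P))
         = (\<integral>\<^sup>+\<omega>. \<integral>\<^sup>+w. ennreal (norm (?F \<omega> w)) \<partial>M \<partial>P)"
        by (subst MP.nn_integral_snd[symmetric]) (auto simp: case_prod_beta')
      also have "\<dots> \<le> (\<integral>\<^sup>+\<omega>. ennreal B * G1 (p x y \<omega>) \<partial>P)"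
      proof (rule nn_integral_mono)
        fix \<omega>
        have "(\<integral>\<^sup>+w. ennreal (norm (?F \<omega> w)) \<partial>M) \<le> (\<integral>\<^sup>+w. ennreal B * (nf w * ennreal \<bar>L a (p x y \<omega>) w\<bar>) \<partial>M)"
        proof (rule nn_integral_mono)
          fix w
          have "\<bar>k x y \<omega>\<bar> * (norm (f w) * \<bar>L a (p x y \<omega>) w\<bar>) \<le> B * (norm (f w) * \<bar>L a (p x y \<omega>) w\<bar>)"
            by (intro mult_right_mono k_bound) auto
          then show "ennreal (norm (?F \<omega> w)) \<le> ennreal B * (nf w * ennreal \<bar>L a (p x y \<omega>) w\<bar>)"
            using B_ge_1 by (simp add: nf_def abs_mult ennreal_mult[symmetric] ennreal_leI mult_ac)
        qed
        also have "\<dots> = ennreal B * G1 (p x y \<omega>)" unfolding G1_def by (rule nn_integral_cmult) measurable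
        finally show "(\<integral>\<^sup>+w. ennreal (norm (?F \<omega> w)) \<partial>M) \<le> ennreal B * G1 (p x y \<omega>)" .
      qed
      also have "\<dots> = ennreal B * maj x G1 y" unfolding maj_def[of x] by (rule nn_integral_cmult) measurable
      also have "\<dots> < \<infinity>" using elim(1) by (simp add: ennreal_mult_less_top)
      finally show "(\<integral>\<^sup>+q. ennreal (norm (case q of (w, \<omega>) \<Rightarrow> ?F \<omega> w)) \<partial>(M \<Otimes>\<^sub>M P)) < \<infinity>" .
    qed measurable
    have "tau x (frac_op a f) y = (\<integral>\<omega>. \<integral>w. ?F \<omega> w \<partial>M \<partial>P)"
      unfolding tau_def[of x] frac_op_def by (simp add: scaleR_scaleR[symmetric] del: scaleR_scaleR)
    also have "\<dots> = (\<integral>w. \<integral>\<omega>. ?F \<omega> w \<partial>P \<partial>M)"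
      by (rule MP.Fubini_integral[OF int])
    also have "\<dots> = (\<integral>w. tau x (L a y) w *\<^sub>R f w + E w *\<^sub>R f w \<partial>M)"
    proof (rule integral_cong_AE)
      show "AE w in M. (\<integral>\<omega>. ?F \<omega> w \<partial>P) = tau x (L a y) w *\<^sub>R f w + E w *\<^sub>R f w"
        using L_swap[OF a, of x y] MP.AE_integrable_fst'[OF int]
      proof eventually_elim
        case (elim w)
        have "(\<integral>\<omega>. ?F \<omega> w \<partial>P) = (\<integral>\<omega>. k x y \<omega> * L a (p x y \<omega>) w \<partial>P) *\<^sub>R f w"
          by (rule integral_scaleR_left_AE) (use elim(2) in simp_all)
        also have "(\<integral>\<omega>. k x y \<omega> * L a (p x y \<omega>) w \<partial>P) = tau x (\<lambda>z. L a z w) y" by (simp add: tau_def[of x])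
        finally show ?case using elim(1) by (simp add: E_def scaleR_add_left)
      qed
    qed measurable
    also have "\<dots> = (\<integral>w. tau x (L a y) w *\<^sub>R f w \<partial>M) + (\<integral>w. E w *\<^sub>R f w \<partial>M)"
    proof (rule Bochner_Integration.integral_add[OF _ intE], rule integrableI_bounded)
      have "(\<integral>\<^sup>+w. ennreal (norm (tau x (L a y) w *\<^sub>R f w)) \<partial>M)
         \<le> (\<integral>\<^sup>+w. ennreal B * (nf w * maj x (\<lambda>z. ennreal \<bar>L a y z\<bar>) w) \<partial>M)"
      proof (rule nn_integral_mono)
        fix w
        have "ennreal \<bar>tau x (L a y) w\<bar> * nf w \<le> (ennreal B * maj x (\<lambda>z. ennreal \<bar>L a y z\<bar>) w) * nf w"
          using norm_tau_le[of "L a y" x w] by (intro mult_right_mono) auto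
        then show "ennreal (norm (tau x (L a y) w *\<^sub>R f w)) \<le> ennreal B * (nf w * maj x (\<lambda>z. ennreal \<bar>L a y z\<bar>) w)"
          by (simp add: nf_def ennreal_mult mult_ac)
      qed
      also have "\<dots> = ennreal B * (\<integral>\<^sup>+w. nf w * maj x (\<lambda>z. ennreal \<bar>L a y z\<bar>) w \<partial>M)"
        by (rule nn_integral_cmult) measurable
      also have "(\<integral>\<^sup>+w. nf w * maj x (\<lambda>z. ennreal \<bar>L a y z\<bar>) w \<partial>M) = (\<integral>\<^sup>+w. ennreal \<bar>L a y w\<bar> * maj (- x) nf w \<partial>M)"
        by (rule maj_dual) measurable
      also have "ennreal B * \<dots> < \<infinity>" using elim(2) by (simp add: ennreal_mult_less_top mult.commute)
      finally show "(\<integral>\<^sup>+w. ennreal (norm (tau x (L a y) w *\<^sub>R f w)) \<partial>M) < \<infinity>" .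
    qed measurable
    also have "(\<integral>w. tau x (L a y) w *\<^sub>R f w \<partial>M) = frac_op a (tau (- x) f) y"
      unfolding frac_op_def
    proof (rule tau_dual)
      have "(\<integral>\<^sup>+w. nf w * maj x (\<lambda>z. ennreal \<bar>L a y z\<bar>) w \<partial>M) = (\<integral>\<^sup>+w. ennreal \<bar>L a y w\<bar> * maj (- x) nf w \<partial>M)"
        by (rule maj_dual) measurable
      then show "(\<integral>\<^sup>+w. ennreal (norm (f w)) * maj x (\<lambda>z. ennreal \<bar>L a y z\<bar>) w \<partial>M) < \<infinity>"
        using elim(2) by (simp add: nf_def mult.commute)
    qed measurable
    finally show ?case .
  qed
  then show ?thesis by blast
qed

end

section \<open>Oscillation estimates\<close>

lemma norm_integral_le_nn_integral:
  fixes f :: "'a \<Rightarrow> 'b::{banach,second_countable_topology}"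
  shows "ennreal (norm (\<integral>x. f x \<partial>M)) \<le> (\<integral>\<^sup>+x. ennreal (norm (f x)) \<partial>M)"
  by (cases "integrable M f") (simp_all add: integral_norm_bound_ennreal not_integrable_integral_eq)

text \<open>
  The constants are parameters, so that the final bound \<open>op_const\<close> visibly depends on them only and
  not on the function.
\<close>
locale bmo_translation = kernel_translation M P p k \<kappa> B D cM \<rho> C1 Cc Cd cK
  for M :: "real measure" and P :: "'w measure" and p k :: "real \<Rightarrow> real \<Rightarrow> 'w \<Rightarrow> real"
    and \<kappa> :: "real \<Rightarrow> real \<Rightarrow> real \<Rightarrow> real" and B D cM :: real
    and \<rho> :: "real \<Rightarrow> real" and C1 Cc Cd cK :: real +
  fixes \<phi> \<psi> :: "real \<Rightarrow> real" and Ci Cp Cs A A' :: real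
  assumes phi_pos: "\<And>r. r > 0 \<Longrightarrow> \<phi> r > 0" and psi_pos: "\<And>r. r > 0 \<Longrightarrow> \<psi> r > 0"
    and phi_inc: "\<And>r s. 0 < r \<Longrightarrow> r \<le> s \<Longrightarrow> \<phi> r \<le> Ci * \<phi> s"
    and phi_dbl: "\<And>r. r > 0 \<Longrightarrow> \<phi> (2 * r) \<le> Cp * \<phi> r"
    and psi_dbl: "\<And>r. r > 0 \<Longrightarrow> \<psi> (2 * r) \<le> Cs * \<psi> r"
    and rho_phi: "\<And>r. r > 0 \<Longrightarrow>
       (\<integral>\<^sup>+t\<in>{r<..}. ennreal (\<rho> t * \<phi> t / t\<^sup>2) \<partial>lborel) \<le> ennreal (A * (\<rho> r * \<phi> r / r))"
    and phi_psi: "\<And>r. r > 0 \<Longrightarrow>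
       ennreal (\<phi> r) * (\<integral>\<^sup>+t\<in>{0<..<r}. ennreal (\<rho> t / t) \<partial>lborel) \<le> ennreal (A' * \<psi> r)"
    and consts_pos: "Ci > 0" "Cp > 0" "Cs > 0" "A > 0" "A' > 0"
begin

lemma rho_partial_sum:
  assumes r: "r > 0"
  shows "(\<Sum>j<n. \<rho> (2 ^ j * r) / (2 ^ j * r)) \<le> 4 * C1 * Cc * (\<rho> r / r)"
proof -
  have nn: "\<rho> (2 ^ j * r) / (2 ^ j * r) \<ge> 0" for j using r rho_pos[of "2 ^ j * r"] by (simp add: less_imp_le)
  have "ennreal (\<Sum>j<n. \<rho> (2 ^ j * r) / (2 ^ j * r)) = (\<Sum>j<n. ennreal (\<rho> (2 ^ j * r) / (2 ^ j * r)))"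
    using nn by (intro sum_ennreal[symmetric]) auto
  also have "\<dots> \<le> (\<Sum>j. ennreal (\<rho> (2 ^ j * r) / (2 ^ j * r)))" by (rule sum_le_suminf) auto
  also have "\<dots> \<le> ennreal (4 * C1 * Cc * (\<rho> r / r))" by (rule rho_dyadic_sum[OF r])
  finally show ?thesis
    using C1_ge_1 Cc_pos rho_pos[OF r] r by (subst (asm) ennreal_le_iff) auto
qed

text \<open>
  As \<open>\<phi>\<close> increases up to the factor \<open>Ci\<close>, the integrand on each dyadic interval is bounded below by
  its value at the left end, up to the factor \<open>4 C1 Ci\<close>.
\<close>
lemma rho_phi_partial_sum:
  assumes r: "r > 0"
  shows "(\<Sum>j<n. \<rho> (2 ^ j * r) * \<phi> (2 ^ j * r) / (2 ^ j * r)) \<le> 4 * C1 * Ci * A * (\<rho> r * \<phi> r / r)"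
proof -
  define c where "c j = \<rho> (2 ^ j * r) * \<phi> (2 ^ j * r) / (4 * C1 * Ci * (2 ^ j * r)\<^sup>2)" for j :: nat
  have s: "2 ^ j * r > 0" for j :: nat using r by simp
  have cn: "c j \<ge> 0" for j
    using rho_pos[OF s[of j]] phi_pos[OF s[of j]] C1_ge_1 consts_pos by (simp add: c_def)
  have le: "(\<Sum>j. ennreal (c j) * ennreal (2 ^ j * r)) \<le> (\<integral>\<^sup>+t\<in>{r<..}. ennreal (\<rho> t * \<phi> t / t\<^sup>2) \<partial>lborel)"
  proof (rule dyadic_sum_le_integral[OF r])
    fix j t assume t: "2 ^ j * r < t" "t < 2 ^ Suc j * r"
    let ?s = "2 ^ j * r"
    have tp: "t > 0" using t s[of j] by linarith
    have "\<rho> ?s \<le> C1 * \<rho> t" using t s[of j] tp by (intro rho_a) auto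
    moreover have "\<phi> ?s \<le> Ci * \<phi> t" using t s by (intro phi_inc) auto
    ultimately have "\<rho> ?s * \<phi> ?s \<le> (C1 * \<rho> t) * (Ci * \<phi> t)"
      using rho_pos[OF s[of j]] phi_pos[OF s[of j]] rho_pos[OF tp] C1_ge_1 by (intro mult_mono) auto
    then have 1: "\<rho> ?s * \<phi> ?s / (C1 * Ci) \<le> \<rho> t * \<phi> t"
      using C1_ge_1 consts_pos by (simp add: pos_divide_le_eq mult_ac)
    have 2: "t\<^sup>2 \<le> (2 * ?s)\<^sup>2" using t tp by (intro power_mono) auto
    have "(\<rho> ?s * \<phi> ?s / (C1 * Ci)) / (2 * ?s)\<^sup>2 \<le> \<rho> t * \<phi> t / t\<^sup>2"
      by (rule frac_le[OF _ 1 _ 2]) (use tp rho_pos[OF tp] phi_pos[OF tp] in auto)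
    moreover have "(\<rho> ?s * \<phi> ?s / (C1 * Ci)) / (2 * ?s)\<^sup>2 = c j" by (simp add: c_def power_mult_distrib)
    ultimately show "ennreal (c j) \<le> ennreal (\<rho> t * \<phi> t / t\<^sup>2)" by (intro ennreal_leI) simp
  qed
  have "ennreal (\<Sum>j<n. c j * (2 ^ j * r)) = (\<Sum>j<n. ennreal (c j * (2 ^ j * r)))"
    using cn s by (intro sum_ennreal[symmetric] mult_nonneg_nonneg less_imp_le[OF s]) auto
  also have "\<dots> = (\<Sum>j<n. ennreal (c j) * ennreal (2 ^ j * r))" using cn r by (simp add: ennreal_mult)
  also have "\<dots> \<le> (\<Sum>j. ennreal (c j) * ennreal (2 ^ j * r))" by (rule sum_le_suminf) auto
  also have "\<dots> \<le> ennreal (A * (\<rho> r * \<phi> r / r))" using le rho_phi[OF r] by (rule order_trans)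
  finally have 3: "(\<Sum>j<n. c j * (2 ^ j * r)) \<le> A * (\<rho> r * \<phi> r / r)"
    using consts_pos rho_pos[OF r] phi_pos[OF r] r by (subst (asm) ennreal_le_iff) auto
  have "(\<Sum>j<n. \<rho> (2 ^ j * r) * \<phi> (2 ^ j * r) / (2 ^ j * r)) = (\<Sum>j<n. 4 * C1 * Ci * (c j * (2 ^ j * r)))"
  proof (rule sum.cong[OF refl])
    fix j
    have "q / s = 4 * C1 * Ci * (q / (4 * C1 * Ci * s\<^sup>2) * s)" if "s > 0" for q s
      using that C1_ge_1 consts_pos by (simp add: power2_eq_square)
    from this[OF s] show "\<rho> (2 ^ j * r) * \<phi> (2 ^ j * r) / (2 ^ j * r) = 4 * C1 * Ci * (c j * (2 ^ j * r))"
      unfolding c_def .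
  qed
  also have "\<dots> = 4 * C1 * Ci * (\<Sum>j<n. c j * (2 ^ j * r))" by (rule sum_distrib_left[symmetric])
  also have "\<dots> \<le> 4 * C1 * Ci * (A * (\<rho> r * \<phi> r / r))"
    using 3 C1_ge_1 consts_pos by (intro mult_left_mono) auto
  finally show ?thesis by (simp add: mult.assoc)
qed

text \<open>
  The integral of \<open>\<rho> t / t\<close> over \<open>(r / 2, r)\<close> is at least \<open>\<rho> r / (2 C1)\<close>.
\<close>
lemma rho_phi_psi:
  assumes r: "r > 0" shows "\<rho> r * \<phi> r \<le> 2 * C1 * A' * \<psi> r"
proof -
  have "ennreal (\<rho> r / (2 * C1)) = (\<integral>\<^sup>+t. ennreal (\<rho> r / (C1 * r)) * indicator {r/2<..<r} t \<partial>lborel)"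
    using r rho_pos[OF r] C1_ge_1
    by (subst nn_integral_cmult_indicator) (auto simp: ennreal_mult[symmetric] field_simps)
  also have "\<dots> \<le> (\<integral>\<^sup>+t\<in>{0<..<r}. ennreal (\<rho> t / t) \<partial>lborel)"
  proof (rule nn_integral_mono)
    fix t
    show "ennreal (\<rho> r / (C1 * r)) * indicator {r/2<..<r} t \<le> ennreal (\<rho> t / t) * indicator {0<..<r} t"
    proof (cases "t \<in> {r/2<..<r}")
      case True
      then have t: "t > 0" "t \<le> r" using r by auto
      have "\<rho> r \<le> C1 * \<rho> t" using True t r by (intro rho_a) auto
      then have "\<rho> r / C1 \<le> \<rho> t" using C1_ge_1 by (simp add: field_simps)
      then have "(\<rho> r / C1) / r \<le> \<rho> t / t" using t rho_pos[OF t(1)] by (intro frac_le) auto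
      then show ?thesis using True t by (auto intro!: ennreal_leI)
    qed simp
  qed
  finally have "ennreal (\<phi> r) * ennreal (\<rho> r / (2 * C1)) \<le> ennreal (\<phi> r) * (\<integral>\<^sup>+t\<in>{0<..<r}. ennreal (\<rho> t / t) \<partial>lborel)"
    by (intro mult_left_mono) auto
  also have "\<dots> \<le> ennreal (A' * \<psi> r)" by (rule phi_psi[OF r])
  finally have "ennreal (\<phi> r * (\<rho> r / (2 * C1))) \<le> ennreal (A' * \<psi> r)"
    using phi_pos[OF r] rho_pos[OF r] C1_ge_1 by (subst ennreal_mult) auto
  then have "\<phi> r * (\<rho> r / (2 * C1)) \<le> A' * \<psi> r"
    using psi_pos[OF r] consts_pos by (subst (asm) ennreal_le_iff) auto
  then show ?thesis using C1_ge_1 by (simp add: pos_divide_le_eq mult_ac)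
qed

definition mB :: "real \<Rightarrow> real" where "mB R = cM * R powr D"

lemma mB_pos: "R > 0 \<Longrightarrow> mB R > 0" by (simp add: mB_def cM_pos)

lemma mB_dbl: "mB (2 * R) = 2 powr D * mB R" by (simp add: mB_def powr_mult)

lemma emeasure_ball: "R > 0 \<Longrightarrow> emeasure M (ball 0 R) = ennreal (mB R)" by (simp add: mB_def M_ball)

definition avg :: "(real \<Rightarrow> 'b::{banach,second_countable_topology}) \<Rightarrow> real \<Rightarrow> 'b" where
  "avg F R = (1 / mB R) *\<^sub>R (\<integral>w. indicator (ball 0 R) w *\<^sub>R F w \<partial>M)"

text \<open>
  Mean oscillation over the balls around the origin only; the oscillation of \<open>f\<close> in the sense of the
  \<open>BMO\<close> norm is that of all the functions \<open>\<tau>\<^sub>x f\<close> in this sense.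
\<close>
definition osc :: "(real \<Rightarrow> 'b::{banach,second_countable_topology}) \<Rightarrow> real \<Rightarrow> bool" where
  "osc F N \<longleftrightarrow> F \<in> borel_measurable borel \<and> N \<ge> 0 \<and> (\<forall>R>0.
     integrable M (\<lambda>w. indicator (ball 0 R) w *\<^sub>R F w) \<and>
     (\<integral>\<^sup>+w\<in>ball 0 R. ennreal (norm (F w - avg F R)) \<partial>M) \<le> ennreal (N * \<phi> R * mB R))"

lemma ball_const_integrable: "integrable M (\<lambda>w. indicator (ball 0 R) w *\<^sub>R (c :: 'b::{banach,second_countable_topology}))"
  using M_ball_finite[of R] by (intro integrable_scaleR_left) (simp add: integrable_indicator_iff sets_M)

lemma avg_diff_le:
  fixes F :: "real \<Rightarrow> 'b::{banach,second_countable_topology}"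
  assumes int: "integrable M (\<lambda>w. indicator (ball 0 R) w *\<^sub>R F w)" and R: "R > 0"
  shows "ennreal (norm (avg F R - c) * mB R) \<le> (\<integral>\<^sup>+w\<in>ball 0 R. ennreal (norm (F w - c)) \<partial>M)"
proof -
  have m: "measure M (ball 0 R) = mB R" using emeasure_ball[OF R] mB_pos[OF R] by (simp add: measure_def)
  have i: "integrable M (\<lambda>w. indicator (ball 0 R) w *\<^sub>R F w - indicator (ball 0 R) w *\<^sub>R c)"
    by (rule Bochner_Integration.integrable_diff[OF int ball_const_integrable])
  have "(\<integral>w. indicator (ball 0 R) w *\<^sub>R F w - indicator (ball 0 R) w *\<^sub>R c \<partial>M)
    = (\<integral>w. indicator (ball 0 R) w *\<^sub>R F w \<partial>M) - (\<integral>w. indicator (ball 0 R) w *\<^sub>R c \<partial>M)"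
    by (rule Bochner_Integration.integral_diff[OF int ball_const_integrable])
  also have "(\<integral>w. indicator (ball 0 R) w *\<^sub>R c \<partial>M) = mB R *\<^sub>R c"
    using M_ball_finite[of R] by (subst integral_scaleR_left) (auto simp: integrable_indicator_iff sets_M m)
  also have "(\<integral>w. indicator (ball 0 R) w *\<^sub>R F w \<partial>M) = mB R *\<^sub>R avg F R"
    using mB_pos[OF R] by (simp add: avg_def)
  finally have "mB R *\<^sub>R (avg F R - c) = (\<integral>w. indicator (ball 0 R) w *\<^sub>R F w - indicator (ball 0 R) w *\<^sub>R c \<partial>M)"
    by (simp add: scaleR_diff_right)
  then have "norm (mB R *\<^sub>R (avg F R - c)) = norm (\<integral>w. indicator (ball 0 R) w *\<^sub>R F w - indicator (ball 0 R) w *\<^sub>R c \<partial>M)"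
    by simp
  then have "ennreal (norm (avg F R - c) * mB R)
     = ennreal (norm (\<integral>w. indicator (ball 0 R) w *\<^sub>R F w - indicator (ball 0 R) w *\<^sub>R c \<partial>M))"
    using mB_pos[OF R] by (simp add: mult.commute)
  also have "\<dots> \<le> (\<integral>\<^sup>+w. ennreal (norm (indicator (ball 0 R) w *\<^sub>R F w - indicator (ball 0 R) w *\<^sub>R c)) \<partial>M)"
    by (rule integral_norm_bound_ennreal[OF i])
  also have "\<dots> = (\<integral>\<^sup>+w\<in>ball 0 R. ennreal (norm (F w - c)) \<partial>M)"
    by (intro nn_integral_cong) (auto simp: indicator_def)
  finally show ?thesis .
qed

lemma ball_dist_le:
  fixes F :: "real \<Rightarrow> 'b::{banach,second_countable_topology}"
  assumes [measurable]: "F \<in> borel_measurable borel" and R: "R > 0"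
  shows "(\<integral>\<^sup>+w\<in>ball 0 R. ennreal (norm (F w - c)) \<partial>M)
    \<le> (\<integral>\<^sup>+w\<in>ball 0 R. ennreal (norm (F w - d)) \<partial>M) + ennreal (norm (d - c) * mB R)"
proof -
  have "(\<integral>\<^sup>+w\<in>ball 0 R. ennreal (norm (F w - c)) \<partial>M)
    \<le> (\<integral>\<^sup>+w. ennreal (norm (F w - d)) * indicator (ball 0 R) w + ennreal (norm (d - c)) * indicator (ball 0 R) w \<partial>M)"
  proof (rule nn_integral_mono)
    fix w
    have "ennreal (norm (F w - c)) \<le> ennreal (norm (F w - d)) + ennreal (norm (d - c))"
      using norm_triangle_ineq[of "F w - d" "d - c"]
      by (simp add: ennreal_plus[symmetric] ennreal_leI del: ennreal_plus)
    then show "ennreal (norm (F w - c)) * indicator (ball 0 R) w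
      \<le> ennreal (norm (F w - d)) * indicator (ball 0 R) w + ennreal (norm (d - c)) * indicator (ball 0 R) w"
      by (auto simp: indicator_def)
  qed
  also have "\<dots> = (\<integral>\<^sup>+w\<in>ball 0 R. ennreal (norm (F w - d)) \<partial>M) + ennreal (norm (d - c)) * emeasure M (ball 0 R)"
    by (subst nn_integral_add) (auto simp: nn_integral_cmult_indicator sets_M)
  finally show ?thesis using emeasure_ball[OF R] mB_pos[OF R] by (simp add: ennreal_mult)
qed

text \<open>
  The averages over consecutive dyadic balls differ by at most \<open>2\<^sup>D N\<close> times the value of \<open>\<phi>\<close> at the
  larger radius, and these differences are added up.
\<close>
lemma osc_dyadic:
  fixes F :: "real \<Rightarrow> 'b::{banach,second_countable_topology}"
  assumes osc: "osc F N" and r: "r > 0"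
  shows "(\<integral>\<^sup>+w\<in>ball 0 (2 ^ j * r). ennreal (norm (F w - avg F r)) \<partial>M)
     \<le> ennreal (mB (2 ^ j * r) * (2 * 2 powr D * N * (\<Sum>i\<le>j. \<phi> (2 ^ i * r))))"
proof -
  let ?R = "\<lambda>j. 2 ^ j * r"
  have R: "?R j > 0" for j using r by simp
  have [measurable]: "F \<in> borel_measurable borel" and N: "N \<ge> 0"
    and int: "\<And>R. R > 0 \<Longrightarrow> integrable M (\<lambda>w. indicator (ball 0 R) w *\<^sub>R F w)"
    and o: "\<And>R. R > 0 \<Longrightarrow> (\<integral>\<^sup>+w\<in>ball 0 R. ennreal (norm (F w - avg F R)) \<partial>M) \<le> ennreal (N * \<phi> R * mB R)"
    using osc by (auto simp: osc_def)
  have two: "2 powr D \<ge> 1" using D_ge_1 by (simp add: ge_one_powr_ge_zero)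
  have phin: "\<phi> (?R j) \<ge> 0" for j using phi_pos[OF R[of j]] by simp
  have step: "norm (avg F (?R j) - avg F (?R (Suc j))) \<le> 2 powr D * N * \<phi> (?R (Suc j))" for j
  proof -
    have "ennreal (norm (avg F (?R j) - avg F (?R (Suc j))) * mB (?R j))
      \<le> (\<integral>\<^sup>+w\<in>ball 0 (?R j). ennreal (norm (F w - avg F (?R (Suc j)))) \<partial>M)"
      by (rule avg_diff_le[OF int R]) (rule R)
    also have "\<dots> \<le> (\<integral>\<^sup>+w\<in>ball 0 (?R (Suc j)). ennreal (norm (F w - avg F (?R (Suc j)))) \<partial>M)"
      using r by (intro nn_integral_mono) (auto simp: indicator_def)
    also have "\<dots> \<le> ennreal (N * \<phi> (?R (Suc j)) * mB (?R (Suc j)))" by (rule o[OF R])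
    finally have "norm (avg F (?R j) - avg F (?R (Suc j))) * mB (?R j) \<le> N * \<phi> (?R (Suc j)) * mB (?R (Suc j))"
      using N phin[of "Suc j"] mB_pos[OF R[of "Suc j"]] by (subst (asm) ennreal_le_iff) auto
    also have "mB (?R (Suc j)) = 2 powr D * mB (?R j)" using mB_dbl[of "?R j"] by (simp add: mult.assoc)
    finally have "norm (avg F (?R j) - avg F (?R (Suc j))) * mB (?R j) \<le> (2 powr D * N * \<phi> (?R (Suc j))) * mB (?R j)"
      by (simp add: mult_ac)
    then show ?thesis using mB_pos[OF R[of j]] by (rule mult_right_le_imp_le)
  qed
  have e: "norm (avg F (?R j) - avg F r) \<le> 2 powr D * N * (\<Sum>i\<le>j. \<phi> (?R i))" for j
  proof (induction j)
    case 0
    show ?case using N phi_pos[OF r] by simp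
  next
    case (Suc j)
    have "norm (avg F (?R (Suc j)) - avg F r)
      \<le> norm (avg F (?R (Suc j)) - avg F (?R j)) + norm (avg F (?R j) - avg F r)"
      using norm_triangle_ineq[of "avg F (?R (Suc j)) - avg F (?R j)" "avg F (?R j) - avg F r"] by simp
    also have "\<dots> \<le> 2 powr D * N * \<phi> (?R (Suc j)) + 2 powr D * N * (\<Sum>i\<le>j. \<phi> (?R i))"
      using step[of j] Suc by (intro add_mono) (simp_all add: norm_minus_commute)
    finally show ?case by (simp add: algebra_simps)
  qed
  have "(\<integral>\<^sup>+w\<in>ball 0 (?R j). ennreal (norm (F w - avg F r)) \<partial>M)
     \<le> (\<integral>\<^sup>+w\<in>ball 0 (?R j). ennreal (norm (F w - avg F (?R j))) \<partial>M) + ennreal (norm (avg F (?R j) - avg F r) * mB (?R j))"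
    by (rule ball_dist_le[OF _ R]) measurable
  also have "\<dots> \<le> ennreal (N * \<phi> (?R j) * mB (?R j)) + ennreal ((2 powr D * N * (\<Sum>i\<le>j. \<phi> (?R i))) * mB (?R j))"
    using mB_pos[OF R[of j]] by (intro add_mono o[OF R] ennreal_leI mult_right_mono e) auto
  also have "\<dots> = ennreal (N * \<phi> (?R j) * mB (?R j) + (2 powr D * N * (\<Sum>i\<le>j. \<phi> (?R i))) * mB (?R j))"
    using N phin mB_pos[OF R[of j]] by (intro ennreal_plus[symmetric]) (auto intro!: mult_nonneg_nonneg sum_nonneg)
  also have "\<dots> \<le> ennreal (mB (?R j) * (2 * 2 powr D * N * (\<Sum>i\<le>j. \<phi> (?R i))))"
  proof (rule ennreal_leI)
    have "\<phi> (?R j) \<le> (\<Sum>i\<le>j. \<phi> (?R i))" using phin by (intro member_le_sum) auto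
    also have "\<dots> \<le> 2 powr D * (\<Sum>i\<le>j. \<phi> (?R i))"
      using two phin mult_right_mono[OF two, of "\<Sum>i\<le>j. \<phi> (?R i)"] by (simp add: sum_nonneg)
    finally have "N * \<phi> (?R j) \<le> N * (2 powr D * (\<Sum>i\<le>j. \<phi> (?R i)))" using N by (rule mult_left_mono)
    then have "N * \<phi> (?R j) * mB (?R j) \<le> N * (2 powr D * (\<Sum>i\<le>j. \<phi> (?R i))) * mB (?R j)"
      using mB_pos[OF R[of j]] by (intro mult_right_mono) auto
    then show "N * \<phi> (?R j) * mB (?R j) + (2 powr D * N * (\<Sum>i\<le>j. \<phi> (?R i))) * mB (?R j)
       \<le> mB (?R j) * (2 * 2 powr D * N * (\<Sum>i\<le>j. \<phi> (?R i)))" by (simp add: algebra_simps)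
  qed
  finally show ?thesis .
qed

text \<open>
  After the order of summation is exchanged, the inner sum over \<open>j \<ge> i\<close> is at most a multiple of its
  first term by \<open>rho_partial_sum\<close>, and what remains is the sum in \<open>rho_phi_partial_sum\<close>.
\<close>
lemma double_sum_le:
  assumes r: "r > 0"
  shows "(\<Sum>j<n. \<rho> (2 ^ j * r) / (2 ^ j * r) * (\<Sum>i\<le>j. \<phi> (2 ^ i * r)))
     \<le> 4 * C1 * Cc * (4 * C1 * Ci * A) * (\<rho> r * \<phi> r / r)"
proof -
  let ?R = "\<lambda>j. 2 ^ j * r"
  let ?a = "\<lambda>j. \<rho> (?R j) / ?R j"
  have R: "?R j > 0" for j using r by simp
  have an: "?a j \<ge> 0" for j using R[of j] rho_pos[OF R[of j]] by (simp add: less_imp_le)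
  have "(\<Sum>j<n. ?a j * (\<Sum>i\<le>j. \<phi> (?R i))) = (\<Sum>j<n. \<Sum>i\<le>j. \<phi> (?R i) * ?a j)"
    by (intro sum.cong refl) (subst sum_distrib_left, intro sum.cong refl, rule mult.commute)
  also have "\<dots> = (\<Sum>i<n. \<Sum>j\<in>{i..<n}. \<phi> (?R i) * ?a j)"
    by (subst sum.Sigma, simp, simp, subst sum.Sigma, simp, simp)
       (rule sum.reindex_bij_witness[of _ "\<lambda>(i, j). (j, i)" "\<lambda>(j, i). (i, j)"], auto)
  also have "\<dots> = (\<Sum>i<n. \<phi> (?R i) * (\<Sum>j\<in>{i..<n}. ?a j))" by (simp add: sum_distrib_left)
  also have "\<dots> \<le> (\<Sum>i<n. \<phi> (?R i) * (4 * C1 * Cc * ?a i))"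
  proof (intro sum_mono mult_left_mono)
    fix i assume i: "i \<in> {..<n}"
    have "(\<Sum>j\<in>{i..<n}. ?a j) = (\<Sum>j<n - i. ?a (j + i))"
      using i by (intro sum.reindex_bij_witness[of _ "\<lambda>j. j + i" "\<lambda>j. j - i"]) auto
    also have "\<dots> = (\<Sum>j<n - i. \<rho> (2 ^ j * ?R i) / (2 ^ j * ?R i))" by (simp add: power_add mult.assoc)
    also have "\<dots> \<le> 4 * C1 * Cc * ?a i" by (rule rho_partial_sum[OF R])
    finally show "(\<Sum>j\<in>{i..<n}. ?a j) \<le> 4 * C1 * Cc * ?a i" .
    show "\<phi> (?R i) \<ge> 0" using phi_pos[OF R[of i]] by simp
  qed
  also have "\<dots> = 4 * C1 * Cc * (\<Sum>i<n. \<rho> (?R i) * \<phi> (?R i) / ?R i)"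
    by (simp add: sum_distrib_left mult_ac)
  also have "\<dots> \<le> 4 * C1 * Cc * (4 * C1 * Ci * A * (\<rho> r * \<phi> r / r))"
    using C1_ge_1 Cc_pos by (intro mult_left_mono rho_phi_partial_sum[OF r]) auto
  finally show ?thesis by (simp add: mult.assoc)
qed

definition tail_const :: real where
  "tail_const = C1 * 2 powr D * (2 * 2 powr D) * (1 + Cp) * cM * (4 * C1 * Cc * (4 * C1 * Ci * A))"

definition W :: "real \<Rightarrow> real" where "W w = \<rho> \<bar>w\<bar> / \<bar>w\<bar> powr (D + 1)"

lemma W_measurable [measurable]: "W \<in> borel_measurable borel"
proof -
  have "W = (\<lambda>w. K w * (1 / \<bar>w\<bar>))" by (rule ext) (simp add: W_def K_def powr_add)
  then show ?thesis by simp
qed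

text \<open>
  On each dyadic annulus \<open>W\<close> is replaced by its value at the inner radius and \<open>osc_dyadic\<close> applies;
  the series is that of \<open>double_sum_le\<close>.
\<close>
lemma osc_tail:
  fixes F :: "real \<Rightarrow> 'b::{banach,second_countable_topology}"
  assumes osc: "osc F N" and r: "r > 0"
  shows "(\<integral>\<^sup>+w\<in>- ball 0 r. ennreal (norm (F w - avg F r)) * ennreal (W w) \<partial>M) \<le> ennreal (tail_const * N * (\<rho> r * \<phi> r / r))"
proof -
  let ?R = "\<lambda>j. 2 ^ j * r"
  have R: "?R j > 0" for j using r by simp
  have Fm [measurable]: "F \<in> borel_measurable borel" and N: "N \<ge> 0" using osc by (auto simp: osc_def)
  have phin: "\<phi> (?R j) \<ge> 0" for j using phi_pos[OF R[of j]] by simp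
  define K1 where "K1 = C1 * 2 powr D * (2 * 2 powr D) * (1 + Cp) * cM * N"
  have K1: "K1 \<ge> 0" using C1_ge_1 consts_pos cM_pos N by (simp add: K1_def)
  define b where "b j = \<rho> (?R j) / ?R j * (\<Sum>i\<le>j. \<phi> (?R i))" for j
  have bn: "b j \<ge> 0" for j
    using rho_pos[OF R[of j]] R[of j] phin r unfolding b_def
    by (intro mult_nonneg_nonneg divide_nonneg_nonneg sum_nonneg) (auto simp: less_imp_le)
  let ?c = "\<lambda>j. ennreal (C1 * \<rho> (?R j) / ?R j powr (D + 1))"
  have "(\<integral>\<^sup>+w\<in>- ball 0 r. ennreal (norm (F w - avg F r)) * ennreal (W w) \<partial>M)
    \<le> (\<Sum>j. ?c j * (\<integral>\<^sup>+w\<in>ball 0 (2 ^ Suc j * r). ennreal (norm (F w - avg F r)) \<partial>M))"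
  proof (rule suminf_annuli[OF _ sets_M r])
    fix j w assume w: "2 ^ j * r \<le> \<bar>w\<bar>" "\<bar>w\<bar> < 2 ^ Suc j * r"
    have "W w \<le> C1 * \<rho> (?R j) / ?R j powr (D + 1)"
      unfolding W_def using w R[of j] by (intro weight_annulus) auto
    then have "ennreal (W w) \<le> ?c j" by (rule ennreal_leI)
    then have "ennreal (norm (F w - avg F r)) * ennreal (W w) \<le> ennreal (norm (F w - avg F r)) * ?c j"
      by (rule mult_left_mono) simp
    then show "ennreal (norm (F w - avg F r)) * ennreal (W w) \<le> ?c j * ennreal (norm (F w - avg F r))"
      by (simp add: mult.commute)
  qed measurable
  also have "\<dots> \<le> (\<Sum>j. ennreal (K1 * b j))"
  proof (rule suminf_le)
    fix j
    have "?c j * (\<integral>\<^sup>+w\<in>ball 0 (2 ^ Suc j * r). ennreal (norm (F w - avg F r)) \<partial>M)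
      \<le> ?c j * ennreal (mB (?R (Suc j)) * (2 * 2 powr D * N * (\<Sum>i\<le>Suc j. \<phi> (?R i))))"
      by (intro mult_left_mono osc_dyadic[OF osc r]) simp
    also have "\<dots> = ennreal (C1 * \<rho> (?R j) / ?R j powr (D + 1) * (mB (?R (Suc j)) * (2 * 2 powr D * N * (\<Sum>i\<le>Suc j. \<phi> (?R i)))))"
      using C1_ge_1 rho_pos[OF R[of j]] by (intro ennreal_mult'[symmetric]) auto
    also have "\<dots> \<le> ennreal (K1 * b j)"
    proof (rule ennreal_leI)
      have "\<phi> (?R (Suc j)) \<le> Cp * \<phi> (?R j)" using phi_dbl[OF R[of j]] by (simp add: mult.assoc)
      also have "\<dots> \<le> Cp * (\<Sum>i\<le>j. \<phi> (?R i))"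
        using phin consts_pos by (intro mult_left_mono member_le_sum) auto
      finally have s: "(\<Sum>i\<le>Suc j. \<phi> (?R i)) \<le> (1 + Cp) * (\<Sum>i\<le>j. \<phi> (?R i))" by (simp add: algebra_simps)
      have m: "mB (?R (Suc j)) = 2 powr D * (cM * ?R j powr D)" using mB_dbl[of "?R j"] by (simp add: mult.assoc mB_def)
      have "C1 * \<rho> (?R j) / ?R j powr (D + 1) * (mB (?R (Suc j)) * (2 * 2 powr D * N * (\<Sum>i\<le>Suc j. \<phi> (?R i))))
        \<le> C1 * \<rho> (?R j) / ?R j powr (D + 1) * (mB (?R (Suc j)) * (2 * 2 powr D * N * ((1 + Cp) * (\<Sum>i\<le>j. \<phi> (?R i)))))"
        using s N C1_ge_1 rho_pos[OF R[of j]] mB_pos[OF R[of "Suc j"]] by (intro mult_left_mono) auto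
      also have "\<dots> = K1 * b j"
      proof -
        have "C1 * q / s powr (D + 1) * (2 powr D * (cM * s powr D) * (2 * 2 powr D * N * ((1 + Cp) * S)))
            = C1 * 2 powr D * (2 * 2 powr D) * (1 + Cp) * cM * N * (q / s * S)" if "s > 0" for q s S :: real
        proof -
          have "s powr (D + 1) = s powr D * s" "s powr D \<noteq> 0" using that by (auto simp: powr_add)
          then show ?thesis using that by (simp add: field_simps)
        qed
        from this[OF R] show ?thesis unfolding m K1_def b_def .
      qed
      finally show "C1 * \<rho> (?R j) / ?R j powr (D + 1) * (mB (?R (Suc j)) * (2 * 2 powr D * N * (\<Sum>i\<le>Suc j. \<phi> (?R i)))) \<le> K1 * b j" .
    qed
    finally show "?c j * (\<integral>\<^sup>+w\<in>ball 0 (2 ^ Suc j * r). ennreal (norm (F w - avg F r)) \<partial>M) \<le> ennreal (K1 * b j)" .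
  qed auto
  also have "\<dots> \<le> ennreal (K1 * (4 * C1 * Cc * (4 * C1 * Ci * A) * (\<rho> r * \<phi> r / r)))"
  proof (rule suminf_le_const)
    fix n
    have "(\<Sum>j<n. ennreal (K1 * b j)) = ennreal (\<Sum>j<n. K1 * b j)" using K1 bn by (intro sum_ennreal) auto
    also have "\<dots> \<le> ennreal (K1 * (4 * C1 * Cc * (4 * C1 * Ci * A) * (\<rho> r * \<phi> r / r)))"
      unfolding sum_distrib_left[symmetric] b_def
      by (intro ennreal_leI mult_left_mono double_sum_le[OF r] K1)
    finally show "(\<Sum>j<n. ennreal (K1 * b j)) \<le> ennreal (K1 * (4 * C1 * Cc * (4 * C1 * Ci * A) * (\<rho> r * \<phi> r / r)))" .
  qed simp
  also have "K1 * (4 * C1 * Cc * (4 * C1 * Ci * A) * (\<rho> r * \<phi> r / r)) = tail_const * N * (\<rho> r * \<phi> r / r)"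
    by (simp add: K1_def tail_const_def mult_ac)
  finally show ?thesis .
qed

lemma W_eq_V: "1 \<le> \<bar>w\<bar> \<Longrightarrow> V w = W w"
  by (simp add: V_def W_def max_absorb1)

text \<open>
  Outside the unit ball \<open>F\<close> is its average plus the deviation estimated in \<open>osc_tail\<close>.
\<close>
lemma osc_weighted:
  fixes F :: "real \<Rightarrow> 'b::{banach,second_countable_topology}"
  assumes osc: "osc F N"
  shows "weighted F"
proof -
  have Fm [measurable]: "F \<in> borel_measurable borel"
    and int: "integrable M (\<lambda>w. indicator (ball 0 1) w *\<^sub>R F w)" using osc by (auto simp: osc_def)
  obtain C where C: "C > 0" "\<And>u w. \<bar>\<bar>u\<bar> - \<bar>w\<bar>\<bar> \<le> 1 \<Longrightarrow> V u \<le> C * V w" using V_shift[of 1] by blast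
  let ?m = "avg F 1"
  have le: "ennreal (norm (F w)) * ennreal (V w)
     \<le> ennreal (C * V 0) * ennreal (norm (indicator (ball 0 1) w *\<^sub>R F w))
      + ennreal (norm (F w - ?m)) * ennreal (W w) * indicator (- ball 0 1) w + ennreal (norm ?m) * ennreal (V w)" for w
  proof (cases "\<bar>w\<bar> < 1")
    case True
    have "norm (F w) * V w \<le> norm (F w) * (C * V 0)" using C(2)[of w 0] True by (intro mult_left_mono) auto
    then have "ennreal (norm (F w)) * ennreal (V w) \<le> ennreal (C * V 0) * ennreal (norm (indicator (ball 0 1) w *\<^sub>R F w))"
      using True C(1) V_pos[of 0] V_pos[of w] by (simp add: ennreal_mult[symmetric] ennreal_leI mult_ac)
    then show ?thesis by (simp add: add.assoc add_increasing2)
  next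
    case False
    have "norm (F w) * V w \<le> (norm (F w - ?m) + norm ?m) * V w"
      using norm_triangle_ineq[of "F w - ?m" ?m] V_pos[of w] by (intro mult_right_mono) auto
    then have "ennreal (norm (F w)) * ennreal (V w) \<le> ennreal (norm (F w - ?m) * V w + norm ?m * V w)"
      using V_pos[of w] by (simp add: ennreal_mult[symmetric] ennreal_leI distrib_right del: ennreal_plus)
    also have "\<dots> = ennreal (norm (F w - ?m)) * ennreal (V w) + ennreal (norm ?m) * ennreal (V w)"
      using V_pos[of w] by (subst ennreal_plus) (auto simp: ennreal_mult)
    finally show ?thesis using False W_eq_V[of w] by simp
  qed
  have "(\<integral>\<^sup>+w. ennreal (norm (F w)) * ennreal (V w) \<partial>M)
     \<le> (\<integral>\<^sup>+w. ennreal (C * V 0) * ennreal (norm (indicator (ball 0 1) w *\<^sub>R F w))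
      + ennreal (norm (F w - ?m)) * ennreal (W w) * indicator (- ball 0 1) w + ennreal (norm ?m) * ennreal (V w) \<partial>M)"
    by (intro nn_integral_mono le)
  also have "\<dots> = ennreal (C * V 0) * (\<integral>\<^sup>+w. ennreal (norm (indicator (ball 0 1) w *\<^sub>R F w)) \<partial>M)
      + (\<integral>\<^sup>+w\<in>- ball 0 1. ennreal (norm (F w - ?m)) * ennreal (W w) \<partial>M) + ennreal (norm ?m) * (\<integral>\<^sup>+w. ennreal (V w) \<partial>M)"
    by (subst nn_integral_add, measurable, subst nn_integral_add, measurable)
       (simp add: nn_integral_cmult)
  also have "\<dots> < \<infinity>"
    using int osc_tail[OF osc, of 1] V_integral_finite
    by (auto simp: ennreal_mult_less_top integrable_iff_bounded intro: le_less_trans)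
  finally show ?thesis by (simp add: weighted_def)
qed

text \<open>
  The radius \<open>3 r\<close> is enlarged to \<open>4 r\<close>, so that doubling \<open>\<psi>\<close> twice leads back to \<open>r\<close>.
\<close>
lemma phi_K_ball:
  assumes r: "r > 0"
  shows "ennreal (\<phi> (2 * r)) * (\<integral>\<^sup>+y\<in>ball 0 (3 * r). KE y \<partial>M) \<le> ennreal (Ci * cK * A' * Cs\<^sup>2 * \<psi> r)"
proof -
  have r4: "4 * r > 0" using r by simp
  have phi: "\<phi> (2 * r) \<le> Ci * \<phi> (4 * r)" using r by (intro phi_inc) auto
  have "ennreal (\<phi> (2 * r)) * (\<integral>\<^sup>+y\<in>ball 0 (3 * r). KE y \<partial>M)
     \<le> ennreal (Ci * \<phi> (4 * r)) * (\<integral>\<^sup>+y\<in>ball 0 (4 * r). KE y \<partial>M)"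
    using r by (intro mult_mono nn_integral_mono ennreal_leI phi) (auto simp: indicator_def)
  also have "\<dots> = ennreal (Ci * cK) * (ennreal (\<phi> (4 * r)) * (\<integral>\<^sup>+t\<in>{0<..<4 * r}. ennreal (\<rho> t / t) \<partial>lborel))"
    using K_int[OF r4] phi_pos[OF r4] consts_pos cK_pos by (simp add: K_def ennreal_mult mult_ac)
  also have "\<dots> \<le> ennreal (Ci * cK) * ennreal (A' * \<psi> (4 * r))" by (intro mult_left_mono phi_psi[OF r4]) simp
  also have "\<dots> = ennreal (Ci * cK * (A' * \<psi> (4 * r)))" 
    using psi_pos[OF r4] consts_pos cK_pos by (simp add: ennreal_mult[symmetric])
  also have "\<dots> \<le> ennreal (Ci * cK * A' * Cs\<^sup>2 * \<psi> r)"
  proof (rule ennreal_leI)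
    have "\<psi> (4 * r) \<le> Cs * \<psi> (2 * r)" using psi_dbl[of "2 * r"] r by simp
    also have "\<dots> \<le> Cs * (Cs * \<psi> r)" using psi_dbl[OF r] consts_pos by (intro mult_left_mono) auto
    finally have "Ci * cK * A' * \<psi> (4 * r) \<le> Ci * cK * A' * (Cs * (Cs * \<psi> r))"
      using consts_pos cK_pos by (intro mult_left_mono) auto
    then show "Ci * cK * (A' * \<psi> (4 * r)) \<le> Ci * cK * A' * Cs\<^sup>2 * \<psi> r" by (simp add: power2_eq_square mult_ac)
  qed
  finally show ?thesis .
qed

text \<open>
  The first summand comes from the points inside the ball of radius \<open>2 r\<close>, the second from those
  outside.
\<close>
definition op_const :: real where
  "op_const = B * mP * (Ci * cK * A' * Cs\<^sup>2) * 2 powr D + B * mP * Cd * tail_const * C1 * A' * Cs"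

lemma op_const_nonneg: "op_const \<ge> 0"
  using B_ge_1 mP_nonneg consts_pos cK_pos Cd_pos C1_ge_1 cM_pos Cc_pos by (auto simp: op_const_def tail_const_def)

text \<open>
  For \<open>\<bar>w\<bar> < 2 r\<close> the regularised kernel is \<open>\<tau>\<^sub>y K\<close>, and its integral over \<open>y\<close> in the ball of radius
  \<open>r\<close> is bounded by the integral of \<open>K\<close> over the ball of radius \<open>3 r\<close>. For \<open>\<bar>w\<bar> \<ge> 2 r\<close> the bound in
  \<open>kernel_smooth\<close> turns the integral into the tail \<open>osc_tail\<close>.
\<close>
lemma frac_op_integral_bound:
  fixes F :: "real \<Rightarrow> 'b::{banach,second_countable_topology}"
  assumes osc: "osc F N" and r: "r > 0"
  shows "(\<integral>\<^sup>+y\<in>ball 0 r. (\<integral>\<^sup>+w. ennreal \<bar>L (2 * r) y w\<bar> * ennreal (norm (F w - avg F (2 * r))) \<partial>M) \<partial>M)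
     \<le> ennreal (op_const * N * \<psi> r * mB r)"
proof -
  have r2: "2 * r > 0" using r by simp
  define h where "h w = ennreal (norm (F w - avg F (2 * r)))" for w
  have Fm [measurable]: "F \<in> borel_measurable borel" and N: "N \<ge> 0" using osc by (auto simp: osc_def)
  have hm [measurable]: "h \<in> borel_measurable borel" unfolding h_def by measurable
  let ?E = "B * mP * Cd * r"
  have E: "?E \<ge> 0" using B_ge_1 mP_nonneg Cd_pos r by auto
  have inner: "(\<integral>\<^sup>+w. ennreal \<bar>L (2 * r) y w\<bar> * h w \<partial>M)
     \<le> ennreal B * (\<integral>\<^sup>+w\<in>ball 0 (2 * r). maj y KE w * h w \<partial>M) + ennreal ?E * (\<integral>\<^sup>+w\<in>- ball 0 (2 * r). h w * ennreal (W w) \<partial>M)"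
    if y: "\<bar>y\<bar> < r" for y
  proof -
    have "(\<integral>\<^sup>+w. ennreal \<bar>L (2 * r) y w\<bar> * h w \<partial>M)
      \<le> (\<integral>\<^sup>+w. ennreal B * (maj y KE w * h w * indicator (ball 0 (2 * r)) w)
          + ennreal ?E * (h w * ennreal (W w) * indicator (- ball 0 (2 * r)) w) \<partial>M)"
    proof (rule nn_integral_mono)
      fix w
      show "ennreal \<bar>L (2 * r) y w\<bar> * h w \<le> ennreal B * (maj y KE w * h w * indicator (ball 0 (2 * r)) w)
          + ennreal ?E * (h w * ennreal (W w) * indicator (- ball 0 (2 * r)) w)"
      proof (cases "\<bar>w\<bar> < 2 * r")
        case True
        have "ennreal \<bar>L (2 * r) y w\<bar> * h w \<le> (ennreal B * maj y KE w) * h w"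
          using norm_tau_K_le[of y w] True by (intro mult_right_mono) (auto simp: L_def cut_def)
        then show ?thesis using True by (simp add: mult.assoc)
      next
        case False
        then have w: "w \<noteq> 0" "2 * \<bar>y\<bar> \<le> \<bar>w\<bar>" using y r by auto
        have Wn: "W w \<ge> 0" using w rho_pos[of "\<bar>w\<bar>"] by (simp add: W_def)
        have "\<bar>L (2 * r) y w\<bar> \<le> B * mP * Cd * \<bar>y\<bar> * W w"
          using kernel_smooth[OF w] False by (simp add: L_def cut_def W_def)
        also have "\<dots> \<le> ?E * W w"
          using y B_ge_1 mP_nonneg Cd_pos Wn by (intro mult_right_mono mult_left_mono) auto
        finally have "ennreal \<bar>L (2 * r) y w\<bar> * h w \<le> ennreal (?E * W w) * h w"
          by (intro mult_right_mono ennreal_leI) auto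
        also have "ennreal (?E * W w) = ennreal ?E * ennreal (W w)" by (rule ennreal_mult[OF E Wn])
        finally show ?thesis using False by (simp add: mult_ac)
      qed
    qed
    also have "\<dots> = ennreal B * (\<integral>\<^sup>+w\<in>ball 0 (2 * r). maj y KE w * h w \<partial>M) + ennreal ?E * (\<integral>\<^sup>+w\<in>- ball 0 (2 * r). h w * ennreal (W w) \<partial>M)"
      by (subst nn_integral_add, measurable) (simp add: nn_integral_cmult)
    finally show ?thesis .
  qed
  let ?T = "\<integral>\<^sup>+w\<in>- ball 0 (2 * r). h w * ennreal (W w) \<partial>M"
  let ?J = "\<integral>\<^sup>+z\<in>ball 0 (3 * r). KE z \<partial>M"
  have "(\<integral>\<^sup>+y\<in>ball 0 r. (\<integral>\<^sup>+w. ennreal \<bar>L (2 * r) y w\<bar> * h w \<partial>M) \<partial>M)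
    \<le> (\<integral>\<^sup>+y. ennreal B * (\<integral>\<^sup>+w. maj y KE w * h w * indicator (ball 0 (2 * r)) w * indicator (ball 0 r) y \<partial>M)
        + (ennreal ?E * ?T) * indicator (ball 0 r) y \<partial>M)"
  proof (rule nn_integral_mono)
    fix y
    show "(\<integral>\<^sup>+w. ennreal \<bar>L (2 * r) y w\<bar> * h w \<partial>M) * indicator (ball 0 r) y
      \<le> ennreal B * (\<integral>\<^sup>+w. maj y KE w * h w * indicator (ball 0 (2 * r)) w * indicator (ball 0 r) y \<partial>M)
        + (ennreal ?E * ?T) * indicator (ball 0 r) y"
      using inner[of y] by (cases "\<bar>y\<bar> < r") auto
  qed
  also have "\<dots> = ennreal B * (\<integral>\<^sup>+y. \<integral>\<^sup>+w. maj y KE w * h w * indicator (ball 0 (2 * r)) w * indicator (ball 0 r) y \<partial>M \<partial>M)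
      + ennreal ?E * ?T * emeasure M (ball 0 r)"
    by (subst nn_integral_add) (auto simp: nn_integral_cmult nn_integral_cmult_indicator)
  also have "(\<integral>\<^sup>+y. \<integral>\<^sup>+w. maj y KE w * h w * indicator (ball 0 (2 * r)) w * indicator (ball 0 r) y \<partial>M \<partial>M)
     = (\<integral>\<^sup>+w. \<integral>\<^sup>+y. maj y KE w * h w * indicator (ball 0 (2 * r)) w * indicator (ball 0 r) y \<partial>M \<partial>M)"
    by (rule MM.Fubini') measurable
  also have "\<dots> = (\<integral>\<^sup>+w. (\<integral>\<^sup>+y\<in>ball 0 r. maj y KE w \<partial>M) * (h w * indicator (ball 0 (2 * r)) w) \<partial>M)"
    by (subst nn_integral_multc[symmetric]) (auto simp: mult_ac)
  also have "\<dots> \<le> (\<integral>\<^sup>+w. (ennreal mP * ?J) * (h w * indicator (ball 0 (2 * r)) w) \<partial>M)"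
  proof (rule nn_integral_mono)
    fix w
    have "(\<integral>\<^sup>+y\<in>ball 0 r. maj y KE w \<partial>M) \<le> ennreal mP * ?J" if "\<bar>w\<bar> < 2 * r"
    proof -
      have "(\<integral>\<^sup>+y\<in>ball 0 r. maj y KE w \<partial>M) = (\<integral>\<^sup>+y\<in>ball 0 r. maj w KE y \<partial>M)" by (subst maj_sym) simp
      also have "\<dots> \<le> ennreal mP * (\<integral>\<^sup>+y\<in>ball 0 (r + \<bar>w\<bar>). KE y \<partial>M)" by (rule maj_ball_le) measurable
      also have "\<dots> \<le> ennreal mP * ?J"
        using that by (intro mult_left_mono nn_integral_mono) (auto simp: indicator_def)
      finally show ?thesis .
    qed
    then show "(\<integral>\<^sup>+y\<in>ball 0 r. maj y KE w \<partial>M) * (h w * indicator (ball 0 (2 * r)) w)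
      \<le> (ennreal mP * ?J) * (h w * indicator (ball 0 (2 * r)) w)"
      by (cases "\<bar>w\<bar> < 2 * r") (auto intro!: mult_right_mono)
  qed
  also have "\<dots> = (ennreal mP * ?J) * (\<integral>\<^sup>+w\<in>ball 0 (2 * r). h w \<partial>M)" by (rule nn_integral_cmult) measurable
  also have "\<dots> \<le> (ennreal mP * ?J) * ennreal (N * \<phi> (2 * r) * mB (2 * r))"
    using osc r2 unfolding h_def osc_def by (intro mult_left_mono) auto
  finally have 1: "(\<integral>\<^sup>+y\<in>ball 0 r. (\<integral>\<^sup>+w. ennreal \<bar>L (2 * r) y w\<bar> * h w \<partial>M) \<partial>M)
     \<le> ennreal B * ((ennreal mP * ?J) * ennreal (N * \<phi> (2 * r) * mB (2 * r))) + ennreal ?E * ?T * emeasure M (ball 0 r)"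
    by (simp add: mult_left_mono)
  have mBr: "mB r > 0" "mB (2 * r) = 2 powr D * mB r" using mB_pos[OF r] mB_dbl by auto
  have pos: "\<phi> (2 * r) > 0" "\<psi> r > 0" "\<psi> (2 * r) > 0" "\<rho> (2 * r) > 0" using phi_pos psi_pos rho_pos r by auto
  let ?P1 = "B * mP * (Ci * cK * A' * Cs\<^sup>2) * 2 powr D * N * \<psi> r * mB r"
  let ?P2 = "B * mP * Cd * tail_const * C1 * A' * Cs * N * \<psi> r * mB r"
  have Ctn: "tail_const \<ge> 0" using consts_pos C1_ge_1 cM_pos Cc_pos by (auto simp: tail_const_def)
  have 2: "ennreal B * ((ennreal mP * ?J) * ennreal (N * \<phi> (2 * r) * mB (2 * r))) \<le> ennreal ?P1"
  proof -
    have "ennreal B * ((ennreal mP * ?J) * ennreal (N * \<phi> (2 * r) * mB (2 * r)))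
      = ennreal (B * mP * N * mB (2 * r)) * (ennreal (\<phi> (2 * r)) * ?J)"
      using B_ge_1 mP_nonneg N pos mBr by (simp add: ennreal_mult mult_ac)
    also have "\<dots> \<le> ennreal (B * mP * N * mB (2 * r)) * ennreal (Ci * cK * A' * Cs\<^sup>2 * \<psi> r)"
      by (intro mult_left_mono phi_K_ball[OF r]) simp
    also have "\<dots> = ennreal (B * mP * N * mB (2 * r) * (Ci * cK * A' * Cs\<^sup>2 * \<psi> r))"
      using B_ge_1 mP_nonneg N pos mBr consts_pos cK_pos by (intro ennreal_mult[symmetric]) auto
    also have "B * mP * N * mB (2 * r) * (Ci * cK * A' * Cs\<^sup>2 * \<psi> r) = ?P1" unfolding mBr by (simp add: mult_ac)
    finally show ?thesis .
  qed
  have 3: "ennreal ?E * ?T * emeasure M (ball 0 r) \<le> ennreal ?P2"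
  proof -
    have "ennreal ?E * ?T * emeasure M (ball 0 r) \<le> ennreal ?E * ennreal (tail_const * N * (\<rho> (2 * r) * \<phi> (2 * r) / (2 * r))) * ennreal (mB r)"
      unfolding emeasure_ball[OF r] h_def by (intro mult_right_mono mult_left_mono osc_tail[OF osc r2]) auto
    also have "\<dots> = ennreal (?E * (tail_const * N * (\<rho> (2 * r) * \<phi> (2 * r) / (2 * r))) * mB r)"
    proof -
      have "tail_const * N * (\<rho> (2 * r) * \<phi> (2 * r) / (2 * r)) \<ge> 0" using Ctn N pos r by simp
      from ennreal_mult[OF E this] ennreal_mult[OF mult_nonneg_nonneg[OF E this] less_imp_le[OF mBr(1)]]
      show ?thesis by (simp only:)
    qed
    also have "\<dots> \<le> ennreal ?P2"
    proof (rule ennreal_leI)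
      have "\<rho> (2 * r) * \<phi> (2 * r) \<le> 2 * C1 * A' * \<psi> (2 * r)" by (rule rho_phi_psi[OF r2])
      also have "\<dots> \<le> 2 * C1 * A' * (Cs * \<psi> r)"
        using psi_dbl[OF r] C1_ge_1 consts_pos by (intro mult_left_mono) auto
      finally have "\<rho> (2 * r) * \<phi> (2 * r) / (2 * r) \<le> 2 * C1 * A' * (Cs * \<psi> r) / (2 * r)"
        using r by (intro divide_right_mono) auto
      then have "?E * (tail_const * N * (\<rho> (2 * r) * \<phi> (2 * r) / (2 * r))) * mB r \<le> ?E * (tail_const * N * (2 * C1 * A' * (Cs * \<psi> r) / (2 * r))) * mB r"
        using E Ctn N mBr by (intro mult_right_mono mult_left_mono) auto
      also have "\<dots> = ?P2" using r by (simp add: field_simps)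
      finally show "?E * (tail_const * N * (\<rho> (2 * r) * \<phi> (2 * r) / (2 * r))) * mB r \<le> ?P2" .
    qed
    finally show ?thesis .
  qed
  have "ennreal ?P1 + ennreal ?P2 = ennreal (?P1 + ?P2)"
    using B_ge_1 mP_nonneg N pos mBr consts_pos cK_pos Ctn Cd_pos C1_ge_1 by (intro ennreal_plus[symmetric]) auto
  also have "?P1 + ?P2 = op_const * N * \<psi> r * mB r" by (simp add: op_const_def algebra_simps)
  finally show ?thesis using order_trans[OF 1 add_mono[OF 2 3]] unfolding h_def by simp
qed

text \<open>
  Passing from \<open>a\<close> to \<open>2 r\<close> adds the constant \<open>c3\<close>, and subtracting the average of \<open>F\<close> adds a
  multiple of the integral of \<open>L (2 r) y\<close>, which by \<open>L_integral\<close> is also independent of \<open>y\<close>.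
\<close>
lemma frac_op_osc:
  fixes F :: "real \<Rightarrow> 'b::{banach,second_countable_topology}"
  assumes osc: "osc F N" and r: "r > 0" and a: "a > 0"
  shows "\<exists>c. (\<integral>\<^sup>+y\<in>ball 0 r. ennreal (norm (frac_op a F y - c)) \<partial>M) \<le> ennreal (op_const * N * \<psi> r * mB r)"
proof -
  have r2: "2 * r > 0" using r by simp
  let ?m = "avg F (2 * r)"
  have Fm [measurable]: "F \<in> borel_measurable borel" using osc by (simp add: osc_def)
  have FV: "(\<integral>\<^sup>+w. ennreal (norm (F w)) * ennreal (V w) \<partial>M) < \<infinity>"
    using osc_weighted[OF osc] by (simp add: weighted_def)
  have AE1: "AE y in M. integrable M (\<lambda>w. L b y w *\<^sub>R F w)" if b: "b > 0" for b
    using weighted_AE_finite[OF _ FV b]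
    by (rule AE_mp[OF _ AE_I2]) (auto intro!: integrableI_bounded simp: ennreal_mult mult.commute)
  define c3 where "c3 = (\<integral>w. (cut (2 * r) w - cut a w) *\<^sub>R F w \<partial>M)"
  have AE: "AE y in M. norm (frac_op a F y - (c3 + K_mass (2 * r) *\<^sub>R ?m)) = norm (\<integral>w. L (2 * r) y w *\<^sub>R (F w - ?m) \<partial>M)"
    using AE1[OF a] AE1[OF r2]
  proof eventually_elim
    case (elim y)
    have iL: "integrable M (\<lambda>w. L (2 * r) y w *\<^sub>R ?m)" using L_integrable[OF r2] by (intro integrable_scaleR_left)
    have "frac_op a F y - frac_op (2 * r) F y = (\<integral>w. L a y w *\<^sub>R F w - L (2 * r) y w *\<^sub>R F w \<partial>M)"
      unfolding frac_op_def by (rule Bochner_Integration.integral_diff[symmetric]) (use elim in auto)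
    also have "\<dots> = c3" unfolding c3_def by (simp add: L_def scaleR_diff_left[symmetric])
    finally have "frac_op a F y = frac_op (2 * r) F y + c3" by (simp add: algebra_simps)
    moreover have "frac_op (2 * r) F y = (\<integral>w. L (2 * r) y w *\<^sub>R (F w - ?m) \<partial>M) + K_mass (2 * r) *\<^sub>R ?m"
    proof -
      have "(\<integral>w. L (2 * r) y w *\<^sub>R (F w - ?m) \<partial>M) = (\<integral>w. L (2 * r) y w *\<^sub>R F w - L (2 * r) y w *\<^sub>R ?m \<partial>M)"
        by (simp add: scaleR_diff_right)
      also have "\<dots> = frac_op (2 * r) F y - (\<integral>w. L (2 * r) y w *\<^sub>R ?m \<partial>M)"
        unfolding frac_op_def by (rule Bochner_Integration.integral_diff[OF elim(2) iL])
      also have "(\<integral>w. L (2 * r) y w *\<^sub>R ?m \<partial>M) = K_mass (2 * r) *\<^sub>R ?m"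
        using L_integrable[OF r2] by (simp add: L_integral[OF r2])
      finally show ?thesis by simp
    qed
    ultimately show ?case by simp
  qed
  have "(\<integral>\<^sup>+y\<in>ball 0 r. ennreal (norm (frac_op a F y - (c3 + K_mass (2 * r) *\<^sub>R ?m))) \<partial>M)
    \<le> (\<integral>\<^sup>+y\<in>ball 0 r. (\<integral>\<^sup>+w. ennreal \<bar>L (2 * r) y w\<bar> * ennreal (norm (F w - ?m)) \<partial>M) \<partial>M)"
  proof (rule nn_integral_mono_AE)
    show "AE y in M. ennreal (norm (frac_op a F y - (c3 + K_mass (2 * r) *\<^sub>R ?m))) * indicator (ball 0 r) y
      \<le> (\<integral>\<^sup>+w. ennreal \<bar>L (2 * r) y w\<bar> * ennreal (norm (F w - ?m)) \<partial>M) * indicator (ball 0 r) y"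
      using AE
    proof eventually_elim
      case (elim y)
      have "ennreal (norm (\<integral>w. L (2 * r) y w *\<^sub>R (F w - ?m) \<partial>M)) \<le> (\<integral>\<^sup>+w. ennreal (norm (L (2 * r) y w *\<^sub>R (F w - ?m))) \<partial>M)"
        by (rule norm_integral_le_nn_integral)
      also have "\<dots> = (\<integral>\<^sup>+w. ennreal \<bar>L (2 * r) y w\<bar> * ennreal (norm (F w - ?m)) \<partial>M)" by (simp add: ennreal_mult)
      finally show ?case unfolding elim by (rule mult_right_mono) simp
    qed
  qed
  also have "\<dots> \<le> ennreal (op_const * N * \<psi> r * mB r)" by (rule frac_op_integral_bound[OF osc r])
  finally show ?thesis by blast
qed

text \<open>
  The third claim is \<open>frac_op_osc\<close> for the function \<open>\<tau>\<^bsub>-x\<^esub> f\<close>, combined with \<open>frac_op_commute\<close>.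
\<close>
theorem frac_op_bounded:
  fixes f :: "real \<Rightarrow> 'b::{banach,second_countable_topology}"
  assumes fm [measurable]: "f \<in> borel_measurable borel" and osc: "\<And>x. osc (tau x f) N"
  shows "AE z in M. integrable M (\<lambda>w. L 1 z w *\<^sub>R f w)"
    and "integrable M (\<lambda>z. indicator (ball 0 t) z *\<^sub>R frac_op 1 f z)"
    and "r > 0 \<Longrightarrow> \<exists>c. (\<integral>\<^sup>+y\<in>ball 0 r. ennreal (norm (tau x (frac_op 1 f) y - c)) \<partial>M) \<le> ennreal (op_const * N * \<psi> r * mB r)"
proof -
  have fV: "(\<integral>\<^sup>+w. ennreal (norm (f w)) * ennreal (V w) \<partial>M) < \<infinity>"
  proof -
    have "(\<integral>\<^sup>+w. ennreal (norm (f w)) * ennreal (V w) \<partial>M) = (\<integral>\<^sup>+w. ennreal (norm (tau 0 f w)) * ennreal (V w) \<partial>M)"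
      by (rule nn_integral_cong_AE) (rule AE_mp[OF AE_nonzero AE_I2], simp add: tau_zero)
    then show ?thesis using osc_weighted[OF osc[of 0]] by (simp add: weighted_def)
  qed
  show "AE z in M. integrable M (\<lambda>w. L 1 z w *\<^sub>R f w)"
    using weighted_AE_finite[OF _ fV, of 1]
    by (rule AE_mp[OF _ AE_I2]) (auto intro!: integrableI_bounded simp: ennreal_mult mult.commute)
  show "integrable M (\<lambda>z. indicator (ball 0 t) z *\<^sub>R frac_op 1 f z)"
  proof (rule integrableI_bounded)
    have "(\<integral>\<^sup>+z. ennreal (norm (indicator (ball 0 t) z *\<^sub>R frac_op 1 f z)) \<partial>M)
       \<le> (\<integral>\<^sup>+z\<in>ball 0 t. (\<integral>\<^sup>+w. ennreal (norm (f w)) * ennreal \<bar>L 1 z w\<bar> \<partial>M) \<partial>M)"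
    proof (rule nn_integral_mono)
      fix z
      have "ennreal (norm (frac_op 1 f z)) \<le> (\<integral>\<^sup>+w. ennreal (norm (L 1 z w *\<^sub>R f w)) \<partial>M)"
        unfolding frac_op_def by (rule norm_integral_le_nn_integral)
      then show "ennreal (norm (indicator (ball 0 t) z *\<^sub>R frac_op 1 f z))
         \<le> (\<integral>\<^sup>+w. ennreal (norm (f w)) * ennreal \<bar>L 1 z w\<bar> \<partial>M) * indicator (ball 0 t) z"
        by (auto simp: indicator_def ennreal_mult mult.commute)
    qed
    also have "\<dots> < \<infinity>" by (rule L_weight_finite[OF _ fV]) auto
    finally show "(\<integral>\<^sup>+z. ennreal (norm (indicator (ball 0 t) z *\<^sub>R frac_op 1 f z)) \<partial>M) < \<infinity>" .
  qed measurable
  show "\<exists>c. (\<integral>\<^sup>+y\<in>ball 0 r. ennreal (norm (tau x (frac_op 1 f) y - c)) \<partial>M) \<le> ennreal (op_const * N * \<psi> r * mB r)" if r: "r > 0"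
  proof -
    have "weighted f" using fV by (simp add: weighted_def)
    then obtain c0 where c0: "AE y in M. tau x (frac_op 1 f) y = frac_op 1 (tau (- x) f) y + c0"
      using frac_op_commute[of f 1 x] by auto
    obtain c where c: "(\<integral>\<^sup>+y\<in>ball 0 r. ennreal (norm (frac_op 1 (tau (- x) f) y - c)) \<partial>M) \<le> ennreal (op_const * N * \<psi> r * mB r)"
      using frac_op_osc[OF osc[of "- x"] r, of 1] by auto
    have "(\<integral>\<^sup>+y\<in>ball 0 r. ennreal (norm (tau x (frac_op 1 f) y - (c + c0))) \<partial>M)
      = (\<integral>\<^sup>+y\<in>ball 0 r. ennreal (norm (frac_op 1 (tau (- x) f) y - c)) \<partial>M)"
      by (rule nn_integral_cong_AE) (rule AE_mp[OF c0 AE_I2], simp)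
    then show ?thesis using c by (intro exI[of _ "c + c0"]) simp
  qed
qed

end

section \<open>The Dunkl measure\<close>

definition dunkl_coeff :: "real \<Rightarrow> real" where
  "dunkl_coeff \<alpha> = inverse (2 powr (\<alpha> + 1) * Gamma (\<alpha> + 1))"

lemma dunkl_coeff_pos: "\<alpha> > -1 \<Longrightarrow> dunkl_coeff \<alpha> > 0"
  by (simp add: dunkl_coeff_def Gamma_real_pos)

definition dunkl_weight :: "real \<Rightarrow> real \<Rightarrow> ennreal" where
  "dunkl_weight \<alpha> x = ennreal (dunkl_coeff \<alpha> * \<bar>x\<bar> powr (2 * \<alpha> + 1))"

lemma dunkl_weight_measurable [measurable]: "dunkl_weight \<alpha> \<in> borel_measurable borel"
  unfolding dunkl_weight_def[abs_def] by measurable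

text \<open>
  The Borel version of \<open>dunkl_measure\<close>, whose completion is \<open>dunkl_measure\<close>
  (\<open>dunkl_measure_completion\<close>). Fubini and substitutions need the product of Borel spaces.
\<close>
definition dmu :: "real \<Rightarrow> real measure" where
  "dmu \<alpha> = density lborel (dunkl_weight \<alpha>)"

lemma sets_dmu [measurable_cong, simp]: "sets (dmu \<alpha>) = sets borel" by (simp add: dmu_def)

lemma space_dmu [simp]: "space (dmu \<alpha>) = UNIV" by (simp add: dmu_def)

lemma nn_integral_dmu:
  "h \<in> borel_measurable borel \<Longrightarrow> (\<integral>\<^sup>+x. h x \<partial>dmu \<alpha>) = (\<integral>\<^sup>+x. dunkl_weight \<alpha> x * h x \<partial>lborel)"
  unfolding dmu_def by (subst nn_integral_density) auto

lemma AE_lborel_neq: "AE x in lborel. x \<noteq> (c::real)"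
  by (rule AE_lborel_singleton)

lemma nn_integral_uminus:
  fixes g :: "real \<Rightarrow> ennreal"
  assumes "g \<in> borel_measurable borel"
  shows "(\<integral>\<^sup>+x. g (- x) \<partial>lborel) = (\<integral>\<^sup>+x. g x \<partial>lborel)"
  using nn_integral_real_affine[OF assms, of "-1" 0] by simp

lemma nn_integral_split_sign:
  fixes g :: "real \<Rightarrow> ennreal"
  assumes [measurable]: "g \<in> borel_measurable borel"
  shows "(\<integral>\<^sup>+x. g x \<partial>lborel) = (\<integral>\<^sup>+x\<in>{0<..}. (g x + g (- x)) \<partial>lborel)"
proof -
  have "(\<integral>\<^sup>+x. g x \<partial>lborel) = (\<integral>\<^sup>+x. g x * indicator {0<..} x + g x * indicator {..<0} x \<partial>lborel)"
    by (rule nn_integral_cong_AE, rule AE_mp[OF AE_lborel_neq[of 0] AE_I2]) (auto simp: indicator_def)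
  also have "\<dots> = (\<integral>\<^sup>+x. g x * indicator {0<..} x \<partial>lborel) + (\<integral>\<^sup>+x. g x * indicator {..<0} x \<partial>lborel)"
    by (rule nn_integral_add) measurable
  also have "(\<integral>\<^sup>+x. g x * indicator {..<0} x \<partial>lborel) = (\<integral>\<^sup>+x. g (- x) * indicator {..<0} (- x) \<partial>lborel)"
    by (rule nn_integral_uminus[symmetric]) measurable
  also have "(\<integral>\<^sup>+x. g x * indicator {0<..} x \<partial>lborel) + \<dots> = (\<integral>\<^sup>+x. g x * indicator {0<..} x + g (- x) * indicator {..<0} (- x) \<partial>lborel)"
    by (rule nn_integral_add[symmetric]) measurable
  also have "\<dots> = (\<integral>\<^sup>+x\<in>{0<..}. (g x + g (- x)) \<partial>lborel)"
    by (intro nn_integral_cong) (auto simp: indicator_def)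
  finally show ?thesis .
qed

lemma nn_integral_abs:
  fixes g :: "real \<Rightarrow> ennreal"
  assumes [measurable]: "g \<in> borel_measurable borel"
  shows "(\<integral>\<^sup>+x. g \<bar>x\<bar> \<partial>lborel) = 2 * (\<integral>\<^sup>+x\<in>{0<..}. g x \<partial>lborel)"
proof -
  have "(\<integral>\<^sup>+x. g \<bar>x\<bar> \<partial>lborel) = (\<integral>\<^sup>+x\<in>{0<..}. (g \<bar>x\<bar> + g \<bar>- x\<bar>) \<partial>lborel)"
    by (rule nn_integral_split_sign) measurable
  also have "\<dots> = (\<integral>\<^sup>+x. 2 * (g x * indicator {0<..} x) \<partial>lborel)"
    by (intro nn_integral_cong) (auto simp: indicator_def mult_2)
  also have "\<dots> = 2 * (\<integral>\<^sup>+x\<in>{0<..}. g x \<partial>lborel)" by (rule nn_integral_cmult) measurable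
  finally show ?thesis .
qed

lemma AE_dmu_neq: "AE y in dmu \<alpha>. y \<noteq> c"
  unfolding dmu_def using AE_lborel_neq[of c] by (subst AE_density) (auto elim!: eventually_mono)

lemma dmu_ball:
  assumes \<alpha>: "\<alpha> > -1" and R: "R > 0"
  shows "emeasure (dmu \<alpha>) (ball 0 R) = ennreal (dunkl_coeff \<alpha> / (\<alpha> + 1) * R powr (2 * \<alpha> + 2))"
proof -
  let ?f = "\<lambda>t. if t \<in> {0..R} then t powr (2 * \<alpha> + 1) else 0"
  have c: "dunkl_coeff \<alpha> > 0" using \<alpha> by (rule dunkl_coeff_pos)
  have "(?f has_integral (R powr (2 * \<alpha> + 1 + 1) / (2 * \<alpha> + 1 + 1))) UNIV"
    using has_integral_powr_from_0[of "2 * \<alpha> + 1" R] \<alpha> R unfolding has_integral_restrict_UNIV by simp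
  then have I: "(\<integral>\<^sup>+t. ennreal (?f t) \<partial>lborel) = ennreal (R powr (2 * \<alpha> + 1 + 1) / (2 * \<alpha> + 1 + 1))"
    by (intro nn_integral_has_integral_lborel) auto
  let ?g = "\<lambda>t. ennreal (dunkl_coeff \<alpha> * t powr (2 * \<alpha> + 1)) * indicator {..<R} t"
  have "emeasure (dmu \<alpha>) (ball 0 R) = (\<integral>\<^sup>+x. ?g \<bar>x\<bar> \<partial>lborel)"
    unfolding dmu_def
    by (subst emeasure_density) (auto simp: dunkl_weight_def indicator_def intro!: nn_integral_cong)
  also have "\<dots> = 2 * (\<integral>\<^sup>+t\<in>{0<..}. ?g t \<partial>lborel)" by (rule nn_integral_abs) measurable
  also have "(\<integral>\<^sup>+t\<in>{0<..}. ?g t \<partial>lborel) = (\<integral>\<^sup>+t. ennreal (dunkl_coeff \<alpha>) * ennreal (?f t) \<partial>lborel)"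
    by (rule nn_integral_cong_AE, rule AE_mp[OF AE_conjI[OF AE_lborel_neq[of 0] AE_lborel_neq[of R]] AE_I2])
       (use c in \<open>auto simp: indicator_def ennreal_mult[symmetric]\<close>)
  also have "\<dots> = ennreal (dunkl_coeff \<alpha>) * ennreal (R powr (2 * \<alpha> + 1 + 1) / (2 * \<alpha> + 1 + 1))"
    unfolding I[symmetric] by (rule nn_integral_cmult) measurable
  also have "2 * \<dots> = ennreal (2 * (dunkl_coeff \<alpha> * (R powr (2 * \<alpha> + 1 + 1) / (2 * \<alpha> + 1 + 1))))"
  proof -
    have "2 * (ennreal u * ennreal v) = ennreal (2 * (u * v))" if "u \<ge> 0" "v \<ge> 0" for u v :: real
      using that by (simp add: ennreal_mult)
    then show ?thesis using c \<alpha> by simp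
  qed
  also have "2 * (dunkl_coeff \<alpha> * (R powr (2 * \<alpha> + 1 + 1) / (2 * \<alpha> + 1 + 1))) = dunkl_coeff \<alpha> / (\<alpha> + 1) * R powr (2 * \<alpha> + 2)"
    using \<alpha> by (simp add: field_simps)
  finally show ?thesis .
qed

text \<open>
  Polar coordinates: the weight \<open>\<bar>y\<bar>\<^bsup>2\<alpha>+1\<^esup>\<close> cancels all but one of the powers in the denominator.
\<close>
lemma dmu_kernel_integral:
  fixes \<rho> :: "real \<Rightarrow> real"
  assumes \<alpha>: "\<alpha> > -1" and R: "R > 0" and pos: "\<And>r. r > 0 \<Longrightarrow> \<rho> r > 0"
    and cont: "continuous_on {0<..} \<rho>"
  shows "(\<integral>\<^sup>+y\<in>ball 0 R. ennreal (\<rho> \<bar>y\<bar> / \<bar>y\<bar> powr (2 * \<alpha> + 2)) \<partial>dmu \<alpha>)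
         = ennreal (2 * dunkl_coeff \<alpha>) * (\<integral>\<^sup>+t\<in>{0<..<R}. ennreal (\<rho> t / t) \<partial>lborel)"
proof -
  have c: "dunkl_coeff \<alpha> > 0" using \<alpha> by (rule dunkl_coeff_pos)
  define r where "r t = indicator {0<..} t * \<rho> t" for t
  have [measurable]: "r \<in> borel_measurable borel"
    using borel_measurable_continuous_on_indicator[OF _ cont] unfolding r_def by simp
  let ?g = "\<lambda>t. ennreal (dunkl_coeff \<alpha>) * (ennreal (r t / t) * indicator {0<..<R} t)"
  let ?h = "\<lambda>y. ennreal (r \<bar>y\<bar> / \<bar>y\<bar> powr (2 * \<alpha> + 2)) * indicator (ball 0 R) y"
  have nz: "AE y in dmu \<alpha>. y \<noteq> 0" by (rule AE_dmu_neq)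
  have "(\<integral>\<^sup>+y\<in>ball 0 R. ennreal (\<rho> \<bar>y\<bar> / \<bar>y\<bar> powr (2 * \<alpha> + 2)) \<partial>dmu \<alpha>) = (\<integral>\<^sup>+y. ?h y \<partial>dmu \<alpha>)"
    by (rule nn_integral_cong_AE, rule AE_mp[OF nz AE_I2]) (auto simp: r_def)
  also have "\<dots> = (\<integral>\<^sup>+y. dunkl_weight \<alpha> y * ?h y \<partial>lborel)" by (rule nn_integral_dmu) measurable
  also have "\<dots> = (\<integral>\<^sup>+y. ?g \<bar>y\<bar> \<partial>lborel)"
  proof (rule nn_integral_cong_AE, rule AE_mp[OF AE_lborel_neq[of 0] AE_I2], rule impI)
    fix y :: real assume y: "y \<noteq> 0"
    show "dunkl_weight \<alpha> y * ?h y = ?g \<bar>y\<bar>"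
    proof (cases "\<bar>y\<bar> < R")
      case True
      have "t powr (2 * \<alpha> + 2) = t powr (2 * \<alpha> + 1) * t" if "t > 0" for t :: real
        using that powr_add[of t "2 * \<alpha> + 1" 1] by (simp add: add.commute)
      then have "dunkl_coeff \<alpha> * t powr (2 * \<alpha> + 1) * (q / t powr (2 * \<alpha> + 2)) = dunkl_coeff \<alpha> * (q / t)"
        if "t > 0" for t q :: real using that by simp
      from this[of "\<bar>y\<bar>" "\<rho> \<bar>y\<bar>"] show ?thesis
        using True y c pos[of "\<bar>y\<bar>"]
        by (simp add: dunkl_weight_def r_def ennreal_mult[symmetric] less_imp_le del: times_divide_eq_right)
    qed (use y in simp)
  qed
  also have "\<dots> = 2 * (\<integral>\<^sup>+t\<in>{0<..}. ?g t \<partial>lborel)" by (rule nn_integral_abs) measurable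
  also have "(\<integral>\<^sup>+t\<in>{0<..}. ?g t \<partial>lborel) = (\<integral>\<^sup>+t. ?g t \<partial>lborel)"
    by (intro nn_integral_cong) (auto simp: indicator_def)
  also have "\<dots> = ennreal (dunkl_coeff \<alpha>) * (\<integral>\<^sup>+t. ennreal (r t / t) * indicator {0<..<R} t \<partial>lborel)"
    by (rule nn_integral_cmult) measurable
  also have "(\<integral>\<^sup>+t. ennreal (r t / t) * indicator {0<..<R} t \<partial>lborel) = (\<integral>\<^sup>+t\<in>{0<..<R}. ennreal (\<rho> t / t) \<partial>lborel)"
    by (intro nn_integral_cong) (auto simp: r_def indicator_def)
  also have "2 * (ennreal (dunkl_coeff \<alpha>) * \<dots>) = ennreal (2 * dunkl_coeff \<alpha>) * \<dots>"
    using c by (simp add: ennreal_mult mult.assoc)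
  finally show ?thesis .
qed

lemma dmu_singleton: "emeasure (dmu \<alpha>) {0} = 0"
proof -
  have "{0} \<in> null_sets (dmu \<alpha>)"
    using AE_dmu_neq[of 0 \<alpha>] AE_iff_null_sets[of "{0}" "dmu \<alpha>"] by simp
  then show ?thesis by blast
qed

lemma sigma_finite_dmu: "sigma_finite_measure (dmu \<alpha>)"
  unfolding dmu_def by (subst sigma_finite_measure.sigma_finite_iff_density_finite[OF sigma_finite_lborel]) (auto simp: dunkl_weight_def)

section \<open>The Dunkl translation as a weighted average\<close>

lemma dunkl_dist_qdist: "dunkl_dist x y \<theta> = sqrt (qdist x y \<theta>)"
  by (simp add: dunkl_dist_def qdist_def)

lemma qdist_ge: "(\<bar>x\<bar> - \<bar>y\<bar>)\<^sup>2 \<le> qdist x y \<theta>"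
  and qdist_le: "qdist x y \<theta> \<le> (\<bar>x\<bar> + \<bar>y\<bar>)\<^sup>2"
proof -
  have "\<bar>x * y * cos \<theta>\<bar> \<le> \<bar>x\<bar> * \<bar>y\<bar> * 1"
    unfolding abs_mult by (intro mult_left_mono abs_cos_le_one) auto
  then have "\<bar>x * y * cos \<theta>\<bar> \<le> \<bar>x\<bar> * \<bar>y\<bar>" by simp
  then have "x * y * cos \<theta> \<le> \<bar>x\<bar> * \<bar>y\<bar>" "- (x * y * cos \<theta>) \<le> \<bar>x\<bar> * \<bar>y\<bar>" by (auto simp: abs_le_iff)
  then show "(\<bar>x\<bar> - \<bar>y\<bar>)\<^sup>2 \<le> qdist x y \<theta>" "qdist x y \<theta> \<le> (\<bar>x\<bar> + \<bar>y\<bar>)\<^sup>2"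
    unfolding qdist_def power2_diff power2_sum by (auto simp: mult.assoc)
qed

lemma qdist_nonneg: "qdist x y \<theta> \<ge> 0"
  by (rule order_trans[OF _ qdist_ge]) simp

lemma dunkl_dist_nonneg [simp]: "dunkl_dist x y \<theta> \<ge> 0"
  by (simp add: dunkl_dist_qdist qdist_nonneg)

lemma dunkl_dist_square: "(dunkl_dist x y \<theta>)\<^sup>2 = qdist x y \<theta>"
  by (simp add: dunkl_dist_qdist qdist_nonneg)

lemma dunkl_dist_ge: "\<bar>\<bar>x\<bar> - \<bar>y\<bar>\<bar> \<le> dunkl_dist x y \<theta>"
  unfolding dunkl_dist_qdist by (rule real_le_rsqrt) (simp add: qdist_ge)

lemma dunkl_dist_le: "dunkl_dist x y \<theta> \<le> \<bar>x\<bar> + \<bar>y\<bar>"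
  unfolding dunkl_dist_qdist by (rule real_le_lsqrt) (simp_all add: qdist_le)

lemma dunkl_dist_sym: "dunkl_dist x y \<theta> = dunkl_dist y x \<theta>"
  by (simp add: dunkl_dist_def algebra_simps)

text \<open>
  The quotient \<open>(x + y) / (x, y)\<^sub>\<theta>\<close> in the Dunkl translation is unbounded where \<open>y\<close> is close to \<open>x\<close>
  and \<open>\<theta>\<close> to \<open>0\<close>; there the factor \<open>1 - cos \<theta>\<close> compensates.
\<close>
lemma angular_factor_square:
  "((1 - cos \<theta>) * (x + y))\<^sup>2 \<le> 4 * qdist x y \<theta>"
proof -
  define s where "s = 1 - cos \<theta>"
  have s: "0 \<le> s" "s \<le> 2" using cos_ge_minus_one[of \<theta>] cos_le_one[of \<theta>] by (auto simp: s_def)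
  have q: "qdist x y \<theta> = (x - y)\<^sup>2 + 2 * x * y * s"
    by (simp add: qdist_def s_def power2_eq_square algebra_simps)
  \<comment> \<open>a factorisation that exhibits the difference as a product of nonnegative terms\<close>
  have id: "4 * ((x - y)\<^sup>2 + 2 * x * y * s) - (s * (x + y))\<^sup>2 = (2 - s) * ((x - y)\<^sup>2 * (2 + s) + 4 * x * y * s)"
    by (simp add: power2_eq_square algebra_simps)
  have "(x - y)\<^sup>2 * (2 + s) + 4 * x * y * s = (x - y)\<^sup>2 * (2 - s) + 2 * s * (x\<^sup>2 + y\<^sup>2)"
    by (simp add: power2_eq_square algebra_simps)
  also have "\<dots> \<ge> 0" using s by (intro add_nonneg_nonneg mult_nonneg_nonneg) auto
  finally have "(2 - s) * ((x - y)\<^sup>2 * (2 + s) + 4 * x * y * s) \<ge> 0" using s by (intro mult_nonneg_nonneg) auto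
  then show ?thesis unfolding s_def[symmetric] q using id by linarith
qed

lemma angular_factor_bound:
  "\<bar>(1 - cos \<theta>) * ((x + y) / dunkl_dist x y \<theta>)\<bar> \<le> 2"
proof (cases "dunkl_dist x y \<theta> = 0")
  case False
  then have d: "dunkl_dist x y \<theta> > 0" using dunkl_dist_nonneg[of x y \<theta>] by linarith
  let ?a = "(1 - cos \<theta>) * (x + y)"
  have "?a\<^sup>2 \<le> (2 * dunkl_dist x y \<theta>)\<^sup>2"
    using angular_factor_square[of \<theta> x y] by (simp add: power_mult_distrib dunkl_dist_square)
  then have "\<bar>?a\<bar> \<le> 2 * dunkl_dist x y \<theta>" using d abs_le_square_iff[of ?a "2 * dunkl_dist x y \<theta>"] by simp
  then have "\<bar>?a\<bar> / dunkl_dist x y \<theta> \<le> 2" using d by (simp add: pos_divide_le_eq)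
  then show ?thesis using d by (simp add: abs_divide)
qed simp

definition bool_sign :: "bool \<Rightarrow> real" where "bool_sign b = (if b then 1 else - 1)"

lemma bool_sign_simps [simp]: "bool_sign True = 1" "bool_sign False = - 1" "\<bar>bool_sign b\<bar> = 1" "bool_sign b \<noteq> 0" "bool_sign b * bool_sign b = 1"
  by (auto simp: bool_sign_def)

lemma bool_sign_measurable [measurable]: "bool_sign \<in> borel_measurable (count_space UNIV)" by simp

text \<open>
  For \<open>\<alpha> > -1/2\<close> the sample point is an angle together with a sign. The sign selects one of the two
  arguments \<open>\<plusminus>(x, y)\<^sub>\<theta>\<close> in the definition of the Dunkl translation.
\<close>
locale dunkl_alpha =
  fixes \<alpha> :: real
  assumes \<alpha>: "\<alpha> > - 1 / 2"
begin

definition angle_measure :: "real measure" where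
  "angle_measure = density lborel (\<lambda>\<theta>. ennreal (indicator {0..pi} \<theta> * angw \<alpha> \<theta>))"

definition sign_angle_measure :: "(real \<times> bool) measure" where "sign_angle_measure = angle_measure \<Otimes>\<^sub>M count_space UNIV"

definition dunkl_pos :: "real \<Rightarrow> real \<Rightarrow> real \<times> bool \<Rightarrow> real" where
  "dunkl_pos x y \<omega> = bool_sign (snd \<omega>) * dunkl_dist x y (fst \<omega>)"

definition dunkl_factor :: "real \<Rightarrow> real \<Rightarrow> real \<times> bool \<Rightarrow> real" where
  "dunkl_factor x y \<omega> = dunkl_const \<alpha> / 2 * ((1 - cos (fst \<omega>)) * (1 + bool_sign (snd \<omega>) * ((x + y) / dunkl_dist x y (fst \<omega>))))"

text \<open>
  The factor \<open>dunkl_factor\<close> as a function of \<open>x\<close>, \<open>y\<close> and the position \<open>z\<close>, with \<open>cos \<theta>\<close> expressed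
  by the law of cosines.
\<close>
definition dunkl_density :: "real \<Rightarrow> real \<Rightarrow> real \<Rightarrow> real" where
  "dunkl_density x y z = dunkl_const \<alpha> / 2 * ((1 - (x\<^sup>2 + y\<^sup>2 - z\<^sup>2) / (2 * x * y)) * (1 + (x + y) / z))"

lemma sets_angle_measure [measurable_cong, simp]: "sets angle_measure = sets borel" by (simp add: angle_measure_def)

lemma space_sign_angle_measure [simp]: "space sign_angle_measure = UNIV" by (simp add: sign_angle_measure_def angle_measure_def space_pair_measure)

lemma sets_sign_angle_measure [measurable_cong]: "sets sign_angle_measure = sets (borel \<Otimes>\<^sub>M count_space UNIV)"
  unfolding sign_angle_measure_def by (rule sets_pair_measure_cong) auto

lemma dunkl_const_eq: "dunkl_const \<alpha> = 1 / angint \<alpha> (\<lambda>_. 1)"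
proof -
  have "(LINT \<theta>:{0..pi}|lebesgue. sin \<theta> powr (2 * \<alpha>)) = (LINT \<theta>:{0..pi}|lborel. 1 * angw \<alpha> \<theta>)"
    unfolding set_lebesgue_integral_def by (subst integral_completion) (auto simp: angw_def)
  then show ?thesis by (simp add: dunkl_const_def angint_def inverse_eq_divide)
qed

lemma dunkl_const_pos: "dunkl_const \<alpha> > 0"
  using angint_1_pos \<alpha> by (simp add: dunkl_const_eq)

lemma angw_int: "integrable lborel (\<lambda>\<theta>. indicator {0..pi} \<theta> * angw \<alpha> \<theta>)"
  using angw_integrable \<alpha> by (simp add: set_integrable_def)

lemma finite_angle_measure: "finite_measure angle_measure"
proof
  have "emeasure angle_measure (space angle_measure) = (\<integral>\<^sup>+\<theta>. ennreal (indicator {0..pi} \<theta> * angw \<alpha> \<theta>) \<partial>lborel)"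
    unfolding angle_measure_def by (subst emeasure_density) auto
  also have "\<dots> < \<infinity>" using angw_int by (subst nn_integral_eq_integral) auto
  finally show "emeasure angle_measure (space angle_measure) \<noteq> \<infinity>" by simp
qed

sublocale angle_measure: finite_measure angle_measure by (rule finite_angle_measure)

sublocale CS: finite_measure "count_space (UNIV :: bool set)" by (rule finite_measure_count_space) simp

sublocale PAC: pair_sigma_finite angle_measure "count_space (UNIV :: bool set)" ..

lemma nn_integral_sign_angle_measure:
  assumes [measurable]: "F \<in> borel_measurable (borel \<Otimes>\<^sub>M count_space UNIV)"
  shows "(\<integral>\<^sup>+\<omega>. F \<omega> \<partial>sign_angle_measure) = (\<integral>\<^sup>+\<theta>\<in>{0..pi}. (ennreal (angw \<alpha> \<theta>) * (F (\<theta>, True) + F (\<theta>, False))) \<partial>lborel)"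
proof -
  have "(\<integral>\<^sup>+\<omega>. F \<omega> \<partial>sign_angle_measure) = (\<integral>\<^sup>+\<theta>. \<integral>\<^sup>+b. F (\<theta>, b) \<partial>count_space UNIV \<partial>angle_measure)"
    unfolding sign_angle_measure_def by (subst CS.nn_integral_fst) auto
  also have "\<dots> = (\<integral>\<^sup>+\<theta>. (F (\<theta>, True) + F (\<theta>, False)) \<partial>angle_measure)"
    by (simp add: nn_integral_count_space_finite UNIV_bool add.commute)
  also have "\<dots> = (\<integral>\<^sup>+\<theta>\<in>{0..pi}. (ennreal (angw \<alpha> \<theta>) * (F (\<theta>, True) + F (\<theta>, False))) \<partial>lborel)"
    unfolding angle_measure_def
    by (subst nn_integral_density) (auto intro!: nn_integral_cong simp: indicator_def)
  finally show ?thesis .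
qed

lemma integral_sign_angle_measure:
  fixes F :: "real \<times> bool \<Rightarrow> 'b::{banach,second_countable_topology}"
  assumes int: "integrable sign_angle_measure F"
  shows "(\<integral>\<omega>. F \<omega> \<partial>sign_angle_measure) = (LINT \<theta>:{0..pi}|lborel. angw \<alpha> \<theta> *\<^sub>R (F (\<theta>, True) + F (\<theta>, False)))"
proof -
  have [measurable]: "F \<in> borel_measurable (borel \<Otimes>\<^sub>M count_space UNIV)"
    using borel_measurable_integrable[OF int] by (simp cong: measurable_cong_sets add: sets_sign_angle_measure)
  have "(\<integral>\<omega>. F \<omega> \<partial>sign_angle_measure) = (\<integral>\<theta>. \<integral>b. F (\<theta>, b) \<partial>count_space UNIV \<partial>angle_measure)"
    using int unfolding sign_angle_measure_def by (subst PAC.integral_fst') auto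
  also have "\<dots> = (\<integral>\<theta>. (F (\<theta>, True) + F (\<theta>, False)) \<partial>angle_measure)"
    by (simp add: lebesgue_integral_count_space_finite UNIV_bool add.commute)
  also have "\<dots> = (LINT \<theta>:{0..pi}|lborel. angw \<alpha> \<theta> *\<^sub>R (F (\<theta>, True) + F (\<theta>, False)))"
    unfolding angle_measure_def set_lebesgue_integral_def by (subst integral_density) auto
  finally show ?thesis .
qed

lemma sign_angle_measure_finite: "finite_measure sign_angle_measure"
proof
  have "emeasure sign_angle_measure (space sign_angle_measure) = emeasure angle_measure UNIV * emeasure (count_space (UNIV::bool set)) UNIV"
    unfolding sign_angle_measure_def using CS.emeasure_pair_measure_Times[of UNIV angle_measure UNIV]
    by (simp add: space_pair_measure angle_measure_def)
  also have "\<dots> < \<infinity>" using angle_measure.emeasure_finite[of UNIV] by (simp add: ennreal_mult_less_top less_top[symmetric] ennreal_mult_eq_top_iff)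
  finally show "emeasure sign_angle_measure (space sign_angle_measure) \<noteq> \<infinity>" by simp
qed

lemma dunkl_dist_measurable [measurable (raw)]:
  assumes [measurable]: "a \<in> borel_measurable N" "b \<in> borel_measurable N" "c \<in> borel_measurable N"
  shows "(\<lambda>n. dunkl_dist (a n) (b n) (c n)) \<in> borel_measurable N"
  unfolding dunkl_dist_def by measurable

lemma dunkl_factor_bound: "\<bar>dunkl_factor x y \<omega>\<bar> \<le> max 1 (2 * dunkl_const \<alpha>)"
proof -
  obtain \<theta> b where \<omega>: "\<omega> = (\<theta>, b)" by (cases \<omega>)
  let ?s = "1 - cos \<theta>" and ?t = "(x + y) / dunkl_dist x y \<theta>"
  have s: "\<bar>?s\<bar> \<le> 2" using cos_ge_minus_one[of \<theta>] cos_le_one[of \<theta>] by auto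
  have "\<bar>?s * (1 + bool_sign b * ?t)\<bar> \<le> \<bar>?s\<bar> + \<bar>?s * ?t\<bar>"
  proof -
    have "\<bar>a * (1 + bool_sign b * t)\<bar> \<le> \<bar>a\<bar> + \<bar>a * t\<bar>" for a t :: real
      using abs_triangle_ineq[of a "a * t"] abs_triangle_ineq4[of a "a * t"] by (cases b) (simp_all add: algebra_simps)
    then show ?thesis .
  qed
  also have "\<dots> \<le> 4" using s angular_factor_bound[of \<theta> x y] by linarith
  finally have "dunkl_const \<alpha> / 2 * \<bar>?s * (1 + bool_sign b * ?t)\<bar> \<le> dunkl_const \<alpha> / 2 * 4"
    using dunkl_const_pos by (intro mult_left_mono) auto
  moreover have "\<bar>dunkl_factor x y \<omega>\<bar> = dunkl_const \<alpha> / 2 * \<bar>?s * (1 + bool_sign b * ?t)\<bar>"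
    using dunkl_const_pos by (simp only: \<omega> dunkl_factor_def fst_conv snd_conv abs_mult) (simp add: abs_mult)?
  ultimately have "\<bar>dunkl_factor x y \<omega>\<bar> \<le> 2 * dunkl_const \<alpha>" by simp
  then show ?thesis by (rule max.coboundedI2)
qed

lemma dunkl_factor_measurable [measurable (raw)]:
  assumes [measurable]: "a \<in> borel_measurable N" "b \<in> borel_measurable N" "c \<in> measurable N (borel \<Otimes>\<^sub>M count_space UNIV)"
  shows "(\<lambda>n. dunkl_factor (a n) (b n) (c n)) \<in> borel_measurable N"
  unfolding dunkl_factor_def by measurable

lemma dunkl_pos_measurable [measurable (raw)]:
  assumes [measurable]: "a \<in> borel_measurable N" "b \<in> borel_measurable N" "c \<in> measurable N (borel \<Otimes>\<^sub>M count_space UNIV)"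
  shows "(\<lambda>n. dunkl_pos (a n) (b n) (c n)) \<in> borel_measurable N"
  unfolding dunkl_pos_def by measurable

lemma dunkl_factor_int: "(\<integral>\<omega>. dunkl_factor x y \<omega> \<partial>sign_angle_measure) = 1"
proof -
  interpret PPf: finite_measure sign_angle_measure by (rule sign_angle_measure_finite)
  have "integrable sign_angle_measure (dunkl_factor x y)"
    using dunkl_factor_bound by (intro PPf.integrable_const_bound[of _ "max 1 (2 * dunkl_const \<alpha>)"]) auto
  then have "(\<integral>\<omega>. dunkl_factor x y \<omega> \<partial>sign_angle_measure) = (LINT \<theta>:{0..pi}|lborel. angw \<alpha> \<theta> *\<^sub>R (dunkl_factor x y (\<theta>, True) + dunkl_factor x y (\<theta>, False)))"
    by (rule integral_sign_angle_measure)
  also have "\<dots> = angint \<alpha> (\<lambda>\<theta>. dunkl_const \<alpha> * (1 + (-1) * cos \<theta>))"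
    unfolding angint_def set_lebesgue_integral_def
  proof (intro Bochner_Integration.integral_cong refl)
    fix \<theta>
    have *: "c / 2 * (s * (1 + 1 * t)) + c / 2 * (s * (1 + - 1 * t)) = c * s" for c s t :: real
    proof -
      have "c / 2 * (s * (1 + 1 * t)) + c / 2 * (s * (1 + - 1 * t)) = c / 2 * (s * (1 + 1 * t) + s * (1 + - 1 * t))"
        by (rule distrib_left[symmetric])
      also have "s * (1 + 1 * t) + s * (1 + - 1 * t) = 2 * s" by (simp add: algebra_simps)
      finally show ?thesis by simp
    qed
    show "indicator {0..pi} \<theta> *\<^sub>R (angw \<alpha> \<theta> *\<^sub>R (dunkl_factor x y (\<theta>, True) + dunkl_factor x y (\<theta>, False)))
      = indicator {0..pi} \<theta> *\<^sub>R (dunkl_const \<alpha> * (1 + - 1 * cos \<theta>) * angw \<alpha> \<theta>)"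
      unfolding dunkl_factor_def fst_conv snd_conv bool_sign_simps * by simp
  qed
  also have "\<dots> = dunkl_const \<alpha> * (angint \<alpha> (\<lambda>_. 1) + (-1) * angint \<alpha> cos)"
  proof -
    have "angint \<alpha> (\<lambda>\<theta>. 1 + (- 1) * cos \<theta>) = angint \<alpha> (\<lambda>_. 1) + angint \<alpha> (\<lambda>\<theta>. (- 1) * cos \<theta>)"
      using \<alpha> by (intro angint_add continuous_intros) auto
    then show ?thesis by (simp only: angint_cmult)
  qed
  also have "\<dots> = 1" using angint_1_pos[of \<alpha>] \<alpha> by (simp add: dunkl_const_eq angint_cos)
  finally show ?thesis .
qed

text \<open>
  The excluded points are those where the law of cosines does not determine the angle or where the
  position may be the origin. The symmetry is an identity of rational functions.
\<close>
lemma dunkl_density_eq: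
  assumes "x \<noteq> 0" "y \<noteq> 0" "y \<noteq> x" "y \<noteq> - x"
  shows "dunkl_factor x y \<omega> = dunkl_density x y (dunkl_pos x y \<omega>) \<and> dunkl_density x y (dunkl_pos x y \<omega>) = dunkl_density (- x) (dunkl_pos x y \<omega>) y"
proof -
  obtain \<theta> b where \<omega>: "\<omega> = (\<theta>, b)" by (cases \<omega>)
  have "\<bar>x\<bar> \<noteq> \<bar>y\<bar>" using assms by (auto simp: abs_if split: if_splits)
  then have "\<bar>\<bar>x\<bar> - \<bar>y\<bar>\<bar> > 0" by simp
  then have d: "dunkl_dist x y \<theta> > 0" using dunkl_dist_ge[of x y \<theta>] by linarith
  define z where "z = dunkl_pos x y \<omega>"
  have z: "z \<noteq> 0" using d by (auto simp: z_def dunkl_pos_def \<omega> bool_sign_def)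
  have "z\<^sup>2 = qdist x y \<theta>" by (simp add: z_def dunkl_pos_def \<omega> power_mult_distrib dunkl_dist_square power2_eq_square[of "bool_sign b"])
  then have "(x\<^sup>2 + y\<^sup>2 - z\<^sup>2) / (2 * x * y) = cos \<theta>" using assms by (simp add: qdist_def)
  moreover have "(x + y) / z = bool_sign b * ((x + y) / dunkl_dist x y \<theta>)"
    by (cases b) (simp_all add: z_def dunkl_pos_def \<omega> minus_divide_left)
  ultimately have "dunkl_factor x y \<omega> = dunkl_density x y z" by (simp add: dunkl_density_def dunkl_factor_def \<omega>)
  moreover have "dunkl_density x y z = dunkl_density (- x) z y"
    using assms z by (simp add: dunkl_density_def field_simps power2_eq_square)
  ultimately show ?thesis by (simp add: z_def)
qed

end

section \<open>Duality of the Dunkl translation\<close>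

text \<open>
  Heron's polynomial: sixteen times the squared area of the triangle with sides \<open>\<bar>x\<bar>, \<bar>y\<bar>, \<bar>z\<bar>\<close>.
\<close>
definition heron :: "real \<Rightarrow> real \<Rightarrow> real \<Rightarrow> real" where
  "heron x y z = 4 * x\<^sup>2 * y\<^sup>2 - (x\<^sup>2 + y\<^sup>2 - z\<^sup>2)\<^sup>2"

definition triangle :: "real \<Rightarrow> real \<Rightarrow> real \<Rightarrow> bool" where
  "triangle x y z \<longleftrightarrow> \<bar>\<bar>x\<bar> - \<bar>y\<bar>\<bar> < \<bar>z\<bar> \<and> \<bar>z\<bar> < \<bar>x\<bar> + \<bar>y\<bar>"

lemma heron_swap: "heron x z y = heron x y z"
  by (simp add: heron_def power2_eq_square algebra_simps)

lemma heron_minus: "heron (- x) y z = heron x y z" "heron x y (- z) = heron x y z"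
  by (simp_all add: heron_def)

lemma triangle_swap: "triangle x z y = triangle x y z"
proof -
  have "\<bar>a - b\<bar> < c \<and> c < a + b \<longleftrightarrow> \<bar>a - c\<bar> < b \<and> b < a + c" for a b c :: real by linarith
  then show ?thesis unfolding triangle_def by blast
qed

lemma triangle_minus: "triangle (- x) y z = triangle x y z" "triangle x y (- z) = triangle x y z"
  by (simp_all add: triangle_def)

lemma heron_pos: assumes "triangle x y z" shows "heron x y z > 0"
proof -
  have "heron x y z = ((\<bar>x\<bar> + \<bar>y\<bar>)\<^sup>2 - z\<^sup>2) * (z\<^sup>2 - (\<bar>x\<bar> - \<bar>y\<bar>)\<^sup>2)"
  proof -
    have "4 * a\<^sup>2 * b\<^sup>2 - (a\<^sup>2 + b\<^sup>2 - z\<^sup>2)\<^sup>2 = ((a + b)\<^sup>2 - z\<^sup>2) * (z\<^sup>2 - (a - b)\<^sup>2)" for a b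
      by (simp add: power2_eq_square algebra_simps)
    from this[of "\<bar>x\<bar>" "\<bar>y\<bar>"] show ?thesis by (simp add: heron_def)
  qed
  moreover have "z\<^sup>2 < (\<bar>x\<bar> + \<bar>y\<bar>)\<^sup>2"
    using assms power_strict_mono[of "\<bar>z\<bar>" "\<bar>x\<bar> + \<bar>y\<bar>" 2] by (simp add: triangle_def)
  moreover have "(\<bar>x\<bar> - \<bar>y\<bar>)\<^sup>2 < z\<^sup>2"
    using assms power_strict_mono[of "\<bar>\<bar>x\<bar> - \<bar>y\<bar>\<bar>" "\<bar>z\<bar>" 2] by (simp add: triangle_def)
  ultimately show ?thesis by simp
qed

context dunkl_alpha begin

text \<open>
  The angular weight \<open>sin\<^sup>2\<^sup>\<alpha> \<theta>\<close> divided by \<open>\<bar>dz / d\<theta>\<bar>\<close>, in terms of \<open>z = (x, y)\<^sub>\<theta>\<close>; the quotient under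
  the power is \<open>sin\<^sup>2 \<theta>\<close>.
\<close>
definition jac :: "real \<Rightarrow> real \<Rightarrow> real \<Rightarrow> real" where
  "jac x y z = (heron x y z / (4 * x\<^sup>2 * y\<^sup>2)) powr (\<alpha> - 1/2) * \<bar>z\<bar> / \<bar>x * y\<bar>"

definition angle_density :: "real \<Rightarrow> real \<Rightarrow> real \<Rightarrow> ennreal" where
  "angle_density x y z = (if triangle x y z then ennreal (jac x y z) else 0)"

lemma angle_density_minus: "angle_density (- x) y z = angle_density x y z" "angle_density x y (- z) = angle_density x y z"
  by (simp_all add: angle_density_def jac_def heron_minus triangle_minus)

lemma angle_density_measurable [measurable]: "angle_density x y \<in> borel_measurable borel"
  unfolding angle_density_def[abs_def] triangle_def jac_def heron_def by measurable

text \<open>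
  For \<open>x y > 0\<close> the distance increases from \<open>\<bar>x - y\<bar>\<close> to \<open>\<bar>x + y\<bar>\<close> as \<open>\<theta>\<close> runs from \<open>0\<close> to \<open>\<pi>\<close>, and
  \<open>x \<noteq> y\<close> keeps it away from \<open>0\<close>, so that the square root is differentiable.
\<close>
lemma angular_substitution_pos:
  assumes xy: "x * y > 0" "x \<noteq> y" and [measurable]: "G \<in> borel_measurable borel"
  shows "(\<integral>\<^sup>+\<theta>\<in>{0..pi}. (G (dunkl_dist x y \<theta>) * ennreal (angw \<alpha> \<theta>)) \<partial>lborel)
     = (\<integral>\<^sup>+z\<in>{0<..}. (G z * angle_density x y z) \<partial>lborel)"
proof -
  have nz: "x \<noteq> 0" "y \<noteq> 0" using xy by auto
  let ?d = "dunkl_dist x y" and ?g' = "\<lambda>\<theta>. x * y * sin \<theta> / dunkl_dist x y \<theta>"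
  have "\<bar>x - y\<bar> = \<bar>\<bar>x\<bar> - \<bar>y\<bar>\<bar>" "\<bar>x + y\<bar> = \<bar>x\<bar> + \<bar>y\<bar>"
    using xy by (auto simp: zero_less_mult_iff)
  moreover have "\<bar>x * y\<bar> = x * y" using xy by simp
  ultimately have abs: "\<bar>x - y\<bar> = \<bar>\<bar>x\<bar> - \<bar>y\<bar>\<bar>" "\<bar>x + y\<bar> = \<bar>x\<bar> + \<bar>y\<bar>" "\<bar>x * y\<bar> = x * y" by auto
  have "\<bar>\<bar>x\<bar> - \<bar>y\<bar>\<bar> > 0" using abs xy by auto
  then have dpos: "?d \<theta> > 0" for \<theta> using dunkl_dist_ge[of x y \<theta>] by linarith
  have der: "(?d has_real_derivative ?g' \<theta>) (at \<theta>)" for \<theta>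
  proof -
    have q: "qdist x y \<theta> > 0" using dpos[of \<theta>] unfolding dunkl_dist_qdist by simp
    have q': "(qdist x y has_real_derivative 2 * x * y * sin \<theta>) (at \<theta>)"
      unfolding qdist_def[abs_def] by (auto intro!: derivative_eq_intros)
    have "((\<lambda>\<theta>. sqrt (qdist x y \<theta>)) has_real_derivative (inverse (sqrt (qdist x y \<theta>)) / 2) * (2 * x * y * sin \<theta>)) (at \<theta>)"
      by (rule DERIV_chain2[where f = sqrt and g = "qdist x y", OF DERIV_real_sqrt[OF q] q'])
    then show ?thesis by (simp add: dunkl_dist_qdist[abs_def] field_simps)
  qed
  have cont: "continuous_on {0..pi} ?g'"
    using dpos by (intro continuous_intros) (auto simp: dunkl_dist_def[abs_def] less_imp_neq[symmetric] intro!: continuous_intros)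
  have d0: "?d 0 = \<bar>x - y\<bar>" "?d pi = \<bar>x + y\<bar>"
  proof -
    have "x\<^sup>2 + y\<^sup>2 - 2 * x * y * cos 0 = (x - y)\<^sup>2" "x\<^sup>2 + y\<^sup>2 - 2 * x * y * cos pi = (x + y)\<^sup>2"
      by (simp_all add: power2_eq_square algebra_simps)
    then show "?d 0 = \<bar>x - y\<bar>" "?d pi = \<bar>x + y\<bar>" unfolding dunkl_dist_def by (simp_all only: real_sqrt_abs)
  qed
  have [measurable]: "jac x y \<in> borel_measurable borel" unfolding jac_def[abs_def] heron_def by measurable
  have "(\<integral>\<^sup>+z\<in>{0<..}. (G z * angle_density x y z) \<partial>lborel) = (\<integral>\<^sup>+z. (G z * ennreal (jac x y z)) * indicator {?d 0..?d pi} z \<partial>lborel)"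
    unfolding d0 abs(1,2)
  proof (rule nn_integral_cong_AE, rule AE_mp[OF AE_conjI[OF AE_lborel_neq[of "\<bar>\<bar>x\<bar> - \<bar>y\<bar>\<bar>"] AE_lborel_neq[of "\<bar>x\<bar> + \<bar>y\<bar>"]] AE_I2], rule impI)
    fix z assume z: "z \<noteq> \<bar>\<bar>x\<bar> - \<bar>y\<bar>\<bar> \<and> z \<noteq> \<bar>x\<bar> + \<bar>y\<bar>"
    have *: "0 < z \<and> a < \<bar>z\<bar> \<and> \<bar>z\<bar> < b \<longleftrightarrow> a \<le> z \<and> z \<le> b" if "z \<noteq> a" "z \<noteq> b" "0 < a" for a b :: real
      using that by linarith
    have "0 < z \<and> triangle x y z \<longleftrightarrow> \<bar>\<bar>x\<bar> - \<bar>y\<bar>\<bar> \<le> z \<and> z \<le> \<bar>x\<bar> + \<bar>y\<bar>"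
      unfolding triangle_def by (rule *) (use z \<open>\<bar>\<bar>x\<bar> - \<bar>y\<bar>\<bar> > 0\<close> in blast)+
    then show "G z * angle_density x y z * indicator {0<..} z = G z * ennreal (jac x y z) * indicator {\<bar>\<bar>x\<bar> - \<bar>y\<bar>\<bar>..\<bar>x\<bar> + \<bar>y\<bar>} z"
      unfolding indicator_def angle_density_def atLeastAtMost_iff greaterThan_iff by auto
  qed
  also have "\<dots> = (\<integral>\<^sup>+\<theta>. (G (?d \<theta>) * ennreal (jac x y (?d \<theta>))) * ennreal (?g' \<theta>) * indicator {0..pi} \<theta> \<partial>lborel)"
  proof (rule nn_integral_substitution_aux[OF _ _ der cont])
    show "0 \<le> ?g' \<theta>" if "\<theta> \<in> {0..pi}" for \<theta>
      using that xy(1) dpos[of \<theta>] sin_ge_zero[of \<theta>] by simp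
  qed simp_all
  also have "\<dots> = (\<integral>\<^sup>+\<theta>\<in>{0..pi}. (G (dunkl_dist x y \<theta>) * ennreal (angw \<alpha> \<theta>)) \<partial>lborel)"
  proof (rule nn_integral_cong_AE, rule AE_mp[OF AE_conjI[OF AE_lborel_neq[of 0] AE_lborel_neq[of pi]] AE_I2], rule impI)
    fix \<theta> :: real assume ne: "\<theta> \<noteq> 0 \<and> \<theta> \<noteq> pi"
    show "G (?d \<theta>) * ennreal (jac x y (?d \<theta>)) * ennreal (?g' \<theta>) * indicator {0..pi} \<theta>
      = G (?d \<theta>) * ennreal (angw \<alpha> \<theta>) * indicator {0..pi} \<theta>"
    proof (cases "\<theta> \<in> {0..pi}")
      case True
      then have s: "sin \<theta> > 0" using ne by (intro sin_gt_zero) auto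
      have "heron x y (?d \<theta>) = 4 * x\<^sup>2 * y\<^sup>2 * (sin \<theta>)\<^sup>2"
      proof -
        have "x\<^sup>2 + y\<^sup>2 - qdist x y \<theta> = 2 * x * y * cos \<theta>" by (simp add: qdist_def)
        then show ?thesis
          unfolding heron_def dunkl_dist_square sin_squared_eq by (simp add: power_mult_distrib right_diff_distrib)
      qed
      then have "heron x y (?d \<theta>) / (4 * x\<^sup>2 * y\<^sup>2) = (sin \<theta>)\<^sup>2" using nz by simp
      then have "jac x y (?d \<theta>) = (sin \<theta>)\<^sup>2 powr (\<alpha> - 1/2) * ?d \<theta> / (x * y)"
        by (simp only: jac_def abs) simp
      also have "(sin \<theta>)\<^sup>2 powr (\<alpha> - 1/2) = sin \<theta> powr (2 * \<alpha> - 1)"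
      proof -
        have "(sin \<theta>)\<^sup>2 = sin \<theta> powr 2" using s by (simp add: powr_numeral)
        then have "(sin \<theta>)\<^sup>2 powr (\<alpha> - 1/2) = (sin \<theta> powr 2) powr (\<alpha> - 1/2)" by (rule arg_cong)
        also have "\<dots> = sin \<theta> powr (2 * (\<alpha> - 1/2))" by (rule powr_powr)
        finally show ?thesis by (simp add: right_diff_distrib)
      qed
      finally have j: "jac x y (?d \<theta>) = sin \<theta> powr (2 * \<alpha> - 1) * ?d \<theta> / (x * y)" .
      have "jac x y (?d \<theta>) * ?g' \<theta> = sin \<theta> powr (2 * \<alpha> - 1) * sin \<theta>"
        unfolding j using dpos[of \<theta>] nz by simp
      also have "\<dots> = angw \<alpha> \<theta>" using s by (simp add: angw_def powr_diff)
      finally have "jac x y (?d \<theta>) * ?g' \<theta> = angw \<alpha> \<theta>" .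
      moreover have "jac x y (?d \<theta>) \<ge> 0" "?g' \<theta> \<ge> 0" using xy dpos[of \<theta>] s by (auto simp: jac_def)
      ultimately have "ennreal (jac x y (?d \<theta>)) * ennreal (?g' \<theta>) = ennreal (angw \<alpha> \<theta>)"
        by (simp only: ennreal_mult[symmetric])
      then show ?thesis by (simp only: mult.assoc)
    qed simp
  qed
  finally show ?thesis ..
qed

text \<open>
  The reflection \<open>\<theta> \<mapsto> \<pi> - \<theta>\<close> exchanges \<open>x\<close> and \<open>- x\<close>.
\<close>
lemma angular_substitution:
  assumes xy: "x \<noteq> 0" "y \<noteq> 0" "y \<noteq> x" "y \<noteq> - x" and [measurable]: "G \<in> borel_measurable borel"
  shows "(\<integral>\<^sup>+\<theta>\<in>{0..pi}. (G (dunkl_dist x y \<theta>) * ennreal (angw \<alpha> \<theta>)) \<partial>lborel)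
     = (\<integral>\<^sup>+z\<in>{0<..}. (G z * angle_density x y z) \<partial>lborel)"
proof (cases "x * y > 0")
  case True
  then show ?thesis using angular_substitution_pos[of x y G] xy by auto
next
  case False
  then have neg: "(- x) * y > 0" "- x \<noteq> y" using xy by (auto simp: mult_less_0_iff not_less order.order_iff_strict)
  have "(\<integral>\<^sup>+\<theta>\<in>{0..pi}. (G (dunkl_dist (- x) y \<theta>) * ennreal (angw \<alpha> \<theta>)) \<partial>lborel)
    = (\<integral>\<^sup>+\<theta>. G (dunkl_dist (- x) y (pi + (- 1) * \<theta>)) * ennreal (angw \<alpha> (pi + (- 1) * \<theta>)) * indicator {0..pi} (pi + (- 1) * \<theta>) \<partial>lborel)"
    by (subst nn_integral_real_affine[of _ "-1" pi]) auto
  also have "\<dots> = (\<integral>\<^sup>+\<theta>\<in>{0..pi}. (G (dunkl_dist x y \<theta>) * ennreal (angw \<alpha> \<theta>)) \<partial>lborel)"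
    by (intro nn_integral_cong) (auto simp: indicator_def dunkl_dist_def angw_def cos_diff sin_diff)
  finally show ?thesis using angular_substitution_pos[OF neg, of G] by (simp add: angle_density_minus)
qed

text \<open>
  The joint density of \<open>(y, z)\<close>, with the powers of \<open>y\<close> from the measure and from \<open>jac\<close> combined. In
  this form the symmetry in \<open>y\<close> and \<open>z\<close> is visible.
\<close>
definition dual_density :: "real \<Rightarrow> real \<Rightarrow> real \<Rightarrow> ennreal" where
  "dual_density x y z = (if triangle x y z then
     ennreal (dunkl_coeff \<alpha> * ((heron x y z / (4 * x\<^sup>2)) powr (\<alpha> - 1/2) * (\<bar>y\<bar> * \<bar>z\<bar> / \<bar>x\<bar>))) else 0)"

lemma dual_density_swap: "dual_density (- x) z y = dual_density x y z"
  unfolding dual_density_def heron_minus triangle_minus heron_swap[of x z y] triangle_swap[of x z y]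
  by (simp add: mult.commute)

lemma dual_density_measurable [measurable]:
  "(\<lambda>(y, z). dual_density x y z) \<in> borel_measurable (borel \<Otimes>\<^sub>M borel)"
  unfolding dual_density_def triangle_def heron_def by measurable

lemma dual_density_eq:
  assumes "x \<noteq> 0" "y \<noteq> 0" shows "dunkl_weight \<alpha> y * angle_density x y z = dual_density x y z"
proof (cases "triangle x y z")
  case True
  have c: "dunkl_coeff \<alpha> > 0" using \<alpha> by (intro dunkl_coeff_pos) auto
  let ?b = "\<alpha> - 1/2" and ?h = "heron x y z / (4 * x\<^sup>2)"
  have h: "?h > 0" using heron_pos[OF True] assms by simp
  have 1: "heron x y z / (4 * x\<^sup>2 * y\<^sup>2) = ?h / y\<^sup>2" by simp
  have 2: "(?h / y\<^sup>2) powr ?b = ?h powr ?b / (y\<^sup>2) powr ?b" by (rule powr_divide)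
  have 3: "(y\<^sup>2) powr ?b = \<bar>y\<bar> powr (2 * \<alpha> - 1)"
  proof -
    have "y\<^sup>2 = \<bar>y\<bar> powr 2" using assms by (simp add: powr_numeral)
    then have "(y\<^sup>2) powr ?b = (\<bar>y\<bar> powr 2) powr ?b" by (rule arg_cong)
    also have "\<dots> = \<bar>y\<bar> powr (2 * ?b)" by (rule powr_powr)
    finally show ?thesis by (simp add: algebra_simps)
  qed
  have 4: "\<bar>y\<bar> powr (2 * \<alpha> + 1) = \<bar>y\<bar> powr (2 * \<alpha> - 1) * \<bar>y\<bar>\<^sup>2"
    using assms powr_add[of "\<bar>y\<bar>" "2 * \<alpha> - 1" 2] by (simp add: powr_numeral add.commute)
  have 5: "\<bar>y\<bar> powr (2 * \<alpha> - 1) > 0" "\<bar>y\<bar> > 0" "\<bar>x\<bar> > 0" using assms by auto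
  have "dunkl_coeff \<alpha> * \<bar>y\<bar> powr (2 * \<alpha> + 1) * jac x y z
      = dunkl_coeff \<alpha> * (?h powr ?b * (\<bar>y\<bar> * \<bar>z\<bar> / \<bar>x\<bar>))"
    unfolding jac_def 1 2 3 4 abs_mult using 5 by (simp add: power2_eq_square field_simps)
  moreover have "jac x y z \<ge> 0" by (simp add: jac_def)
  ultimately show ?thesis using True c
    by (simp add: dunkl_weight_def angle_density_def dual_density_def ennreal_mult[symmetric] less_imp_le)
qed (simp add: angle_density_def dual_density_def)

lemma dual_kernel_form:
  assumes x: "x \<noteq> 0" and F: "(\<lambda>(y, z). F y z) \<in> borel_measurable (borel \<Otimes>\<^sub>M borel)"
  shows "(\<integral>\<^sup>+y. (\<integral>\<^sup>+\<omega>. F y (dunkl_pos x y \<omega>) \<partial>sign_angle_measure) \<partial>dmu \<alpha>) = (\<integral>\<^sup>+y. (\<integral>\<^sup>+z. F y z * dual_density x y z \<partial>lborel) \<partial>lborel)"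
proof -
  have [measurable (raw)]: "(\<lambda>q. F (a q) (b q)) \<in> borel_measurable N"
    if "a \<in> borel_measurable N" "b \<in> borel_measurable N" for a b and N :: "'z measure"
    using measurable_compose[OF measurable_Pair[OF that] F] by simp
  interpret PPf: finite_measure sign_angle_measure by (rule sign_angle_measure_finite)
  have [measurable (raw)]: "(\<lambda>q. dual_density x (a q) (b q)) \<in> borel_measurable N"
    if "a \<in> borel_measurable N" "b \<in> borel_measurable N" for a b and N :: "'z measure"
    using measurable_compose[OF measurable_Pair[OF that] dual_density_measurable[of x]] by simp
  have m: "(\<lambda>y. \<integral>\<^sup>+\<omega>. F y (dunkl_pos x y \<omega>) \<partial>sign_angle_measure) \<in> borel_measurable borel"
    by measurable
  have "(\<integral>\<^sup>+y. (\<integral>\<^sup>+\<omega>. F y (dunkl_pos x y \<omega>) \<partial>sign_angle_measure) \<partial>dmu \<alpha>) = (\<integral>\<^sup>+y. dunkl_weight \<alpha> y * (\<integral>\<^sup>+\<omega>. F y (dunkl_pos x y \<omega>) \<partial>sign_angle_measure) \<partial>lborel)"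
    by (rule nn_integral_dmu[OF m])
  also have "\<dots> = (\<integral>\<^sup>+y. (\<integral>\<^sup>+z. F y z * dual_density x y z \<partial>lborel) \<partial>lborel)"
  proof (rule nn_integral_cong_AE, rule AE_mp[OF AE_conjI[OF AE_lborel_neq[of 0] AE_conjI[OF AE_lborel_neq[of x] AE_lborel_neq[of "- x"]]] AE_I2], rule impI)
    fix y assume y: "y \<noteq> 0 \<and> y \<noteq> x \<and> y \<noteq> - x"
    have "(\<integral>\<^sup>+\<omega>. F y (dunkl_pos x y \<omega>) \<partial>sign_angle_measure)
      = (\<integral>\<^sup>+\<theta>\<in>{0..pi}. ((F y (dunkl_dist x y \<theta>) + F y (- dunkl_dist x y \<theta>)) * ennreal (angw \<alpha> \<theta>)) \<partial>lborel)"
      by (subst nn_integral_sign_angle_measure) (auto simp: dunkl_pos_def mult.commute)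
    also have "\<dots> = (\<integral>\<^sup>+z\<in>{0<..}. ((F y z + F y (- z)) * angle_density x y z) \<partial>lborel)"
      using y x by (intro angular_substitution[where G = "\<lambda>z. F y z + F y (- z)"]) auto
    also have "\<dots> = (\<integral>\<^sup>+z\<in>{0<..}. (F y z * angle_density x y z + F y (- z) * angle_density x y (- z)) \<partial>lborel)"
      by (simp add: angle_density_minus distrib_right)
    also have "\<dots> = (\<integral>\<^sup>+z. F y z * angle_density x y z \<partial>lborel)"
      by (rule nn_integral_split_sign[symmetric]) measurable
    finally have "dunkl_weight \<alpha> y * (\<integral>\<^sup>+\<omega>. F y (dunkl_pos x y \<omega>) \<partial>sign_angle_measure) = (\<integral>\<^sup>+z. dunkl_weight \<alpha> y * (F y z * angle_density x y z) \<partial>lborel)"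
      by (simp add: nn_integral_cmult)
    also have "\<dots> = (\<integral>\<^sup>+z. F y z * dual_density x y z \<partial>lborel)"
      using y x by (intro nn_integral_cong) (simp add: dual_density_eq[symmetric] mult_ac)
    finally show "dunkl_weight \<alpha> y * (\<integral>\<^sup>+\<omega>. F y (dunkl_pos x y \<omega>) \<partial>sign_angle_measure) = (\<integral>\<^sup>+z. F y z * dual_density x y z \<partial>lborel)" .
  qed
  finally show ?thesis .
qed

lemma dunkl_pos_zero: "dunkl_pos 0 y \<omega> = bool_sign (snd \<omega>) * \<bar>y\<bar>"
  by (simp add: dunkl_pos_def dunkl_dist_def)

text \<open>
  For \<open>x \<noteq> 0\<close> this is the symmetry of the density. For \<open>x = 0\<close> there is no density: the positions
  are \<open>y\<close> and \<open>- y\<close>, and the reflection invariance of the measure takes its place.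
\<close>
lemma dual_nn_sign_angle_measure:
  assumes F: "(\<lambda>(y, z). F y z) \<in> borel_measurable (borel \<Otimes>\<^sub>M borel)"
  shows "(\<integral>\<^sup>+y. (\<integral>\<^sup>+\<omega>. F y (dunkl_pos x y \<omega>) \<partial>sign_angle_measure) \<partial>dmu \<alpha>) = (\<integral>\<^sup>+z. (\<integral>\<^sup>+\<omega>. F (dunkl_pos (- x) z \<omega>) z \<partial>sign_angle_measure) \<partial>dmu \<alpha>)"
proof -
  have [measurable (raw)]: "(\<lambda>q. F (a q) (b q)) \<in> borel_measurable N"
    if "a \<in> borel_measurable N" "b \<in> borel_measurable N" for a b and N :: "'z measure"
    using measurable_compose[OF measurable_Pair[OF that] F] by simp
  show ?thesis
  proof (cases "x = 0")
    case False
    have [measurable (raw)]: "(\<lambda>q. dual_density x (a q) (b q)) \<in> borel_measurable N"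
      if "a \<in> borel_measurable N" "b \<in> borel_measurable N" for a b and N :: "'z measure"
      using measurable_compose[OF measurable_Pair[OF that] dual_density_measurable[of x]] by simp
    have "(\<integral>\<^sup>+z. (\<integral>\<^sup>+\<omega>. F (dunkl_pos (- x) z \<omega>) z \<partial>sign_angle_measure) \<partial>dmu \<alpha>) = (\<integral>\<^sup>+z. (\<integral>\<^sup>+y. F y z * dual_density (- x) z y \<partial>lborel) \<partial>lborel)"
      using False by (intro dual_kernel_form[where F = "\<lambda>z y. F y z"]) auto
    also have "\<dots> = (\<integral>\<^sup>+y. (\<integral>\<^sup>+z. F y z * dual_density x y z \<partial>lborel) \<partial>lborel)"
      unfolding dual_density_swap by (rule lborel_pair.Fubini') measurable
    also have "\<dots> = (\<integral>\<^sup>+y. (\<integral>\<^sup>+\<omega>. F y (dunkl_pos x y \<omega>) \<partial>sign_angle_measure) \<partial>dmu \<alpha>)"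
      by (rule dual_kernel_form[OF False F, symmetric])
    finally show ?thesis ..
  next
    case True
    interpret PPf: finite_measure sign_angle_measure by (rule sign_angle_measure_finite)
    define I where "I = (\<integral>\<^sup>+\<theta>\<in>{0..pi}. ennreal (angw \<alpha> \<theta>) \<partial>lborel)"
    have *: "(\<integral>\<^sup>+\<omega>. H (dunkl_pos 0 y \<omega>) \<partial>sign_angle_measure) = I * (H y + H (- y))" if [measurable]: "H \<in> borel_measurable borel" for H y
    proof -
      have "(\<integral>\<^sup>+\<omega>. H (dunkl_pos 0 y \<omega>) \<partial>sign_angle_measure) = (\<integral>\<^sup>+\<theta>\<in>{0..pi}. (ennreal (angw \<alpha> \<theta>) * (H \<bar>y\<bar> + H (- \<bar>y\<bar>))) \<partial>lborel)"
        unfolding dunkl_pos_zero by (subst nn_integral_sign_angle_measure) auto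
      also have "\<dots> = (\<integral>\<^sup>+\<theta>. ennreal (angw \<alpha> \<theta>) * indicator {0..pi} \<theta> * (H \<bar>y\<bar> + H (- \<bar>y\<bar>)) \<partial>lborel)"
        by (simp add: mult_ac)
      also have "\<dots> = I * (H \<bar>y\<bar> + H (- \<bar>y\<bar>))" unfolding I_def by (rule nn_integral_multc) measurable
      also have "H \<bar>y\<bar> + H (- \<bar>y\<bar>) = H y + H (- y)" by (auto simp: abs_if add.commute)
      finally show ?thesis .
    qed
    have "(\<integral>\<^sup>+y. (\<integral>\<^sup>+\<omega>. F y (dunkl_pos 0 y \<omega>) \<partial>sign_angle_measure) \<partial>dmu \<alpha>) = (\<integral>\<^sup>+y. I * (F y y + F y (- y)) \<partial>dmu \<alpha>)"
      by (intro nn_integral_cong *) measurable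
    also have "\<dots> = (\<integral>\<^sup>+y. dunkl_weight \<alpha> y * (I * F y y) + dunkl_weight \<alpha> y * (I * F y (- y)) \<partial>lborel)"
      by (subst nn_integral_dmu) (auto simp: distrib_left)
    also have "\<dots> = (\<integral>\<^sup>+y. dunkl_weight \<alpha> y * (I * F y y) \<partial>lborel) + (\<integral>\<^sup>+y. dunkl_weight \<alpha> y * (I * F y (- y)) \<partial>lborel)"
      by (rule nn_integral_add) measurable
    also have "(\<integral>\<^sup>+y. dunkl_weight \<alpha> y * (I * F y (- y)) \<partial>lborel) = (\<integral>\<^sup>+y. dunkl_weight \<alpha> (- y) * (I * F (- y) (- (- y))) \<partial>lborel)"
      by (rule nn_integral_uminus[symmetric]) measurable
    also have "(\<integral>\<^sup>+y. dunkl_weight \<alpha> y * (I * F y y) \<partial>lborel) + \<dots>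
      = (\<integral>\<^sup>+y. dunkl_weight \<alpha> y * (I * F y y) + dunkl_weight \<alpha> (- y) * (I * F (- y) (- (- y))) \<partial>lborel)"
      by (rule nn_integral_add[symmetric]) measurable
    also have "\<dots> = (\<integral>\<^sup>+z. I * (F z z + F (- z) z) \<partial>dmu \<alpha>)"
      by (subst nn_integral_dmu) (auto simp: distrib_left dunkl_weight_def)
    also have "\<dots> = (\<integral>\<^sup>+z. (\<integral>\<^sup>+\<omega>. F (dunkl_pos 0 z \<omega>) z \<partial>sign_angle_measure) \<partial>dmu \<alpha>)"
      by (intro nn_integral_cong *[symmetric]) measurable
    finally show ?thesis using True by simp
  qed
qed

sublocale dm: sigma_finite_measure "dmu \<alpha>" by (rule sigma_finite_dmu)
sublocale PPf: finite_measure sign_angle_measure by (rule sign_angle_measure_finite)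
sublocale dmPP: pair_sigma_finite "dmu \<alpha>" sign_angle_measure ..

lemma dual_distr_sign_angle_measure:
  "distr (dmu \<alpha> \<Otimes>\<^sub>M sign_angle_measure) (borel \<Otimes>\<^sub>M borel) (\<lambda>(y, \<omega>). (y, dunkl_pos x y \<omega>))
     = distr (dmu \<alpha> \<Otimes>\<^sub>M sign_angle_measure) (borel \<Otimes>\<^sub>M borel) (\<lambda>(z, \<omega>). (dunkl_pos (- x) z \<omega>, z))" (is "?L = ?R")
proof (rule measure_eqI)
  fix A assume "A \<in> sets ?L"
  then have A [measurable]: "A \<in> sets (borel \<Otimes>\<^sub>M borel)" by simp
  have 1: "(\<lambda>(y, \<omega>). (y, dunkl_pos x y \<omega>)) \<in> measurable (dmu \<alpha> \<Otimes>\<^sub>M sign_angle_measure) (borel \<Otimes>\<^sub>M borel)"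
    and 2: "(\<lambda>(z, \<omega>). (dunkl_pos (- x) z \<omega>, z)) \<in> measurable (dmu \<alpha> \<Otimes>\<^sub>M sign_angle_measure) (borel \<Otimes>\<^sub>M borel)"
    by measurable
  have "emeasure ?L A = (\<integral>\<^sup>+q. indicator A q \<partial>?L)" using A by simp
  also have "\<dots> = (\<integral>\<^sup>+q. indicator A (fst q, dunkl_pos x (fst q) (snd q)) \<partial>(dmu \<alpha> \<Otimes>\<^sub>M sign_angle_measure))"
    by (subst nn_integral_distr[OF 1]) (auto simp: case_prod_beta')
  also have "\<dots> = (\<integral>\<^sup>+y. (\<integral>\<^sup>+\<omega>. indicator A (y, dunkl_pos x y \<omega>) \<partial>sign_angle_measure) \<partial>dmu \<alpha>)"
    by (subst PPf.nn_integral_fst[symmetric]) auto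
  also have "\<dots> = (\<integral>\<^sup>+z. (\<integral>\<^sup>+\<omega>. indicator A (dunkl_pos (- x) z \<omega>, z) \<partial>sign_angle_measure) \<partial>dmu \<alpha>)"
    by (rule dual_nn_sign_angle_measure[where F = "\<lambda>y z. indicator A (y, z)"]) measurable
  also have "\<dots> = (\<integral>\<^sup>+q. indicator A (dunkl_pos (- x) (fst q) (snd q), fst q) \<partial>(dmu \<alpha> \<Otimes>\<^sub>M sign_angle_measure))"
    by (subst PPf.nn_integral_fst[symmetric]) auto
  also have "\<dots> = (\<integral>\<^sup>+q. indicator A q \<partial>?R)"
    by (subst nn_integral_distr[OF 2]) (auto simp: case_prod_beta')
  also have "\<dots> = emeasure ?R A" using A by simp
  finally show "emeasure ?L A = emeasure ?R A" .
qed simp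

sublocale tr: averaged_translation "dmu \<alpha>" sign_angle_measure dunkl_pos dunkl_factor dunkl_density "max 1 (2 * dunkl_const \<alpha>)" "2 * \<alpha> + 2" "dunkl_coeff \<alpha> / (\<alpha> + 1)"
proof unfold_locales
  show "sets (dmu \<alpha>) = sets borel" by simp
  show "emeasure (dmu \<alpha>) (ball 0 R) = ennreal (dunkl_coeff \<alpha> / (\<alpha> + 1) * R powr (2 * \<alpha> + 2))" if "R > 0" for R
    using that \<alpha> by (intro dmu_ball) auto
  show "dunkl_coeff \<alpha> / (\<alpha> + 1) > 0" using \<alpha> dunkl_coeff_pos[of \<alpha>] by simp
  show "2 * \<alpha> + 2 \<ge> 1" using \<alpha> by simp
  show "emeasure (dmu \<alpha>) {0} = 0" by (rule dmu_singleton)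
  show "(\<lambda>(x, y, \<omega>). dunkl_pos x y \<omega>) \<in> borel_measurable (borel \<Otimes>\<^sub>M borel \<Otimes>\<^sub>M sign_angle_measure)" by measurable
  show "(\<lambda>(x, y, \<omega>). dunkl_factor x y \<omega>) \<in> borel_measurable (borel \<Otimes>\<^sub>M borel \<Otimes>\<^sub>M sign_angle_measure)" by measurable
  show "max 1 (2 * dunkl_const \<alpha>) \<ge> 1" by simp
  show "\<bar>dunkl_factor x y \<omega>\<bar> \<le> max 1 (2 * dunkl_const \<alpha>)" for x y \<omega> by (rule dunkl_factor_bound)
  show "(\<integral>\<omega>. dunkl_factor x y \<omega> \<partial>sign_angle_measure) = 1" for x y by (rule dunkl_factor_int)
  show "\<bar>\<bar>x\<bar> - \<bar>y\<bar>\<bar> \<le> \<bar>dunkl_pos x y \<omega>\<bar>" for x y \<omega> by (simp add: dunkl_pos_def abs_mult dunkl_dist_ge)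
  show "\<bar>dunkl_pos x y \<omega>\<bar> \<le> \<bar>x\<bar> + \<bar>y\<bar>" for x y \<omega> by (simp add: dunkl_pos_def abs_mult dunkl_dist_le)
  show "dunkl_pos x y \<omega> = dunkl_pos y x \<omega>" for x y \<omega> by (simp add: dunkl_pos_def dunkl_dist_sym)
  show "dunkl_factor x y \<omega> = dunkl_factor y x \<omega>" for x y \<omega> by (simp add: dunkl_factor_def dunkl_dist_sym[of x y] add.commute)
  show "distr (dmu \<alpha> \<Otimes>\<^sub>M sign_angle_measure) (borel \<Otimes>\<^sub>M borel) (\<lambda>(y, \<omega>). (y, dunkl_pos x y \<omega>))
     = distr (dmu \<alpha> \<Otimes>\<^sub>M sign_angle_measure) (borel \<Otimes>\<^sub>M borel) (\<lambda>(z, \<omega>). (dunkl_pos (- x) z \<omega>, z))" for x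
    by (rule dual_distr_sign_angle_measure)
  show "(\<lambda>(y, z). dunkl_density x y z) \<in> borel_measurable (borel \<Otimes>\<^sub>M borel)" for x unfolding dunkl_density_def by measurable
  show "AE (y, \<omega>) in dmu \<alpha> \<Otimes>\<^sub>M sign_angle_measure. dunkl_factor x y \<omega> = dunkl_density x y (dunkl_pos x y \<omega>) \<and> dunkl_density x y (dunkl_pos x y \<omega>) = dunkl_density (- x) (dunkl_pos x y \<omega>) y"
    if x: "x \<noteq> 0" for x
  proof -
    have "AE q in dmu \<alpha> \<Otimes>\<^sub>M sign_angle_measure. fst q \<noteq> 0 \<and> fst q \<noteq> x \<and> fst q \<noteq> - x"
    proof (rule dmPP.AE_pair_measure)
      show "AE y in dmu \<alpha>. AE \<omega> in sign_angle_measure. fst (y, \<omega>) \<noteq> 0 \<and> fst (y, \<omega>) \<noteq> x \<and> fst (y, \<omega>) \<noteq> - x"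
        using AE_dmu_neq[of 0 \<alpha>] AE_dmu_neq[of x \<alpha>] AE_dmu_neq[of "- x" \<alpha>] by eventually_elim simp
    qed measurable
    then show ?thesis by eventually_elim (use dunkl_density_eq[OF x] in auto)
  qed
  show "dunkl_factor 0 y \<omega> = 0 \<or> dunkl_pos 0 y \<omega> = y" if "y \<noteq> 0" for y \<omega>
    using that unfolding dunkl_pos_zero by (cases "snd \<omega>"; cases "y > 0") (auto simp: dunkl_factor_def dunkl_dist_def)
qed

end

section \<open>Triple symmetry of the Dunkl translation\<close>

context averaged_translation begin

lemma maj_bounded_finite:
  fixes g :: "real \<Rightarrow> real"
  assumes "\<And>z. \<bar>z\<bar> \<le> \<bar>x\<bar> + \<bar>y\<bar> \<Longrightarrow> \<bar>g z\<bar> \<le> C"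
  shows "maj x (\<lambda>z. ennreal (norm (g z))) y < \<infinity>"
proof -
  have "maj x (\<lambda>z. ennreal (norm (g z))) y \<le> ennreal C * ennreal mP"
    by (rule maj_le) (use assms in \<open>auto intro!: ennreal_leI\<close>)
  also have "\<dots> < \<infinity>" by (simp add: ennreal_mult_less_top)
  finally show ?thesis .
qed

lemma continuous_bounded_on_ball:
  fixes g :: "real \<Rightarrow> real"
  assumes "continuous_on UNIV g"
  shows "\<exists>C\<ge>0. \<forall>z. \<bar>z\<bar> \<le> R \<longrightarrow> \<bar>g z\<bar> \<le> C"
proof -
  have "compact (g ` {- R..R})" by (intro compact_continuous_image continuous_on_subset[OF assms]) auto
  then obtain C where C: "\<And>z. z \<in> {- R..R} \<Longrightarrow> \<bar>g z\<bar> \<le> C"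
    by (meson bounded_real compact_imp_bounded imageI)
  have "\<bar>g z\<bar> \<le> max C 0" if "\<bar>z\<bar> \<le> R" for z using C[of z] that by (auto simp: abs_le_iff)
  then show ?thesis by (intro exI[of _ "max C 0"]) auto
qed

lemma tau_diff_le:
  fixes g h :: "real \<Rightarrow> real"
  assumes [measurable]: "g \<in> borel_measurable borel" "h \<in> borel_measurable borel"
    and gb: "\<And>z. \<bar>z\<bar> \<le> \<bar>x\<bar> + \<bar>y\<bar> \<Longrightarrow> \<bar>g z\<bar> \<le> C" and hb: "\<And>z. \<bar>z\<bar> \<le> \<bar>x\<bar> + \<bar>y\<bar> \<Longrightarrow> \<bar>h z\<bar> \<le> C'"
    and e: "\<And>z. \<bar>z\<bar> \<le> \<bar>x\<bar> + \<bar>y\<bar> \<Longrightarrow> \<bar>g z - h z\<bar> \<le> e" and e0: "e \<ge> 0"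
  shows "\<bar>tau x g y - tau x h y\<bar> \<le> B * mP * e"
proof -
  have "norm (tau x (\<lambda>z. g z - h z) y - 0) \<le> B * mP * e"
    by (rule tau_near_const) (use e e0 in auto)
  moreover have "tau x (\<lambda>z. g z - h z) y = tau x g y - tau x h y"
    by (rule tau_diff[OF assms(1,2)]; rule maj_bounded_finite; (rule gb | rule hb))
  ultimately show ?thesis by simp
qed

lemma tau_bound:
  fixes g :: "real \<Rightarrow> real"
  assumes [measurable]: "g \<in> borel_measurable borel"
    and gb: "\<And>z. \<bar>z\<bar> \<le> \<bar>x\<bar> + \<bar>y\<bar> \<Longrightarrow> \<bar>g z\<bar> \<le> C" and C: "C \<ge> 0"
  shows "\<bar>tau x g y\<bar> \<le> B * mP * C"
  using tau_near_const[of g x y 0 C] gb C by auto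

lemma tau_linear_combination:
  fixes h :: "nat \<Rightarrow> real \<Rightarrow> real"
  assumes "\<And>i. i \<in> I \<Longrightarrow> continuous_on UNIV (h i)"
  shows "tau x (\<lambda>z. \<Sum>i\<in>I. c i * h i z) y = (\<Sum>i\<in>I. c i * tau x (h i) y)"
proof -
  have int: "integrable P (\<lambda>\<omega>. k x y \<omega> *\<^sub>R h i (p x y \<omega>))" if i: "i \<in> I" for i
  proof -
    obtain C where "\<And>z. \<bar>z\<bar> \<le> \<bar>x\<bar> + \<bar>y\<bar> \<Longrightarrow> \<bar>h i z\<bar> \<le> C"
      using continuous_bounded_on_ball[OF assms[OF i]] by blast
    then show ?thesis
      by (intro tau_integrand_integrable borel_measurable_continuous_onI assms i maj_bounded_finite)
  qed
  have "tau x (\<lambda>z. \<Sum>i\<in>I. c i * h i z) y = (\<integral>\<omega>. (\<Sum>i\<in>I. c i *\<^sub>R (k x y \<omega> *\<^sub>R h i (p x y \<omega>))) \<partial>P)"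
    unfolding tau_def by (simp add: sum_distrib_left mult_ac)
  also have "\<dots> = (\<Sum>i\<in>I. (\<integral>\<omega>. c i *\<^sub>R (k x y \<omega> *\<^sub>R h i (p x y \<omega>)) \<partial>P))"
    by (rule Bochner_Integration.integral_sum) (use int in simp)
  also have "\<dots> = (\<Sum>i\<in>I. c i * tau x (h i) y)" by (simp add: tau_def)
  finally show ?thesis .
qed

text \<open>
  An even continuous function is uniformly close, on a ball containing all relevant positions, to a
  polynomial in \<open>t\<^sup>2\<close>; both iterated averages depend on the function with Lipschitz constant
  \<open>(B mP)\<^sup>2\<close>.
\<close>
lemma triple_of_monomials:
  fixes g :: "real \<Rightarrow> real"
  assumes mono: "\<And>m x y w. tau x (\<lambda>z. tau z (\<lambda>t. t ^ (2 * m)) w) y = tau x (\<lambda>z. tau z (\<lambda>t. t ^ (2 * m)) y) w"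
    and tau_mono_cont: "\<And>m w. continuous_on UNIV (\<lambda>z. tau z (\<lambda>t. t ^ (2 * m)) w)"
    and g: "continuous_on UNIV g" and even: "\<And>t. g (- t) = g t"
  shows "tau x (\<lambda>z. tau z g w) y = tau x (\<lambda>z. tau z g y) w"
proof -
  let ?\<Phi> = "\<lambda>g y w. tau x (\<lambda>z. tau z g w) y"
  define R where "R = \<bar>x\<bar> + \<bar>y\<bar> + \<bar>w\<bar>"
  have [measurable]: "g \<in> borel_measurable borel" by (rule borel_measurable_continuous_onI[OF g])
  have Bm: "B * mP \<ge> 0" using B_ge_1 mP_nonneg by auto
  have close: "\<bar>?\<Phi> g y w - ?\<Phi> g w y\<bar> \<le> e" if e: "e > 0" for e
  proof -
    define e' where "e' = e / (2 * (B * mP * (B * mP) + 1))"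
    have q: "B * mP * (B * mP) \<ge> 0" using Bm by auto
    have "2 * (u + 1) > 0" if "u \<ge> 0" for u :: real using that by simp
    from this[OF q] have "2 * (B * mP * (B * mP) + 1) > 0" .
    then have e': "e' > 0" unfolding e'_def by (rule divide_pos_pos[OF e])
    have ee: "2 * (B * mP * (B * mP * e')) \<le> e"
    proof -
      have "2 * (B * mP * (B * mP * e')) = (B * mP * (B * mP)) * (2 * e')" by simp
      also have "\<dots> \<le> (B * mP * (B * mP) + 1) * (2 * e')" using e' by (intro mult_right_mono) auto
      also have "\<dots> = e"
      proof -
        have "(u + 1) * (2 * (e / (2 * (u + 1)))) = e" if "u \<ge> 0" for u :: real using that by (simp add: field_simps)
        from this[OF q] show ?thesis unfolding e'_def .
      qed
      finally show ?thesis .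
    qed
    \<comment> \<open>Weierstrass is applied in the variable \<open>s = t\<^sup>2\<close>, which yields even powers only\<close>
    have cont: "continuous_on {0..R\<^sup>2} (\<lambda>s. g (sqrt s))"
      by (intro continuous_on_compose2[OF g] continuous_intros) auto
    obtain pl where pl: "real_polynomial_function pl" "\<And>s. s \<in> {0..R\<^sup>2} \<Longrightarrow> \<bar>g (sqrt s) - pl s\<bar> < e'"
      using Stone_Weierstrass_real_polynomial_function[OF compact_Icc cont e'] by blast
    obtain a n where an: "pl = (\<lambda>s. \<Sum>i\<le>n. a i * s ^ i)"
      using pl(1) real_polynomial_function_iff_sum by blast
    define h where "h t = (\<Sum>i\<le>n. a i * t ^ (2 * i))" for t :: real
    have hc: "continuous_on UNIV h" unfolding h_def by (intro continuous_intros)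
    have [measurable]: "h \<in> borel_measurable borel" by (rule borel_measurable_continuous_onI[OF hc])
    have gh: "\<bar>g t - h t\<bar> \<le> e'" if "\<bar>t\<bar> \<le> R" for t
    proof -
      have "t\<^sup>2 \<le> R\<^sup>2" using that power_mono[of "\<bar>t\<bar>" R 2] by simp
      then have "\<bar>g (sqrt (t\<^sup>2)) - pl (t\<^sup>2)\<bar> < e'" by (intro pl) auto
      moreover have "g (sqrt (t\<^sup>2)) = g t" using even[of t] by (auto simp: abs_if)
      moreover have "pl (t\<^sup>2) = h t" by (simp add: an h_def power_mult)
      ultimately show ?thesis by simp
    qed
    obtain C where C: "C \<ge> 0" "\<And>z. \<bar>z\<bar> \<le> R \<Longrightarrow> \<bar>g z\<bar> \<le> C" using continuous_bounded_on_ball[OF g] by blast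
    obtain C' where C': "C' \<ge> 0" "\<And>z. \<bar>z\<bar> \<le> R \<Longrightarrow> \<bar>h z\<bar> \<le> C'" using continuous_bounded_on_ball[OF hc] by blast
    have approx: "\<bar>?\<Phi> g u v - ?\<Phi> h u v\<bar> \<le> B * mP * (B * mP * e')" if uv: "\<bar>x\<bar> + \<bar>u\<bar> + \<bar>v\<bar> = R" for u v
    proof (rule tau_diff_le)
      have r: "\<bar>s\<bar> \<le> R" if "\<bar>z\<bar> \<le> \<bar>x\<bar> + \<bar>u\<bar>" "\<bar>s\<bar> \<le> \<bar>z\<bar> + \<bar>v\<bar>" for z s using that uv by linarith
      fix z assume z: "\<bar>z\<bar> \<le> \<bar>x\<bar> + \<bar>u\<bar>"
      show "\<bar>tau z g v\<bar> \<le> B * mP * C" by (rule tau_bound) (use C r z in auto)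
      show "\<bar>tau z h v\<bar> \<le> B * mP * C'" by (rule tau_bound) (use C' r z in auto)
      show "\<bar>tau z g v - tau z h v\<bar> \<le> B * mP * e'"
        by (rule tau_diff_le[where C = C and C' = C']) (use C C' gh r z e' in auto)
    qed (use Bm e' in auto)
    have "?\<Phi> h u v = (\<Sum>i\<le>n. a i * ?\<Phi> (\<lambda>t. t ^ (2 * i)) u v)" for u v
    proof -
      have "tau z h v = (\<Sum>i\<le>n. a i * tau z (\<lambda>t. t ^ (2 * i)) v)" for z
        unfolding h_def by (rule tau_linear_combination) (intro continuous_intros)
      then have "?\<Phi> h u v = tau x (\<lambda>z. \<Sum>i\<le>n. a i * tau z (\<lambda>t. t ^ (2 * i)) v) u" by simp
      also have "\<dots> = (\<Sum>i\<le>n. a i * ?\<Phi> (\<lambda>t. t ^ (2 * i)) u v)"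
        by (rule tau_linear_combination) (rule tau_mono_cont)
      finally show ?thesis .
    qed
    then have "?\<Phi> h y w = ?\<Phi> h w y" using mono[of x _ w y] by simp
    moreover have "\<bar>?\<Phi> g y w - ?\<Phi> h y w\<bar> \<le> B * mP * (B * mP * e')" by (rule approx) (simp add: R_def)
    moreover have "\<bar>?\<Phi> g w y - ?\<Phi> h w y\<bar> \<le> B * mP * (B * mP * e')" by (rule approx) (simp add: R_def)
    ultimately show ?thesis using ee by linarith
  qed
  show ?thesis
  proof (rule ccontr)
    assume "?\<Phi> g y w \<noteq> ?\<Phi> g w y"
    then have "\<bar>?\<Phi> g y w - ?\<Phi> g w y\<bar> > 0" by simp
    then show False using close[of "\<bar>?\<Phi> g y w - ?\<Phi> g w y\<bar> / 2"] by simp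
  qed
qed

end

context dunkl_alpha begin

abbreviation d\<^sub>\<alpha> :: real where "d\<^sub>\<alpha> \<equiv> 2 * \<alpha> + 2"

lemma d\<^sub>\<alpha>_pos: "d\<^sub>\<alpha> > 0" using \<alpha> by simp

lemma tau_power:
  "tr.tau x (\<lambda>t. t ^ n) y = angint \<alpha> (\<lambda>\<theta>. dunkl_factor x y (\<theta>, True) * dunkl_dist x y \<theta> ^ n + dunkl_factor x y (\<theta>, False) * (- dunkl_dist x y \<theta>) ^ n)"
proof -
  have "continuous_on UNIV (\<lambda>t::real. t ^ n)" by (intro continuous_intros)
  from tr.continuous_bounded_on_ball[OF this] obtain C where "\<And>z. \<bar>z\<bar> \<le> \<bar>x\<bar> + \<bar>y\<bar> \<Longrightarrow> \<bar>z ^ n\<bar> \<le> C" by blast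
  then have "integrable sign_angle_measure (\<lambda>\<omega>. dunkl_factor x y \<omega> *\<^sub>R dunkl_pos x y \<omega> ^ n)"
    by (intro tr.tau_integrand_integrable(2)[of "\<lambda>t. t ^ n"] tr.maj_bounded_finite) auto
  then show ?thesis
    unfolding tr.tau_def angint_def
    by (subst integral_sign_angle_measure) (auto simp: dunkl_pos_def mult.commute)
qed

lemma dunkl_factor_sum: "dunkl_factor x y (\<theta>, True) + dunkl_factor x y (\<theta>, False) = dunkl_const \<alpha> * (1 - cos \<theta>)"
  and dunkl_factor_diff: "dunkl_factor x y (\<theta>, True) - dunkl_factor x y (\<theta>, False) = dunkl_const \<alpha> * (1 - cos \<theta>) * ((x + y) / dunkl_dist x y \<theta>)"
proof -
  have "c / 2 * (s * (1 + 1 * t)) + c / 2 * (s * (1 + - 1 * t)) = c * s"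
    "c / 2 * (s * (1 + 1 * t)) - c / 2 * (s * (1 + - 1 * t)) = c * s * t" for c s t :: real
  proof -
    have "c / 2 * (s * (1 + 1 * t)) + c / 2 * (s * (1 + - 1 * t)) = c / 2 * (s * (1 + 1 * t) + s * (1 + - 1 * t))"
      by (rule distrib_left[symmetric])
    also have "s * (1 + 1 * t) + s * (1 + - 1 * t) = 2 * s" by (simp add: algebra_simps)
    finally show "c / 2 * (s * (1 + 1 * t)) + c / 2 * (s * (1 + - 1 * t)) = c * s" by simp
    have "c / 2 * (s * (1 + 1 * t)) - c / 2 * (s * (1 + - 1 * t)) = c / 2 * (s * (1 + 1 * t) - s * (1 + - 1 * t))"
      by (rule right_diff_distrib[symmetric])
    also have "s * (1 + 1 * t) - s * (1 + - 1 * t) = 2 * s * t" by (simp add: algebra_simps)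
    finally show "c / 2 * (s * (1 + 1 * t)) - c / 2 * (s * (1 + - 1 * t)) = c * s * t" by simp
  qed
  then show "dunkl_factor x y (\<theta>, True) + dunkl_factor x y (\<theta>, False) = dunkl_const \<alpha> * (1 - cos \<theta>)"
    "dunkl_factor x y (\<theta>, True) - dunkl_factor x y (\<theta>, False) = dunkl_const \<alpha> * (1 - cos \<theta>) * ((x + y) / dunkl_dist x y \<theta>)"
    unfolding dunkl_factor_def fst_conv snd_conv bool_sign_simps by blast+
qed

lemma angint_one_minus_cos:
  "angint \<alpha> (\<lambda>\<theta>. dunkl_const \<alpha> * (1 - cos \<theta>) * qdist x y \<theta> ^ m)
     = dunkl_fact d\<^sub>\<alpha> (2 * m) * (fps_nth (prod_even d\<^sub>\<alpha> x y) m + fps_nth (prod_odd d\<^sub>\<alpha> x y) m)"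
proof -
  have "angint \<alpha> (\<lambda>\<theta>. dunkl_const \<alpha> * (1 - cos \<theta>) * qdist x y \<theta> ^ m)
     = angint \<alpha> (\<lambda>\<theta>. dunkl_const \<alpha> * (qdist x y \<theta> ^ m + (- 1) * (qdist x y \<theta> ^ m * cos \<theta>)))"
    by (rule arg_cong[of _ _ "angint \<alpha>"], rule ext) (simp add: algebra_simps)
  also have "\<dots> = dunkl_const \<alpha> * (angint \<alpha> (\<lambda>\<theta>. qdist x y \<theta> ^ m) + (- 1) * angint \<alpha> (\<lambda>\<theta>. qdist x y \<theta> ^ m * cos \<theta>))"
  proof -
    have "angint \<alpha> (\<lambda>\<theta>. qdist x y \<theta> ^ m + (- 1) * (qdist x y \<theta> ^ m * cos \<theta>))
       = angint \<alpha> (\<lambda>\<theta>. qdist x y \<theta> ^ m) + angint \<alpha> (\<lambda>\<theta>. (- 1) * (qdist x y \<theta> ^ m * cos \<theta>))"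
      using \<alpha> by (intro angint_add continuous_intros) auto
    then show ?thesis by (simp only: angint_cmult)
  qed
  also have "\<dots> = (dunkl_const \<alpha> * angint \<alpha> (\<lambda>_. 1)) * (dunkl_fact d\<^sub>\<alpha> (2 * m) * (fps_nth (prod_even d\<^sub>\<alpha> x y) m + fps_nth (prod_odd d\<^sub>\<alpha> x y) m))"
    using \<alpha> by (simp only: angint_qdist[OF _ refl]) (simp add: algebra_simps)
  also have "dunkl_const \<alpha> * angint \<alpha> (\<lambda>_. 1) = 1"
    using angint_1_pos[of \<alpha>] \<alpha> by (simp add: dunkl_const_eq)
  finally show ?thesis by simp
qed

text \<open>
  Generalised binomial formula: \<open>\<tau>\<^sub>x (t\<^sup>n) y / dunkl_fact d n\<close> is the coefficient of \<open>t\<^sup>n\<close> in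
  \<open>E (x t) E (y t)\<close>. The quotients by the distance cancel for even \<open>n\<close>, and the two claims of
  \<open>angint_qdist\<close> add up.
\<close>
lemma tau_even_power:
  "tr.tau x (\<lambda>t. t ^ (2 * m)) y = dunkl_fact d\<^sub>\<alpha> (2 * m) * (fps_nth (prod_even d\<^sub>\<alpha> x y) m + fps_nth (prod_odd d\<^sub>\<alpha> x y) m)"
proof -
  have "dunkl_factor x y (\<theta>, True) * dunkl_dist x y \<theta> ^ (2 * m) + dunkl_factor x y (\<theta>, False) * (- dunkl_dist x y \<theta>) ^ (2 * m)
     = dunkl_const \<alpha> * (1 - cos \<theta>) * qdist x y \<theta> ^ m" for \<theta>
  proof -
    have "dunkl_dist x y \<theta> ^ (2 * m) = qdist x y \<theta> ^ m" "(- dunkl_dist x y \<theta>) ^ (2 * m) = qdist x y \<theta> ^ m"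
      by (simp_all add: power_mult dunkl_dist_square)
    then show ?thesis by (simp only: distrib_right[symmetric] dunkl_factor_sum)
  qed
  then show ?thesis unfolding tau_power by (simp only: angint_one_minus_cos)
qed

text \<open>
  For odd powers the quotients by the distance remain and leave a factor \<open>x + y\<close>, which
  \<open>euler_prod_mixed\<close> absorbs.
\<close>
lemma tau_odd_power:
  "tr.tau x (\<lambda>t. t ^ (2 * m + 1)) y = dunkl_fact d\<^sub>\<alpha> (2 * m + 1) * fps_nth (prod_mixed d\<^sub>\<alpha> x y) m"
proof -
  have "dunkl_factor x y (\<theta>, True) * dunkl_dist x y \<theta> ^ (2 * m + 1) + dunkl_factor x y (\<theta>, False) * (- dunkl_dist x y \<theta>) ^ (2 * m + 1)
     = (x + y) * (dunkl_const \<alpha> * (1 - cos \<theta>) * qdist x y \<theta> ^ m)" for \<theta>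
  proof -
    let ?d = "dunkl_dist x y \<theta>"
    have p: "?d ^ (2 * m + 1) = ?d * qdist x y \<theta> ^ m" "(- ?d) ^ (2 * m + 1) = - (?d * qdist x y \<theta> ^ m)"
      by (simp_all add: power_mult dunkl_dist_square)
    have "dunkl_factor x y (\<theta>, True) * ?d ^ (2 * m + 1) + dunkl_factor x y (\<theta>, False) * (- ?d) ^ (2 * m + 1)
      = (dunkl_factor x y (\<theta>, True) - dunkl_factor x y (\<theta>, False)) * (?d * qdist x y \<theta> ^ m)"
      unfolding p by (simp add: left_diff_distrib)
    also have "\<dots> = (x + y) * (dunkl_const \<alpha> * (1 - cos \<theta>) * qdist x y \<theta> ^ m)"
    proof (cases "?d = 0")
      \<comment> \<open>at distance \<open>0\<close> the quotient is \<open>0\<close> by convention, and the other side vanishes as well\<close>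
      case True
      then have "qdist x y \<theta> = 0" using dunkl_dist_square[of x y \<theta>] by simp
      then have "((1 - cos \<theta>) * (x + y))\<^sup>2 \<le> 0" using angular_factor_square[of \<theta> x y] by simp
      then have "(1 - cos \<theta>) * (x + y) = 0" by simp
      then have "(x + y) * (dunkl_const \<alpha> * (1 - cos \<theta>) * qdist x y \<theta> ^ m) = 0" by auto
      then show ?thesis using True by simp
    next
      case False
      then show ?thesis unfolding dunkl_factor_diff by simp
    qed
    finally show ?thesis .
  qed
  then have "tr.tau x (\<lambda>t. t ^ (2 * m + 1)) y = (x + y) * (dunkl_fact d\<^sub>\<alpha> (2 * m) * (fps_nth (prod_even d\<^sub>\<alpha> x y) m + fps_nth (prod_odd d\<^sub>\<alpha> x y) m))"
    unfolding tau_power by (simp only: angint_cmult angint_one_minus_cos)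
  also have "\<dots> = dunkl_fact d\<^sub>\<alpha> (2 * m) * ((x + y) * (fps_nth (prod_even d\<^sub>\<alpha> x y) m + fps_nth (prod_odd d\<^sub>\<alpha> x y) m))" by simp
  also have "(x + y) * (fps_nth (prod_even d\<^sub>\<alpha> x y) m + fps_nth (prod_odd d\<^sub>\<alpha> x y) m) = (2 * real m + d\<^sub>\<alpha>) * fps_nth (prod_mixed d\<^sub>\<alpha> x y) m"
    using arg_cong[OF euler_prod_mixed[OF d\<^sub>\<alpha>_pos, of x y], of "\<lambda>F. fps_nth F m"]
    by (simp add: numeral_fps_const distrib_right)
  finally show ?thesis by simp
qed

lemma tau_even_power_expand:
  "tr.tau z (\<lambda>t. t ^ (2 * m)) w = dunkl_fact d\<^sub>\<alpha> (2 * m) *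
     ((\<Sum>i\<in>{0..m}. (fps_nth (dunkl_exp_even d\<^sub>\<alpha> w) (m - i) / dunkl_fact d\<^sub>\<alpha> (2 * i)) * z ^ (2 * i))
      + (\<Sum>i\<in>{..<m}. (fps_nth (dunkl_exp_odd d\<^sub>\<alpha> w) (m - 1 - i) / dunkl_fact d\<^sub>\<alpha> (2 * i + 1)) * z ^ (2 * i + 1)))"
proof -
  have "fps_nth (prod_even d\<^sub>\<alpha> z w) m = (\<Sum>i\<in>{0..m}. (fps_nth (dunkl_exp_even d\<^sub>\<alpha> w) (m - i) / dunkl_fact d\<^sub>\<alpha> (2 * i)) * z ^ (2 * i))"
    unfolding prod_even_def fps_mult_nth by (intro sum.cong refl) (simp add: dunkl_exp_even_def ac_simps)
  moreover have "fps_nth (prod_odd d\<^sub>\<alpha> z w) m = (\<Sum>i\<in>{..<m}. (fps_nth (dunkl_exp_odd d\<^sub>\<alpha> w) (m - 1 - i) / dunkl_fact d\<^sub>\<alpha> (2 * i + 1)) * z ^ (2 * i + 1))"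
  proof (cases m)
    case (Suc n)
    have "fps_nth (prod_odd d\<^sub>\<alpha> z w) m = fps_nth (dunkl_exp_odd d\<^sub>\<alpha> z * dunkl_exp_odd d\<^sub>\<alpha> w) n" by (simp add: prod_odd_def Suc)
    also have "\<dots> = (\<Sum>i\<in>{0..n}. (fps_nth (dunkl_exp_odd d\<^sub>\<alpha> w) (n - i) / dunkl_fact d\<^sub>\<alpha> (2 * i + 1)) * z ^ (2 * i + 1))"
      unfolding fps_mult_nth by (intro sum.cong refl) (simp add: dunkl_exp_odd_def ac_simps del: dunkl_fact.simps)
    also have "{0..n} = {..<m}" using Suc by auto
    finally show ?thesis using Suc by simp
  qed (simp add: prod_odd_def)
  ultimately show ?thesis by (simp only: tau_even_power)
qed

text \<open>
  The coefficient is that of \<open>t\<^sup>2\<^sup>m\<close> in the product of the three exponentials, expanded as the even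
  part of \<open>E (x t) E (y t)\<close> times the even part of \<open>E (w t)\<close> plus the product of the odd parts.
\<close>
lemma tau_tau_even_power:
  "tr.tau x (\<lambda>z. tr.tau z (\<lambda>t. t ^ (2 * m)) w) y = dunkl_fact d\<^sub>\<alpha> (2 * m) * fps_nth
      ((prod_even d\<^sub>\<alpha> x y + prod_odd d\<^sub>\<alpha> x y) * dunkl_exp_even d\<^sub>\<alpha> w + fps_X * (prod_mixed d\<^sub>\<alpha> x y * dunkl_exp_odd d\<^sub>\<alpha> w)) m"
proof -
  define a b where "a i = fps_nth (dunkl_exp_even d\<^sub>\<alpha> w) (m - i) / dunkl_fact d\<^sub>\<alpha> (2 * i)"
    and "b i = fps_nth (dunkl_exp_odd d\<^sub>\<alpha> w) (m - 1 - i) / dunkl_fact d\<^sub>\<alpha> (2 * i + 1)" for i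
  have g: "dunkl_fact d\<^sub>\<alpha> n \<noteq> 0" for n using dunkl_fact_pos[OF d\<^sub>\<alpha>_pos, of n] by linarith
  \<comment> \<open>even and odd powers of \<open>z\<close> are written as a sum over two indices, for \<open>tau_linear_combination\<close>\<close>
  have "tr.tau x (\<lambda>z. tr.tau z (\<lambda>t. t ^ (2 * m)) w) y
    = tr.tau x (\<lambda>z. \<Sum>s\<in>{0::nat, 1}. dunkl_fact d\<^sub>\<alpha> (2 * m) * (if s = 0 then (\<Sum>i\<in>{0..m}. a i * z ^ (2 * i)) else (\<Sum>i\<in>{..<m}. b i * z ^ (2 * i + 1)))) y"
    unfolding tau_even_power_expand a_def b_def by (simp add: distrib_left)
  also have "\<dots> = (\<Sum>s\<in>{0::nat, 1}. dunkl_fact d\<^sub>\<alpha> (2 * m) * tr.tau x (\<lambda>z. if s = 0 then (\<Sum>i\<in>{0..m}. a i * z ^ (2 * i)) else (\<Sum>i\<in>{..<m}. b i * z ^ (2 * i + 1))) y)"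
    by (rule tr.tau_linear_combination) (auto intro!: continuous_intros)
  also have "\<dots> = dunkl_fact d\<^sub>\<alpha> (2 * m) * (tr.tau x (\<lambda>z. \<Sum>i\<in>{0..m}. a i * z ^ (2 * i)) y + tr.tau x (\<lambda>z. \<Sum>i\<in>{..<m}. b i * z ^ (2 * i + 1)) y)"
    by (simp add: distrib_left)
  also have "tr.tau x (\<lambda>z. \<Sum>i\<in>{0..m}. a i * z ^ (2 * i)) y = (\<Sum>i\<in>{0..m}. a i * tr.tau x (\<lambda>z. z ^ (2 * i)) y)"
    by (rule tr.tau_linear_combination) (intro continuous_intros)
  also have "\<dots> = fps_nth ((prod_even d\<^sub>\<alpha> x y + prod_odd d\<^sub>\<alpha> x y) * dunkl_exp_even d\<^sub>\<alpha> w) m"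
    unfolding tau_even_power fps_mult_nth using g by (intro sum.cong refl) (simp add: a_def mult.commute)
  also have "tr.tau x (\<lambda>z. \<Sum>i\<in>{..<m}. b i * z ^ (2 * i + 1)) y = (\<Sum>i\<in>{..<m}. b i * tr.tau x (\<lambda>z. z ^ (2 * i + 1)) y)"
    by (rule tr.tau_linear_combination) (intro continuous_intros)
  also have "\<dots> = fps_nth (fps_X * (prod_mixed d\<^sub>\<alpha> x y * dunkl_exp_odd d\<^sub>\<alpha> w)) m"
  proof (cases m)
    case (Suc n)
    have "(\<Sum>i\<in>{..<m}. b i * tr.tau x (\<lambda>z. z ^ (2 * i + 1)) y) = (\<Sum>i\<in>{0..n}. fps_nth (prod_mixed d\<^sub>\<alpha> x y) i * fps_nth (dunkl_exp_odd d\<^sub>\<alpha> w) (n - i))"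
      using Suc g unfolding tau_odd_power
      by (intro sum.cong) (auto simp: b_def mult.commute simp del: dunkl_fact.simps)
    moreover have "fps_nth (fps_X * (prod_mixed d\<^sub>\<alpha> x y * dunkl_exp_odd d\<^sub>\<alpha> w)) m = fps_nth (prod_mixed d\<^sub>\<alpha> x y * dunkl_exp_odd d\<^sub>\<alpha> w) n"
      using Suc by simp
    ultimately show ?thesis by (simp only: fps_mult_nth)
  qed simp
  finally show ?thesis by simp
qed

lemma triple_monomial:
  "tr.tau x (\<lambda>z. tr.tau z (\<lambda>t. t ^ (2 * m)) w) y = tr.tau x (\<lambda>z. tr.tau z (\<lambda>t. t ^ (2 * m)) y) w"
proof -
  have "(prod_even d\<^sub>\<alpha> x y + prod_odd d\<^sub>\<alpha> x y) * dunkl_exp_even d\<^sub>\<alpha> w + fps_X * (prod_mixed d\<^sub>\<alpha> x y * dunkl_exp_odd d\<^sub>\<alpha> w)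
    = (prod_even d\<^sub>\<alpha> x w + prod_odd d\<^sub>\<alpha> x w) * dunkl_exp_even d\<^sub>\<alpha> y + fps_X * (prod_mixed d\<^sub>\<alpha> x w * dunkl_exp_odd d\<^sub>\<alpha> y)"
    unfolding prod_even_def prod_odd_def prod_mixed_def by (simp only: algebra_simps)
  then show ?thesis unfolding tau_tau_even_power by simp
qed

sublocale tr: symmetric_translation "dmu \<alpha>" sign_angle_measure dunkl_pos dunkl_factor dunkl_density "max 1 (2 * dunkl_const \<alpha>)" "2 * \<alpha> + 2" "dunkl_coeff \<alpha> / (\<alpha> + 1)"
proof (unfold_locales, rule tr.triple_of_monomials[OF triple_monomial])
  fix m w
  show "continuous_on UNIV (\<lambda>z. tr.tau z (\<lambda>t. t ^ (2 * m)) w)"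
    unfolding tau_even_power_expand by (intro continuous_intros)
qed

end

section \<open>The ordinary translation\<close>

text \<open>The measure is a multiple of Lebesgue measure, so duality is translation invariance.\<close>
lemma dunkl_half_translation:
  "symmetric_translation (dmu (- 1 / 2)) (count_space (UNIV :: unit set)) (\<lambda>x y _. x + y) (\<lambda>_ _ _. 1) (\<lambda>_ _ _. 1) 1
     (2 * (- 1 / 2) + 2) (dunkl_coeff (- 1 / 2) / (- 1 / 2 + 1))"
proof -
  interpret dm: sigma_finite_measure "dmu (- 1 / 2)" by (rule sigma_finite_dmu)
  interpret U: finite_measure "count_space (UNIV :: unit set)" by (rule finite_measure_count_space) simp
  interpret pair_sigma_finite "dmu (- 1 / 2)" "count_space (UNIV :: unit set)" ..
  interpret averaged_translation "dmu (- 1 / 2)" "count_space (UNIV :: unit set)" "\<lambda>x y _. x + y" "\<lambda>_ _ _. 1" "\<lambda>_ _ _. 1" 1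
     "2 * (- 1 / 2) + 2" "dunkl_coeff (- 1 / 2) / (- 1 / 2 + 1)"
  proof unfold_locales
    show "sets (dmu (- 1 / 2)) = sets borel" by simp
    show "emeasure (dmu (- 1 / 2)) (ball 0 R) = ennreal (dunkl_coeff (- 1 / 2) / (- 1 / 2 + 1) * R powr (2 * (- 1 / 2) + 2))" if "R > 0" for R
      using that by (intro dmu_ball) auto
    show "dunkl_coeff (- 1 / 2) / (- 1 / 2 + 1) > 0" using dunkl_coeff_pos[of "- 1 / 2"] by simp
    show "emeasure (dmu (- 1 / 2)) {0} = 0" by (rule dmu_singleton)
    show "distr (dmu (- 1 / 2) \<Otimes>\<^sub>M count_space (UNIV :: unit set)) (borel \<Otimes>\<^sub>M borel) (\<lambda>(y, \<omega>). (y, x + y))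
       = distr (dmu (- 1 / 2) \<Otimes>\<^sub>M count_space (UNIV :: unit set)) (borel \<Otimes>\<^sub>M borel) (\<lambda>(z, \<omega>). (- x + z, z))" (is "?L = ?R") for x
    proof (rule measure_eqI)
      fix A assume "A \<in> sets ?L"
      then have A [measurable]: "A \<in> sets (borel \<Otimes>\<^sub>M borel)" by simp
      let ?c = "ennreal (dunkl_coeff (- 1 / 2))"
      have w: "(\<integral>\<^sup>+y. dunkl_weight (- 1 / 2) y * h y \<partial>lborel) = (\<integral>\<^sup>+y. ?c * h y \<partial>lborel)" for h
        by (rule nn_integral_cong_AE, rule AE_mp[OF AE_lborel_neq[of 0] AE_I2]) (simp add: dunkl_weight_def)
      have 1: "(\<lambda>(y, \<omega>). (y, x + y)) \<in> measurable (dmu (- 1 / 2) \<Otimes>\<^sub>M count_space (UNIV :: unit set)) (borel \<Otimes>\<^sub>M borel)"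
        and 2: "(\<lambda>(z, \<omega>). (- x + z, z)) \<in> measurable (dmu (- 1 / 2) \<Otimes>\<^sub>M count_space (UNIV :: unit set)) (borel \<Otimes>\<^sub>M borel)"
        by measurable
      have "emeasure ?L A = (\<integral>\<^sup>+q. indicator A q \<partial>?L)" using A by simp
      also have "\<dots> = (\<integral>\<^sup>+q. indicator A (fst q, x + fst q) \<partial>(dmu (- 1 / 2) \<Otimes>\<^sub>M count_space (UNIV :: unit set)))"
        by (subst nn_integral_distr[OF 1]) (auto simp: case_prod_beta')
      also have "\<dots> = (\<integral>\<^sup>+y. indicator A (y, x + y) \<partial>dmu (- 1 / 2))"
        by (subst U.nn_integral_fst[symmetric]) (auto simp: nn_integral_count_space_finite)
      also have "\<dots> = (\<integral>\<^sup>+y. ?c * indicator A (y, x + y) \<partial>lborel)" by (subst nn_integral_dmu, measurable) (rule w)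
      also have "\<dots> = (\<integral>\<^sup>+z. ?c * indicator A (- x + 1 * z, x + (- x + 1 * z)) \<partial>lborel)"
        by (subst nn_integral_real_affine[of _ 1 "- x"]) auto
      also have "\<dots> = (\<integral>\<^sup>+z. ?c * indicator A (- x + z, z) \<partial>lborel)" by simp
      also have "\<dots> = (\<integral>\<^sup>+z. indicator A (- x + z, z) \<partial>dmu (- 1 / 2))"
        by (subst nn_integral_dmu, measurable) (rule w[symmetric])
      also have "\<dots> = (\<integral>\<^sup>+q. indicator A (- x + fst q, fst q) \<partial>(dmu (- 1 / 2) \<Otimes>\<^sub>M count_space (UNIV :: unit set)))"
        by (subst U.nn_integral_fst[symmetric]) (auto simp: nn_integral_count_space_finite)
      also have "\<dots> = (\<integral>\<^sup>+q. indicator A q \<partial>?R)"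
        by (subst nn_integral_distr[OF 2]) (auto simp: case_prod_beta')
      also have "\<dots> = emeasure ?R A" using A by simp
      finally show "emeasure ?L A = emeasure ?R A" .
    qed simp
  qed (auto simp: lebesgue_integral_count_space_finite add.commute abs_if)
  show ?thesis
    by unfold_locales (simp add: tau_def lebesgue_integral_count_space_finite add_ac)
qed

section \<open>Functions measurable for a completion\<close>

lemma measurable_AE_eq_completion:
  assumes v: "v \<in> borel_measurable (completion M)" and eq: "AE x in M. u x = v x"
  shows "u \<in> borel_measurable (completion M)"
proof (rule measurableI)
  fix A :: "'b::topological_space set" assume A: "A \<in> sets borel"
  have "AE x in completion M. x \<in> v -` A \<inter> space M \<longleftrightarrow> x \<in> u -` A \<inter> space M"
    using AE_completion[OF eq] by eventually_elim simp
  then show "u -` A \<inter> space (completion M) \<in> sets (completion M)" unfolding space_completion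
  proof (rule completion.in_sets_AE[unfolded space_completion, where A = "v -` A \<inter> space M"])
    show "v -` A \<inter> space M \<in> sets (completion M)" using measurable_sets[OF v A] by simp
  qed simp_all
qed simp

lemma integral_AE_eq_completion:
  fixes v :: "'a \<Rightarrow> 'b::{banach,second_countable_topology}"
  assumes v: "v \<in> borel_measurable M" and eq: "AE x in M. u x = v x"
  shows "(\<integral>x. u x \<partial>completion M) = (\<integral>x. v x \<partial>M)"
    and "integrable (completion M) u \<longleftrightarrow> integrable M v"
proof -
  have v': "v \<in> borel_measurable (completion M)" using v by (rule measurable_completion)
  have u': "u \<in> borel_measurable (completion M)" by (rule measurable_AE_eq_completion[OF v' eq])
  have "(\<integral>x. u x \<partial>completion M) = (\<integral>x. v x \<partial>completion M)"
    by (rule integral_cong_AE[OF u' v' AE_completion[OF eq]])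
  then show "(\<integral>x. u x \<partial>completion M) = (\<integral>x. v x \<partial>M)" using integral_completion[OF v] by simp
  have "integrable (completion M) u \<longleftrightarrow> integrable (completion M) v"
    by (rule integrable_cong_AE[OF u' v' AE_completion[OF eq]])
  then show "integrable (completion M) u \<longleftrightarrow> integrable M v" using integrable_completion[OF v] by simp
qed

text \<open>
  The function is changed on a null set \<open>N\<close> that contains the null parts of the preimages of
  countably many basic open sets.
\<close>
lemma completion_borel_representative:
  fixes f :: "'a \<Rightarrow> 'b::{banach,second_countable_topology}"
  assumes f: "f \<in> borel_measurable (completion M)"
  shows "\<exists>g \<in> borel_measurable M. AE x in M. f x = g x"
proof -
  obtain \<B> :: "'b set set" where \<B>: "countable \<B>" "topological_basis \<B>" using ex_countable_basis by blast
  define A where "A b = f -` b \<inter> space M" for b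
  have A: "A b \<in> sets (completion M)" if "b \<in> \<B>" for b
    using measurable_sets[OF f, of b] topological_basis_open[OF \<B>(2) that] by (simp add: A_def)
  have "AE x in M. \<forall>b\<in>\<B>. x \<notin> null_part M (A b)"
    using \<B>(1) AE_notin_null_part[OF A] by (simp add: AE_ball_countable)
  then obtain N where N: "{x \<in> space M. \<not> (\<forall>b\<in>\<B>. x \<notin> null_part M (A b))} \<subseteq> N" "emeasure M N = 0" "N \<in> sets M"
    by (rule AE_E)
  define g where "g x = (if x \<in> N then 0 else f x)" for x
  have "g \<in> measurable M (sigma UNIV \<B>)"
  proof (rule measurable_measure_of)
    fix b assume b: "b \<in> \<B>"
    have "g -` b \<inter> space M = (if 0 \<in> b then N \<inter> space M else {}) \<union> (main_part M (A b) \<inter> space M - N)"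
    proof (intro set_eqI)
      fix x
      have "x \<in> A b \<longleftrightarrow> x \<in> main_part M (A b)" if "x \<in> space M" "x \<notin> N"
        using main_part_null_part_Un[OF A[OF b]] N(1) that b by blast
      then show "x \<in> g -` b \<inter> space M \<longleftrightarrow> x \<in> (if 0 \<in> b then N \<inter> space M else {}) \<union> (main_part M (A b) \<inter> space M - N)"
        by (auto simp: g_def A_def)
    qed
    moreover have "main_part M (A b) \<in> sets M" using A[OF b] by (rule main_part_sets)
    ultimately show "g -` b \<inter> space M \<in> sets M" using N(3) by auto
  qed auto
  then have "g \<in> borel_measurable M" using borel_eq_countable_basis[OF \<B>] by simp
  moreover have "AE x in M. f x = g x"
    using N by (intro AE_I[of _ _ N]) (auto simp: g_def)
  ultimately show ?thesis by blast
qed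

lemma dunkl_measure_completion:
  assumes "\<alpha> > - 1" shows "dunkl_measure \<alpha> = completion (dmu \<alpha>)"
proof -
  have c: "dunkl_coeff \<alpha> > 0" using assms by (rule dunkl_coeff_pos)
  have "AE x in lborel. 0 < dunkl_weight \<alpha> x"
    by (rule AE_mp[OF AE_lborel_neq[of 0] AE_I2]) (use c in \<open>simp add: dunkl_weight_def\<close>)
  then have "completion (dmu \<alpha>) = density lebesgue (dunkl_weight \<alpha>)"
    unfolding dmu_def by (rule completion_density_eq) simp
  then show ?thesis by (simp add: dunkl_measure_def dunkl_weight_def[abs_def] dunkl_coeff_def)
qed

lemma locally_integrable_borel_representative:
  fixes f :: "real \<Rightarrow> 'b::{banach,second_countable_topology}"
  assumes \<alpha>: "\<alpha> > - 1" and f: "locally_integrable (dunkl_measure \<alpha>) f"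
  shows "\<exists>g \<in> borel_measurable borel. (AE x in dmu \<alpha>. f x = g x) \<and> (\<forall>R. (\<integral>\<^sup>+x\<in>ball 0 R. ennreal (norm (g x)) \<partial>dmu \<alpha>) < \<infinity>)"
proof -
  let ?C = "completion (dmu \<alpha>)"
  have int: "integrable ?C (\<lambda>x. indicator (cball 0 R) x *\<^sub>R f x)" for R :: real
    using f unfolding locally_integrable_def set_integrable_def dunkl_measure_completion[OF \<alpha>] by simp
  have "f \<in> borel_measurable ?C"
  proof (rule borel_measurable_LIMSEQ_metric)
    show "(\<lambda>x. indicator (cball 0 (real n)) x *\<^sub>R f x) \<in> borel_measurable ?C" for n
      using int[of "real n"] by (rule borel_measurable_integrable)
    fix x :: real
    obtain n0 where n0: "\<bar>x\<bar> < real n0" using reals_Archimedean2 by blast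
    have "\<forall>\<^sub>F n in sequentially. indicator (cball 0 (real n)) x *\<^sub>R f x = f x"
      using eventually_ge_at_top[of n0] by eventually_elim (use n0 in simp)
    then show "(\<lambda>n. indicator (cball 0 (real n)) x *\<^sub>R f x) \<longlonglongrightarrow> f x" by (rule tendsto_eventually)
  qed
  then obtain g where g: "g \<in> borel_measurable (dmu \<alpha>)" and eq: "AE x in dmu \<alpha>. f x = g x"
    using completion_borel_representative by blast
  have gm [measurable]: "g \<in> borel_measurable borel" using g by simp
  have "(\<integral>\<^sup>+x\<in>ball 0 R. ennreal (norm (g x)) \<partial>dmu \<alpha>) < \<infinity>" for R
  proof -
    have ae: "AE x in dmu \<alpha>. indicator (cball 0 R) x *\<^sub>R f x = indicator (cball 0 R) x *\<^sub>R g x"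
      using eq by eventually_elim simp
    have m: "(\<lambda>x. indicator (cball 0 R) x *\<^sub>R g x) \<in> borel_measurable (dmu \<alpha>)"
      using borel_measurable_indicator[of "cball 0 R" borel] by measurable
    have "integrable (dmu \<alpha>) (\<lambda>x. indicator (cball 0 R) x *\<^sub>R g x)"
      using integral_AE_eq_completion(2)[OF m ae] int[of R] by (rule iffD1)
    then have "(\<integral>\<^sup>+x. ennreal (norm (indicator (cball 0 R) x *\<^sub>R g x)) \<partial>dmu \<alpha>) < \<infinity>"
      by (simp add: integrable_iff_bounded)
    moreover have "(\<integral>\<^sup>+x\<in>ball 0 R. ennreal (norm (g x)) \<partial>dmu \<alpha>) \<le> (\<integral>\<^sup>+x. ennreal (norm (indicator (cball 0 R) x *\<^sub>R g x)) \<partial>dmu \<alpha>)"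
      by (intro nn_integral_mono) (auto simp: indicator_def)
    ultimately show ?thesis by (meson le_less_trans)
  qed
  then show ?thesis using gm eq by blast
qed

section \<open>Translates of almost everywhere classes\<close>

context averaged_translation begin

lemma maj_locally_finite_AE:
  assumes [measurable]: "g \<in> borel_measurable borel" and fin: "\<And>R. (\<integral>\<^sup>+z\<in>ball 0 R. g z \<partial>M) < \<infinity>"
  shows "AE y in M. maj x g y < \<infinity>"
proof (rule AE_of_balls)
  fix t :: real assume "t > 0"
  have "(\<integral>\<^sup>+y\<in>ball 0 t. maj x g y \<partial>M) \<le> ennreal mP * (\<integral>\<^sup>+z\<in>ball 0 (t + \<bar>x\<bar>). g z \<partial>M)"
    by (rule maj_ball_le) measurable
  also have "\<dots> < \<infinity>" using fin by (simp add: ennreal_mult_less_top)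
  finally show "(\<integral>\<^sup>+y\<in>ball 0 t. maj x g y \<partial>M) < \<infinity>" .
qed measurable

text \<open>
  A null set meets the positions of almost every \<open>y\<close> in a null set; this makes the translation well
  defined on classes of functions.
\<close>
lemma maj_null_AE:
  assumes N: "N \<in> null_sets M"
  shows "AE y in M. maj x (indicator N) y = 0"
proof -
  have [measurable]: "N \<in> sets borel" using N by (auto simp: null_sets_def sets_M)
  have "(\<integral>\<^sup>+y. 1 * maj x (indicator N) y \<partial>M) = (\<integral>\<^sup>+z. indicator N z * maj (- x) (\<lambda>_. 1) z \<partial>M)"
    by (rule maj_dual) measurable
  also have "\<dots> = 0" using AE_not_in[OF N] by (intro nn_integral_0_iff_AE[THEN iffD2]) (auto elim!: eventually_mono)
  finally have "(\<integral>\<^sup>+y. maj x (indicator N) y \<partial>M) = 0" by simp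
  then show ?thesis by (subst (asm) nn_integral_0_iff_AE) auto
qed

end

lemma AE_null_set_borel:
  assumes "AE x in M. P x"
  obtains N where "N \<in> null_sets M" "\<And>x. x \<in> space M \<Longrightarrow> x \<notin> N \<Longrightarrow> P x"
  using assms by (elim AE_E) (auto simp: null_sets_def)

lemma half_translation_AE:
  fixes g h :: "real \<Rightarrow> 'b::{real_normed_field,banach,second_countable_topology}"
  assumes eq: "AE z in dmu (- 1 / 2). g z = h z"
  shows "AE y in dmu (- 1 / 2). dunkl_translation (- 1 / 2) x g y = averaged_translation.tau (count_space (UNIV :: unit set)) (\<lambda>x y _. x + y) (\<lambda>_ _ _. 1) x h y"
proof -
  interpret symmetric_translation "dmu (- 1 / 2)" "count_space (UNIV :: unit set)" "\<lambda>x y _. x + y" "\<lambda>_ _ _. 1" "\<lambda>_ _ _. 1" 1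
     "2 * (- 1 / 2) + 2" "dunkl_coeff (- 1 / 2) / (- 1 / 2 + 1)" by (rule dunkl_half_translation)
  obtain N where N: "N \<in> null_sets (dmu (- 1 / 2))" "\<And>z. z \<notin> N \<Longrightarrow> g z = h z"
    using AE_null_set_borel[OF eq] by auto
  show ?thesis
    using maj_null_AE[OF N(1), of x]
  proof eventually_elim
    case (elim y)
    then have "x + y \<notin> N" by (auto simp: maj_def nn_integral_count_space_finite indicator_def split: if_splits)
    then show ?case using N(2) by (simp add: dunkl_translation_def tau_def lebesgue_integral_count_space_finite)
  qed
qed

context dunkl_alpha begin

text \<open>
  The integral over \<open>\<theta>\<close> of the representative \<open>h\<close> is the average over angle and sign, which exists
  for almost every \<open>y\<close>; for almost every \<open>y\<close> the positions avoid, for almost all angles, the set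
  where \<open>g\<close> and \<open>h\<close> differ.
\<close>
lemma dunkl_translation_AE:
  fixes g h :: "real \<Rightarrow> 'b::{real_normed_field,banach,second_countable_topology}"
  assumes eq: "AE z in dmu \<alpha>. g z = h z" and [measurable]: "h \<in> borel_measurable borel"
    and fin: "\<And>R. (\<integral>\<^sup>+z\<in>ball 0 R. ennreal (norm (h z)) \<partial>dmu \<alpha>) < \<infinity>"
  shows "AE y in dmu \<alpha>. dunkl_translation \<alpha> x g y = tr.tau x h y"
proof -
  obtain N where N: "N \<in> null_sets (dmu \<alpha>)" "\<And>z. z \<notin> N \<Longrightarrow> g z = h z"
    using AE_null_set_borel[OF eq] by auto
  have [measurable]: "N \<in> sets borel" using N by (auto simp: null_sets_def)
  have "AE y in dmu \<alpha>. tr.maj x (\<lambda>z. ennreal (norm (h z))) y < \<infinity>"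
    by (rule tr.maj_locally_finite_AE[OF _ fin]) measurable
  then show ?thesis
    using tr.maj_null_AE[OF N(1), of x]
  proof eventually_elim
    case (elim y)
    let ?d = "dunkl_dist x y"
    let ?\<Psi> = "\<lambda>g \<theta>. ((1 - cos \<theta>) * sin \<theta> powr (2 * \<alpha>)) *\<^sub>R
          (g (?d \<theta>) + g (- ?d \<theta>) + ((x + y) / ?d \<theta>) *\<^sub>R (g (?d \<theta>) - g (- ?d \<theta>)))"
    have "tr.tau x h y = (LINT \<theta>:{0..pi}|lborel. angw \<alpha> \<theta> *\<^sub>R (dunkl_factor x y (\<theta>, True) *\<^sub>R h (?d \<theta>) + dunkl_factor x y (\<theta>, False) *\<^sub>R h (- ?d \<theta>)))"
      unfolding tr.tau_def using tr.tau_integrand_integrable(2)[OF _ elim(1)]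
      by (subst integral_sign_angle_measure) (auto simp: dunkl_pos_def)
    also have "\<dots> = (LINT \<theta>:{0..pi}|lborel. (dunkl_const \<alpha> / 2) *\<^sub>R ?\<Psi> h \<theta>)"
    proof -
      have "a *\<^sub>R ((c * (s * (1 + 1 * t))) *\<^sub>R u + (c * (s * (1 + - 1 * t))) *\<^sub>R v) = c *\<^sub>R ((s * a) *\<^sub>R (u + v + t *\<^sub>R (u - v)))"
        for a c s t :: real and u v :: 'b
        by (simp add: algebra_simps)
      then show ?thesis unfolding dunkl_factor_def fst_conv snd_conv bool_sign_simps angw_def by (simp only:)
    qed
    also have "\<dots> = (dunkl_const \<alpha> / 2) *\<^sub>R (LINT \<theta>:{0..pi}|lborel. ?\<Psi> h \<theta>)"
      unfolding set_lebesgue_integral_def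
      by (subst integral_scaleR_right[symmetric]) (simp add: mult_ac)
    also have "(LINT \<theta>:{0..pi}|lborel. ?\<Psi> h \<theta>) = (LINT \<theta>:{0..pi}|lebesgue. ?\<Psi> g \<theta>)"
      unfolding set_lebesgue_integral_def
    proof (rule integral_AE_eq_completion(1)[symmetric])
      show "(\<lambda>\<theta>. indicator {0..pi} \<theta> *\<^sub>R ?\<Psi> h \<theta>) \<in> borel_measurable lborel" by measurable
      have "(\<integral>\<^sup>+\<theta>\<in>{0..pi}. (ennreal (angw \<alpha> \<theta>) * (indicator N (?d \<theta>) + indicator N (- ?d \<theta>))) \<partial>lborel) = 0"
        using elim(2) unfolding tr.maj_def by (subst (asm) nn_integral_sign_angle_measure) (auto simp: dunkl_pos_def)
      then have "AE \<theta> in lborel. ennreal (angw \<alpha> \<theta>) * (indicator N (?d \<theta>) + indicator N (- ?d \<theta>)) * indicator {0..pi} \<theta> = 0"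
        by (subst (asm) nn_integral_0_iff_AE) auto
      then show "AE \<theta> in lborel. indicator {0..pi} \<theta> *\<^sub>R ?\<Psi> g \<theta> = indicator {0..pi} \<theta> *\<^sub>R ?\<Psi> h \<theta>"
        using AE_lborel_neq[of 0] AE_lborel_neq[of pi]
      proof eventually_elim
        case (elim \<theta>)
        show ?case
        proof (cases "\<theta> \<in> {0..pi}")
          case True
          then have "sin \<theta> > 0" using elim by (intro sin_gt_zero) auto
          then have "angw \<alpha> \<theta> > 0" by (simp add: angw_def)
          then have "?d \<theta> \<notin> N" "- ?d \<theta> \<notin> N" using elim(1) True by (auto simp: indicator_def split: if_splits)
          then show ?thesis using N(2) by simp
        qed simp
      qed
    qed
    finally show ?case using \<alpha> by (simp add: dunkl_translation_def)
  qed
qed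

end

section \<open>Boundedness of the fractional integral\<close>

context bmo_translation begin

lemma K_eq_dunkl_kernel:
  assumes D: "D = dunkl_dim \<alpha>" shows "K = dunkl_kernel \<alpha> \<rho>"
  by (rule ext) (unfold K_def dunkl_kernel_def, unfold D, rule refl)

text \<open>
  The functions in \<open>dunkl_BMO\<close> are only Lebesgue measurable, and their translates are given by a
  formula valid almost everywhere. Everything is transferred to a Borel representative \<open>f'\<close>, to
  which \<open>frac_op_bounded\<close> applies. The hypotheses \<open>bridge_real\<close> and \<open>bridge\<close> say that \<open>tau\<close>
  represents the Dunkl translation of the kernel and of classes of functions.
\<close>
lemma dunkl_frac_bounded:
  fixes f :: "real \<Rightarrow> 'b::{real_normed_field,banach,second_countable_topology}"
  assumes \<alpha>: "\<alpha> > - 1" and M: "M = dmu \<alpha>" and D: "D = dunkl_dim \<alpha>"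
    and bridge_real: "\<And>(h :: real \<Rightarrow> real) x. h \<in> borel_measurable borel \<Longrightarrow>
       (\<And>R. (\<integral>\<^sup>+z\<in>ball 0 R. ennreal (norm (h z)) \<partial>M) < \<infinity>) \<Longrightarrow>
       AE y in M. dunkl_translation \<alpha> x h y = tau x h y"
    and bridge: "\<And>(g :: real \<Rightarrow> 'b) h x. AE z in M. g z = h z \<Longrightarrow> h \<in> borel_measurable borel \<Longrightarrow>
       (\<And>R. (\<integral>\<^sup>+z\<in>ball 0 R. ennreal (norm (h z)) \<partial>M) < \<infinity>) \<Longrightarrow>
       AE y in M. dunkl_translation \<alpha> x g y = tau x h y"
    and f: "f \<in> dunkl_BMO \<alpha> \<phi>"
  shows "(AE x in dunkl_measure \<alpha>. integrable (dunkl_measure \<alpha>) (dunkl_frac_integrand \<alpha> \<rho> f x)) \<and>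
         dunkl_frac_integral \<alpha> \<rho> f \<in> dunkl_BMO \<alpha> \<psi> \<and>
         dunkl_BMO_norm \<alpha> \<psi> (dunkl_frac_integral \<alpha> \<rho> f) \<le> ennreal (2 * op_const + 1) * dunkl_BMO_norm \<alpha> \<phi> f"
proof -
  have DM: "dunkl_measure \<alpha> = completion M" unfolding M by (rule dunkl_measure_completion[OF \<alpha>])
  have KK: "K = dunkl_kernel \<alpha> \<rho>" by (rule K_eq_dunkl_kernel[OF D])
  obtain f' where f'm: "f' \<in> borel_measurable borel" and ff': "AE x in M. f x = f' x"
    and f'fin: "\<And>R. (\<integral>\<^sup>+x\<in>ball 0 R. ennreal (norm (f' x)) \<partial>M) < \<infinity>"
    using locally_integrable_borel_representative[OF \<alpha>, of f] f unfolding dunkl_BMO_def M by auto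
  note [measurable] = f'm
  have emb: "emeasure (dunkl_measure \<alpha>) (ball 0 r) = ennreal (mB r)" if "r > 0" for r
    unfolding DM using emeasure_ball[OF that] by (subst emeasure_completion) (simp_all add: sets_M)
  have meb: "measure (dunkl_measure \<alpha>) (ball 0 r) = mB r" if "r > 0" for r
    using emb[OF that] mB_pos[OF that] by (simp add: measure_def)
  have average: "dunkl_average \<alpha> g r x = avg (tau x h) r"
    and oscillation: "(\<integral>\<^sup>+y\<in>ball 0 r. ennreal (norm (dunkl_translation \<alpha> x g y - c)) \<partial>dunkl_measure \<alpha>)
       = (\<integral>\<^sup>+y\<in>ball 0 r. ennreal (norm (tau x h y - c)) \<partial>M)"
    if r: "r > 0" and [measurable]: "h \<in> borel_measurable borel" and eq: "AE y in M. dunkl_translation \<alpha> x g y = tau x h y"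
    for g h :: "real \<Rightarrow> 'b" and r x c
  proof -
    have "AE y in M. indicator (ball 0 r) y *\<^sub>R dunkl_translation \<alpha> x g y = indicator (ball 0 r) y *\<^sub>R tau x h y"
      using eq by eventually_elim simp
    then have "(LINT y:ball 0 r|dunkl_measure \<alpha>. dunkl_translation \<alpha> x g y) = (\<integral>y. indicator (ball 0 r) y *\<^sub>R tau x h y \<partial>M)"
      unfolding set_lebesgue_integral_def DM by (intro integral_AE_eq_completion(1)) auto
    then show "dunkl_average \<alpha> g r x = avg (tau x h) r"
      by (simp add: dunkl_average_def avg_def meb[OF r] inverse_eq_divide)
    show "(\<integral>\<^sup>+y\<in>ball 0 r. ennreal (norm (dunkl_translation \<alpha> x g y - c)) \<partial>dunkl_measure \<alpha>)
       = (\<integral>\<^sup>+y\<in>ball 0 r. ennreal (norm (tau x h y - c)) \<partial>M)"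
      unfolding DM nn_integral_completion
      by (rule nn_integral_cong_AE) (use eq in \<open>auto elim!: eventually_mono\<close>)
  qed
  define N where "N = enn2real (dunkl_BMO_norm \<alpha> \<phi> f)"
  have N: "N \<ge> 0" "dunkl_BMO_norm \<alpha> \<phi> f = ennreal N"
    using f by (auto simp: N_def dunkl_BMO_def ennreal_enn2real_if)
  have tf: "AE y in M. dunkl_translation \<alpha> x f y = tau x f' y" for x
    by (rule bridge[OF ff' f'm f'fin])
  have osc: "osc (tau x f') N" for x
    unfolding osc_def
  proof (intro conjI allI impI)
    show "tau x f' \<in> borel_measurable borel" by measurable
    show "N \<ge> 0" by (rule N)
    fix R :: real assume R: "R > 0"
    show "integrable M (\<lambda>w. indicator (ball 0 R) w *\<^sub>R tau x f' w)"
    proof (rule integrableI_bounded)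
      have "(\<integral>\<^sup>+w. ennreal (norm (indicator (ball 0 R) w *\<^sub>R tau x f' w)) \<partial>M)
        \<le> (\<integral>\<^sup>+w. ennreal B * (maj x (\<lambda>z. ennreal (norm (f' z))) w * indicator (ball 0 R) w) \<partial>M)"
        by (intro nn_integral_mono) (use norm_tau_le[OF f'm, of x] in \<open>auto simp: indicator_def\<close>)
      also have "\<dots> = ennreal B * (\<integral>\<^sup>+w\<in>ball 0 R. maj x (\<lambda>z. ennreal (norm (f' z))) w \<partial>M)"
        by (rule nn_integral_cmult) measurable
      also have "\<dots> \<le> ennreal B * (ennreal mP * (\<integral>\<^sup>+z\<in>ball 0 (R + \<bar>x\<bar>). ennreal (norm (f' z)) \<partial>M))"
        by (intro mult_left_mono maj_ball_le) auto
      also have "\<dots> < \<infinity>" using f'fin by (simp add: ennreal_mult_less_top)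
      finally show "(\<integral>\<^sup>+w. ennreal (norm (indicator (ball 0 R) w *\<^sub>R tau x f' w)) \<partial>M) < \<infinity>" .
    qed measurable
    let ?X = "\<integral>\<^sup>+w\<in>ball 0 R. ennreal (norm (tau x f' w - avg (tau x f') R)) \<partial>M"
    have "ennreal (1 / \<phi> R) * (1 / emeasure (dunkl_measure \<alpha>) (ball 0 R)) *
          (\<integral>\<^sup>+y\<in>ball 0 R. ennreal (norm (dunkl_translation \<alpha> x f y - dunkl_average \<alpha> f R x)) \<partial>dunkl_measure \<alpha>)
        \<le> dunkl_BMO_norm \<alpha> \<phi> f"
      unfolding dunkl_BMO_norm_def by (rule SUP_upper2[of R]) (use R in \<open>auto intro: SUP_upper\<close>)
    then have le: "ennreal (1 / \<phi> R) * (1 / ennreal (mB R)) * ?X \<le> ennreal N"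
      unfolding emb[OF R] average[OF R f'm tf] oscillation[OF R f'm tf] N(2) .
    have p: "\<phi> R > 0" "mB R > 0" using phi_pos[OF R] mB_pos[OF R] .
    have i: "1 / ennreal (mB R) = ennreal (1 / mB R)" using divide_ennreal[of 1 "mB R"] p by simp
    have "ennreal (\<phi> R * mB R) * (ennreal (1 / \<phi> R) * ennreal (1 / mB R)) = ennreal (\<phi> R * mB R * (1 / \<phi> R * (1 / mB R)))"
      using p by (simp add: ennreal_mult[symmetric])
    also have "\<phi> R * mB R * (1 / \<phi> R * (1 / mB R)) = 1" using p by simp
    finally have "ennreal (\<phi> R * mB R) * (ennreal (1 / \<phi> R) * (1 / ennreal (mB R))) = 1" unfolding i by simp
    then have "?X = ennreal (\<phi> R * mB R) * (ennreal (1 / \<phi> R) * (1 / ennreal (mB R)) * ?X)"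
      by (simp only: mult.assoc[symmetric] mult_1_left)
    also have "\<dots> \<le> ennreal (\<phi> R * mB R) * ennreal N" by (intro mult_left_mono le) simp
    also have "\<dots> = ennreal (N * \<phi> R * mB R)" using p N(1) by (simp add: ennreal_mult[symmetric] mult_ac)
    finally show "?X \<le> ennreal (N * \<phi> R * mB R)" .
  qed
  note bounded = frac_op_bounded[OF f'm osc]
  have tK: "AE w in M. dunkl_translation \<alpha> z (dunkl_kernel \<alpha> \<rho>) w = tau z K w" for z
    unfolding KK[symmetric]
    by (rule bridge_real) (use K_ball_finite in \<open>auto simp: K_nonneg\<close>)
  have integrand: "AE w in M. dunkl_frac_integrand \<alpha> \<rho> f z w = L 1 z w *\<^sub>R f' w" for z
    using tK[of z] ff'
  proof eventually_elim
    case (elim w)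
    have "L 1 z w = dunkl_translation \<alpha> z (dunkl_kernel \<alpha> \<rho>) w - dunkl_kernel \<alpha> \<rho> w * (1 - indicator (ball 0 1) w)"
      unfolding L_def elim(1) by (simp add: cut_def KK indicator_def)
    then show ?case using elim(2) by (simp add: dunkl_frac_integrand_def scaleR_conv_of_real mult.commute)
  qed
  have frac: "dunkl_frac_integral \<alpha> \<rho> f = frac_op 1 f'"
    unfolding dunkl_frac_integral_def frac_op_def DM
    by (rule ext, rule integral_AE_eq_completion(1)[OF _ integrand]) measurable
  have int: "AE x in dunkl_measure \<alpha>. integrable (dunkl_measure \<alpha>) (dunkl_frac_integrand \<alpha> \<rho> f x)"
    unfolding DM AE_completion_iff
    using bounded(1) by eventually_elim (subst integral_AE_eq_completion(2)[OF _ integrand], auto)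
  have TTm [measurable]: "frac_op 1 f' \<in> borel_measurable borel" by measurable
  have TTfin: "(\<integral>\<^sup>+z\<in>ball 0 R. ennreal (norm (frac_op 1 f' z)) \<partial>M) < \<infinity>" for R
  proof -
    have "(\<integral>\<^sup>+z\<in>ball 0 R. ennreal (norm (frac_op 1 f' z)) \<partial>M) = (\<integral>\<^sup>+z. ennreal (norm (indicator (ball 0 R) z *\<^sub>R frac_op 1 f' z)) \<partial>M)"
      by (intro nn_integral_cong) (auto simp: indicator_def)
    then show ?thesis using bounded(2)[of R] by (simp add: integrable_iff_bounded)
  qed
  have tT: "AE y in M. dunkl_translation \<alpha> x (dunkl_frac_integral \<alpha> \<rho> f) y = tau x (frac_op 1 f') y" for x
    unfolding frac by (rule bridge[OF _ TTm TTfin]) simp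
  have loc: "locally_integrable (dunkl_measure \<alpha>) (dunkl_frac_integral \<alpha> \<rho> f)"
    unfolding locally_integrable_def set_integrable_def frac DM
  proof (intro allI impI)
    fix S :: "real set" assume S: "compact S"
    then have [measurable]: "S \<in> sets borel" by (rule compact_imp_closed[THEN borel_closed])
    obtain R where R: "S \<subseteq> ball 0 R" using bounded_subset_ballD[OF compact_imp_bounded[OF S], of 0] by blast
    have "integrable M (\<lambda>z. indicator S z *\<^sub>R frac_op 1 f' z)"
      by (rule Bochner_Integration.integrable_bound[OF bounded(2)[of R]])
         (use R in \<open>auto simp: indicator_def intro!: AE_I2\<close>)
    then show "integrable (completion M) (\<lambda>z. indicator S z *\<^sub>R frac_op 1 f' z)"
      by (subst integrable_completion) auto
  qed
  have norm: "dunkl_BMO_norm \<alpha> \<psi> (dunkl_frac_integral \<alpha> \<rho> f) \<le> ennreal (2 * op_const * N)"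
    unfolding dunkl_BMO_norm_def
  proof (intro SUP_least)
    fix r x :: real assume "r \<in> {0<..}"
    then have r: "r > 0" by simp
    let ?T = "tau x (frac_op 1 f')"
    have p: "\<psi> r > 0" "mB r > 0" using psi_pos[OF r] mB_pos[OF r] .
    obtain c where c: "(\<integral>\<^sup>+y\<in>ball 0 r. ennreal (norm (?T y - c)) \<partial>M) \<le> ennreal (op_const * N * \<psi> r * mB r)"
      using bounded(3)[OF r] by blast
    have [measurable]: "?T \<in> borel_measurable borel" by measurable
    have "integrable M (\<lambda>w. indicator (ball 0 r) w *\<^sub>R ?T w)"
    proof (rule integrableI_bounded)
      have "(\<integral>\<^sup>+w. ennreal (norm (indicator (ball 0 r) w *\<^sub>R ?T w)) \<partial>M) = (\<integral>\<^sup>+w\<in>ball 0 r. ennreal (norm (?T w - 0)) \<partial>M)"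
        by (intro nn_integral_cong) (auto simp: indicator_def)
      also have "\<dots> \<le> (\<integral>\<^sup>+y\<in>ball 0 r. ennreal (norm (?T y - c)) \<partial>M) + ennreal (norm (c - 0) * mB r)"
        by (rule ball_dist_le[OF _ r]) measurable
      also have "\<dots> < \<infinity>" using c by (auto intro: le_less_trans)
      finally show "(\<integral>\<^sup>+w. ennreal (norm (indicator (ball 0 r) w *\<^sub>R ?T w)) \<partial>M) < \<infinity>" .
    qed measurable
    then have a: "ennreal (norm (avg ?T r - c) * mB r) \<le> (\<integral>\<^sup>+w\<in>ball 0 r. ennreal (norm (?T w - c)) \<partial>M)"
      by (rule avg_diff_le[OF _ r])
    \<comment> \<open>replacing the constant \<open>c\<close> by the average costs a factor \<open>2\<close>\<close>
    have "(\<integral>\<^sup>+y\<in>ball 0 r. ennreal (norm (?T y - avg ?T r)) \<partial>M)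
      \<le> (\<integral>\<^sup>+y\<in>ball 0 r. ennreal (norm (?T y - c)) \<partial>M) + ennreal (norm (c - avg ?T r) * mB r)"
      by (rule ball_dist_le[OF _ r]) measurable
    also have "\<dots> \<le> ennreal (op_const * N * \<psi> r * mB r) + ennreal (op_const * N * \<psi> r * mB r)"
      using a c by (intro add_mono) (auto simp: norm_minus_commute intro: order_trans)
    also have "\<dots> = ennreal (2 * op_const * N * (\<psi> r * mB r))"
      using op_const_nonneg N(1) p by (subst ennreal_plus[symmetric]) (auto simp: algebra_simps)
    finally have X: "(\<integral>\<^sup>+y\<in>ball 0 r. ennreal (norm (?T y - avg ?T r)) \<partial>M) \<le> ennreal (2 * op_const * N * (\<psi> r * mB r))" .
    have "ennreal (1 / \<psi> r) * (1 / ennreal (mB r)) * (\<integral>\<^sup>+y\<in>ball 0 r. ennreal (norm (?T y - avg ?T r)) \<partial>M)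
      \<le> ennreal (1 / \<psi> r) * (1 / ennreal (mB r)) * ennreal (2 * op_const * N * (\<psi> r * mB r))"
      by (intro mult_left_mono X) simp
    also have "\<dots> = ennreal (1 / \<psi> r * (1 / mB r) * (2 * op_const * N * (\<psi> r * mB r)))"
    proof -
      have i: "1 / ennreal (mB r) = ennreal (1 / mB r)" using divide_ennreal[of 1 "mB r"] p by simp
      show ?thesis unfolding i using p N(1) op_const_nonneg by (simp add: ennreal_mult[symmetric])
    qed
    also have "1 / \<psi> r * (1 / mB r) * (2 * op_const * N * (\<psi> r * mB r)) = 2 * op_const * N" using p by simp
    finally show "ennreal (1 / \<psi> r) * (1 / emeasure (dunkl_measure \<alpha>) (ball 0 r)) *
          (\<integral>\<^sup>+y\<in>ball 0 r. ennreal (norm (dunkl_translation \<alpha> x (dunkl_frac_integral \<alpha> \<rho> f) y - dunkl_average \<alpha> (dunkl_frac_integral \<alpha> \<rho> f) r x)) \<partial>dunkl_measure \<alpha>)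
        \<le> ennreal (2 * op_const * N)"
      unfolding emb[OF r] average[OF r TTm tT] oscillation[OF r TTm tT] .
  qed
  also have "\<dots> \<le> ennreal ((2 * op_const + 1) * N)" using N(1) by (intro ennreal_leI) (simp add: algebra_simps)
  also have "\<dots> = ennreal (2 * op_const + 1) * dunkl_BMO_norm \<alpha> \<phi> f"
    using N op_const_nonneg by (simp add: ennreal_mult)
  finally have norm': "dunkl_BMO_norm \<alpha> \<psi> (dunkl_frac_integral \<alpha> \<rho> f) \<le> ennreal (2 * op_const + 1) * dunkl_BMO_norm \<alpha> \<phi> f" .
  have "dunkl_BMO_norm \<alpha> \<psi> (dunkl_frac_integral \<alpha> \<rho> f) < \<infinity>"
    using norm by (rule le_less_trans) simp
  then show ?thesis using int loc norm' by (simp add: dunkl_BMO_def)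
qed

end

lemma bmo_translationI:
  fixes \<alpha> C\<^sub>1 C\<^sub>1' C\<^sub>1'' A A' Ci Cp Cs :: real and \<rho> \<phi> \<psi> :: "real \<Rightarrow> real"
  assumes gen: "symmetric_translation (dmu \<alpha>) P p k \<kappa> B (2 * \<alpha> + 2) cM"
    and \<alpha>: "\<alpha> > - 1"
    and rho_pos: "\<And>r. r > 0 \<Longrightarrow> \<rho> r > 0"
    and phi_pos: "\<And>r. r > 0 \<Longrightarrow> \<phi> r > 0"
    and psi_pos: "\<And>r. r > 0 \<Longrightarrow> \<psi> r > 0"
    and pos: "C\<^sub>1 > 0" "C\<^sub>1' > 0" "C\<^sub>1'' > 0" "A > 0" "A' > 0" "Ci > 0" "Cp > 0" "Cs > 0"
    and rho_a: "\<And>r s. \<lbrakk>r > 0; s > 0; 1 / 2 \<le> r / s; r / s \<le> 2\<rbrakk>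
           \<Longrightarrow> 1 / C\<^sub>1 \<le> \<rho> r / \<rho> s \<and> \<rho> r / \<rho> s \<le> C\<^sub>1"
    and rho_c: "\<And>r. r > 0 \<Longrightarrow>
           (\<integral>\<^sup>+t\<in>{r<..}. ennreal (\<rho> t / t\<^sup>2) \<partial>lebesgue) \<le> ennreal (C\<^sub>1' * (\<rho> r / r))"
    and rho_d: "\<And>r s. \<lbrakk>r > 0; s > 0; 1 / 2 \<le> r / s; r / s \<le> 2\<rbrakk>
           \<Longrightarrow> \<bar>\<rho> r / r powr dunkl_dim \<alpha> - \<rho> s / s powr dunkl_dim \<alpha>\<bar>
                 \<le> C\<^sub>1'' * \<bar>r - s\<bar> * (\<rho> s / s powr (dunkl_dim \<alpha> + 1))"
    and phi_inc: "\<And>r s. 0 < r \<Longrightarrow> r \<le> s \<Longrightarrow> \<phi> r \<le> Ci * \<phi> s"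
    and phi_dbl: "\<And>r. r > 0 \<Longrightarrow> \<phi> (2 * r) \<le> Cp * \<phi> r"
    and psi_dbl: "\<And>r. r > 0 \<Longrightarrow> \<psi> (2 * r) \<le> Cs * \<psi> r"
    and rho_phi: "\<And>r. r > 0 \<Longrightarrow>
           (\<integral>\<^sup>+t\<in>{r<..}. ennreal (\<rho> t * \<phi> t / t\<^sup>2) \<partial>lebesgue) \<le> ennreal (A * (\<rho> r * \<phi> r / r))"
    and phi_psi: "\<And>r. r > 0 \<Longrightarrow>
           ennreal (\<phi> r) * (\<integral>\<^sup>+t\<in>{0<..<r}. ennreal (\<rho> t / t) \<partial>lebesgue) \<le> ennreal (A' * \<psi> r)"
  shows "bmo_translation (dmu \<alpha>) P p k \<kappa> B (2 * \<alpha> + 2) cM \<rho> C\<^sub>1 C\<^sub>1' C\<^sub>1'' (2 * dunkl_coeff \<alpha>) \<phi> \<psi> Ci Cp Cs A A'"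
proof -
  interpret symmetric_translation "dmu \<alpha>" P p k \<kappa> B "2 * \<alpha> + 2" cM by (rule gen)
  have quot: "1 / 2 \<le> r / s" "r / s \<le> 2" if "r > 0" "s > 0" "r \<le> 2 * s" "s \<le> 2 * r" for r s :: real
    using that by (simp_all add: field_simps)
  have d: "\<bar>\<rho> r / r powr (2 * \<alpha> + 2) - \<rho> s / s powr (2 * \<alpha> + 2)\<bar> \<le> C\<^sub>1'' * \<bar>r - s\<bar> * (\<rho> s / s powr (2 * \<alpha> + 2 + 1))"
    if "r > 0" "s > 0" "r \<le> 2 * s" "s \<le> 2 * r" for r s
    using rho_d[OF that(1,2) quot[OF that]] by (simp only: dunkl_dim_def)
  have cont: "continuous_on {0<..} \<rho>"
    by (rule continuous_of_quotient_isCont, rule quotient_isCont, assumption, rule d)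
  have c: "dunkl_coeff \<alpha> > 0" using \<alpha> by (rule dunkl_coeff_pos)
  show ?thesis
  proof unfold_locales
    show "\<rho> r \<le> C\<^sub>1 * \<rho> s" if "r > 0" "s > 0" "r \<le> 2 * s" "s \<le> 2 * r" for r s
      using rho_a[OF that(1,2) quot[OF that]] rho_pos[OF that(2)] by (simp add: pos_divide_le_eq)
    show "(\<integral>\<^sup>+t\<in>{0<..<R}. ennreal (\<rho> t / t) \<partial>lborel) < \<infinity>" if R: "R > 0" for R
    proof (rule ccontr)
      \<comment> \<open>as \<open>\<phi> R > 0\<close>, the bound by \<open>\<psi> R\<close> forces the integral to be finite\<close>
      assume "\<not> (\<integral>\<^sup>+t\<in>{0<..<R}. ennreal (\<rho> t / t) \<partial>lborel) < \<infinity>"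
      then have "ennreal (\<phi> R) * (\<integral>\<^sup>+t\<in>{0<..<R}. ennreal (\<rho> t / t) \<partial>lborel) = \<infinity>"
        using phi_pos[OF R] by (simp add: less_top[symmetric] ennreal_mult_top)
      then show False using phi_psi[OF R] by (simp add: nn_integral_completion top_unique)
    qed
    show "(\<integral>\<^sup>+t\<in>{r<..}. ennreal (\<rho> t / t\<^sup>2) \<partial>lborel) \<le> ennreal (C\<^sub>1' * (\<rho> r / r))" if "r > 0" for r
      using rho_c[OF that] by (simp add: nn_integral_completion)
    show "(\<integral>\<^sup>+t\<in>{r<..}. ennreal (\<rho> t * \<phi> t / t\<^sup>2) \<partial>lborel) \<le> ennreal (A * (\<rho> r * \<phi> r / r))" if "r > 0" for r
      using rho_phi[OF that] by (simp add: nn_integral_completion)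
    show "ennreal (\<phi> r) * (\<integral>\<^sup>+t\<in>{0<..<r}. ennreal (\<rho> t / t) \<partial>lborel) \<le> ennreal (A' * \<psi> r)" if "r > 0" for r
      using phi_psi[OF that] by (simp add: nn_integral_completion)
    show "(\<integral>\<^sup>+y\<in>ball 0 R. ennreal (\<rho> \<bar>y\<bar> / \<bar>y\<bar> powr (2 * \<alpha> + 2)) \<partial>dmu \<alpha>)
         = ennreal (2 * dunkl_coeff \<alpha>) * (\<integral>\<^sup>+t\<in>{0<..<R}. ennreal (\<rho> t / t) \<partial>lborel)" if "R > 0" for R
      by (rule dmu_kernel_integral[OF \<alpha> that rho_pos cont])
  qed (use d pos c rho_pos phi_pos psi_pos phi_inc phi_dbl psi_dbl in \<open>auto\<close>)
qed

theorem theorem7p1: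
  fixes \<alpha> C\<^sub>1 C\<^sub>1' C\<^sub>1'' A A' :: real and \<rho> \<phi> \<psi> :: "real \<Rightarrow> real"
  assumes "\<alpha> \<ge> - 1 / 2"
    and "\<And>r. r > 0 \<Longrightarrow> \<rho> r > 0"
    and "\<And>r. r > 0 \<Longrightarrow> \<phi> r > 0"
    and "\<And>r. r > 0 \<Longrightarrow> \<psi> r > 0"
    and "C\<^sub>1 > 0" and "C\<^sub>1' > 0" and "C\<^sub>1'' > 0" and "A > 0" and "A' > 0"
    and rho_a: "\<And>r s. \<lbrakk>r > 0; s > 0; 1 / 2 \<le> r / s; r / s \<le> 2\<rbrakk>
           \<Longrightarrow> 1 / C\<^sub>1 \<le> \<rho> r / \<rho> s \<and> \<rho> r / \<rho> s \<le> C\<^sub>1"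
    and rho_b: "(\<integral>\<^sup>+t\<in>{0<..<1}. ennreal (\<rho> t / t) \<partial>lebesgue) < \<infinity>"
    and rho_c: "\<And>r. r > 0 \<Longrightarrow>
           (\<integral>\<^sup>+t\<in>{r<..}. ennreal (\<rho> t / t\<^sup>2) \<partial>lebesgue) \<le> ennreal (C\<^sub>1' * (\<rho> r / r))"
    and rho_d: "\<And>r s. \<lbrakk>r > 0; s > 0; 1 / 2 \<le> r / s; r / s \<le> 2\<rbrakk>
           \<Longrightarrow> \<bar>\<rho> r / r powr dunkl_dim \<alpha> - \<rho> s / s powr dunkl_dim \<alpha>\<bar>
                 \<le> C\<^sub>1'' * \<bar>r - s\<bar> * (\<rho> s / s powr (dunkl_dim \<alpha> + 1))"
    and "almost_increasing \<phi>" and "almost_increasing \<psi>"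
    and "comparable \<phi> (\<lambda>r. \<phi> (2 * r))" and "comparable \<psi> (\<lambda>r. \<psi> (2 * r))"
    and rho_phi: "\<And>r. r > 0 \<Longrightarrow>
           (\<integral>\<^sup>+t\<in>{r<..}. ennreal (\<rho> t * \<phi> t / t\<^sup>2) \<partial>lebesgue) \<le> ennreal (A * (\<rho> r * \<phi> r / r))"
    and phi_psi: "\<And>r. r > 0 \<Longrightarrow>
           ennreal (\<phi> r) * (\<integral>\<^sup>+t\<in>{0<..<r}. ennreal (\<rho> t / t) \<partial>lebesgue) \<le> ennreal (A' * \<psi> r)"
  shows "\<exists>C>0. \<forall>f :: real \<Rightarrow> 'a::{real_normed_field,banach,second_countable_topology}.
           f \<in> dunkl_BMO \<alpha> \<phi> \<longrightarrow>
             (AE x in dunkl_measure \<alpha>. integrable (dunkl_measure \<alpha>) (dunkl_frac_integrand \<alpha> \<rho> f x)) \<and>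
             dunkl_frac_integral \<alpha> \<rho> f \<in> dunkl_BMO \<alpha> \<psi> \<and>
             dunkl_BMO_norm \<alpha> \<psi> (dunkl_frac_integral \<alpha> \<rho> f) \<le> ennreal C * dunkl_BMO_norm \<alpha> \<phi> f"
proof -
  obtain Ci where Ci: "Ci > 0" "\<And>r s. 0 < r \<Longrightarrow> r \<le> s \<Longrightarrow> \<phi> r \<le> Ci * \<phi> s"
    using assms(14) unfolding almost_increasing_def by blast
  obtain Cp where Cp: "Cp > 0" "\<And>r. r > 0 \<Longrightarrow> \<phi> (2 * r) \<le> Cp * \<phi> r"
    using assms(16) unfolding comparable_def by blast
  obtain Cs where Cs: "Cs > 0" "\<And>r. r > 0 \<Longrightarrow> \<psi> (2 * r) \<le> Cs * \<psi> r"
    using assms(17) unfolding comparable_def by blast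
  have \<alpha>1: "\<alpha> > - 1" using assms(1) by simp
  note bmo = bmo_translationI[OF _ \<alpha>1 assms(2-4) assms(5-9) Ci(1) Cp(1) Cs(1) rho_a rho_c rho_d Ci(2) Cp(2) Cs(2) rho_phi phi_psi]
  show ?thesis
  proof (cases "\<alpha> = - 1 / 2")
    case True
    have "symmetric_translation (dmu \<alpha>) (count_space (UNIV :: unit set)) (\<lambda>x y _. x + y) (\<lambda>_ _ _. 1) (\<lambda>_ _ _. 1) 1
       (2 * \<alpha> + 2) (dunkl_coeff \<alpha> / (\<alpha> + 1))"
      unfolding True by (rule dunkl_half_translation)
    then interpret bmo_translation "dmu \<alpha>" "count_space (UNIV :: unit set)" "\<lambda>x y _. x + y" "\<lambda>_ _ _. 1" "\<lambda>_ _ _. 1" 1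
       "2 * \<alpha> + 2" "dunkl_coeff \<alpha> / (\<alpha> + 1)" \<rho> C\<^sub>1 C\<^sub>1' C\<^sub>1'' "2 * dunkl_coeff \<alpha>" \<phi> \<psi> Ci Cp Cs A A'
      by (rule bmo)
    show ?thesis
    \<comment> \<open>the summand \<open>1\<close> makes the constant positive, as \<open>op_const\<close> may vanish\<close>
    proof (rule exI[of _ "2 * op_const + 1"], rule conjI, goal_cases)
      case 1
      show "2 * op_const + 1 > 0" using op_const_nonneg by simp
    next
      case 2
      show ?case
      proof (intro allI impI, rule dunkl_frac_bounded)
      show "AE y in dmu \<alpha>. dunkl_translation \<alpha> x h y = tau x h y" for h :: "real \<Rightarrow> real" and x
        using half_translation_AE[of h h x] unfolding True by simp
      show "AE y in dmu \<alpha>. dunkl_translation \<alpha> x g y = tau x h y" if "AE z in dmu \<alpha>. g z = h z"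
        for g h :: "real \<Rightarrow> 'a" and x
        using half_translation_AE[of g h x] that unfolding True by simp
      qed (use \<alpha>1 in \<open>simp_all add: dunkl_dim_def\<close>)
    qed
  next
    case False
    then interpret dunkl_alpha \<alpha> using assms(1) by unfold_locales simp
    interpret bt: bmo_translation "dmu \<alpha>" sign_angle_measure dunkl_pos dunkl_factor dunkl_density "max 1 (2 * dunkl_const \<alpha>)"
       "2 * \<alpha> + 2" "dunkl_coeff \<alpha> / (\<alpha> + 1)" \<rho> C\<^sub>1 C\<^sub>1' C\<^sub>1'' "2 * dunkl_coeff \<alpha>" \<phi> \<psi> Ci Cp Cs A A'
      by (rule bmo[OF tr.symmetric_translation_axioms])
    show ?thesis
    proof (rule exI[of _ "2 * bt.op_const + 1"], rule conjI, goal_cases)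
      case 1
      show "2 * bt.op_const + 1 > 0" using bt.op_const_nonneg by simp
    next
      case 2
      show ?case
      proof (intro allI impI, rule bt.dunkl_frac_bounded)
      show "AE y in dmu \<alpha>. dunkl_translation \<alpha> x h y = tr.tau x h y"
        if "h \<in> borel_measurable borel" "\<And>R. (\<integral>\<^sup>+z\<in>ball 0 R. ennreal (norm (h z)) \<partial>dmu \<alpha>) < \<infinity>"
        for h :: "real \<Rightarrow> real" and x
        using that by (intro dunkl_translation_AE) auto
      show "AE y in dmu \<alpha>. dunkl_translation \<alpha> x g y = tr.tau x h y"
        if "AE z in dmu \<alpha>. g z = h z" "h \<in> borel_measurable borel" "\<And>R. (\<integral>\<^sup>+z\<in>ball 0 R. ennreal (norm (h z)) \<partial>dmu \<alpha>) < \<infinity>"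
        for g h :: "real \<Rightarrow> 'a" and x
        using that by (intro dunkl_translation_AE) auto
      qed (use \<alpha>1 in \<open>simp_all add: dunkl_dim_def\<close>)
    qed
  qed
qed

end
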